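(* The map $\log_F:\mathscr{A}'\rightarrow\mathscr{E}$, $f(x)\mapsto\log_F(f(x))$, is an isomorphism of $\mathcal{O}_K$-modules, with inverse $\exp_F:\mathscr{E}\rightarrow\mathscr{A}'$, $g(x)\mapsto\exp_F(g(x))$.
   Context: $K$ is a finite extension of $\mathbb{Q}_p$ with ring of integers $\mathcal{O}_K$, uniformizer $\pi$, residue field of size $q$ (with $\pi\mid q$ so that $q/\pi\in\mathcal{O}_K$). $F$ is a Lubin-Tate formal group law over $\mathcal{O}_K$ attached to $\pi$, with endomorphisms $[a](x)$, $x\oplus y=F(x,y)$, and logarithm/exponential $\log_F,\exp_F$. $\mathfrak{F}_n$ is the kernel of $[\pi^{n+1}](x)$ and $K_n=K(\mathfrak{F}_n)$. Fix $u_0\in\mathfrak{F}_0$ nonzero and $u_n$ with $[\pi](u_{n+1})=u_n$. $S$ is the set of sequences $(x_n)$ with $x_n$ in the maximal ideal of $K_n$ and $\text{Tr}^{\text{LT}}_{K_{n+1}/K_n}(x_{n+1})=[q/\pi](x_n)$, where $\text{Tr}^{\text{LT}}$ is the trace computed with $\oplus$ in place of addition. $\mathscr{A}'$ is the set of $f\in\mathcal{O}_K[[x]]$ such that $(f(u_n))$ is a sequence $(\alpha_n)\in S$ with $\sup_n|\alpha_n|<1$; it is an $\mathcal{O}_K$-module with addition $F(f_1(x),f_2(x))$ and action $a\cdot f=[a](f(x))$. Coleman's trace operator $\mathscr{L}$ satisfies $\mathscr{L}(f)([\pi](x))=\sum_{z\in\mathfrak{F}_0}f(x\oplus z)$. $\mathscr{E}$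 is the set of $g\in\pi\mathcal{O}_K[[x]]$ with $\mathscr{L}(g)=\frac{q}{\pi}g$, an $\mathcal{O}_K$-module under ordinary addition and scalar multiplication.
   Formalization: If the residue field has size q = 2, K is assumed to be Q_2. For every other K with q = 2 the claim fails: u_0 lies in K, and the constant series u_0 is a nonzero element of A' with log_F(u_0) = 0. *)

theory Defs
  imports
    "HOL-Algebra.Algebraic_Closure_Type"
    "HOL-Algebra.Generated_Fields"
    "HOL-Algebra.QuotRing"
    "HOL-Algebra.Module"
    "HOL-Analysis.Elementary_Metric_Spaces"
begin

unbundle fps_syntax

text \<open>
  All fields live inside one ambient type, a field of characteristic 0 with a multiplicative
  ultrametric absolute value. The locale \<^verbatim>\<open>lubin_tate_tower\<close> below forces the ambient field to be an
  algebraic closure of \<open>\<rat>\<^sub>p\<close>, and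
  \<open>absv\<close> to be the extension of the \<open>p\<close>-adic absolute value.
\<close>

class nonarch_field = field_char_0 + metric_space +
  fixes absv :: "'a \<Rightarrow> real"
  assumes dist_absv: "dist x y = absv (x - y)"
    and absv_mult: "absv (x * y) = absv x * absv y"
    and absv_add_le_max: "absv (x + y) \<le> max (absv x) (absv y)"

abbreviation ambient :: "'a::nonarch_field ring" where
  "ambient \<equiv> ring_of_type_algebra"

text \<open>
  If \<open>absv\<close> restricts to the \<open>p\<close>-adic absolute value on \<open>\<rat>\<close> and the closure of \<open>\<rat>\<close> is complete,
  then this closure is a completion of \<open>\<rat>\<close> for that absolute value, i.e. the field \<open>\<rat>\<^sub>p\<close>.
\<close>

definition Qp :: "'a::nonarch_field set" where
  "Qp = closure \<rat>"

definition val_ring :: "'a::nonarch_field set \<Rightarrow> 'a set" where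
  "val_ring K = {x \<in> K. absv x \<le> 1}"

definition max_ideal :: "'a::nonarch_field set \<Rightarrow> 'a set" where
  "max_ideal K = {x \<in> K. absv x < 1}"

definition O_ring :: "'a::nonarch_field set \<Rightarrow> 'a ring" where
  "O_ring K = ambient\<lparr>carrier := val_ring K\<rparr>"

definition residue_card :: "'a::nonarch_field set \<Rightarrow> nat" where
  "residue_card K = card (carrier (O_ring K Quot max_ideal K))"

definition uniformizer :: "'a::nonarch_field set \<Rightarrow> 'a \<Rightarrow> bool" where
  "uniformizer K \<pi> \<longleftrightarrow> \<pi> \<noteq> 0 \<and> max_ideal K = (*) \<pi> ` val_ring K"

definition fps_over :: "'a::nonarch_field set \<Rightarrow> 'a fps set" where
  "fps_over A = {f. \<forall>n. f $ n \<in> A}"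

text \<open>
  Evaluation and substitution, with the infinite sums taken in the metric of the ambient field
  (coefficientwise for power series). Series with nonzero constant term may thus be
  substituted, which a purely formal composition would not allow. A series \<open>F(X,Y)\<close> is a term of
  type \<^typ>\<open>'a fps fps\<close>, and \<open>F $ i $ j\<close> is the coefficient of \<open>X\<^sup>i Y\<^sup>j\<close>.
\<close>

definition fps_eval :: "'a::nonarch_field fps \<Rightarrow> 'a \<Rightarrow> 'a" where
  "fps_eval f x = (\<Sum>k. f $ k * x ^ k)"

definition fps_eval2 :: "'a::nonarch_field fps fps \<Rightarrow> 'a \<Rightarrow> 'a \<Rightarrow> 'a" where
  "fps_eval2 F x y = (\<Sum>m. \<Sum>i\<le>m. F $ i $ (m - i) * (x ^ i * y ^ (m - i)))"

definition fps_subst :: "'a::nonarch_field fps \<Rightarrow> 'a fps \<Rightarrow> 'a fps" where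
  "fps_subst f g = Abs_fps (\<lambda>n. \<Sum>k. f $ k * (g ^ k) $ n)"

definition fps_subst2 :: "'a::nonarch_field fps fps \<Rightarrow> 'a fps \<Rightarrow> 'a fps \<Rightarrow> 'a fps" where
  "fps_subst2 F f g =
     Abs_fps (\<lambda>n. \<Sum>m. \<Sum>i\<le>m. F $ i $ (m - i) * (f ^ i * g ^ (m - i)) $ n)"

text \<open>
  Associativity compares the coefficients of \<open>X\<^sup>a Y\<^sup>b Z\<^sup>c\<close> in \<open>F(F(X,Y),Z)\<close> and \<open>F(X,F(Y,Z))\<close>. The sums
  are finite because \<open>F\<close> has no constant term, so that \<open>F\<^sup>i\<close> has no monomial of total degree below
  \<open>i\<close>.
\<close>

definition formal_group_law :: "'a::nonarch_field set \<Rightarrow> 'a fps fps \<Rightarrow> bool" where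
  "formal_group_law R F \<longleftrightarrow>
     (\<forall>i j. F $ i $ j \<in> R) \<and>
     (\<forall>i. F $ i $ 0 = (if i = 1 then 1 else 0)) \<and>
     (\<forall>j. F $ 0 $ j = (if j = 1 then 1 else 0)) \<and>
     (\<forall>i j. F $ i $ j = F $ j $ i) \<and>
     (\<forall>a b c. (\<Sum>i\<le>a + b. F $ i $ c * (F ^ i) $ a $ b) =
              (\<Sum>j\<le>b + c. F $ a $ j * (F ^ j) $ b $ c))"

text \<open>
  \<open>h(F(X,Y)) = G(h(X),h(Y))\<close>, again by comparing coefficients of \<open>X\<^sup>a Y\<^sup>b\<close>; the sums are finite because
  \<open>F\<close> and \<open>h\<close> have no constant term.
\<close>

definition fgl_hom :: "'a::nonarch_field fps fps \<Rightarrow> 'a fps fps \<Rightarrow> 'a fps \<Rightarrow> bool" where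
  "fgl_hom F G h \<longleftrightarrow> h $ 0 = 0 \<and>
     (\<forall>a b. (\<Sum>k\<le>a + b. h $ k * (F ^ k) $ a $ b) =
            (\<Sum>i\<le>a. \<Sum>j\<le>b. G $ i $ j * (h ^ i) $ a * (h ^ j) $ b))"

definition additive_fgl :: "'a::nonarch_field fps fps" where
  "additive_fgl = fps_X + fps_const fps_X"

text \<open>
  \<open>F\<close> is attached to \<open>\<pi>\<close> if it has an endomorphism \<open>e\<close> with \<open>e(x) \<equiv> \<pi>x\<close> modulo degree 2 and
  \<open>e(x) \<equiv> x\<^sup>q\<close> modulo \<open>\<pi>\<close>.
\<close>

definition lubin_tate_fgl :: "'a::nonarch_field set \<Rightarrow> 'a \<Rightarrow> 'a fps fps \<Rightarrow> bool" where
  "lubin_tate_fgl K \<pi> F \<longleftrightarrow> formal_group_law (val_ring K) F \<and>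
     (\<exists>e \<in> fps_over (val_ring K).
        fgl_hom F F e \<and> e $ 1 = \<pi> \<and>
        e - fps_X ^ residue_card K \<in> fps_over ((*) \<pi> ` val_ring K))"

text \<open>The endomorphism \<open>[a](x)\<close>.\<close>

definition fgl_endo :: "'a::nonarch_field set \<Rightarrow> 'a fps fps \<Rightarrow> 'a \<Rightarrow> 'a fps" where
  "fgl_endo K F a = (THE h. h \<in> fps_over (val_ring K) \<and> fgl_hom F F h \<and> h $ 1 = a)"

definition fgl_log :: "'a::nonarch_field set \<Rightarrow> 'a fps fps \<Rightarrow> 'a fps" where
  "fgl_log K F = (THE l. l \<in> fps_over K \<and> fgl_hom F additive_fgl l \<and> l $ 1 = 1)"

definition fgl_exp :: "'a::nonarch_field set \<Rightarrow> 'a fps fps \<Rightarrow> 'a fps" where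
  "fgl_exp K F = fps_inv (fgl_log K F)"

text \<open>\<open>torsion K \<pi> F n\<close> is the kernel of \<open>[\<pi>\<^sup>n\<^sup>+\<^sup>1]\<close>, with index \<open>n + 1\<close>; \<open>level K \<pi> F n\<close> is \<open>K\<^sub>n\<close>.\<close>

definition torsion :: "'a::nonarch_field set \<Rightarrow> 'a \<Rightarrow> 'a fps fps \<Rightarrow> nat \<Rightarrow> 'a set" where
  "torsion K \<pi> F n = {z. absv z < 1 \<and> fps_eval (fgl_endo K F (\<pi> ^ (n + 1))) z = 0}"

definition level :: "'a::nonarch_field set \<Rightarrow> 'a \<Rightarrow> 'a fps fps \<Rightarrow> nat \<Rightarrow> 'a set" where
  "level K \<pi> F n = generate_field ambient (K \<union> torsion K \<pi> F n)"

text \<open>Automorphisms are made \<^const>\<open>extensional\<close> so that each occurs only once in sums.\<close>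

definition galois_group :: "'a::nonarch_field set \<Rightarrow> 'a set \<Rightarrow> ('a \<Rightarrow> 'a) set" where
  "galois_group L M =
     {\<sigma> \<in> ring_iso (ambient\<lparr>carrier := L\<rparr>) (ambient\<lparr>carrier := L\<rparr>) \<inter> extensional L.
        \<forall>x\<in>M. \<sigma> x = x}"

definition fgl_points :: "'a::nonarch_field fps fps \<Rightarrow> 'a monoid" where
  "fgl_points F = \<lparr>carrier = {x. absv x < 1}, monoid.mult = fps_eval2 F, one = 0\<rparr>"

text \<open>The product in the group of points of \<open>F\<close> is the sum of the conjugates with respect to \<open>F\<close>.\<close>

definition lt_trace :: "'a::nonarch_field fps fps \<Rightarrow> 'a set \<Rightarrow> 'a set \<Rightarrow> 'a \<Rightarrow> 'a" where
  "lt_trace F L M x = finprod (fgl_points F) (\<lambda>\<sigma>. \<sigma> x) (galois_group L M)"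

definition trace_seqs :: "'a::nonarch_field set \<Rightarrow> 'a \<Rightarrow> 'a fps fps \<Rightarrow> (nat \<Rightarrow> 'a) set" where
  "trace_seqs K \<pi> F =
     {x. \<forall>n. x n \<in> max_ideal (level K \<pi> F n) \<and>
             lt_trace F (level K \<pi> F (Suc n)) (level K \<pi> F n) (x (Suc n)) =
             fps_eval (fgl_endo K F (of_nat (residue_card K) / \<pi>)) (x n)}"

definition A_set :: "'a::nonarch_field set \<Rightarrow> 'a \<Rightarrow> 'a fps fps \<Rightarrow> (nat \<Rightarrow> 'a) \<Rightarrow> 'a fps set" where
  "A_set K \<pi> F u =
     {f \<in> fps_over (val_ring K).
        (\<lambda>n. fps_eval f (u n)) \<in> trace_seqs K \<pi> F \<and> (SUP n. absv (fps_eval f (u n))) < 1}"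

text \<open>The fields \<open>mult\<close> and \<open>one\<close> of a module record play no role, and are filled in arbitrarily.\<close>

definition A_module ::
    "'a::nonarch_field set \<Rightarrow> 'a \<Rightarrow> 'a fps fps \<Rightarrow> (nat \<Rightarrow> 'a) \<Rightarrow> ('a, 'a fps) module" where
  "A_module K \<pi> F u =
     \<lparr>carrier = A_set K \<pi> F u, monoid.mult = (\<lambda>_ _. 0), one = 0, ring.zero = 0,
      add = fps_subst2 F, module.smult = (\<lambda>a f. fps_subst (fgl_endo K F a) f)\<rparr>"

text \<open>
  Coleman's trace of \<open>f\<close> is the unique \<open>h\<close> with \<open>h([\<pi>](x))\<close> equal to the sum of \<open>f(x \<oplus> z)\<close> over the
  kernel of \<open>[\<pi>]\<close>; its existence, for \<open>f\<close> with coefficients in \<open>\<O>\<^sub>K\<close>, is a theorem of Coleman.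
\<close>

definition coleman_trace ::
    "'a::nonarch_field set \<Rightarrow> 'a \<Rightarrow> 'a fps fps \<Rightarrow> 'a fps \<Rightarrow> 'a fps" where
  "coleman_trace K \<pi> F f =
     (THE h. h \<in> fps_over (val_ring K) \<and>
        h oo fgl_endo K F \<pi> =
        (\<Sum>z\<in>torsion K \<pi> F 0. fps_subst f (fps_subst2 F fps_X (fps_const z))))"

definition E_set :: "'a::nonarch_field set \<Rightarrow> 'a \<Rightarrow> 'a fps fps \<Rightarrow> 'a fps set" where
  "E_set K \<pi> F =
     {g \<in> fps_over ((*) \<pi> ` val_ring K).
        coleman_trace K \<pi> F g = fps_const (of_nat (residue_card K) / \<pi>) * g}"

definition E_module :: "'a::nonarch_field set \<Rightarrow> 'a \<Rightarrow> 'a fps fps \<Rightarrow> ('a, 'a fps) module" where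
  "E_module K \<pi> F =
     \<lparr>carrier = E_set K \<pi> F, monoid.mult = (\<lambda>_ _. 0), one = 0, ring.zero = 0,
      add = (+), module.smult = (\<lambda>a g. fps_const a * g)\<rparr>"

definition module_iso ::
    "'r ring \<Rightarrow> ('r, 'm) module \<Rightarrow> ('r, 'n) module \<Rightarrow> ('m \<Rightarrow> 'n) set" where
  "module_iso R M N =
     {h. Module.module R M \<and> Module.module R N \<and> bij_betw h (carrier M) (carrier N) \<and>
         (\<forall>x\<in>carrier M. \<forall>y\<in>carrier M. h (x \<oplus>\<^bsub>M\<^esub> y) = h x \<oplus>\<^bsub>N\<^esub> h y) \<and>
         (\<forall>a\<in>carrier R. \<forall>x\<in>carrier M. h (a \<odot>\<^bsub>M\<^esub> x) = a \<odot>\<^bsub>N\<^esub> h x)}"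

locale lubin_tate_tower =
  fixes p :: nat
    and K :: "'a::nonarch_field set"
    and \<pi> :: 'a
    and F :: "'a fps fps"
    and u :: "nat \<Rightarrow> 'a"
  assumes prime_p: "prime p"
    and absv_padic: "\<And>m :: int. m \<noteq> 0 \<Longrightarrow>
          absv (of_int m :: 'a) = 1 / real p ^ multiplicity (int p) m"
    and complete_Qp: "complete (Qp :: 'a set)"
    and ambient_closure: "algebraic_closure (ambient :: 'a ring) Qp"
    and subfield_K: "subfield K ambient"
    and Qp_subset_K: "Qp \<subseteq> K"
    and finite_K: "ring.finite_dimension ambient Qp K"
    and uniformizer: "uniformizer K \<pi>"
    and lubin_tate: "lubin_tate_fgl K \<pi> F"
    and u_0: "u 0 \<in> torsion K \<pi> F 0" "u 0 \<noteq> 0"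
    and u_Suc: "\<And>n. absv (u (Suc n)) < 1" "\<And>n. fps_eval (fgl_endo K F \<pi>) (u (Suc n)) = u n"

text \<open>
  If the residue field has two elements, then \<open>u\<^sub>0 \<in> K\<close>. If moreover \<open>K \<noteq> \<rat>\<^sub>2\<close>, then \<open>q/\<pi>\<close> is not a unit
  and the constant series \<open>u\<^sub>0\<close> is a nonzero element of \<^const>\<open>A_set\<close> with logarithm 0. The
  injectivity of the logarithm on \<^const>\<open>A_set\<close> therefore needs that case to be excluded.
\<close>

end

theory Submission
  imports
    Defs
    "HOL-Algebra.Sylow"
    "HOL-Analysis.Infinite_Sum"
begin

text \<open>
  Put \<open>r = \<bar>\<pi>\<bar>\<^bsup>1/(q-1)\<^esup>\<close> and \<open>[\<pi>](X) = \<phi>(X)\<close>. The logarithm \<open>\<lambda>\<close> is the solution of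
  \<open>\<lambda> \<circ> \<phi> = \<pi> \<lambda>\<close> with linear coefficient 1; the recursion gives \<open>\<bar>\<lambda>\<^sub>n\<bar> r\<^sup>n \<le> r\<close>, so \<open>\<lambda>\<close> and \<open>exp\<^sub>F\<close>
  are inverse isometries of the disc \<open>\<bar>x\<bar> < r\<close>. If \<open>q \<ge> 3\<close>, then \<open>\<bar>\<pi>\<bar> < r\<close> and both are
  inverse bijections of \<open>\<pi>\<O>[[X]]\<close>. Since \<open>\<bar>u\<^sub>n\<bar>\<close> tends to 1, the condition \<open>sup \<bar>f(u\<^sub>n)\<bar> < 1\<close> means
  exactly that \<open>f \<in> \<pi>\<O>[[X]]\<close>. The conjugates of \<open>u\<^sub>n\<^sub>+\<^sub>1\<close> over \<open>K\<^sub>n\<close> are the \<open>u\<^sub>n\<^sub>+\<^sub>1 \<oplus> z\<close> with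
  \<open>z \<in> \<FF>\<^sub>0\<close>, so \<open>\<lambda>\<close> turns the trace of \<open>f(u\<^sub>n\<^sub>+\<^sub>1)\<close> into the value at \<open>u\<^sub>n\<close> of Coleman's trace of
  \<open>\<lambda> \<circ> f\<close>, and a bounded series is determined by its values at the \<open>u\<^sub>n\<close>. If \<open>q = 2\<close> and \<open>K = \<rat>\<^sub>2\<close>, then \<open>q / \<pi>\<close>
  is a unit, and both modules vanish, because their elements can be divided by \<open>\<pi>\<close> indefinitely.
\<close>

section \<open>Non-Archimedean absolute values and infinite sums\<close>

text \<open>The ambient field is an algebraic closure, hence not complete: an infinite sum can only
  be formed inside a complete subfield containing its terms. The analytic lemmas therefore carry
  such a subfield \<open>C\<close>. Identities between series are mostly proved by comparing values,
  since a bounded series with zeros arbitrarily close to 0 vanishes. So the logarithm, controlled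
  only on the disc of radius r, still yields formal identities, and these hold on the whole open
  unit disc once the coefficients are known to be integral. Beyond radius r the arithmetic rests on
  one expansion: \<O>[[X]] is spanned by 1, ..., X^(q-1) over \<O>[[[\<pi>](X)]]. It bounds the
  number of solutions of [\<pi>](x) = w by q, it replaces a power series on such a fibre by a
  polynomial, so that automorphisms commute with its values without a continuity argument, and it
  reduces Coleman's trace to power sums of q roots. The restriction for q = 2 comes from r = |\<pi>|
  in that case: elements of \<pi>\<O>[[X]] may then take values on the boundary of the disc where
  the exponential is controlled.\<close>

lemma absv_zero [simp]: "absv (0::'a::nonarch_field) = 0"
  by (metis diff_self dist_absv dist_self)

lemma absv_nonneg [simp]: "0 \<le> absv (x::'a::nonarch_field)"
  by (metis diff_zero dist_absv zero_le_dist)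

lemma absv_eq_0 [simp]: "absv (x::'a::nonarch_field) = 0 \<longleftrightarrow> x = 0"
  by (metis absv_zero diff_zero dist_absv dist_eq_0_iff)

lemma absv_pos [simp]: "0 < absv (x::'a::nonarch_field) \<longleftrightarrow> x \<noteq> 0"
  by (metis absv_eq_0 absv_nonneg less_eq_real_def less_irrefl)

lemma absv_one [simp]: "absv (1::'a::nonarch_field) = 1"
  by (metis absv_eq_0 absv_mult mult_cancel_right1 mult_1 zero_neq_one)

lemma absv_minus [simp]: "absv (- x::'a::nonarch_field) = absv x"
  by (metis diff_0 diff_zero dist_absv dist_commute)

lemma absv_diff_commute: "absv (x - y::'a::nonarch_field) = absv (y - x)"
  by (metis absv_minus minus_diff_eq)

lemma absv_power: "absv (x ^ n::'a::nonarch_field) = absv x ^ n"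
  by (induction n) (auto simp: absv_mult)

lemma absv_inverse: "absv (inverse x::'a::nonarch_field) = inverse (absv x)"
proof (cases "x = 0")
  case False
  then have "absv x * absv (inverse x) = 1"
    by (simp add: absv_mult [symmetric])
  then show ?thesis by (metis inverse_unique)
qed simp

lemma absv_divide: "absv (x / y::'a::nonarch_field) = absv x / absv y"
  by (simp add: divide_inverse absv_mult absv_inverse)

lemma absv_add_le: "absv x \<le> B \<Longrightarrow> absv y \<le> B \<Longrightarrow> absv (x + y::'a::nonarch_field) \<le> B"
  using absv_add_le_max[of x y] by linarith

lemma absv_add_less: "absv x < B \<Longrightarrow> absv y < B \<Longrightarrow> absv (x + y::'a::nonarch_field) < B"
  using absv_add_le_max[of x y] by linarith

lemma absv_diff_le: "absv x \<le> B \<Longrightarrow> absv y \<le> B \<Longrightarrow> absv (x - y::'a::nonarch_field) \<le> B"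
  using absv_add_le[of x B "- y"] by simp

lemma absv_diff_less: "absv x < B \<Longrightarrow> absv y < B \<Longrightarrow> absv (x - y::'a::nonarch_field) < B"
  using absv_add_less[of x B "- y"] by simp

lemma absv_sum_le:
  fixes f :: "'i \<Rightarrow> 'a::nonarch_field"
  assumes "\<And>i. i \<in> A \<Longrightarrow> absv (f i) \<le> B" "0 \<le> B"
  shows "absv (sum f A) \<le> B"
  using assms by (induction A rule: infinite_finite_induct) (auto intro: absv_add_le)

text \<open>If the sum were smaller than \<open>x\<close>, then \<open>x = (x + y) - y\<close> would
  be a difference of two elements smaller than \<open>x\<close>.\<close>

lemma absv_add_eq:
  assumes "absv y < absv x"
  shows "absv (x + y::'a::nonarch_field) = absv x"
proof (rule antisym)
  show "absv (x + y) \<le> absv x"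
    using assms by (intro absv_add_le) auto
  show "absv x \<le> absv (x + y)"
    using assms absv_add_le_max[of "x + y" "- y"] by (auto simp: max_def split: if_splits)
qed

lemma absv_of_nat_le: "absv (of_nat n :: 'a::nonarch_field) \<le> 1"
  by (induction n) (auto intro: absv_add_le)

lemma absv_le_1_power: "absv x \<le> 1 \<Longrightarrow> absv (x ^ n :: 'a::nonarch_field) \<le> 1"
  by (simp add: absv_power power_le_one)

section \<open>Continuity of the field operations\<close>

instance nonarch_field \<subseteq> topological_group_add
proof
  fix a b :: 'a
  show "((\<lambda>x. fst x + snd x) \<longlongrightarrow> a + b) (nhds a \<times>\<^sub>F nhds b)"
  proof (rule tendstoI)
    fix e :: real assume e: "0 < e"
    have "\<forall>\<^sub>F x in nhds a \<times>\<^sub>F nhds b. dist (fst x) a < e \<and> dist (snd x) b < e"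
      using tendstoD[OF filterlim_fst e, of a] tendstoD[OF filterlim_snd e, of b]
      by (intro eventually_conj)
    then show "\<forall>\<^sub>F x in nhds a \<times>\<^sub>F nhds b. dist (fst x + snd x) (a + b) < e"
    proof eventually_elim
      case (elim x)
      then show ?case
        using absv_add_less[of "fst x - a" e "snd x - b"] by (simp add: dist_absv algebra_simps)
    qed
  qed
  show "(uminus \<longlongrightarrow> - a) (nhds a)"
  proof (rule tendstoI)
    fix e :: real assume e: "0 < e"
    have "\<forall>\<^sub>F x in nhds a. dist x a < e"
      using tendstoD[OF filterlim_ident e] .
    then show "\<forall>\<^sub>F x in nhds a. dist (- x) (- a) < e"
      by eventually_elim (simp add: dist_absv absv_diff_commute)
  qed
qed

instance nonarch_field \<subseteq> topological_ab_group_add ..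

instance nonarch_field \<subseteq> topological_semigroup_mult
proof
  fix a b :: 'a
  show "((\<lambda>x. fst x * snd x) \<longlongrightarrow> a * b) (nhds a \<times>\<^sub>F nhds b)"
  proof (rule tendstoI)
    fix e :: real assume e: "0 < e"
    \<comment> \<open>\<open>d\<close> times each of 1, |a| and |b| is below \<open>e\<close>, which
      bounds the three terms of the expansion \<open>eq\<close>; \<open>d \<le> 1\<close> takes care
      of the product \<open>s * t\<close>.\<close>
    define d where "d = min 1 (e / (2 * (1 + absv a + absv b)))"
    have s: "1 + absv a + absv b > 0"
      using absv_nonneg[of a] absv_nonneg[of b] by linarith
    have d: "0 < d" "d \<le> 1" "d * (1 + absv a + absv b) < e"
    proof -
      show "0 < d" "d \<le> 1" using e s by (auto simp: d_def)
      have "d * (1 + absv a + absv b) \<le> e / (2 * (1 + absv a + absv b)) * (1 + absv a + absv b)"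
        using s by (intro mult_right_mono) (auto simp: d_def)
      also have "\<dots> = e / 2" using s by (simp add: field_simps)
      finally show "d * (1 + absv a + absv b) < e" using e by simp
    qed
    have "\<forall>\<^sub>F x in nhds a \<times>\<^sub>F nhds b. dist (fst x) a < d \<and> dist (snd x) b < d"
      using tendstoD[OF filterlim_fst d(1), of a] tendstoD[OF filterlim_snd d(1), of b]
      by (intro eventually_conj)
    then show "\<forall>\<^sub>F x in nhds a \<times>\<^sub>F nhds b. dist (fst x * snd x) (a * b) < e"
    proof eventually_elim
      case (elim x)
      define s t where "s = fst x - a" and "t = snd x - b"
      have st: "absv s < d" "absv t < d" using elim by (auto simp: s_def t_def dist_absv)
      have eq: "fst x * snd x - a * b = s * t + (a * t + s * b)"
        by (simp add: s_def t_def algebra_simps)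
      have 1: "absv s * absv t \<le> d * 1" using st d by (intro mult_mono) auto
      have 2: "absv t * absv a \<le> d * absv a" "absv s * absv b \<le> d * absv b"
        using st by (auto intro!: mult_right_mono)
      have "0 \<le> d * absv a" "0 \<le> d * absv b" "0 \<le> d" using d by auto
      then have "absv s * absv t < e" "absv t * absv a < e" "absv s * absv b < e"
        using 1 2 d(3) unfolding distrib_left mult_1_right by linarith+
      then have "absv (s * t) < e" "absv (a * t) < e" "absv (s * b) < e"
        by (auto simp: absv_mult mult.commute)
      then show ?case unfolding dist_absv eq by (intro absv_add_less)
    qed
  qed
qed

section \<open>Unordered sums in complete subfields\<close>

lemma has_sum_absv_le:
  fixes f :: "'i \<Rightarrow> 'a::nonarch_field"
  assumes "(f has_sum s) A" "\<And>i. i \<in> A \<Longrightarrow> absv (f i) \<le> B" "0 \<le> B"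
  shows "absv s \<le> B"
proof -
  have "s \<in> cball 0 B"
  proof (rule Lim_in_closed_set)
    show "(sum f \<longlongrightarrow> s) (finite_subsets_at_top A)"
      using assms(1) by (simp add: has_sum_def)
    show "\<forall>\<^sub>F U in finite_subsets_at_top A. sum f U \<in> cball 0 B"
      using assms(2,3) by (intro eventually_finite_subsets_at_top_weakI)
        (auto simp: dist_absv intro!: absv_sum_le)
  qed auto
  then show ?thesis by (simp add: dist_absv)
qed

text \<open>The place where infinite sums are formed; \<open>cfield_containing\<close> supplies one
  around any finite set of points.\<close>

definition cfield :: "'a::nonarch_field set \<Rightarrow> bool" where
  "cfield C \<longleftrightarrow> subfield C ambient \<and> complete C"

lemma ambient_simps [simp]:
  "carrier (ambient :: 'a::nonarch_field ring) = UNIV"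
  "x \<otimes>\<^bsub>ambient\<^esub> y = x * (y::'a)" "\<one>\<^bsub>ambient\<^esub> = (1::'a)"
  "\<zero>\<^bsub>ambient\<^esub> = (0::'a)" "x \<oplus>\<^bsub>ambient\<^esub> y = x + (y::'a)"
  by (auto simp: ring_of_type_algebra_def)

lemma field_ambient: "field (ambient :: 'a::nonarch_field ring)"
  by (rule field_from_type_algebra)

lemma ambient_minus [simp]: "\<ominus>\<^bsub>ambient\<^esub> x = - (x::'a::nonarch_field)"
proof -
  interpret field "ambient :: 'a ring" by (rule field_ambient)
  show ?thesis by (rule minus_equality) auto
qed

lemma ambient_inv [simp]: "x \<noteq> 0 \<Longrightarrow> inv\<^bsub>ambient\<^esub> x = inverse (x::'a::nonarch_field)"
proof -
  interpret field "ambient :: 'a ring" by (rule field_ambient)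
  assume "x \<noteq> 0"
  then show ?thesis by (intro comm_inv_char) auto
qed

lemma subfield_ambient:
  assumes "subfield C (ambient :: 'a::nonarch_field ring)"
  shows "0 \<in> C" "1 \<in> C" "x \<in> C \<Longrightarrow> y \<in> C \<Longrightarrow> x + y \<in> C"
    "x \<in> C \<Longrightarrow> y \<in> C \<Longrightarrow> x - y \<in> C" "x \<in> C \<Longrightarrow> - x \<in> C"
    "x \<in> C \<Longrightarrow> y \<in> C \<Longrightarrow> x * y \<in> C" "x \<in> C \<Longrightarrow> inverse x \<in> C"
    "x \<in> C \<Longrightarrow> y \<in> C \<Longrightarrow> x / y \<in> C"
proof -
  interpret field "ambient :: 'a ring" by (rule field_ambient)
  have 0: "0 \<in> C" "1 \<in> C" "\<And>x y. x \<in> C \<Longrightarrow> y \<in> C \<Longrightarrow> x + y \<in> C"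
    "\<And>x y. x \<in> C \<Longrightarrow> y \<in> C \<Longrightarrow> x * y \<in> C" "\<And>x. x \<in> C \<Longrightarrow> - x \<in> C"
    using subringE[OF subfieldE(1)[OF assms]] by auto
  have 1: "inverse x \<in> C" if "x \<in> C" for x
  proof (cases "x = 0")
    case False
    then show ?thesis using subfield_m_inv(1)[OF assms, of x] that by auto
  qed (use 0 in auto)
  show "0 \<in> C" "1 \<in> C" "x \<in> C \<Longrightarrow> y \<in> C \<Longrightarrow> x + y \<in> C"
    "x \<in> C \<Longrightarrow> - x \<in> C"
    "x \<in> C \<Longrightarrow> y \<in> C \<Longrightarrow> x * y \<in> C" "x \<in> C \<Longrightarrow> inverse x \<in> C" by (rule 0 1; assumption)+
  show "x \<in> C \<Longrightarrow> y \<in> C \<Longrightarrow> x - y \<in> C" using 0 by (metis diff_conv_add_uminus)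
  show "x \<in> C \<Longrightarrow> y \<in> C \<Longrightarrow> x / y \<in> C" using 0 1 by (metis divide_inverse)
qed

lemma subfield_ambient_sum:
  assumes "subfield C (ambient :: 'a::nonarch_field ring)" "\<And>i. i \<in> A \<Longrightarrow> f i \<in> C"
  shows "sum f A \<in> C"
  using assms(2) by (induction A rule: infinite_finite_induct) (auto intro: subfield_ambient[OF assms(1)])

lemma subfield_ambient_power:
  assumes "subfield C (ambient :: 'a::nonarch_field ring)" "x \<in> C"
  shows "x ^ n \<in> C"
  by (induction n) (auto intro: subfield_ambient[OF assms(1)] assms(2))

lemma subfield_ambient_of_nat:
  assumes "subfield C (ambient :: 'a::nonarch_field ring)"
  shows "of_nat n \<in> C"
  by (induction n) (auto intro: subfield_ambient[OF assms(1)])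

lemmas cfield_sub = cfield_def[THEN iffD1, THEN conjunct1]
lemmas cfield_intros = subfield_ambient[OF cfield_sub] subfield_ambient_sum[OF cfield_sub]
  subfield_ambient_power[OF cfield_sub] subfield_ambient_of_nat[OF cfield_sub]

text \<open>The terms tend to 0 along the cofinite filter. In a complete ultrametric field this
  already suffices for summability (\<open>complete_has_sum\<close>), in contrast to the real
  case.\<close>

definition null_family :: "('i \<Rightarrow> 'a::nonarch_field) \<Rightarrow> 'i set \<Rightarrow> bool" where
  "null_family f A \<longleftrightarrow> (\<forall>e>0. finite {i\<in>A. e \<le> absv (f i)})"

text \<open>In the applications \<open>w\<close> is a total degree: the terms decay geometrically in
  it, and only finitely many nonzero ones occur up to each degree.\<close>

lemma null_family_weight:
  fixes f :: "'i \<Rightarrow> 'a::nonarch_field" and w :: "'i \<Rightarrow> nat"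
  assumes t: "0 \<le> t" "t < 1"
    and le: "\<And>i. i \<in> A \<Longrightarrow> absv (f i) \<le> B * t ^ w i"
    and fin: "\<And>N. finite {i\<in>A. f i \<noteq> 0 \<and> w i \<le> N}"
  shows "null_family f A"
  unfolding null_family_def
proof (intro allI impI)
  fix e :: real assume e: "0 < e"
  have "(\<lambda>n. B * t ^ n) \<longlonglongrightarrow> B * 0"
    using t by (intro tendsto_intros LIMSEQ_power_zero) auto
  then have "\<forall>\<^sub>F n in sequentially. B * t ^ n < e"
    using e by (auto dest: order_tendstoD)
  then obtain N where N: "\<And>n. n \<ge> N \<Longrightarrow> B * t ^ n < e"
    by (auto simp: eventually_sequentially)
  have "{i\<in>A. e \<le> absv (f i)} \<subseteq> {i\<in>A. f i \<noteq> 0 \<and> w i \<le> N}"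
  proof safe
    fix i assume i: "i \<in> A" "e \<le> absv (f i)"
    show "w i \<le> N" using le[OF i(1)] i(2) N[of "w i"] by (cases "w i \<le> N") auto
  qed (use e in auto)
  then show "finite {i\<in>A. e \<le> absv (f i)}" using fin finite_subset by blast
qed

text \<open>Apart from the finitely many terms of size at least e/2, every finite sum of terms has
  size at most e/2, however many terms it has. Hence the partial sums form a Cauchy filter.\<close>

lemma complete_has_sum:
  fixes f :: "'i \<Rightarrow> 'a::nonarch_field"
  assumes C: "complete C" "0 \<in> C" "\<And>x y. x \<in> C \<Longrightarrow> y \<in> C \<Longrightarrow> x + y \<in> C"
    and f: "\<And>i. i \<in> A \<Longrightarrow> f i \<in> C" and null: "null_family f A"
  obtains s where "s \<in> C" "(f has_sum s) A"
proof -
  let ?F = "filtermap (sum f) (finite_subsets_at_top A)"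
  have sumC: "sum f U \<in> C" if "U \<subseteq> A" for U
    using that f by (induction U rule: infinite_finite_induct) (auto intro: C)
  have "cauchy_filter ?F"
    unfolding cauchy_filter_metric_filtermap
  proof (intro allI impI)
    fix e :: real assume e: "0 < e"
    define D where "D = {i\<in>A. e / 2 \<le> absv (f i)}"
    have D: "finite D" "D \<subseteq> A"
      using null half_gt_zero[OF e] unfolding null_family_def D_def by blast+
    have small: "absv (sum f Z) \<le> e / 2" if "Z \<subseteq> A - D" for Z
      using that e by (intro absv_sum_le) (auto simp: D_def)
    let ?P = "\<lambda>U. finite U \<and> D \<subseteq> U \<and> U \<subseteq> A"
    have "eventually ?P (finite_subsets_at_top A)"
      using D unfolding eventually_finite_subsets_at_top by blast
    moreover have "dist (sum f U) (sum f V) < e" if "?P U" "?P V" for U V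
    proof -
      have "sum f U = sum f D + sum f (U - D)" "sum f V = sum f D + sum f (V - D)"
        using that by (auto simp: sum.subset_diff add.commute)
      then have "sum f U - sum f V = sum f (U - D) - sum f (V - D)" by simp
      moreover have "absv (sum f (U - D) - sum f (V - D)) \<le> e / 2"
        using that by (intro absv_diff_le small) auto
      ultimately show ?thesis using e by (simp add: dist_absv)
    qed
    ultimately show "\<exists>P. eventually P (finite_subsets_at_top A) \<and>
        (\<forall>U V. P U \<and> P V \<longrightarrow> dist (sum f U) (sum f V) < e)"
      by (intro exI[of _ ?P] conjI allI impI) simp_all
  qed
  moreover have "?F \<le> principal C"
    unfolding le_principal eventually_filtermap
    by (intro eventually_finite_subsets_at_top_weakI) (auto intro: sumC)
  moreover have "?F \<noteq> bot" by (simp add: filtermap_bot_iff)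
  ultimately obtain s where "s \<in> C" "?F \<le> nhds s"
    using C(1) unfolding complete_uniform by blast
  then show ?thesis using that by (auto simp: has_sum_def filterlim_def)
qed

lemma cfield_has_sum:
  assumes "cfield C" "\<And>i. i \<in> A \<Longrightarrow> f i \<in> C" "null_family f A"
  obtains s where "s \<in> C" "(f has_sum s) A"
  using assms complete_has_sum[of C A f] by (auto simp: cfield_def intro: subfield_ambient)

lemma has_sum_in_cfield:
  assumes "cfield C" "\<And>i. i \<in> A \<Longrightarrow> f i \<in> C" "null_family f A" "(f has_sum s) A"
  shows "s \<in> C"
  using cfield_has_sum[OF assms(1-3)] has_sum_unique[OF assms(4)] by metis

text \<open>The null condition on the product makes the double family summable, and its total can be
  computed by rows as well as by columns. Convergence of the iterated sums alone would not permit
  the exchange.\<close>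

lemma has_sum_fubini:
  fixes f :: "'i \<Rightarrow> 'j \<Rightarrow> 'a::nonarch_field"
  assumes C: "cfield C" "\<And>i j. i \<in> A \<Longrightarrow> j \<in> B \<Longrightarrow> f i j \<in> C"
    and null: "null_family (\<lambda>(i, j). f i j) (A \<times> B)"
    and rows: "\<And>i. i \<in> A \<Longrightarrow> (f i has_sum r i) B" and R: "(r has_sum R) A"
  shows "((\<lambda>(i, j). f i j) has_sum R) (A \<times> B)"
    and "(\<And>j. j \<in> B \<Longrightarrow> ((\<lambda>i. f i j) has_sum c j) A) \<Longrightarrow> (c has_sum R) B"
proof -
  obtain T where T: "((\<lambda>(i, j). f i j) has_sum T) (A \<times> B)"
    using cfield_has_sum[OF C(1) _ null] C(2) by (metis (mono_tags, lifting) SigmaE case_prod_conv)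
  have "(r has_sum T) A"
    using has_sum_SigmaD[OF T, of r] rows by simp
  then have "T = R" using R by (rule has_sum_unique)
  with T show 1: "((\<lambda>(i, j). f i j) has_sum R) (A \<times> B)" by simp
  assume cols: "\<And>j. j \<in> B \<Longrightarrow> ((\<lambda>i. f i j) has_sum c j) A"
  have "((\<lambda>(j, i). f i j) has_sum R) (B \<times> A)"
    using 1 by (subst has_sum_reindex_bij_witness[where j = prod.swap and i = prod.swap and T = "A \<times> B"
          and h = "\<lambda>(i, j). f i j" and s' = R]) auto
  from has_sum_SigmaD[OF this, of c] cols show "(c has_sum R) B" by simp
qed

lemma has_sum_prod:
  fixes f :: "'i \<Rightarrow> 'a::nonarch_field"
  assumes C: "cfield C" "\<And>i. i \<in> A \<Longrightarrow> f i \<in> C" "\<And>j. j \<in> B \<Longrightarrow> g j \<in> C"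
    and null: "null_family (\<lambda>(i, j). f i * g j) (A \<times> B)"
    and f: "(f has_sum s) A" and g: "(g has_sum t) B"
  shows "((\<lambda>(i, j). f i * g j) has_sum (s * t)) (A \<times> B)"
proof (rule has_sum_fubini(1)[where r = "\<lambda>i. f i * t", OF C(1) _ null])
  show "((\<lambda>j. f i * g j) has_sum (f i * t)) B" if "i \<in> A" for i
    by (rule has_sum_cmult_right[OF g])
  show "((\<lambda>i. f i * t) has_sum (s * t)) A" by (rule has_sum_cmult_left[OF f])
qed (auto intro: cfield_intros[OF C(1)] C)

section \<open>Evaluation and substitution of power series\<close>

lemma fps_overD: "f \<in> fps_over C \<Longrightarrow> f $ n \<in> C"
  by (simp add: fps_over_def)

lemma fps_overI: "(\<And>n. f $ n \<in> C) \<Longrightarrow> f \<in> fps_over C"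
  by (simp add: fps_over_def)

lemma fps_over_mono: "f \<in> fps_over C \<Longrightarrow> C \<subseteq> D \<Longrightarrow> f \<in> fps_over D"
  by (auto simp: fps_over_def)

lemma fps_over_intros:
  assumes "cfield C"
  shows "0 \<in> fps_over C" "1 \<in> fps_over C" "fps_X \<in> fps_over C"
    "c \<in> C \<Longrightarrow> fps_const c \<in> fps_over C"
    "f \<in> fps_over C \<Longrightarrow> g \<in> fps_over C \<Longrightarrow> f + g \<in> fps_over C"
    "f \<in> fps_over C \<Longrightarrow> g \<in> fps_over C \<Longrightarrow> f - g \<in> fps_over C"
    "f \<in> fps_over C \<Longrightarrow> g \<in> fps_over C \<Longrightarrow> f * g \<in> fps_over C"
    "f \<in> fps_over C \<Longrightarrow> g \<in> fps_over C \<Longrightarrow> f oo g \<in> fps_over C"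
    "f \<in> fps_over C \<Longrightarrow> f ^ k \<in> fps_over C"
    "(\<And>i. i \<in> A \<Longrightarrow> F i \<in> fps_over C) \<Longrightarrow> sum F A \<in> fps_over C"
proof -
  note [intro] = cfield_intros[OF assms]
  have mult: "f \<in> fps_over C \<Longrightarrow> g \<in> fps_over C \<Longrightarrow> f * g \<in> fps_over C" for f g
    by (auto simp: fps_over_def fps_mult_nth)
  have one: "1 \<in> fps_over C"
    by (auto simp: fps_over_def)
  have power: "f \<in> fps_over C \<Longrightarrow> f ^ k \<in> fps_over C" for f k
    by (induction k) (auto intro: mult one)
  show "f \<in> fps_over C \<Longrightarrow> g \<in> fps_over C \<Longrightarrow> f oo g \<in> fps_over C"
    by (intro fps_overI, unfold fps_compose_nth)
      (intro cfield_intros(9)[OF assms] cfield_intros(6)[OF assms] fps_overD power)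
  show "f \<in> fps_over C \<Longrightarrow> f ^ k \<in> fps_over C" by (rule power)
qed (use assms in \<open>auto simp: fps_over_def fps_X_def fps_mult_nth fps_sum_nth
      intro!: cfield_intros[OF assms]\<close>)

text \<open>\<open>B\<close> bounds the Gauss norm of radius \<open>s\<close>. A bound is used in
  place of the supremum itself, which may be infinite.\<close>

definition gauss_le :: "real \<Rightarrow> real \<Rightarrow> 'a::nonarch_field fps \<Rightarrow> bool" where
  "gauss_le s B f \<longleftrightarrow> (\<forall>n. absv (f $ n) * s ^ n \<le> B)"

lemma gauss_leD: "gauss_le s B f \<Longrightarrow> absv (f $ n) * s ^ n \<le> B"
  by (simp add: gauss_le_def)

lemma gauss_le_1: "gauss_le 1 B f \<longleftrightarrow> (\<forall>n. absv (f $ n) \<le> B)"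
  by (simp add: gauss_le_def)

lemma gauss_le_nonneg: "gauss_le s B f \<Longrightarrow> 0 \<le> B"
  using gauss_leD[of s B f 0] order_trans[OF absv_nonneg[of "f $ 0"]] by simp

lemma gauss_le_mono: "gauss_le s B f \<Longrightarrow> B \<le> B' \<Longrightarrow> gauss_le s B' f"
  unfolding gauss_le_def by (meson order_trans)

lemma gauss_le_radius:
  assumes "gauss_le s B f" "0 \<le> s'" "s' \<le> s"
  shows "gauss_le s' B f"
  unfolding gauss_le_def
proof
  fix n
  have "absv (f $ n) * s' ^ n \<le> absv (f $ n) * s ^ n"
    using assms by (intro mult_left_mono power_mono) auto
  then show "absv (f $ n) * s' ^ n \<le> B" using gauss_leD[OF assms(1), of n] by linarith
qed

lemma absv_mult_le_iff:
  assumes "0 \<le> (s::real)"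
  shows "absv (x::'a::nonarch_field) * s \<le> B \<and> absv y * s \<le> B \<Longrightarrow> absv (x + y) * s \<le> B"
    and "absv (x::'a::nonarch_field) * s \<le> B \<and> absv y * s \<le> B \<Longrightarrow> absv (x - y) * s \<le> B"
proof -
  have *: "absv (x + y) * s \<le> B" if "absv x * s \<le> B \<and> absv y * s \<le> B" for x y :: 'a
  proof -
    have "absv (x + y) * s \<le> max (absv x) (absv y) * s"
      using assms by (intro mult_right_mono absv_add_le_max)
    then show ?thesis using that by (auto simp: max_def split: if_splits)
  qed
  show "absv (x::'a) * s \<le> B \<and> absv y * s \<le> B \<Longrightarrow> absv (x + y) * s \<le> B" by (rule *)
  show "absv (x::'a) * s \<le> B \<and> absv y * s \<le> B \<Longrightarrow> absv (x - y) * s \<le> B"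
    using *[of x "- y"] by simp
qed

lemma gauss_le_add: "0 \<le> s \<Longrightarrow> gauss_le s B f \<Longrightarrow> gauss_le s B g \<Longrightarrow> gauss_le s B (f + g)"
  unfolding gauss_le_def by (auto intro!: absv_mult_le_iff(1))

lemma gauss_le_diff: "0 \<le> s \<Longrightarrow> gauss_le s B f \<Longrightarrow> gauss_le s B g \<Longrightarrow> gauss_le s B (f - g)"
  unfolding gauss_le_def by (auto intro!: absv_mult_le_iff(2))

lemma gauss_le_zero: "0 \<le> B \<Longrightarrow> gauss_le s B 0"
  by (simp add: gauss_le_def)

lemma gauss_le_sum:
  assumes "0 \<le> s" "0 \<le> B" "\<And>i. i \<in> A \<Longrightarrow> gauss_le s B (f i)"
  shows "gauss_le s B (sum f A)"
  using assms(3)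
  by (induction A rule: infinite_finite_induct)
    (auto intro: gauss_le_add gauss_le_zero assms)

lemma absv_sum_mult_le:
  assumes "\<And>i. i \<in> A \<Longrightarrow> absv (f i :: 'a::nonarch_field) * s \<le> B" "0 \<le> B" "0 \<le> s"
  shows "absv (sum f A) * s \<le> B"
  using assms(1)
  by (induction A rule: infinite_finite_induct)
    (auto intro!: absv_mult_le_iff simp: assms)

lemma gauss_le_mult:
  assumes "0 \<le> s" "gauss_le s A f" "gauss_le s B g"
  shows "gauss_le s (A * B) (f * g)"
  unfolding gauss_le_def fps_mult_nth
proof
  fix n
  show "absv (\<Sum>i = 0..n. f $ i * g $ (n - i)) * s ^ n \<le> A * B"
  proof (rule absv_sum_mult_le)
    fix i assume i: "i \<in> {0..n}"
    then have "s ^ n = s ^ i * s ^ (n - i)" by (simp flip: power_add)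
    then have "absv (f $ i * g $ (n - i)) * s ^ n
        = (absv (f $ i) * s ^ i) * (absv (g $ (n - i)) * s ^ (n - i))"
      by (simp add: absv_mult)
    also have "\<dots> \<le> A * B"
      using assms gauss_le_nonneg by (intro mult_mono gauss_leD) auto
    finally show "absv (f $ i * g $ (n - i)) * s ^ n \<le> A * B" .
  qed (use assms in \<open>auto intro!: mult_nonneg_nonneg dest: gauss_le_nonneg\<close>)
qed

lemma gauss_le_const: "0 \<le> B \<Longrightarrow> absv c \<le> B \<Longrightarrow> gauss_le s B (fps_const c)"
  by (auto simp: gauss_le_def)

lemma gauss_le_one: "gauss_le s 1 1"
  by (auto simp: gauss_le_def)

lemma gauss_le_X: "0 \<le> s \<Longrightarrow> gauss_le s s fps_X"
  by (auto simp: gauss_le_def fps_X_def)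

lemma gauss_le_power: "0 \<le> s \<Longrightarrow> gauss_le s B f \<Longrightarrow> gauss_le s (B ^ k) (f ^ k)"
  by (induction k) (auto intro: gauss_le_one gauss_le_mult)

lemma gauss_le_const_mult:
  assumes "gauss_le s B f" shows "gauss_le s (absv c * B) (fps_const c * f)"
  using assms by (auto simp: gauss_le_def absv_mult mult.assoc intro: mult_left_mono)

text \<open>The substitution lemmas demand strict inequalities between radii, so a bound at a
  critical radius is reached as a limit of smaller radii.\<close>

lemma gauss_le_limit:
  assumes "\<And>t. 0 < t \<Longrightarrow> t < s \<Longrightarrow> gauss_le t B f" "0 < s"
  shows "gauss_le s B f"
  unfolding gauss_le_def
proof
  fix n
  have "((\<lambda>t. absv (f $ n) * t ^ n) \<longlongrightarrow> absv (f $ n) * s ^ n) (at_left s)"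
    by (intro tendsto_intros)
  moreover have "\<forall>\<^sub>F t in at_left s. absv (f $ n) * t ^ n \<le> B"
    using eventually_at_left_real[OF assms(2)]
    by eventually_elim (auto intro: gauss_leD assms(1))
  ultimately show "absv (f $ n) * s ^ n \<le> B"
    by (rule tendsto_upperbound) simp
qed

section \<open>Values of a series inside its disc of convergence\<close>

lemma fps_eval_eqI: "((\<lambda>n. f $ n * x ^ n) has_sum t) UNIV \<Longrightarrow> fps_eval f x = t"
  unfolding fps_eval_def by (metis has_sum_imp_sums sums_unique)

lemma gauss_le_term:
  assumes "gauss_le s B f" "absv x < s"
  shows "absv (f $ n * x ^ n) \<le> B * (absv x / s) ^ n"
proof -
  have s: "0 < s" using assms(2) absv_nonneg[of x] by linarith
  then have "absv (f $ n * x ^ n) = (absv (f $ n) * s ^ n) * (absv x / s) ^ n"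
    by (simp add: absv_mult absv_power power_divide)
  also have "\<dots> \<le> B * (absv x / s) ^ n"
    using s by (intro mult_right_mono gauss_leD assms) auto
  finally show ?thesis .
qed

lemma fps_eval_has_sum:
  assumes "cfield C" "f \<in> fps_over C" "x \<in> C" "gauss_le s B f" "absv x < s"
  shows "((\<lambda>n. f $ n * x ^ n) has_sum fps_eval f x) UNIV"
    and "fps_eval f x \<in> C" and "absv (fps_eval f x) \<le> B"
proof -
  have s: "0 < s" using assms(5) absv_nonneg[of x] by linarith
  have null: "null_family (\<lambda>n. f $ n * x ^ n) UNIV"
  proof (rule null_family_weight[where w = id and t = "absv x / s" and B = B])
    show "absv (f $ n * x ^ n) \<le> B * (absv x / s) ^ id n" for n
      using gauss_le_term[OF assms(4,5)] by simp
  qed (use s assms(5) in auto)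
  have "f $ n * x ^ n \<in> C" for n
    using assms by (auto intro!: cfield_intros[OF assms(1)] fps_overD)
  then obtain t where t: "t \<in> C" "((\<lambda>n. f $ n * x ^ n) has_sum t) UNIV"
    using cfield_has_sum[OF assms(1) _ null] by auto
  with fps_eval_eqI show 1: "((\<lambda>n. f $ n * x ^ n) has_sum fps_eval f x) UNIV"
    and "fps_eval f x \<in> C" by blast+
  show "absv (fps_eval f x) \<le> B"
  proof (rule has_sum_absv_le[OF 1])
    show "absv (f $ n * x ^ n) \<le> B" for n
    proof (rule order_trans[OF gauss_le_term[OF assms(4,5)]])
      show "B * (absv x / s) ^ n \<le> B"
        using s assms(5) gauss_le_nonneg[OF assms(4)]
        by (intro mult_left_le power_le_one) auto
    qed
  qed (use gauss_le_nonneg[OF assms(4)] in auto)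
qed

lemma fps_eval_const [simp]: "fps_eval (fps_const c) x = c"
proof (rule fps_eval_eqI)
  have "((\<lambda>n. fps_const c $ n * x ^ n) has_sum (\<Sum>n\<in>{0}. fps_const c $ n * x ^ n)) UNIV"
    by (subst has_sum_cong_neutral[where T = "{0}" and g = "\<lambda>n. fps_const c $ n * x ^ n"])
       (auto simp: has_sum_finite intro: has_sum_finiteI)
  then show "((\<lambda>n. fps_const c $ n * x ^ n) has_sum c) UNIV" by simp
qed

lemma has_sum_finite_support:
  fixes f :: "'i \<Rightarrow> 'b::{comm_monoid_add,t2_space}"
  assumes "finite N" "\<And>i. i \<notin> N \<Longrightarrow> f i = 0"
  shows "(f has_sum sum f N) UNIV"
proof -
  have "(f has_sum sum f N) N" using assms by (auto intro: has_sum_finite)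
  then show ?thesis
    by (subst has_sum_cong_neutral[where T = N and g = f]) (use assms(2) in auto)
qed

lemma fps_eval_0_right [simp]: "fps_eval f 0 = f $ 0"
proof (rule fps_eval_eqI)
  have "((\<lambda>n. f $ n * 0 ^ n) has_sum (\<Sum>n\<in>{0}. f $ n * 0 ^ n)) UNIV"
    by (rule has_sum_finite_support) auto
  then show "((\<lambda>n. f $ n * 0 ^ n) has_sum f $ 0) UNIV" by simp
qed

lemma fps_eval_X [simp]: "fps_eval fps_X x = x"
proof (rule fps_eval_eqI)
  have "((\<lambda>n. fps_X $ n * x ^ n) has_sum (\<Sum>n\<in>{1}. fps_X $ n * x ^ n)) UNIV"
    by (rule has_sum_finite_support) (auto simp: fps_X_def)
  then show "((\<lambda>n. fps_X $ n * x ^ n) has_sum x) UNIV" by (simp add: fps_X_def)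
qed

lemma fps_eval_one [simp]: "fps_eval 1 x = 1"
  using fps_eval_const[of 1 x] by simp

lemma fps_eval_zero [simp]: "fps_eval 0 x = 0"
  using fps_eval_const[of 0 x] by simp

lemma fps_eval_add:
  assumes "cfield C" "f \<in> fps_over C" "g \<in> fps_over C" "x \<in> C" "gauss_le s A f" "gauss_le s B g"
    "absv x < s"
  shows "fps_eval (f + g) x = fps_eval f x + fps_eval g x"
  using has_sum_add[OF fps_eval_has_sum(1)[OF assms(1,2,4,5,7)] fps_eval_has_sum(1)[OF assms(1,3,4,6,7)]]
  by (intro fps_eval_eqI) (simp add: algebra_simps)

lemma fps_eval_cmult:
  assumes "cfield C" "f \<in> fps_over C" "x \<in> C" "gauss_le s A f" "absv x < s"
  shows "fps_eval (fps_const c * f) x = c * fps_eval f x"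
  using has_sum_cmult_right[OF fps_eval_has_sum(1)[OF assms], of c]
  by (intro fps_eval_eqI) (simp add: algebra_simps)

lemma fps_eval_diff:
  assumes "cfield C" "f \<in> fps_over C" "g \<in> fps_over C" "x \<in> C" "gauss_le s A f" "gauss_le s B g"
    "absv x < s"
  shows "fps_eval (f - g) x = fps_eval f x - fps_eval g x"
proof -
  have "fps_eval (f + fps_const (-1) * g) x = fps_eval f x + fps_eval (fps_const (-1) * g) x"
  proof (rule fps_eval_add[OF assms(1,2) _ assms(4,5) _ assms(7)])
    show "fps_const (- 1) * g \<in> fps_over C"
      using assms by (auto intro!: fps_over_intros cfield_intros)
    show "gauss_le s (absv (- 1::'a) * B) (fps_const (- 1) * g)"
      by (rule gauss_le_const_mult[OF assms(6)])
  qed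
  then show ?thesis
    using fps_eval_cmult[OF assms(1,3,4,6,7), of "-1"] by (simp flip: fps_const_neg)
qed

lemma null_family_geometric:
  fixes f :: "nat \<Rightarrow> nat \<Rightarrow> 'a::nonarch_field"
  assumes "\<And>i j. absv (f i j) \<le> B * a ^ i * b ^ j" "0 \<le> a" "a < 1" "0 \<le> b" "b < 1" "0 \<le> B"
  shows "null_family (\<lambda>(i, j). f i j) (UNIV \<times> UNIV)"
proof (rule null_family_weight[where w = "\<lambda>(i, j). i + j" and t = "max a b" and B = B])
  show "absv (case p of (i, j) \<Rightarrow> f i j) \<le> B * max a b ^ (case p of (i, j) \<Rightarrow> i + j)" for p
  proof (cases p)
    case (Pair i j)
    have "B * a ^ i * b ^ j \<le> B * max a b ^ i * max a b ^ j"
      using assms by (intro mult_mono power_mono mult_nonneg_nonneg zero_le_power) auto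
    then show ?thesis using order_trans[OF assms(1)[of i j]] Pair by (simp add: power_add mult.assoc)
  qed
  show "finite {p \<in> UNIV \<times> UNIV. (case p of (i, j) \<Rightarrow> f i j) \<noteq> 0 \<and> (case p of (i, j) \<Rightarrow> i + j) \<le> N}"
    for N :: nat
    by (rule finite_subset[of _ "{..N} \<times> {..N}"]) auto
qed (use assms in auto)

lemma has_sum_diagonal:
  fixes f :: "nat \<Rightarrow> nat \<Rightarrow> 'a::nonarch_field"
  assumes "((\<lambda>(i, j). f i j) has_sum t) (UNIV \<times> UNIV)"
  shows "((\<lambda>m. \<Sum>i\<le>m. f i (m - i)) has_sum t) UNIV"
proof -
  have "((\<lambda>(m, i). f i (m - i)) has_sum t) (Sigma UNIV (\<lambda>m. {..m}))"
    by (rule has_sum_reindex_bij_witness[where i = "\<lambda>(i, j). (i + j, i)" and j = "\<lambda>(m, i). (i, m - i)"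
          and T = "UNIV \<times> UNIV" and h = "\<lambda>(i, j). f i j" and s' = t, THEN iffD2, OF _ _ _ _ _ _ assms]) auto
  from has_sum_SigmaD[OF this, of "\<lambda>m. \<Sum>i\<le>m. f i (m - i)"] show ?thesis
    by (simp add: has_sum_finite)
qed

lemma fps_eval_mult:
  assumes "cfield C" "f \<in> fps_over C" "g \<in> fps_over C" "x \<in> C" "gauss_le s A f" "gauss_le s B g"
    "absv x < s"
  shows "fps_eval (f * g) x = fps_eval f x * fps_eval g x"
proof (rule fps_eval_eqI)
  have s: "0 < s" using assms(7) absv_nonneg[of x] by linarith
  have "((\<lambda>(i, j). (f $ i * x ^ i) * (g $ j * x ^ j)) has_sum (fps_eval f x * fps_eval g x)) (UNIV \<times> UNIV)"
  proof (rule has_sum_prod[OF assms(1)])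
    show "null_family (\<lambda>(i, j). (f $ i * x ^ i) * (g $ j * x ^ j)) (UNIV \<times> UNIV)"
    proof (rule null_family_geometric[where B = "A * B" and a = "absv x / s" and b = "absv x / s"])
      fix i j
      have "absv (f $ i * x ^ i) * absv (g $ j * x ^ j)
          \<le> (A * (absv x / s) ^ i) * (B * (absv x / s) ^ j)"
        using s gauss_le_nonneg[OF assms(5)] by (intro mult_mono gauss_le_term assms) auto
      then show "absv ((f $ i * x ^ i) * (g $ j * x ^ j)) \<le> A * B * (absv x / s) ^ i * (absv x / s) ^ j"
        by (simp add: absv_mult mult_ac)
    qed (use s assms in \<open>auto intro!: mult_nonneg_nonneg dest: gauss_le_nonneg\<close>)
  qed (use assms in \<open>auto intro!: fps_eval_has_sum cfield_intros[OF assms(1)] fps_overD\<close>)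
  from has_sum_diagonal[OF this]
  show "((\<lambda>n. (f * g) $ n * x ^ n) has_sum fps_eval f x * fps_eval g x) UNIV"
  proof (rule has_sum_cong[THEN iffD1, rotated])
    fix n
    have "(\<Sum>i\<le>n. (f $ i * x ^ i) * (g $ (n - i) * x ^ (n - i))) = (\<Sum>i\<le>n. f $ i * g $ (n - i) * x ^ n)"
      by (intro sum.cong) (auto simp: mult_ac simp flip: power_add)
    then show "(\<Sum>i\<le>n. (f $ i * x ^ i) * (g $ (n - i) * x ^ (n - i))) = (f * g) $ n * x ^ n"
      by (simp add: fps_mult_nth sum_distrib_right atLeast0AtMost)
  qed
qed

lemma fps_eval_power:
  assumes "cfield C" "f \<in> fps_over C" "x \<in> C" "gauss_le s A f" "absv x < s"
  shows "fps_eval (f ^ k) x = fps_eval f x ^ k"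
proof (induction k)
  case (Suc k)
  have s: "0 \<le> s" using assms(5) absv_nonneg[of x] by linarith
  have "fps_eval (f * f ^ k) x = fps_eval f x * fps_eval (f ^ k) x"
    by (rule fps_eval_mult[OF assms(1,2) _ assms(3,4) _ assms(5)])
       (auto intro: fps_over_intros assms gauss_le_power s)
  with Suc show ?case by simp
qed simp

lemma fps_eval_sum:
  assumes "cfield C" "x \<in> C" "absv x < s" "\<And>i. i \<in> A \<Longrightarrow> f i \<in> fps_over C"
    "\<And>i. i \<in> A \<Longrightarrow> gauss_le s B (f i)"
  shows "fps_eval (sum f A) x = (\<Sum>i\<in>A. fps_eval (f i) x)"
  using assms(4,5)
proof (induction A rule: infinite_finite_induct)
  case (insert i A)
  have s: "0 \<le> s" using assms(3) absv_nonneg[of x] by linarith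
  have B: "0 \<le> B" using insert.prems(2)[of i] gauss_le_nonneg by auto
  have "fps_eval (f i + sum f A) x = fps_eval (f i) x + fps_eval (sum f A) x"
    by (rule fps_eval_add[OF assms(1) _ _ assms(2) _ _ assms(3)])
       (use insert in \<open>auto intro!: fps_over_intros(10)[OF assms(1)] gauss_le_sum s B\<close>)
  with insert show ?case by simp
qed auto

text \<open>\<open>g\<close> maps the disc of radius \<open>s'\<close> into the closed disc of
  radius \<open>G\<close>, which lies strictly inside the disc of radius \<open>s\<close> where
  \<open>h\<close> is bounded. Everything rests on the estimate \<open>le\<close>, whose ratio
  \<open>G / s\<close> is below 1: it makes the coefficients converge, bounds them, and justifies
  the exchange of sums behind the last claim.\<close>

lemma fps_subst:
  assumes C: "cfield C" and h: "h \<in> fps_over C" "gauss_le s B h"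
    and g: "g \<in> fps_over C" "gauss_le s' G g" and G: "G < s" and s': "0 < s'"
  shows fps_subst_has_sum: "((\<lambda>k. h $ k * (g ^ k) $ n) has_sum fps_subst h g $ n) UNIV"
    and fps_subst_over: "fps_subst h g \<in> fps_over C"
    and fps_subst_gauss: "gauss_le s' B (fps_subst h g)"
    and fps_subst_gauss': "h $ 0 = 0 \<Longrightarrow> B \<le> s \<Longrightarrow> gauss_le s' G (fps_subst h g)"
    and fps_eval_subst: "x \<in> C \<Longrightarrow> absv x < s' \<Longrightarrow>
      fps_eval (fps_subst h g) x = fps_eval h (fps_eval g x)"
proof -
  have G0: "0 \<le> G" and B0: "0 \<le> B" using g h gauss_le_nonneg by auto
  have s: "0 < s" using G0 G by linarith
  have le: "absv (h $ k * (g ^ k) $ n) * s' ^ n \<le> B * (G / s) ^ k" for k n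
  proof -
    have "absv (h $ k * (g ^ k) $ n) * s' ^ n = absv (h $ k) * (absv ((g ^ k) $ n) * s' ^ n)"
      by (simp add: absv_mult)
    also have "\<dots> \<le> absv (h $ k) * G ^ k"
      using s' by (intro mult_left_mono gauss_leD[OF gauss_le_power] g) auto
    also have "\<dots> = (absv (h $ k) * s ^ k) * (G / s) ^ k"
      using s by (simp add: power_divide)
    also have "\<dots> \<le> B * (G / s) ^ k"
      using s G0 by (intro mult_right_mono gauss_leD h) auto
    finally show ?thesis .
  qed
  have le': "B * (G / s) ^ k \<le> B" for k
    using B0 G G0 s by (intro mult_left_le power_le_one) auto
  have inC: "h $ k * (g ^ k) $ n \<in> C" for k n
    using fps_overD[OF fps_over_intros(9)[OF C g(1)]] fps_overD[OF h(1)]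
    by (auto intro: cfield_intros[OF C])
  have null: "null_family (\<lambda>k. h $ k * (g ^ k) $ n) UNIV" for n
  proof (rule null_family_weight[where w = id and t = "G / s" and B = "B / s' ^ n"])
    show "absv (h $ k * (g ^ k) $ n) \<le> B / s' ^ n * (G / s) ^ id k" for k
      using le[of k n] s' by (simp add: pos_le_divide_eq)
  qed (use s G0 G in auto)
  show hs: "((\<lambda>k. h $ k * (g ^ k) $ n) has_sum fps_subst h g $ n) UNIV" for n
  proof -
    obtain t where t: "t \<in> C" "((\<lambda>k. h $ k * (g ^ k) $ n) has_sum t) UNIV"
      using cfield_has_sum[OF C _ null] inC by metis
    then have "fps_subst h g $ n = t"
      unfolding fps_subst_def using has_sum_imp_sums sums_unique by fastforce
    with t show ?thesis by simp
  qed
  show over: "fps_subst h g \<in> fps_over C"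
    using has_sum_in_cfield[OF C inC null hs] by (auto intro: fps_overI)
  show gauss: "gauss_le s' B (fps_subst h g)"
    unfolding gauss_le_def
  proof
    fix n
    have "absv (fps_subst h g $ n) \<le> B / s' ^ n"
    proof (rule has_sum_absv_le[OF hs])
      show "absv (h $ k * (g ^ k) $ n) \<le> B / s' ^ n" for k
        using order_trans[OF le[of k n] le'[of k]] s' by (simp add: field_simps)
    qed (use s' B0 in auto)
    then show "absv (fps_subst h g $ n) * s' ^ n \<le> B" using s' by (simp add: field_simps)
  qed
  show "gauss_le s' G (fps_subst h g)" if "h $ 0 = 0" "B \<le> s"
    unfolding gauss_le_def
  proof
    fix n
    have "absv (fps_subst h g $ n) \<le> G / s' ^ n"
    proof (rule has_sum_absv_le[OF hs])
      fix k
      have "absv (h $ k * (g ^ k) $ n) * s' ^ n \<le> G"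
      proof (cases k)
        case 0
        then show ?thesis using that G0 by simp
      next
        case (Suc m)
        \<comment> \<open>As \<open>k\<close> is positive, one factor \<open>G / s\<close> turns the
          \<open>s\<close> that bounds \<open>B\<close> into \<open>G\<close>.\<close>
        have "B * (G / s) ^ k \<le> s * (G / s) ^ k"
          using that s G0 by (intro mult_right_mono) auto
        also have "\<dots> = G * (G / s) ^ m" using s Suc by simp
        also have "\<dots> \<le> G" using G0 G s by (intro mult_left_le power_le_one) auto
        finally show ?thesis using le[of k n] by linarith
      qed
      then show "absv (h $ k * (g ^ k) $ n) \<le> G / s' ^ n" using s' by (simp add: field_simps)
    qed (use s' G0 in auto)
    then show "absv (fps_subst h g $ n) * s' ^ n \<le> G" using s' by (simp add: field_simps)
  qed
  assume x: "x \<in> C" "absv x < s'"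
  show "fps_eval (fps_subst h g) x = fps_eval h (fps_eval g x)"
  proof (rule fps_eval_eqI, rule has_sum_fubini(2)[OF C])
    show "null_family (\<lambda>(k, n). h $ k * (g ^ k) $ n * x ^ n) (UNIV \<times> UNIV)"
    proof (rule null_family_geometric[where B = B and a = "G / s" and b = "absv x / s'"])
      fix k n
      have "absv (h $ k * (g ^ k) $ n * x ^ n)
          = (absv (h $ k * (g ^ k) $ n) * s' ^ n) * (absv x / s') ^ n"
        using s' by (simp add: absv_mult absv_power power_divide)
      also have "\<dots> \<le> (B * (G / s) ^ k) * (absv x / s') ^ n"
        using s' by (intro mult_right_mono le) auto
      finally show "absv (h $ k * (g ^ k) $ n * x ^ n) \<le> B * (G / s) ^ k * (absv x / s') ^ n" .
    qed (use s s' G G0 B0 x in auto)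
    show "((\<lambda>n. h $ k * (g ^ k) $ n * x ^ n) has_sum h $ k * fps_eval g x ^ k) UNIV" for k
    proof -
      have "((\<lambda>n. (g ^ k) $ n * x ^ n) has_sum fps_eval (g ^ k) x) UNIV"
        by (rule fps_eval_has_sum[OF C _ x(1) gauss_le_power[OF _ g(2)] x(2)])
           (use s' g(1) in \<open>auto intro: fps_over_intros[OF C]\<close>)
      from has_sum_cmult_right[OF this, of "h $ k"] show ?thesis
        by (simp add: mult.assoc fps_eval_power[OF C g(1) x(1) g(2) x(2)])
    qed
    have "absv (fps_eval g x) < s"
      using fps_eval_has_sum(3)[OF C g(1) x(1) g(2) x(2)] G by linarith
    then show "((\<lambda>k. h $ k * fps_eval g x ^ k) has_sum fps_eval h (fps_eval g x)) UNIV"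
      by (intro fps_eval_has_sum(1)[OF C h(1) _ h(2)] fps_eval_has_sum(2)[OF C g(1) x(1) g(2) x(2)])
    show "((\<lambda>k. h $ k * (g ^ k) $ n * x ^ n) has_sum fps_subst h g $ n * x ^ n) UNIV" for n
      by (rule has_sum_cmult_left[OF hs])
    show "h $ k * (g ^ k) $ n * x ^ n \<in> C" for k n
      by (rule cfield_intros(6)[OF C inC]) (use x in \<open>auto intro: cfield_intros[OF C]\<close>)
  qed
qed

lemma fps_subst_eq_compose: "g $ 0 = 0 \<Longrightarrow> fps_subst h g = h oo g"
proof (rule fps_ext)
  fix n assume g: "g $ 0 = 0"
  have "(\<Sum>k. h $ k * (g ^ k) $ n) = (\<Sum>k\<in>{0..n}. h $ k * (g ^ k) $ n)"
    using startsby_zero_power_prefix[OF g] by (intro suminf_finite) auto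
  then show "fps_subst h g $ n = (h oo g) $ n"
    by (simp add: fps_subst_def fps_compose_nth)
qed

text \<open>Closed under composition and compositional inverse; the values have absolute value at most \<open>\<bar>x\<bar>\<close>.\<close>

definition tame :: "real \<Rightarrow> 'a::nonarch_field fps \<Rightarrow> bool" where
  "tame s h \<longleftrightarrow> h $ 0 = 0 \<and> gauss_le s s h"

text \<open>Without a constant term, every term shrinks at least by the factor \<open>s' / s\<close>
  when the radius shrinks from \<open>s\<close> to \<open>s'\<close>.\<close>

lemma tame_radius:
  assumes "tame s g" "0 < s'" "s' \<le> s"
  shows "tame s' g"
  unfolding tame_def gauss_le_def
proof (intro conjI allI)
  show "g $ 0 = 0" using assms by (simp add: tame_def)
  fix n
  show "absv (g $ n) * s' ^ n \<le> s'"
  proof (cases n)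
    case 0
    then show ?thesis using assms by (simp add: tame_def)
  next
    case (Suc m)
    have "absv (g $ n) * s' ^ n = (absv (g $ n) * s ^ n) * (s' / s) ^ n"
      using assms by (simp add: power_divide)
    also have "\<dots> \<le> s * (s' / s) ^ n"
      using assms by (intro mult_right_mono gauss_leD) (auto simp: tame_def)
    also have "\<dots> = s' * (s' / s) ^ m" using assms Suc by simp
    also have "\<dots> \<le> s'" using assms by (intro mult_left_le power_le_one) auto
    finally show ?thesis .
  qed
qed

text \<open>Schwarz's lemma. If the value were larger than \<open>x\<close>, tameness could be
  applied at a radius \<open>t\<close> strictly between the two absolute values and would bound the
  value by \<open>t\<close>.\<close>

lemma fps_eval_tame:
  assumes "cfield C" "g \<in> fps_over C" "x \<in> C" "tame s g" "absv x < s"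
  shows "absv (fps_eval g x) \<le> absv x"
proof (rule ccontr)
  assume "\<not> ?thesis"
  then obtain t where t: "absv x < t" "t < absv (fps_eval g x)" "t \<le> s"
    using dense[of "absv x" "min s (absv (fps_eval g x))"] assms(5) by auto
  have "tame t g" using tame_radius[OF assms(4), of t] t absv_nonneg[of x] by linarith
  then have "absv (fps_eval g x) \<le> t"
    using fps_eval_has_sum(3)[OF assms(1-3), of t t] t by (auto simp: tame_def)
  then show False using t by simp
qed

lemma tame_compose:
  assumes "0 < s" "tame s h" "tame s g"
  shows "tame s (h oo g)"
  unfolding tame_def gauss_le_def
proof (intro conjI allI)
  show "(h oo g) $ 0 = 0" using assms by (simp add: tame_def)
  fix n
  show "absv ((h oo g) $ n) * s ^ n \<le> s"
    unfolding fps_compose_nth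
  proof (rule absv_sum_mult_le)
    fix k
    have "absv ((g ^ k) $ n) * s ^ n \<le> s ^ k"
      using assms by (intro gauss_leD[OF gauss_le_power]) (auto simp: tame_def)
    then have "absv (h $ k) * (absv ((g ^ k) $ n) * s ^ n) \<le> absv (h $ k) * s ^ k"
      by (rule mult_left_mono) simp
    also have "\<dots> \<le> s" using assms by (auto simp: tame_def gauss_le_def)
    finally show "absv (h $ k * (g ^ k) $ n) * s ^ n \<le> s" by (simp add: absv_mult mult.assoc)
  qed (use assms in auto)
qed

lemma fps_eval_compose:
  assumes "cfield C" "h \<in> fps_over C" "g \<in> fps_over C" "x \<in> C" "gauss_le s B h" "tame s g" "absv x < s"
  shows "fps_eval (h oo g) x = fps_eval h (fps_eval g x)"
proof -
  \<comment> \<open>Tameness at radius \<open>s\<close> only gives \<open>G = s\<close>; the smaller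
    radius \<open>t\<close> provides the strict inequality that substitution requires.\<close>
  obtain t where t: "absv x < t" "t < s" using dense[OF assms(7)] by auto
  have t0: "0 < t" using t absv_nonneg[of x] by linarith
  have "gauss_le t t g" using tame_radius[OF assms(6) t0] t by (auto simp: tame_def)
  from fps_eval_subst[OF assms(1,2,5,3) this t(2) t0 assms(4) t(1)]
  show ?thesis using fps_subst_eq_compose[of g h] assms(6) by (simp add: tame_def)
qed

text \<open>Near 0 the lowest nonzero term, of degree \<open>n\<close>, dominates: the remaining
  ones are of the order of |x|^(n+1). So the nonzero zeros of a nonzero series stay away from
  0.\<close>

lemma fps_eq_0I:
  assumes "cfield C" "f \<in> fps_over C" "gauss_le s B f" "0 < s"
    and zeros: "\<And>e. 0 < e \<Longrightarrow> \<exists>x\<in>C. x \<noteq> 0 \<and> absv x < e \<and> fps_eval f x = 0"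
  shows "f = 0"
proof (rule ccontr)
  assume "f \<noteq> 0"
  define n where "n = (LEAST n. f $ n \<noteq> 0)"
  obtain n0 where "f $ n0 \<noteq> 0" using \<open>f \<noteq> 0\<close> unfolding fps_nonzero_nth by auto
  then have n: "f $ n \<noteq> 0" "\<And>m. m < n \<Longrightarrow> f $ m = 0"
    unfolding n_def by (rule LeastI) (auto dest: not_less_Least)
  have B0: "0 \<le> B" using assms(3) gauss_le_nonneg by auto
  \<comment> \<open>For |x| below this bound, the estimate B |x| / s^(n+1) for the remaining terms,
    divided by |x|^n, falls below |f_n|. The denominator \<open>B + 1\<close> avoids a division by
    0.\<close>
  define e where "e = min s (absv (f $ n) * s ^ (n + 1) / (B + 1))"
  have e: "0 < e" using assms(4) B0 n(1) by (auto simp: e_def)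
  obtain x where x: "x \<in> C" "x \<noteq> 0" "absv x < e" "fps_eval f x = 0"
    using zeros[OF e] by auto
  have xs: "absv x < s" using x(3) by (simp add: e_def)
  have "((\<lambda>m. f $ m * x ^ m) has_sum 0) UNIV"
    using fps_eval_has_sum(1)[OF assms(1,2) x(1) assms(3) xs] x(4) by simp
  moreover have "((\<lambda>m. f $ m * x ^ m) has_sum f $ n * x ^ n) {n}"
    by (simp add: has_sum_finite_iff)
  ultimately have "((\<lambda>m. f $ m * x ^ m) has_sum (0 - f $ n * x ^ n)) (UNIV - {n})"
    by (rule has_sum_Diff) auto
  then have "absv (0 - f $ n * x ^ n) \<le> B * (absv x / s) ^ (n + 1)"
  proof (rule has_sum_absv_le)
    fix m assume m: "m \<in> UNIV - {n}"
    show "absv (f $ m * x ^ m) \<le> B * (absv x / s) ^ (n + 1)"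
    proof (cases "m < n")
      case True
      then show ?thesis using n(2) B0 assms(4) by simp
    next
      case False
      then have "n + 1 \<le> m" using m by auto
      then have "B * (absv x / s) ^ m \<le> B * (absv x / s) ^ (n + 1)"
        using xs assms(4) B0 by (intro mult_left_mono power_decreasing) auto
      then show ?thesis using gauss_le_term[OF assms(3) xs, of m] by linarith
    qed
  qed (use B0 assms(4) in auto)
  then have "absv (f $ n) * absv x ^ n \<le> (B * absv x / s ^ (n + 1)) * absv x ^ n"
    by (simp add: absv_mult absv_power power_divide mult_ac)
  then have "absv (f $ n) \<le> B * absv x / s ^ (n + 1)"
    by (rule mult_right_le_imp_le) (use x(2) in simp)
  then have 1: "absv (f $ n) * s ^ (n + 1) \<le> B * absv x"
    using assms(4) by (simp add: field_simps)
  have "absv x * (B + 1) < absv (f $ n) * s ^ (n + 1)"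
    using x(3) B0 by (auto simp: e_def pos_less_divide_eq)
  moreover have "B * absv x \<le> absv x * (B + 1)" by (simp add: algebra_simps)
  ultimately show False using 1 by linarith
qed

lemma fps_eqI_eval:
  assumes "cfield C" "f \<in> fps_over C" "g \<in> fps_over C" "gauss_le s A f" "gauss_le s B g" "0 < s"
    and "\<And>e. 0 < e \<Longrightarrow> \<exists>x\<in>C. x \<noteq> 0 \<and> absv x < e"
    and eq: "\<And>x. x \<in> C \<Longrightarrow> absv x < s \<Longrightarrow> fps_eval f x = fps_eval g x"
  shows "f = g"
proof -
  have "f - g = 0"
  proof (rule fps_eq_0I[OF assms(1), of _ s "max A B"])
    show "gauss_le s (max A B) (f - g)"
      using assms by (intro gauss_le_diff) (auto intro: gauss_le_mono)
    fix e :: real assume "0 < e"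
    then obtain x where x: "x \<in> C" "x \<noteq> 0" "absv x < min e s"
      using assms(7)[of "min e s"] assms(6) by auto
    then have "fps_eval (f - g) x = 0"
      using fps_eval_diff[OF assms(1-3) x(1) assms(4,5)] eq by simp
    with x show "\<exists>x\<in>C. x \<noteq> 0 \<and> absv x < e \<and> fps_eval (f - g) x = 0" by auto
  qed (use assms in \<open>auto intro: fps_over_intros\<close>)
  then show ?thesis by simp
qed

section \<open>Power series in two variables\<close>

definition fps2_over :: "'a::nonarch_field set \<Rightarrow> 'a fps fps set" where
  "fps2_over C = {F. \<forall>i j. F $ i $ j \<in> C}"

definition gauss2_le :: "real \<Rightarrow> real \<Rightarrow> 'a::nonarch_field fps fps \<Rightarrow> bool" where
  "gauss2_le s B F \<longleftrightarrow> (\<forall>i j. absv (F $ i $ j) * s ^ (i + j) \<le> B)"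

lemma gauss2_leD: "gauss2_le s B F \<Longrightarrow> absv (F $ i $ j) * s ^ (i + j) \<le> B"
  by (simp add: gauss2_le_def)

lemma gauss2_le_nonneg: "gauss2_le s B F \<Longrightarrow> 0 \<le> B"
  using gauss2_leD[of s B F 0 0] order_trans[OF absv_nonneg[of "F $ 0 $ 0"]] by simp

lemma fps2_over_mult:
  assumes "cfield C" "F \<in> fps2_over C" "G \<in> fps2_over C"
  shows "F * G \<in> fps2_over C"
  using assms unfolding fps2_over_def
  by (auto simp: fps_mult_nth fps_sum_nth intro!: cfield_intros[OF assms(1)])

lemma fps2_over_power:
  assumes "cfield C" "F \<in> fps2_over C"
  shows "F ^ k \<in> fps2_over C"
proof (induction k)
  case 0
  then show ?case using assms by (auto simp: fps2_over_def intro: cfield_intros[OF assms(1)])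
qed (auto intro: fps2_over_mult assms)

lemma gauss2_le_mult:
  assumes "0 \<le> s" "gauss2_le s A F" "gauss2_le s B G"
  shows "gauss2_le s (A * B) (F * G)"
  unfolding gauss2_le_def fps_mult_nth fps_sum_nth
proof (intro allI absv_sum_mult_le)
  fix i j k l :: nat assume i: "k \<in> {0..i}" and j: "l \<in> {0..j}"
  then have "s ^ (i + j) = s ^ (k + l) * s ^ ((i - k) + (j - l))" by (simp flip: power_add)
  then have "absv (F $ k $ l * G $ (i - k) $ (j - l)) * s ^ (i + j)
      = (absv (F $ k $ l) * s ^ (k + l)) * (absv (G $ (i - k) $ (j - l)) * s ^ ((i - k) + (j - l)))"
    by (simp add: absv_mult)
  also have "\<dots> \<le> A * B"
    using assms gauss2_le_nonneg by (intro mult_mono gauss2_leD) auto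
  finally show "absv (F $ k $ l * G $ (i - k) $ (j - l)) * s ^ (i + j) \<le> A * B" .
qed (use assms in \<open>auto intro!: mult_nonneg_nonneg dest: gauss2_le_nonneg\<close>)

lemma gauss2_le_power:
  assumes "0 \<le> s" "gauss2_le s B F" shows "gauss2_le s (B ^ k) (F ^ k)"
proof (induction k)
  case 0
  then show ?case by (auto simp: gauss2_le_def)
qed (auto intro: gauss2_le_mult assms)

lemma gauss2_le_radius:
  assumes "gauss2_le s B F" "0 \<le> s'" "s' \<le> s"
  shows "gauss2_le s' B F"
  unfolding gauss2_le_def
proof (intro allI)
  fix i j
  have "absv (F $ i $ j) * s' ^ (i + j) \<le> absv (F $ i $ j) * s ^ (i + j)"
    using assms by (intro mult_left_mono power_mono) auto
  then show "absv (F $ i $ j) * s' ^ (i + j) \<le> B" using gauss2_leD[OF assms(1), of i j] by linarith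
qed

lemma gauss2_le_mono: "gauss2_le s B F \<Longrightarrow> B \<le> B' \<Longrightarrow> gauss2_le s B' F"
  unfolding gauss2_le_def by (meson order_trans)

lemma gauss2_le_1: "gauss2_le 1 B F \<longleftrightarrow> (\<forall>i j. absv (F $ i $ j) \<le> B)"
  by (simp add: gauss2_le_def)

lemma gauss2_le_small:
  assumes "gauss2_le 1 1 F" "F $ 0 $ 0 = 0" "0 \<le> s" "s \<le> 1"
  shows "gauss2_le s s F"
  unfolding gauss2_le_def
proof (intro allI)
  fix i j
  show "absv (F $ i $ j) * s ^ (i + j) \<le> s"
  proof (cases "i + j = 0")
    case True
    then show ?thesis using assms by simp
  next
    case False
    then have "s ^ (i + j) \<le> s ^ 1" using assms by (intro power_decreasing) auto
    then have "absv (F $ i $ j) * s ^ (i + j) \<le> 1 * s ^ 1"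
      using assms by (intro mult_mono) (auto simp: gauss2_le_1)
    then show ?thesis by simp
  qed
qed

lemma fps2_power_nth_0:
  assumes "F $ 0 $ 0 = (0::'a::comm_ring_1)" "a + b < k"
  shows "(F ^ k) $ a $ b = 0"
  using assms(2)
proof (induction k arbitrary: a b)
  case (Suc k)
  have "F $ i $ j * (F ^ k) $ (a - i) $ (b - j) = 0" if "i \<le> a" "j \<le> b" for i j
  proof (cases "i + j = 0")
    case True
    then show ?thesis using assms(1) by simp
  next
    case False
    then have "(F ^ k) $ (a - i) $ (b - j) = 0" using Suc.prems that by (intro Suc.IH) auto
    then show ?thesis by simp
  qed
  then show ?case by (simp add: fps_mult_nth fps_sum_nth)
qed simp

section \<open>Values of series in two variables\<close>

lemma fps_eval2_eqI:
  assumes "((\<lambda>(i, j). F $ i $ j * (x ^ i * y ^ j)) has_sum t) (UNIV \<times> UNIV)"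
  shows "fps_eval2 F x y = t"
  unfolding fps_eval2_def
  by (rule sums_unique[OF has_sum_imp_sums[OF has_sum_diagonal[OF assms]], symmetric])

lemma fps2_null_family:
  assumes "gauss2_le s B F" "absv x < s" "absv y < s"
  shows "null_family (\<lambda>(i, j). F $ i $ j * (x ^ i * y ^ j)) (UNIV \<times> UNIV)"
proof (rule null_family_geometric[where B = B and a = "absv x / s" and b = "absv y / s"])
  have s: "0 < s" using assms(2) absv_nonneg[of x] by linarith
  fix i j
  have "absv (F $ i $ j * (x ^ i * y ^ j))
      = (absv (F $ i $ j) * s ^ (i + j)) * ((absv x / s) ^ i * (absv y / s) ^ j)"
    using s by (simp add: absv_mult absv_power power_divide power_add)
  also have "\<dots> \<le> B * ((absv x / s) ^ i * (absv y / s) ^ j)"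
    using s by (intro mult_right_mono gauss2_leD assms) auto
  finally show "absv (F $ i $ j * (x ^ i * y ^ j)) \<le> B * (absv x / s) ^ i * (absv y / s) ^ j"
    by (simp add: mult.assoc)
next
  have s: "0 < s" using assms(2) absv_nonneg[of x] by linarith
  show "0 \<le> absv x / s" "absv x / s < 1" "0 \<le> absv y / s" "absv y / s < 1" "0 \<le> B"
    using s assms gauss2_le_nonneg by auto
qed

lemma fps_eval2_has_sum:
  assumes "cfield C" "F \<in> fps2_over C" "x \<in> C" "y \<in> C" "gauss2_le s B F" "absv x < s" "absv y < s"
  shows "((\<lambda>(i, j). F $ i $ j * (x ^ i * y ^ j)) has_sum fps_eval2 F x y) (UNIV \<times> UNIV)"
    and "fps_eval2 F x y \<in> C"
    and "absv (fps_eval2 F x y) \<le> B"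
proof -
  have s: "0 < s" using assms(6) absv_nonneg[of x] by linarith
  have inC: "F $ i $ j * (x ^ i * y ^ j) \<in> C" for i j
    using assms by (auto simp: fps2_over_def intro!: cfield_intros[OF assms(1)])
  then have inC': "(case p of (i, j) \<Rightarrow> F $ i $ j * (x ^ i * y ^ j)) \<in> C" for p
    by (cases p) simp
  obtain t where t: "t \<in> C" "((\<lambda>(i, j). F $ i $ j * (x ^ i * y ^ j)) has_sum t) (UNIV \<times> UNIV)"
    by (rule cfield_has_sum[OF assms(1) inC' fps2_null_family[OF assms(5-7)]])
  from t fps_eval2_eqI[OF t(2)]
  show 1: "((\<lambda>(i, j). F $ i $ j * (x ^ i * y ^ j)) has_sum fps_eval2 F x y) (UNIV \<times> UNIV)"
    and "fps_eval2 F x y \<in> C" by simp_all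
  show "absv (fps_eval2 F x y) \<le> B"
  proof (rule has_sum_absv_le[OF 1])
    fix p :: "nat \<times> nat"
    obtain i j where p: "p = (i, j)" by (cases p)
    have "absv x ^ i * absv y ^ j \<le> s ^ i * s ^ j"
      using assms s by (intro mult_mono power_mono) auto
    then have "absv (F $ i $ j * (x ^ i * y ^ j)) \<le> absv (F $ i $ j) * s ^ (i + j)"
      by (simp add: absv_mult absv_power power_add mult_left_mono)
    also have "\<dots> \<le> B" by (rule gauss2_leD[OF assms(5)])
    finally show "absv (case p of (i, j) \<Rightarrow> F $ i $ j * (x ^ i * y ^ j)) \<le> B" by (simp add: p)
  qed (rule gauss2_le_nonneg[OF assms(5)])
qed

text \<open>The one-variable series F(X, y). It reduces statements on values in two variables to
  those in one.\<close>

definition fps2_row :: "'a::nonarch_field fps fps \<Rightarrow> 'a \<Rightarrow> 'a fps" where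
  "fps2_row F y = Abs_fps (\<lambda>i. fps_eval (F $ i) y)"

lemma gauss2_le_nth:
  assumes "gauss2_le s B F" "0 < s"
  shows "gauss_le s (B / s ^ i) (F $ i)"
  unfolding gauss_le_def
proof
  fix j show "absv (F $ i $ j) * s ^ j \<le> B / s ^ i"
    using gauss2_leD[OF assms(1), of i j] assms(2) by (simp add: field_simps power_add)
qed

lemma fps2_row:
  assumes "cfield C" "F \<in> fps2_over C" "y \<in> C" "gauss2_le s B F" "absv y < s"
  shows fps2_row_over: "fps2_row F y \<in> fps_over C"
    and fps2_row_gauss: "gauss_le s B (fps2_row F y)"
    and fps2_row_has_sum: "((\<lambda>j. F $ i $ j * y ^ j) has_sum fps2_row F y $ i) UNIV"
    and fps2_row_eval: "x \<in> C \<Longrightarrow> absv x < s \<Longrightarrow> fps_eval (fps2_row F y) x = fps_eval2 F x y"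
proof -
  have s: "0 < s" using assms(5) absv_nonneg[of y] by linarith
  have Fi: "F $ i \<in> fps_over C" for i using assms(2) by (auto simp: fps2_over_def fps_over_def)
  note ev = fps_eval_has_sum[OF assms(1) Fi assms(3) gauss2_le_nth[OF assms(4) s] assms(5)]
  show over: "fps2_row F y \<in> fps_over C" using ev(2) by (auto simp: fps2_row_def fps_over_def)
  show g: "gauss_le s B (fps2_row F y)"
    using ev(3) s by (simp add: fps2_row_def gauss_le_def pos_le_divide_eq)
  show row: "((\<lambda>j. F $ i $ j * y ^ j) has_sum fps2_row F y $ i) UNIV" for i
    using ev(1) by (simp add: fps2_row_def)
  assume x: "x \<in> C" "absv x < s"
  show "fps_eval (fps2_row F y) x = fps_eval2 F x y"
  proof (rule fps_eval_eqI)
    have "((\<lambda>j. F $ i $ j * (x ^ i * y ^ j)) has_sum fps2_row F y $ i * x ^ i) UNIV" for i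
      using has_sum_cmult_left[OF row, of i "x ^ i"] by (simp add: mult_ac)
    with has_sum_SigmaD[OF fps_eval2_has_sum(1)[OF assms(1,2) x(1) assms(3,4) x(2) assms(5)],
        of "\<lambda>i. fps2_row F y $ i * x ^ i"]
    show "((\<lambda>n. fps2_row F y $ n * x ^ n) has_sum fps_eval2 F x y) UNIV" by simp
  qed
qed

lemma fps2_row_power:
  assumes "cfield C" "F \<in> fps2_over C" "y \<in> C" "gauss2_le s B F" "absv y < s"
  shows "fps2_row (F ^ k) y = fps2_row F y ^ k"
proof (induction k)
  case 0
  show ?case
  proof (rule fps_ext)
    fix n show "fps2_row (F ^ 0) y $ n = (fps2_row F y ^ 0) $ n"
      by (cases n) (auto simp: fps2_row_def)
  qed
next
  case (Suc k)
  have s: "0 < s" using assms(5) absv_nonneg[of y] by linarith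
  show ?case
  proof (rule fps_ext)
    fix n
    have over: "F $ i \<in> fps_over C" "(F ^ k) $ i \<in> fps_over C" for i
      using assms(2) fps2_over_power[OF assms(1,2), of k] by (auto simp: fps2_over_def fps_over_def)
    note g1 = gauss2_le_nth[OF assms(4) s]
    note g2 = gauss2_le_nth[OF gauss2_le_power[OF _ assms(4)] s]
    have gm: "gauss_le s (B * B ^ k / s ^ n) (F $ i * (F ^ k) $ (n - i))" if "i \<le> n" for i
    proof -
      have "B / s ^ i * (B ^ k / s ^ (n - i)) = B * B ^ k / s ^ n"
        using power_add[of s i "n - i"] that by simp
      with gauss_le_mult[OF less_imp_le[OF s] g1[of i] g2[of k "n - i"]] s show ?thesis
        by (simp only: less_imp_le)
    qed
    have "fps2_row (F ^ Suc k) y $ n = fps_eval (\<Sum>i=0..n. F $ i * (F ^ k) $ (n - i)) y"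
      by (simp add: fps2_row_def fps_mult_nth)
    also have "\<dots> = (\<Sum>i=0..n. fps_eval (F $ i * (F ^ k) $ (n - i)) y)"
      by (rule fps_eval_sum[OF assms(1,3,5)])
         (auto intro: fps_over_intros[OF assms(1)] over gm)
    also have "\<dots> = (\<Sum>i=0..n. fps2_row F y $ i * fps2_row (F ^ k) y $ (n - i))"
      using fps_eval_mult[OF assms(1) over(1) over(2) assms(3) g1 g2 assms(5)] s
      by (simp add: fps2_row_def)
    also have "\<dots> = (fps2_row F y ^ Suc k) $ n" by (simp add: Suc fps_mult_nth)
    finally show "fps2_row (F ^ Suc k) y $ n = (fps2_row F y ^ Suc k) $ n" .
  qed
qed

lemma fps_eval2_power:
  assumes "cfield C" "F \<in> fps2_over C" "x \<in> C" "y \<in> C" "gauss2_le s B F" "absv x < s" "absv y < s"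
  shows "fps_eval2 (F ^ k) x y = fps_eval2 F x y ^ k"
proof -
  have s: "0 \<le> s" using assms(6) absv_nonneg[of x] by linarith
  have "fps_eval2 (F ^ k) x y = fps_eval (fps2_row (F ^ k) y) x"
    by (rule fps2_row_eval[OF assms(1) _ assms(4) gauss2_le_power[OF s assms(5)], symmetric])
       (use assms fps2_over_power in auto)
  also have "\<dots> = fps_eval (fps2_row F y) x ^ k"
    unfolding fps2_row_power[OF assms(1,2,4,5,7)]
    by (rule fps_eval_power[OF assms(1) fps2_row_over[OF assms(1,2,4,5,7)] assms(3) fps2_row_gauss[OF assms(1,2,4,5,7)] assms(6)])
  finally show ?thesis using fps2_row_eval[OF assms(1,2,4,5,7,3,6)] by simp
qed

text \<open>The series \<open>h(F(X,Y))\<close> and \<open>G(h(X),h(Y))\<close> compared by \<^const>\<open>fgl_hom\<close>.\<close>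

definition fps2_outer :: "'a::nonarch_field fps \<Rightarrow> 'a fps fps \<Rightarrow> 'a fps fps" where
  "fps2_outer h F = Abs_fps (\<lambda>a. Abs_fps (\<lambda>b. \<Sum>k\<le>a + b. h $ k * (F ^ k) $ a $ b))"

definition fps2_inner :: "'a::nonarch_field fps fps \<Rightarrow> 'a fps \<Rightarrow> 'a fps fps" where
  "fps2_inner G h =
     Abs_fps (\<lambda>a. Abs_fps (\<lambda>b. \<Sum>i\<le>a. \<Sum>j\<le>b. G $ i $ j * (h ^ i) $ a * (h ^ j) $ b))"

text \<open>Turns the comparison of coefficients into an identity of series, which can be evaluated
  at points (\<open>fps_eval_hom\<close>) and can be proved from values (\<open>fgl_hom_log\<close>,
  \<open>fgl_hom_endo\<close>).\<close>

lemma fgl_hom_iff: "fgl_hom F G h \<longleftrightarrow> h $ 0 = 0 \<and> fps2_outer h F = fps2_inner G h"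
  by (auto simp: fgl_hom_def fps2_outer_def fps2_inner_def fps_eq_iff)

lemma max3_power_bound:
  assumes "0 \<le> a" "0 \<le> b" "0 \<le> c" "0 \<le> (B::real)"
  shows "B * a ^ i * b ^ j * c ^ k \<le> B * max a (max b c) ^ (i + j + k)"
proof -
  have "a ^ i * b ^ j * c ^ k \<le> max a (max b c) ^ i * max a (max b c) ^ j * max a (max b c) ^ k"
    using assms by (intro mult_mono power_mono mult_nonneg_nonneg zero_le_power) auto
  then have "B * (a ^ i * b ^ j * c ^ k) \<le> B * max a (max b c) ^ (i + j + k)"
    using assms by (intro mult_left_mono) (auto simp: power_add)
  then show ?thesis by (simp add: mult.assoc)
qed

lemma fps2_outer_over:
  assumes "cfield C" "h \<in> fps_over C" "F \<in> fps2_over C"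
  shows "fps2_outer h F \<in> fps2_over C"
  using assms fps2_over_power[OF assms(1,3)]
  by (auto simp: fps2_over_def fps2_outer_def fps_over_def intro!: cfield_intros[OF assms(1)])

lemma fps2_inner_over:
  assumes "cfield C" "h \<in> fps_over C" "G \<in> fps2_over C"
  shows "fps2_inner G h \<in> fps2_over C"
  using assms fps_over_intros(9)[OF assms(1,2)]
  by (auto simp: fps2_over_def fps2_inner_def fps_over_def intro!: cfield_intros[OF assms(1)])

text \<open>The sums over the exponent \<open>k\<close> of \<open>h\<close> and over the monomials
  (a, b) of F^k are exchanged; \<open>G < s\<close> gives the decay in \<open>k\<close>. For a fixed
  monomial only \<open>k \<le> a + b\<close> contributes, so the inner sum of the other order is
  finite.\<close>

lemma fps_eval2_outer:
  assumes C: "cfield C" and h: "h \<in> fps_over C" "gauss_le s B h"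
    and F: "F \<in> fps2_over C" "gauss2_le s' G F" "F $ 0 $ 0 = 0" and G: "G < s"
    and x: "x \<in> C" "absv x < s'" and y: "y \<in> C" "absv y < s'"
  shows "fps_eval2 (fps2_outer h F) x y = fps_eval h (fps_eval2 F x y)"
proof -
  have G0: "0 \<le> G" and B0: "0 \<le> B" using F h gauss2_le_nonneg gauss_le_nonneg by auto
  have s: "0 < s" using G0 G by linarith
  have s': "0 < s'" using x(2) absv_nonneg[of x] by linarith
  let ?f = "\<lambda>k (a, b). h $ k * ((F ^ k) $ a $ b * (x ^ a * y ^ b))"
  let ?t = "max (G / s) (max (absv x / s') (absv y / s'))"
  have inC: "h $ k * ((F ^ k) $ a $ b * (x ^ a * y ^ b)) \<in> C" for k a b
    using fps2_over_power[OF C F(1)] fps_overD[OF h(1)] x y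
    by (auto simp: fps2_over_def intro!: cfield_intros[OF C])
  show ?thesis
  proof (rule fps_eval2_eqI, rule has_sum_fubini(2)[OF C])
    show "?f k p \<in> C" for k p using inC by (cases p) auto
    show "null_family (\<lambda>(k, p). ?f k p) (UNIV \<times> (UNIV \<times> UNIV))"
    proof (rule null_family_weight[where w = "\<lambda>(k, a, b). k + a + b" and t = ?t and B = B])
      fix p :: "nat \<times> nat \<times> nat"
      obtain k a b where p: "p = (k, a, b)" by (cases p) auto
      have "absv (h $ k * ((F ^ k) $ a $ b * (x ^ a * y ^ b)))
          = (absv (h $ k) * s ^ k) * (absv ((F ^ k) $ a $ b) * s' ^ (a + b)) / s ^ k
              * (absv x / s') ^ a * (absv y / s') ^ b"
        using s s' by (simp add: absv_mult absv_power power_divide power_add)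
      also have "\<dots> \<le> B * G ^ k / s ^ k * (absv x / s') ^ a * (absv y / s') ^ b"
        using s s' B0 G0
        by (intro mult_right_mono divide_right_mono mult_mono gauss_leD h gauss2_leD[OF gauss2_le_power] F)
           auto
      also have "\<dots> = B * (G / s) ^ k * (absv x / s') ^ a * (absv y / s') ^ b"
        by (simp add: power_divide)
      also have "\<dots> \<le> B * ?t ^ (k + a + b)"
        using s s' G0 B0 by (intro max3_power_bound) auto
      finally show "absv (case p of (k, p) \<Rightarrow> ?f k p) \<le> B * ?t ^ (case p of (k, a, b) \<Rightarrow> k + a + b)"
        by (simp add: p)
    next
      fix N :: nat
      show "finite {p \<in> UNIV \<times> UNIV \<times> UNIV. (case p of (k, p) \<Rightarrow> ?f k p) \<noteq> 0 \<and>
          (case p of (k, a, b) \<Rightarrow> k + a + b) \<le> N}"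
        by (rule finite_subset[of _ "{..N} \<times> {..N} \<times> {..N}"]) auto
    qed (use s s' G G0 x y in \<open>auto simp: le_max_iff_disj\<close>)
    show "(?f k has_sum h $ k * fps_eval2 F x y ^ k) (UNIV \<times> UNIV)" for k
    proof -
      have "((\<lambda>(a, b). (F ^ k) $ a $ b * (x ^ a * y ^ b)) has_sum fps_eval2 (F ^ k) x y) (UNIV \<times> UNIV)"
        by (rule fps_eval2_has_sum(1)[OF C _ x(1) y(1) gauss2_le_power[OF _ F(2)] x(2) y(2)])
           (use s' fps2_over_power[OF C F(1)] in auto)
      from has_sum_cmult_right[OF this, of "h $ k"] show ?thesis
        by (simp add: fps_eval2_power[OF C F(1) x(1) y(1) F(2) x(2) y(2)] case_prod_unfold)
    qed
    have "absv (fps_eval2 F x y) < s"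
      using fps_eval2_has_sum(3)[OF C F(1) x(1) y(1) F(2) x(2) y(2)] G by linarith
    then show "((\<lambda>k. h $ k * fps_eval2 F x y ^ k) has_sum fps_eval h (fps_eval2 F x y)) UNIV"
      by (intro fps_eval_has_sum(1)[OF C h(1) _ h(2)]
          fps_eval2_has_sum(2)[OF C F(1) x(1) y(1) F(2) x(2) y(2)])
    fix p :: "nat \<times> nat"
    obtain a b where p: "p = (a, b)" by (cases p) auto
    have "((\<lambda>k. h $ k * ((F ^ k) $ a $ b * (x ^ a * y ^ b))) has_sum
        (\<Sum>k\<in>{..a + b}. h $ k * ((F ^ k) $ a $ b * (x ^ a * y ^ b)))) UNIV"
      by (rule has_sum_finite_support) (auto simp: fps2_power_nth_0[of F, OF F(3)])
    then show "((\<lambda>k. ?f k p) has_sum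
        (case p of (a, b) \<Rightarrow> fps2_outer h F $ a $ b * (x ^ a * y ^ b))) UNIV"
      by (simp add: p fps2_outer_def sum_distrib_right mult.assoc)
  qed
qed

lemma fps_power_nth_0: "h $ 0 = (0::'a::comm_ring_1) \<Longrightarrow> a < i \<Longrightarrow> (h ^ i) $ a = 0"
  using startsby_zero_power_prefix by blast

text \<open>An exchange of two double sums: one over the monomials of \<open>F\<close>, one over the
  monomials in the product of the powers of h(X) and h(Y).\<close>

lemma fps_eval2_inner:
  assumes C: "cfield C" and h: "h \<in> fps_over C" "gauss_le s' s' h" "h $ 0 = 0"
    and F: "F \<in> fps2_over C" "gauss2_le s B F" and s: "s' < s"
    and x: "x \<in> C" "absv x < s'" and y: "y \<in> C" "absv y < s'"
  shows "fps_eval2 (fps2_inner F h) x y = fps_eval2 F (fps_eval h x) (fps_eval h y)"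
proof -
  have B0: "0 \<le> B" using F gauss2_le_nonneg by auto
  have s': "0 < s'" using x(2) absv_nonneg[of x] by linarith
  note hi = fps_over_intros(9)[OF C h(1)] and gi = gauss_le_power[OF less_imp_le[OF s'] h(2)]
  note hx = fps_eval_has_sum[OF C h(1) x(1) h(2) x(2)]
  note hy = fps_eval_has_sum[OF C h(1) y(1) h(2) y(2)]
  let ?f = "\<lambda>(i, j) (a, b). F $ i $ j * (((h ^ i) $ a * x ^ a) * ((h ^ j) $ b * y ^ b))"
  let ?t = "max (s' / s) (max (absv x / s') (absv y / s'))"
  have tm: "absv ((h ^ i) $ a * z ^ a) \<le> s' ^ i * (absv z / s') ^ a" if "absv z < s'" for i a z
    using gauss_le_term[OF gi that] .
  show ?thesis
  proof (rule fps_eval2_eqI, rule has_sum_fubini(2)[OF C])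
    show "?f p q \<in> C" for p q
      using F(1) x y fps_overD[OF hi]
      by (cases p; cases q) (auto simp: fps2_over_def intro!: cfield_intros[OF C])
    show "null_family (\<lambda>(p, q). ?f p q) ((UNIV \<times> UNIV) \<times> (UNIV \<times> UNIV))"
    proof (rule null_family_weight[where w = "\<lambda>((i, j), a, b). (i + j) + a + b" and t = ?t and B = B])
      fix p :: "(nat \<times> nat) \<times> nat \<times> nat"
      obtain i j a b where p: "p = ((i, j), a, b)" by (cases p) auto
      have "absv (F $ i $ j * (((h ^ i) $ a * x ^ a) * ((h ^ j) $ b * y ^ b)))
          = absv (F $ i $ j) * (absv ((h ^ i) $ a * x ^ a) * absv ((h ^ j) $ b * y ^ b))"
        by (simp add: absv_mult)
      also have "\<dots> \<le> absv (F $ i $ j) *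
          ((s' ^ i * (absv x / s') ^ a) * (s' ^ j * (absv y / s') ^ b))"
        using s' by (intro mult_left_mono mult_mono tm x y) auto
      also have "\<dots> = (absv (F $ i $ j) * s ^ (i + j)) *
          ((s' / s) ^ (i + j) * (absv x / s') ^ a * (absv y / s') ^ b)"
        using s s' by (simp add: power_add power_divide)
      also have "\<dots> \<le> B * ((s' / s) ^ (i + j) * (absv x / s') ^ a * (absv y / s') ^ b)"
        using s s' by (intro mult_right_mono gauss2_leD F) auto
      also have "\<dots> = B * (s' / s) ^ (i + j) * (absv x / s') ^ a * (absv y / s') ^ b"
        by (simp add: mult.assoc)
      also have "\<dots> \<le> B * ?t ^ ((i + j) + a + b)"
        using s s' B0 by (intro max3_power_bound) auto
      finally show "absv (case p of (p, q) \<Rightarrow> ?f p q)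
          \<le> B * ?t ^ ((\<lambda>((i, j), a, b). (i + j) + a + b) p)"
        by (simp add: p)
    next
      fix N :: nat
      show "finite {p \<in> (UNIV \<times> UNIV) \<times> UNIV \<times> UNIV. (case p of (p, q) \<Rightarrow> ?f p q) \<noteq> 0 \<and>
          (\<lambda>((i, j), a, b). (i + j) + a + b) p \<le> N}"
        by (rule finite_subset[of _ "({..N} \<times> {..N}) \<times> {..N} \<times> {..N}"]) auto
    qed (use s s' x y in \<open>auto simp: le_max_iff_disj\<close>)
    show "(?f p has_sum (case p of (i, j) \<Rightarrow> F $ i $ j * (fps_eval h x ^ i * fps_eval h y ^ j)))
        (UNIV \<times> UNIV)" for p
    proof (cases p)
      case (Pair i j)
      have "((\<lambda>(a, b). ((h ^ i) $ a * x ^ a) * ((h ^ j) $ b * y ^ b)) has_sum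
          fps_eval (h ^ i) x * fps_eval (h ^ j) y) (UNIV \<times> UNIV)"
      proof (rule has_sum_prod[OF C])
        show "null_family (\<lambda>(a, b). ((h ^ i) $ a * x ^ a) * ((h ^ j) $ b * y ^ b)) (UNIV \<times> UNIV)"
        proof (rule null_family_geometric[where B = "s' ^ i * s' ^ j" and a = "absv x / s'" and b = "absv y / s'"])
          fix a b
          have "absv ((h ^ i) $ a * x ^ a) * absv ((h ^ j) $ b * y ^ b)
              \<le> (s' ^ i * (absv x / s') ^ a) * (s' ^ j * (absv y / s') ^ b)"
            using s' by (intro mult_mono tm x y) auto
          then show "absv (((h ^ i) $ a * x ^ a) * ((h ^ j) $ b * y ^ b))
              \<le> s' ^ i * s' ^ j * (absv x / s') ^ a * (absv y / s') ^ b"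
            by (simp add: absv_mult mult_ac)
        qed (use s' x y in auto)
      qed (use x y fps_overD[OF hi] fps_eval_has_sum(1)[OF C hi _ gi] in
          \<open>auto intro!: cfield_intros[OF C]\<close>)
      from has_sum_cmult_right[OF this, of "F $ i $ j"] show ?thesis
        by (simp add: Pair case_prod_unfold fps_eval_power[OF C h(1) x(1) h(2) x(2)]
            fps_eval_power[OF C h(1) y(1) h(2) y(2)])
    qed
    show "((\<lambda>(i, j). F $ i $ j * (fps_eval h x ^ i * fps_eval h y ^ j)) has_sum
        fps_eval2 F (fps_eval h x) (fps_eval h y)) (UNIV \<times> UNIV)"
      by (rule fps_eval2_has_sum(1)[OF C F(1) _ _ F(2)]) (use hx hy s in auto)
    fix q :: "nat \<times> nat"
    obtain a b where q: "q = (a, b)" by (cases q) auto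
    have "((\<lambda>p. ?f p (a, b)) has_sum (\<Sum>p\<in>{..a} \<times> {..b}. ?f p (a, b))) UNIV"
    proof (rule has_sum_finite_support)
      fix p assume "p \<notin> {..a} \<times> {..b}"
      then show "?f p (a, b) = 0" using fps_power_nth_0[OF h(3)] by (cases p) auto
    qed auto
    also have "(\<Sum>p\<in>{..a} \<times> {..b}. ?f p (a, b)) = fps2_inner F h $ a $ b * (x ^ a * y ^ b)"
      by (simp add: fps2_inner_def sum.cartesian_product sum_distrib_left sum_distrib_right mult_ac case_prod_unfold)
    finally show "((\<lambda>p. ?f p q) has_sum
        (case q of (a, b) \<Rightarrow> fps2_inner F h $ a $ b * (x ^ a * y ^ b))) (UNIV \<times> UNIV)"
      by (simp add: q)
  qed
qed

text \<open>\<open>f\<close> and \<open>g\<close> may have constant terms. Convergence comes from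
  \<open>G < 1\<close>: as \<open>F\<close> has integral coefficients, the term with exponents i and
  j is at most G^(i+j).\<close>

lemma fps_subst2:
  assumes C: "cfield C" and F: "F \<in> fps2_over C" "gauss2_le 1 1 F" "F $ 0 $ 0 = 0"
    and f: "f \<in> fps_over C" "gauss_le s G f" and g: "g \<in> fps_over C" "gauss_le s G g"
    and G: "G < 1" and s: "0 < s"
  shows fps_subst2_over: "fps_subst2 F f g \<in> fps_over C"
    and fps_subst2_gauss: "gauss_le s G (fps_subst2 F f g)"
    and fps_eval_subst2: "x \<in> C \<Longrightarrow> absv x < s \<Longrightarrow>
      fps_eval (fps_subst2 F f g) x = fps_eval2 F (fps_eval f x) (fps_eval g x)"
proof -
  have G0: "0 \<le> G" using f gauss_le_nonneg by auto
  let ?c = "\<lambda>n (i, j). F $ i $ j * (f ^ i * g ^ j) $ n"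
  have over: "f ^ i * g ^ j \<in> fps_over C" for i j
    using f g by (intro fps_over_intros[OF C])
  have gm: "gauss_le s (G ^ i * G ^ j) (f ^ i * g ^ j)" for i j
    using f g s by (intro gauss_le_mult gauss_le_power) auto
  have inC: "?c n p \<in> C" for n p
    using F(1) fps_overD[OF over]
    by (cases p) (auto simp: fps2_over_def intro!: cfield_intros[OF C])
  have le: "absv (F $ i $ j * (f ^ i * g ^ j) $ n) * s ^ n \<le> G ^ i * G ^ j" for i j n
  proof -
    have "absv (F $ i $ j) * (absv ((f ^ i * g ^ j) $ n) * s ^ n) \<le> 1 * (G ^ i * G ^ j)"
      using F(2) G0 s by (intro mult_mono gauss_leD[OF gm]) (auto simp: gauss2_le_1)
    then show ?thesis by (simp add: absv_mult)
  qed
  \<comment> \<open>The monomials of \<open>F\<close> have positive degree, so at least one factor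
    \<open>G\<close> survives.\<close>
  have le': "absv (F $ i $ j * (f ^ i * g ^ j) $ n) * s ^ n \<le> G" for i j n
  proof (cases "i + j = 0")
    case True
    then show ?thesis using F(3) G0 by simp
  next
    case False
    then have "G ^ (i + j) \<le> G ^ 1" using G0 G by (intro power_decreasing) auto
    then show ?thesis using le[of i j n] by (simp add: power_add)
  qed
  have null: "null_family (?c n) (UNIV \<times> UNIV)" for n
  proof (rule null_family_geometric[where B = "1 / s ^ n" and a = G and b = G])
    show "absv (F $ i $ j * (f ^ i * g ^ j) $ n) \<le> 1 / s ^ n * G ^ i * G ^ j" for i j
      using le[of i j n] s by (simp add: pos_le_divide_eq)
  qed (use G G0 s in auto)
  have hs: "(?c n has_sum fps_subst2 F f g $ n) (UNIV \<times> UNIV)" for n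
  proof -
    obtain t where t: "t \<in> C" "(?c n has_sum t) (UNIV \<times> UNIV)"
      by (rule cfield_has_sum[OF C inC null])
    then have "fps_subst2 F f g $ n = t"
      unfolding fps_subst2_def fps_nth_Abs_fps
      using sums_unique[OF has_sum_imp_sums[OF has_sum_diagonal[OF t(2)]]] by simp
    with t show ?thesis by simp
  qed
  show over': "fps_subst2 F f g \<in> fps_over C"
    using has_sum_in_cfield[OF C inC null hs] by (auto intro: fps_overI)
  show "gauss_le s G (fps_subst2 F f g)"
    unfolding gauss_le_def
  proof
    fix n
    have "absv (fps_subst2 F f g $ n) \<le> G / s ^ n"
    proof (rule has_sum_absv_le[OF hs])
      show "absv (?c n p) \<le> G / s ^ n" for p
        using le' s by (cases p) (simp add: pos_le_divide_eq)
    qed (use s G0 in auto)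
    then show "absv (fps_subst2 F f g $ n) * s ^ n \<le> G" using s by (simp add: pos_le_divide_eq)
  qed
  assume x: "x \<in> C" "absv x < s"
  note fx = fps_eval_has_sum[OF C f(1) x(1) f(2) x(2)]
  note gx = fps_eval_has_sum[OF C g(1) x(1) g(2) x(2)]
  let ?t = "max (max G G) (absv x / s)"
  show "fps_eval (fps_subst2 F f g) x = fps_eval2 F (fps_eval f x) (fps_eval g x)"
  proof (rule fps_eval_eqI, rule has_sum_fubini(2)[where f = "\<lambda>p n. ?c n p * x ^ n" and A = "UNIV \<times> UNIV", OF C])
    show "?c n p * x ^ n \<in> C" for n p
      using inC x by (intro cfield_intros[OF C])
    show "null_family (\<lambda>(p, n). ?c n p * x ^ n) ((UNIV \<times> UNIV) \<times> UNIV)"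
    proof (rule null_family_weight[where w = "\<lambda>((i, j), n). i + j + n" and t = "max G (max G (absv x / s))" and B = 1])
      fix p :: "(nat \<times> nat) \<times> nat"
      obtain i j n where p: "p = ((i, j), n)" by (cases p) auto
      have "absv (F $ i $ j * (f ^ i * g ^ j) $ n * x ^ n)
          = absv (F $ i $ j * (f ^ i * g ^ j) $ n) * s ^ n * (absv x / s) ^ n"
        using s by (simp add: absv_mult absv_power power_divide)
      also have "\<dots> \<le> G ^ i * G ^ j * (absv x / s) ^ n"
        using s by (intro mult_right_mono le) auto
      also have "\<dots> \<le> 1 * max G (max G (absv x / s)) ^ (i + j + n)"
        using max3_power_bound[of G G "absv x / s" 1 i j n] s G0 by simp
      finally show "absv (case p of (p, n) \<Rightarrow> ?c n p * x ^ n)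
          \<le> 1 * max G (max G (absv x / s)) ^ ((\<lambda>((i, j), n). i + j + n) p)"
        by (simp add: p)
    next
      fix N :: nat
      show "finite {p \<in> (UNIV \<times> UNIV) \<times> UNIV. (case p of (p, n) \<Rightarrow> ?c n p * x ^ n) \<noteq> 0 \<and>
          (\<lambda>((i, j), n). i + j + n) p \<le> N}"
        by (rule finite_subset[of _ "({..N} \<times> {..N}) \<times> {..N}"]) auto
    qed (use s x G G0 in auto)
    show "((\<lambda>n. ?c n p * x ^ n) has_sum
        (case p of (i, j) \<Rightarrow> F $ i $ j * (fps_eval f x ^ i * fps_eval g x ^ j))) UNIV" for p
    proof (cases p)
      case (Pair i j)
      have "((\<lambda>n. (f ^ i * g ^ j) $ n * x ^ n) has_sum fps_eval (f ^ i * g ^ j) x) UNIV"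
        by (rule fps_eval_has_sum(1)[OF C over x(1) gm x(2)])
      also have "fps_eval (f ^ i * g ^ j) x = fps_eval f x ^ i * fps_eval g x ^ j"
        using f g s by (simp add: fps_eval_mult[OF C _ _ x(1) gauss_le_power gauss_le_power x(2)]
            fps_eval_power[OF C _ x(1) _ x(2)] fps_over_intros[OF C])
      finally show ?thesis
        using has_sum_cmult_right[where c = "F $ i $ j" and f = "\<lambda>n. (f ^ i * g ^ j) $ n * x ^ n"]
        by (simp add: Pair mult.assoc)
    qed
    show "((\<lambda>(i, j). F $ i $ j * (fps_eval f x ^ i * fps_eval g x ^ j)) has_sum
        fps_eval2 F (fps_eval f x) (fps_eval g x)) (UNIV \<times> UNIV)"
      by (rule fps_eval2_has_sum(1)[OF C F(1) _ _ F(2)]) (use fx gx G in auto)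
    show "((\<lambda>p. ?c n p * x ^ n) has_sum fps_subst2 F f g $ n * x ^ n) (UNIV \<times> UNIV)" for n
      by (rule has_sum_cmult_left[OF hs])
  qed
qed

text \<open>One variable at a time: F(X, y) vanishes for every small \<open>y\<close>, so every
  coefficient of a power of X, a series in Y, has the value 0 at all small \<open>y\<close>.\<close>

lemma fps2_eq_0I:
  assumes "cfield C" "F \<in> fps2_over C" "gauss2_le s B F" "0 < s"
    and "\<And>e. 0 < e \<Longrightarrow> \<exists>x\<in>C. x \<noteq> 0 \<and> absv x < e"
    and zeros: "\<And>x y. x \<in> C \<Longrightarrow> y \<in> C \<Longrightarrow> absv x < s \<Longrightarrow> absv y < s \<Longrightarrow> fps_eval2 F x y = 0"
  shows "F = 0"
proof -
  have row: "fps2_row F y = 0" if y: "y \<in> C" "absv y < s" for y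
  proof (rule fps_eqI_eval[OF assms(1) _ _ _ gauss_le_zero assms(4,5)])
    show "fps2_row F y \<in> fps_over C" "gauss_le s B (fps2_row F y)"
      using fps2_row[OF assms(1,2) y(1) assms(3) y(2)] by auto
    show "fps_eval (fps2_row F y) x = fps_eval 0 x" if "x \<in> C" "absv x < s" for x
      using fps2_row_eval[OF assms(1,2) y(1) assms(3) y(2) that] zeros that y by simp
    show "(0::real) \<le> 0" by simp
  qed (auto intro: fps_over_intros[OF assms(1)])
  have "F $ i = 0" for i
  proof (rule fps_eqI_eval[OF assms(1) _ _ gauss2_le_nth[OF assms(3,4)] gauss_le_zero assms(4,5)])
    show "F $ i \<in> fps_over C" using assms(2) by (auto simp: fps2_over_def fps_over_def)
    show "fps_eval (F $ i) y = fps_eval 0 y" if "y \<in> C" "absv y < s" for y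
      using row[OF that] by (auto simp: fps2_row_def fps_eq_iff)
    show "(0::real) \<le> 0" by simp
  qed (auto intro: fps_over_intros[OF assms(1)])
  then show ?thesis by (simp add: fps_eq_iff)
qed

lemma fps2_eqI_eval:
  assumes "cfield C" "F \<in> fps2_over C" "G \<in> fps2_over C" "gauss2_le s A F" "gauss2_le s B G" "0 < s"
    and "\<And>e. 0 < e \<Longrightarrow> \<exists>x\<in>C. x \<noteq> 0 \<and> absv x < e"
    and eq: "\<And>x y. x \<in> C \<Longrightarrow> y \<in> C \<Longrightarrow> absv x < s \<Longrightarrow> absv y < s \<Longrightarrow> fps_eval2 F x y = fps_eval2 G x y"
  shows "F = G"
proof -
  have "F - G = 0"
  proof (rule fps2_eq_0I[OF assms(1), of _ s "max A B"])
    show over: "F - G \<in> fps2_over C"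
      using assms(2,3) by (auto simp: fps2_over_def intro!: cfield_intros[OF assms(1)])
    show "gauss2_le s (max A B) (F - G)"
    proof -
      have "gauss2_le s (max A B) F" "gauss2_le s (max A B) G"
        by (rule gauss2_le_mono[OF assms(4)] gauss2_le_mono[OF assms(5)]; simp)+
      then show ?thesis
        unfolding gauss2_le_def using assms(6) by (auto intro!: absv_mult_le_iff(2))
    qed
    fix x y assume xy: "x \<in> C" "y \<in> C" "absv x < s" "absv y < s"
    have "((\<lambda>p. (case p of (i, j) \<Rightarrow> F $ i $ j * (x ^ i * y ^ j))
        + (- 1) * (case p of (i, j) \<Rightarrow> G $ i $ j * (x ^ i * y ^ j))) has_sum
        (fps_eval2 F x y + (- 1) * fps_eval2 G x y)) (UNIV \<times> UNIV)"
      by (intro has_sum_add has_sum_cmult_right fps_eval2_has_sum(1)[OF assms(1)]) (use assms xy in auto)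
    then show "fps_eval2 (F - G) x y = 0"
      using eq[OF xy] by (intro fps_eval2_eqI) (simp add: case_prod_unfold algebra_simps)
  qed (use assms in auto)
  then show ?thesis by simp
qed

section \<open>The base field and its residue field\<close>

lemma complete_seqI:
  fixes S :: "'a::metric_space set"
  assumes "\<And>f. (\<And>n. f n \<in> S) \<Longrightarrow> Cauchy f \<Longrightarrow> \<exists>l\<in>S. f \<longlonglongrightarrow> l"
  shows "complete S"
  using assms unfolding complete_def by blast

text \<open>\<open>v\<close> has positive distance \<open>d\<close> from the closed subspace
  \<open>E\<close>, and scaling gives |c| d \<le> |c v + w|. So a Cauchy sequence of sums has Cauchy
  coordinates.\<close>

lemma complete_line_extension:
  fixes k E :: "'a::nonarch_field set"
  assumes k: "cfield k" and E: "complete E" "0 \<in> E" "\<And>x y. x \<in> E \<Longrightarrow> y \<in> E \<Longrightarrow> x - y \<in> E"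
    "\<And>c x. c \<in> k \<Longrightarrow> x \<in> E \<Longrightarrow> c * x \<in> E" and v: "v \<notin> E"
  shows "complete {c * v + w |c w. c \<in> k \<and> w \<in> E}"
proof (rule complete_seqI)
  fix f :: "nat \<Rightarrow> 'a"
  assume f: "\<And>n. f n \<in> {c * v + w |c w. c \<in> k \<and> w \<in> E}" and cauchy: "Cauchy f"
  have "closed E" using E(1) by (rule complete_imp_closed)
  then have "open (- E)" by (simp add: open_Compl)
  then obtain d where d: "0 < d" "\<And>y. dist y v < d \<Longrightarrow> y \<in> - E"
    using open_dist[THEN iffD1, rule_format, of "- E" v] v by auto
  have ge: "absv c * d \<le> absv (c * v + w)" if "c \<in> k" "w \<in> E" for c w
  proof (cases "c = 0")
    case False
    have "inverse c * (0 - w) \<in> E" using that by (intro E cfield_intros[OF k])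
    then have "\<not> dist (inverse c * (0 - w)) v < d" using d(2)[of "inverse c * (0 - w)"] by auto
    then have "d \<le> absv (v + inverse c * w)"
      by (simp add: dist_absv absv_diff_commute algebra_simps)
    then have "absv c * d \<le> absv c * absv (v + inverse c * w)" by (simp add: mult_left_mono)
    also have "\<dots> = absv (c * v + w)" using False by (simp add: distrib_left flip: absv_mult mult.assoc)
    finally show ?thesis .
  qed simp
  have "\<forall>n. \<exists>c w. c \<in> k \<and> w \<in> E \<and> f n = c * v + w" using f by blast
  then obtain c w where cw: "\<And>n. c n \<in> k" "\<And>n. w n \<in> E" "\<And>n. f n = c n * v + w n" by metis
  have "Cauchy c"
    unfolding Cauchy_def
  proof (intro allI impI)
    fix e :: real assume e: "0 < e"
    then obtain N where N: "\<And>m n. m \<ge> N \<Longrightarrow> n \<ge> N \<Longrightarrow> dist (f m) (f n) < e * d"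
      using cauchy d(1) unfolding Cauchy_def by (metis mult_pos_pos)
    have "dist (c m) (c n) < e" if "m \<ge> N" "n \<ge> N" for m n
    proof -
      have "absv (c m - c n) * d \<le> absv ((c m - c n) * v + (w m - w n))"
        using cw E(3) by (intro ge) (auto intro: cfield_intros[OF k])
      also have "\<dots> = dist (f m) (f n)" by (simp add: dist_absv cw(3) algebra_simps)
      also have "\<dots> < e * d" using N that by blast
      finally show ?thesis using d(1) by (simp add: dist_absv)
    qed
    then show "\<exists>N. \<forall>m\<ge>N. \<forall>n\<ge>N. dist (c m) (c n) < e" by blast
  qed
  then obtain c' where c': "c' \<in> k" "c \<longlonglongrightarrow> c'"
    using k cw(1) unfolding cfield_def complete_def by blast
  have "Cauchy (\<lambda>n. f n - c n * v)"
    unfolding Cauchy_def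
  proof (intro allI impI)
    fix e :: real assume e: "0 < e"
    have v0: "absv v > 0" using v E(2) by auto
    obtain N where N: "\<And>m n. m \<ge> N \<Longrightarrow> n \<ge> N \<Longrightarrow> dist (f m) (f n) < e"
      using cauchy e unfolding Cauchy_def by metis
    obtain M where M: "\<And>m n. m \<ge> M \<Longrightarrow> n \<ge> M \<Longrightarrow> dist (c m) (c n) < e / absv v"
      using \<open>Cauchy c\<close> e v0 unfolding Cauchy_def by (metis divide_pos_pos)
    have "dist (f m - c m * v) (f n - c n * v) < e" if "m \<ge> max M N" "n \<ge> max M N" for m n
    proof -
      have "absv ((c m - c n) * v) < e"
        using M[of m n] that v0 by (simp add: dist_absv absv_mult pos_less_divide_eq)
      moreover have "absv (f m - f n) < e" using N[of m n] that by (simp add: dist_absv)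
      ultimately have "absv ((f m - f n) - (c m - c n) * v) < e" by (rule absv_diff_less[rotated])
      then show ?thesis by (simp add: dist_absv algebra_simps)
    qed
    then show "\<exists>N. \<forall>m\<ge>N. \<forall>n\<ge>N. dist (f m - c m * v) (f n - c n * v) < e" by blast
  qed
  then have "Cauchy w" by (simp add: cw(3))
  then obtain w' where w': "w' \<in> E" "w \<longlonglongrightarrow> w'"
    using E(1) cw(2) unfolding complete_def by blast
  have "f \<longlonglongrightarrow> c' * v + w'"
    unfolding cw(3) by (intro tendsto_add tendsto_mult_right c' w')
  then show "\<exists>l\<in>{c * v + w |c w. c \<in> k \<and> w \<in> E}. f \<longlonglongrightarrow> l"
    using c' w' by blast
qed

lemma complete_finite_dimension:
  fixes k E :: "'a::nonarch_field set"
  assumes k: "cfield k" and dim: "ring.finite_dimension ambient k E"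
  shows "complete E"
proof -
  interpret field "ambient :: 'a ring" by (rule field_ambient)
  obtain n where "dimension n k E" using dim by (auto simp: finite_dimension_def)
  \<comment> \<open>The subspace properties are carried through the induction because
    \<open>complete_line_extension\<close> asks for them.\<close>
  then have "complete E \<and> 0 \<in> E \<and> (\<forall>x\<in>E. \<forall>y\<in>E. x - y \<in> E) \<and> (\<forall>c\<in>k. \<forall>x\<in>E. c * x \<in> E)"
    using k
  proof (induction rule: dimension.induct)
    case (zero_dim K)
    then show ?case by (simp add: compact_imp_complete finite_imp_compact)
  next
    case (Suc_dim v E n K)
    then have E: "complete E" "0 \<in> E" "\<And>x y. x \<in> E \<Longrightarrow> y \<in> E \<Longrightarrow> x - y \<in> E"
      "\<And>c x. c \<in> K \<Longrightarrow> x \<in> E \<Longrightarrow> c * x \<in> E" by auto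
    have eq: "line_extension K v E = {c * v + w |c w. c \<in> K \<and> w \<in> E}"
      by (auto simp: line_extension_mem_iff; blast)
    have "complete (line_extension K v E)"
      unfolding eq using Suc_dim(2) by (intro complete_line_extension[OF Suc_dim.prems] E)
    moreover have "0 \<in> line_extension K v E"
      using E(2) cfield_intros(1)[OF Suc_dim.prems] unfolding eq by force
    moreover have "x - y \<in> line_extension K v E"
      if xy: "x \<in> line_extension K v E" "y \<in> line_extension K v E" for x y
    proof -
      obtain c w where "x = c * v + w" "c \<in> K" "w \<in> E" using xy(1) unfolding eq by blast
      moreover obtain d z where "y = d * v + z" "d \<in> K" "z \<in> E" using xy(2) unfolding eq by blast
      ultimately have "x - y = (c - d) * v + (w - z)" "c - d \<in> K" "w - z \<in> E"
        using E(3) cfield_intros(4)[OF Suc_dim.prems] by (auto simp: algebra_simps)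
      then show ?thesis unfolding eq by blast
    qed
    moreover have "a * x \<in> line_extension K v E" if ax: "a \<in> K" "x \<in> line_extension K v E" for a x
    proof -
      obtain c w where "x = c * v + w" "c \<in> K" "w \<in> E" using ax(2) unfolding eq by blast
      then have "a * x = (a * c) * v + a * w" "a * c \<in> K" "a * w \<in> E"
        using ax(1) E(4) cfield_intros(6)[OF Suc_dim.prems] by (auto simp: algebra_simps)
      then show ?thesis unfolding eq by blast
    qed
    ultimately show ?case by blast
  qed
  then show ?thesis by blast
qed

lemma fps_over_val_ring: "fps_over (val_ring C) = {f \<in> fps_over C. gauss_le 1 1 f}"
  by (auto simp: fps_over_def val_ring_def gauss_le_1)

lemma gauss_le_1_power_nth: "gauss_le 1 1 f \<Longrightarrow> absv ((f ^ k) $ n) \<le> 1"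
  using gauss_le_power[of 1 1 f k] by (simp add: gauss_le_1)

context lubin_tate_tower
begin

abbreviation q :: nat where "q \<equiv> residue_card K"

lemma cfield_Qp: "cfield (Qp :: 'a set)"
proof -
  interpret algebraic_closure "ambient :: 'a ring" Qp by (rule ambient_closure)
  show ?thesis using complete_Qp subfield_axioms by (simp add: cfield_def)
qed

lemma cfield_K: "cfield K"
  using complete_finite_dimension[OF cfield_Qp finite_K] subfield_K by (simp add: cfield_def)

lemma algebraic_over:
  assumes "Qp \<subseteq> M"
  shows "(ring.algebraic ambient over M) (x :: 'a)"
proof -
  interpret algebraic_closure "ambient :: 'a ring" Qp by (rule ambient_closure)
  show ?thesis using algebraic_mono[OF assms algebraic_extension] by simp
qed

lemma cfield_simple_extension:
  assumes "cfield M" "Qp \<subseteq> M"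
  shows "cfield (ring.simple_extension ambient M (x :: 'a))"
    and "M \<subseteq> ring.simple_extension ambient M x" "x \<in> ring.simple_extension ambient M x"
proof -
  interpret field "ambient :: 'a ring" by (rule field_ambient)
  have M: "subfield M ambient" using assms(1) by (simp add: cfield_def)
  have alg: "(algebraic over M) x" by (rule algebraic_over[OF assms(2)])
  have "subfield (simple_extension M x) ambient" "finite_dimension M (simple_extension M x)"
    using simple_extension_is_subfield[OF M, of x] finite_dimension_simple_extension[OF M, of x] alg
    by auto
  then show "cfield (simple_extension M x)"
    using complete_finite_dimension[OF assms(1)] by (simp add: cfield_def)
  show "M \<subseteq> simple_extension M x" "x \<in> simple_extension M x"
    using simple_extension_incl[of M x] simple_extension_mem[OF subfieldE(1)[OF M], of x] by auto
qed

text \<open>The points are algebraic over Qp, so adjoining them one at a time keeps the field finite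
  over a complete one, hence complete.\<close>

lemma cfield_containing:
  assumes "finite A"
  obtains C where "cfield C" "K \<subseteq> C" "A \<subseteq> (C :: 'a set)"
proof -
  have "\<exists>C. cfield C \<and> K \<subseteq> C \<and> A \<subseteq> (C :: 'a set)"
    using assms
  proof (induction A)
    case empty
    then show ?case using cfield_K by auto
  next
    case (insert x A)
    then obtain C where C: "cfield C" "K \<subseteq> C" "A \<subseteq> C" by blast
    have "Qp \<subseteq> C" using C(2) Qp_subset_K by blast
    note * = cfield_simple_extension[OF C(1) this, of x]
    show ?case
      by (rule exI[of _ "ring.simple_extension ambient C x"]) (use * C in auto)
  qed
  then show ?thesis using that by blast
qed

section \<open>The uniformizer and the valuation of K\<close>

lemma \<pi>_nz: "\<pi> \<noteq> 0" and max_ideal_K: "max_ideal K = (*) \<pi> ` val_ring K"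
  using uniformizer by (auto simp: uniformizer_def)

lemma \<pi>_K: "\<pi> \<in> K" and \<pi>_less_1: "absv \<pi> < 1" and \<pi>_pos: "0 < absv \<pi>"
proof -
  have "\<pi> * 1 \<in> max_ideal K"
    unfolding max_ideal_K by (rule imageI) (auto simp: val_ring_def intro: cfield_intros[OF cfield_K])
  then show "\<pi> \<in> K" "absv \<pi> < 1" by (auto simp: max_ideal_def)
  show "0 < absv \<pi>" using \<pi>_nz by simp
qed

lemma absv_less_1_imp_le: "x \<in> K \<Longrightarrow> absv x < 1 \<Longrightarrow> absv x \<le> absv \<pi>"
proof -
  assume "x \<in> K" "absv x < 1"
  then have "x \<in> (*) \<pi> ` val_ring K" unfolding max_ideal_K[symmetric] by (simp add: max_ideal_def)
  then obtain y where "x = \<pi> * y" "absv y \<le> 1" by (auto simp: val_ring_def)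
  then show ?thesis using mult_left_le[of "absv y" "absv \<pi>"] by (simp add: absv_mult)
qed

lemma \<pi>_val_ring: "(*) \<pi> ` val_ring K = {x \<in> K. absv x \<le> absv \<pi>}"
  unfolding max_ideal_K[symmetric] max_ideal_def
  using absv_less_1_imp_le \<pi>_less_1 by force

lemma fps_over_\<pi>_val_ring: "fps_over ((*) \<pi> ` val_ring K) = {f \<in> fps_over K. gauss_le 1 (absv \<pi>) f}"
  by (auto simp: fps_over_def \<pi>_val_ring gauss_le_1)

lemma K_nonzero_small: "0 < (e::real) \<Longrightarrow> \<exists>x\<in>K. x \<noteq> 0 \<and> absv x < e"
proof -
  assume "0 < e"
  then obtain n where "absv \<pi> ^ n < e"
    using real_arch_pow_inv \<pi>_less_1 by blast
  then show ?thesis using \<pi>_K \<pi>_nz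
    by (intro bexI[of _ "\<pi> ^ n"]) (auto simp: absv_power intro: cfield_intros[OF cfield_K])
qed

lemma cring_O: "cring (O_ring K)"
proof (rule cringI)
  note [simp] = O_ring_def val_ring_def and [intro] = cfield_intros[OF cfield_K]
  show "abelian_group (O_ring K)"
  proof (rule abelian_groupI)
    show "\<exists>y\<in>carrier (O_ring K). y \<oplus>\<^bsub>O_ring K\<^esub> x = \<zero>\<^bsub>O_ring K\<^esub>" if "x \<in> carrier (O_ring K)" for x
      by (rule bexI[of _ "- x"]) (use that in auto)
  qed (auto intro: absv_add_le)
  show "Group.comm_monoid (O_ring K)"
    by (rule comm_monoidI) (auto simp: absv_mult mult_le_one mult_ac)
qed (auto simp: O_ring_def algebra_simps)

lemma O_carrier: "carrier (O_ring K) = {x \<in> K. absv x \<le> 1}"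
  by (simp add: O_ring_def val_ring_def)

lemma O_simps [simp]:
  "x \<otimes>\<^bsub>O_ring K\<^esub> y = x * y" "\<one>\<^bsub>O_ring K\<^esub> = 1" "\<zero>\<^bsub>O_ring K\<^esub> = 0" "x \<oplus>\<^bsub>O_ring K\<^esub> y = x + y"
  by (simp_all add: O_ring_def)

lemma ideal_max_ideal: "ideal (max_ideal K) (O_ring K)"
proof (rule idealI)
  interpret cring "O_ring K" by (rule cring_O)
  show "ring (O_ring K)" by (rule ring_axioms)
  note [intro] = cfield_intros[OF cfield_K]
  show "subgroup (max_ideal K) (add_monoid (O_ring K))"
  proof (rule group.subgroupI[OF a_group])
    show "max_ideal K \<subseteq> carrier (add_monoid (O_ring K))" by (auto simp: O_carrier max_ideal_def)
    show "max_ideal K \<noteq> {}" using \<pi>_K \<pi>_less_1 by (auto simp: max_ideal_def)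
    fix a assume a: "a \<in> max_ideal K"
    then have "\<ominus>\<^bsub>O_ring K\<^esub> a = - a"
      by (intro minus_equality) (auto simp: O_carrier max_ideal_def)
    then show "inv\<^bsub>add_monoid (O_ring K)\<^esub> a \<in> max_ideal K"
      using a by (auto simp: a_inv_def max_ideal_def)
  qed (auto simp: max_ideal_def intro: absv_add_less)
  fix a x assume "a \<in> max_ideal K" "x \<in> carrier (O_ring K)"
  then have "x * a \<in> K" "absv x * absv a < 1"
    using mult_right_mono[of "absv x" 1 "absv a"]
    by (auto simp: max_ideal_def O_carrier intro: le_less_trans)
  then show "x \<otimes>\<^bsub>O_ring K\<^esub> a \<in> max_ideal K" "a \<otimes>\<^bsub>O_ring K\<^esub> x \<in> max_ideal K"
    by (auto simp: max_ideal_def absv_mult mult.commute)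
qed

section \<open>The residue field\<close>

definition residue :: "'a \<Rightarrow> 'a set" where
  "residue a = max_ideal K +>\<^bsub>O_ring K\<^esub> a"

abbreviation residue_ring :: "'a set ring" where
  "residue_ring \<equiv> O_ring K Quot max_ideal K"

lemma residue_hom: "ring_hom_ring (O_ring K) residue_ring residue"
  using ideal.rcos_ring_hom_ring[OF ideal_max_ideal] by (simp add: residue_def[abs_def])

lemma residue_carrier: "carrier residue_ring = residue ` {x \<in> K. absv x \<le> 1}"
  by (auto simp: FactRing_def A_RCOSETS_def' residue_def O_carrier)

lemma residue_zero: "\<zero>\<^bsub>residue_ring\<^esub> = max_ideal K" and residue_one: "\<one>\<^bsub>residue_ring\<^esub> = residue 1"
  by (simp_all add: FactRing_def residue_def)

lemma residue_add:
  "x \<in> K \<Longrightarrow> absv x \<le> 1 \<Longrightarrow> y \<in> K \<Longrightarrow> absv y \<le> 1 \<Longrightarrow>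
    residue (x + y) = residue x \<oplus>\<^bsub>residue_ring\<^esub> residue y"
  and residue_mult:
  "x \<in> K \<Longrightarrow> absv x \<le> 1 \<Longrightarrow> y \<in> K \<Longrightarrow> absv y \<le> 1 \<Longrightarrow>
    residue (x * y) = residue x \<otimes>\<^bsub>residue_ring\<^esub> residue y"
proof -
  interpret h: ring_hom_ring "O_ring K" residue_ring residue by (rule residue_hom)
  show "x \<in> K \<Longrightarrow> absv x \<le> 1 \<Longrightarrow> y \<in> K \<Longrightarrow> absv y \<le> 1 \<Longrightarrow>
    residue (x + y) = residue x \<oplus>\<^bsub>residue_ring\<^esub> residue y"
    "x \<in> K \<Longrightarrow> absv x \<le> 1 \<Longrightarrow> y \<in> K \<Longrightarrow> absv y \<le> 1 \<Longrightarrow>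
    residue (x * y) = residue x \<otimes>\<^bsub>residue_ring\<^esub> residue y"
    using h.hom_add[of x y] h.hom_mult[of x y] by (auto simp: O_carrier)
qed

lemma residue_eq_zero_iff:
  assumes "x \<in> K" "absv x \<le> 1"
  shows "residue x = \<zero>\<^bsub>residue_ring\<^esub> \<longleftrightarrow> absv x < 1"
proof -
  interpret ideal "max_ideal K" "O_ring K" by (rule ideal_max_ideal)
  have "residue x = max_ideal K \<longleftrightarrow> x \<in> max_ideal K"
    unfolding residue_def
    using a_coset_join1[OF _ _ a_subgroup] a_coset_join2[OF _ a_subgroup] assms
    by (auto simp: O_carrier)
  then show ?thesis using assms unfolding residue_zero by (simp add: max_ideal_def)
qed

lemma residue_eqD:
  assumes "residue x = residue y" "x \<in> K" "absv x \<le> 1" "y \<in> K" "absv y \<le> 1"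
  shows "absv (x - y) < 1"
proof -
  note [intro] = cfield_intros[OF cfield_K]
  have "residue (x + - y) = residue (y + - y)"
    using residue_add[of x "- y"] residue_add[of y "- y"] assms by auto
  also have "\<dots> = \<zero>\<^bsub>residue_ring\<^esub>"
    using residue_eq_zero_iff[of 0] by auto
  finally show ?thesis using residue_eq_zero_iff[of "x + - y"] assms by (auto intro: absv_diff_le)
qed

lemma residue_field: "field residue_ring"
proof -
  interpret ideal "max_ideal K" "O_ring K" by (rule ideal_max_ideal)
  interpret h: ring_hom_ring "O_ring K" residue_ring residue by (rule residue_hom)
  interpret R: cring residue_ring
    using quotient_is_cring[OF cring_O] .
  show ?thesis
  proof (rule R.cring_fieldI2)
    show "\<zero>\<^bsub>residue_ring\<^esub> \<noteq> \<one>\<^bsub>residue_ring\<^esub>"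
      using residue_eq_zero_iff[of 1] cfield_intros(2)[OF cfield_K] by (auto simp: residue_one)
    fix a assume a: "a \<in> carrier residue_ring" "a \<noteq> \<zero>\<^bsub>residue_ring\<^esub>"
    then obtain x where x: "a = residue x" "x \<in> K" "absv x \<le> 1" by (auto simp: residue_carrier)
    then have x1: "absv x = 1" using a(2) residue_eq_zero_iff[of x] by auto
    have ix: "inverse x \<in> K" "absv (inverse x) \<le> 1"
      using x x1 by (auto simp: absv_inverse intro: cfield_intros[OF cfield_K])
    have "a \<otimes>\<^bsub>residue_ring\<^esub> residue (inverse x) = residue (x * inverse x)"
      using residue_mult x ix by simp
    also have "x * inverse x = 1" using x1 by (intro right_inverse) auto
    finally show "\<exists>b\<in>carrier residue_ring. a \<otimes>\<^bsub>residue_ring\<^esub> b = \<one>\<^bsub>residue_ring\<^esub>"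
      using ix by (auto simp: residue_carrier residue_one)
  qed
qed

text \<open>This is [\<pi>], but it is introduced by choice: that \<open>fgl_endo\<close> is well
  defined, and agrees with \<open>frob\<close> at \<pi>, is established only later
  (\<open>fgl_endo_eq\<close>, \<open>endo_\<pi>\<close>).\<close>

definition frob :: "'a fps" where
  "frob = (SOME e. e \<in> fps_over (val_ring K) \<and> fgl_hom F F e \<and> e $ 1 = \<pi> \<and>
     e - fps_X ^ q \<in> fps_over ((*) \<pi> ` val_ring K))"

lemma frob:
  shows frob_over: "frob \<in> fps_over K" and frob_gauss: "gauss_le 1 1 frob"
    and frob_hom: "fgl_hom F F frob" and frob_1: "frob $ 1 = \<pi>"
    and frob_cong: "absv ((frob - fps_X ^ q) $ n) \<le> absv \<pi>"
proof -
  have "\<exists>e. e \<in> fps_over (val_ring K) \<and> fgl_hom F F e \<and> e $ 1 = \<pi> \<and>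
     e - fps_X ^ q \<in> fps_over ((*) \<pi> ` val_ring K)"
    using lubin_tate by (auto simp: lubin_tate_fgl_def)
  from someI_ex[OF this] have *: "frob \<in> fps_over (val_ring K) \<and> fgl_hom F F frob \<and> frob $ 1 = \<pi> \<and>
     frob - fps_X ^ q \<in> fps_over ((*) \<pi> ` val_ring K)" unfolding frob_def .
  then show "frob \<in> fps_over K" "gauss_le 1 1 frob" "fgl_hom F F frob" "frob $ 1 = \<pi>"
    "absv ((frob - fps_X ^ q) $ n) \<le> absv \<pi>"
    by (auto simp: fps_over_val_ring fps_over_\<pi>_val_ring gauss_le_1)
qed

lemma frob_0: "frob $ 0 = 0"
  using frob_hom by (simp add: fgl_hom_def)

lemma frob_tame: "tame 1 frob"
  using frob_0 frob_gauss by (simp add: tame_def)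

text \<open>For q = 0 the constant coefficient of \<open>frob - fps_X ^ q\<close> would be -1, for q
  = 1 its linear coefficient would be \<pi> - 1; neither is divisible by \<pi>. As
  \<open>card\<close> is 0 on infinite sets, the finiteness of the residue field follows
  too.\<close>

lemma q_ge_2: "2 \<le> q"
proof (rule ccontr)
  assume "\<not> 2 \<le> q"
  then consider "q = 0" | "q = 1" by linarith
  then show False
  proof cases
    case 1
    then show False using frob_cong[of 0] frob_0 \<pi>_less_1 by simp
  next
    case 2
    have "absv (- 1 + \<pi>) = absv (- 1 :: 'a)" using \<pi>_less_1 by (intro absv_add_eq) simp
    then show False using frob_cong[of 1] 2 frob_1 \<pi>_less_1 by simp
  qed
qed

lemma finite_residue: "finite (carrier residue_ring)"
  using q_ge_2 by (intro card_ge_0_finite) (simp add: residue_card_def)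

lemma residue_add_pow:
  assumes "x \<in> K" "absv x \<le> 1"
  shows "residue x [^]\<^bsub>add_monoid residue_ring\<^esub> (n::nat) = residue (of_nat n * x)"
proof (induction n)
  case 0
  interpret ring residue_ring using residue_hom by (rule ring_hom_ring.axioms(2))
  show ?case using residue_eq_zero_iff[of 0] cfield_intros(1)[OF cfield_K]
    by simp
next
  case (Suc n)
  have "residue (of_nat n * x + x) = residue (of_nat n * x) \<oplus>\<^bsub>residue_ring\<^esub> residue x"
    using assms absv_of_nat_le[of n, where 'a = 'a]
    by (intro residue_add) (auto simp: absv_mult mult_le_one intro: cfield_intros[OF cfield_K])
  then show ?case using Suc by (simp add: nat_pow_def algebra_simps)
qed

lemma residue_pow:
  assumes "x \<in> K" "absv x \<le> 1"
  shows "residue x [^]\<^bsub>residue_ring\<^esub> (n::nat) = residue (x ^ n)"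
proof (induction n)
  case 0
  show ?case by (simp add: nat_pow_def residue_one)
next
  case (Suc n)
  have "residue (x ^ n * x) = residue (x ^ n) \<otimes>\<^bsub>residue_ring\<^esub> residue x"
    using assms
    by (intro residue_mult) (auto simp: absv_power power_le_one intro: cfield_intros[OF cfield_K])
  then show ?case using Suc by (simp add: nat_pow_def mult.commute)
qed

text \<open>By Lagrange's theorem q annihilates the additive group of the residue field, so it is
  not a unit. Thus q/\<pi> is integral.\<close>

lemma absv_q_le: "absv (of_nat q :: 'a) \<le> absv \<pi>"
proof -
  interpret R: field residue_ring by (rule residue_field)
  have "residue 1 \<in> carrier (add_monoid residue_ring)"
    using cfield_intros(2)[OF cfield_K] by (auto simp: residue_carrier)
  from group.pow_order_eq_1[OF R.a_group this] have "residue (of_nat q * 1) = \<zero>\<^bsub>residue_ring\<^esub>"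
    using residue_add_pow[of 1 q] cfield_intros(2)[OF cfield_K]
    by (simp add: Coset.order_def residue_card_def)
  then have "absv (of_nat q :: 'a) < 1"
    using residue_eq_zero_iff[of "of_nat q"] absv_of_nat_le cfield_intros(11)[OF cfield_K] by auto
  then show ?thesis using cfield_intros(11)[OF cfield_K] by (intro absv_less_1_imp_le)
qed

text \<open>Fermat's little theorem in the residue field, whose multiplicative group has order q -
  1. Discreteness of the valuation sharpens \<open>< 1\<close> to
  \<open>\<le> absv \<pi>\<close>.\<close>

lemma absv_pow_q_diff_le:
  assumes "x \<in> K" "absv x \<le> 1"
  shows "absv (x ^ q - x) \<le> absv \<pi>"
proof -
  note [intro] = cfield_intros[OF cfield_K]
  have "absv (x ^ q - x) < 1"
  proof (cases "absv x < 1")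
    case True
    then have "absv (x ^ q) < 1" using q_ge_2 by (simp add: absv_power power_less_one_iff)
    with True show ?thesis by (intro absv_diff_less)
  next
    case False
    interpret R: field residue_ring by (rule residue_field)
    interpret U: group "Multiplicative_Group.mult_of residue_ring" by (rule R.field_mult_group)
    have "residue x \<in> carrier (Multiplicative_Group.mult_of residue_ring)"
      using assms False residue_eq_zero_iff[of x] by (auto simp: residue_carrier)
    from U.pow_order_eq_1[OF this] have "residue (x ^ (q - 1)) = residue 1"
      using residue_pow[OF assms, of "q - 1"] R.order_mult_of[OF finite_residue]
      by (simp add: Multiplicative_Group.nat_pow_mult_of Coset.order_def residue_card_def residue_one)
    then have "absv (x ^ (q - 1) - 1) < 1"
      by (rule residue_eqD) (use assms in \<open>auto simp: absv_power power_le_one\<close>)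
    moreover have "x ^ q - x = x * (x ^ (q - 1) - 1)"
      using q_ge_2 by (cases q) (auto simp: algebra_simps)
    ultimately show ?thesis using assms False by (simp add: absv_mult)
  qed
  then show ?thesis using assms by (intro absv_less_1_imp_le) auto
qed

lemma absv_of_nat_eq_1: "\<not> p dvd n \<Longrightarrow> absv (of_nat n :: 'a) = 1"
proof -
  assume n: "\<not> p dvd n"
  then have "int n \<noteq> 0" "\<not> int p dvd int n" by (auto intro: Nat.gr0I)
  then show ?thesis
    using absv_padic[of "int n"] not_dvd_imp_multiplicity_0[of "int p" "int n"] by simp
qed

text \<open>If a prime l different from p divided q, a Sylow l-subgroup of the additive group of the
  residue field would contain a nonzero element killed by a power of l. But l has absolute value 1,
  so multiplication by it is injective there.\<close>

lemma q_prime_power: "\<exists>m. q = p ^ m"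
proof -
  have "l = p" if l: "prime l" "l dvd q" for l
  proof (rule ccontr)
    assume "l \<noteq> p"
    interpret R: field residue_ring by (rule residue_field)
    define a where "a = multiplicity l q"
    have a: "a > 0" using l q_ge_2 by (simp add: a_def prime_multiplicity_gt_zero_iff)
    have "l ^ a dvd q" by (simp add: a_def multiplicity_dvd)
    then obtain m where m: "q = l ^ a * m" by auto
    have "\<exists>H. subgroup H (add_monoid residue_ring) \<and> card H = l ^ a"
      using m finite_residue by (intro sylow_thm[OF l(1) R.a_group, where m = m])
        (auto simp: Coset.order_def residue_card_def)
    then obtain H where H: "subgroup H (add_monoid residue_ring)" "card H = l ^ a" by blast
    have "1 < card H" using H(2) one_less_power[of l a] a prime_gt_1_nat[OF l(1)] by simp
    then have "\<not> H \<subseteq> {\<zero>\<^bsub>residue_ring\<^esub>}" using card_mono[of "{\<zero>\<^bsub>residue_ring\<^esub>}" H] by auto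
    then obtain h where h: "h \<in> H" "h \<noteq> \<zero>\<^bsub>residue_ring\<^esub>" by blast
    then have "h \<in> carrier residue_ring" using subgroup.subset[OF H(1)] by auto
    then obtain x where x: "h = residue x" "x \<in> K" "absv x \<le> 1" by (auto simp: residue_carrier)
    interpret G: group "add_monoid residue_ring\<lparr>carrier := H\<rparr>"
      using R.add.subgroup_imp_group[OF H(1)] .
    have "h [^]\<^bsub>add_monoid residue_ring\<lparr>carrier := H\<rparr>\<^esub> (l ^ a) = \<zero>\<^bsub>residue_ring\<^esub>"
      using G.pow_order_eq_1[of h] h H(2) by (simp add: Coset.order_def)
    then have "residue (of_nat (l ^ a) * x) = \<zero>\<^bsub>residue_ring\<^esub>"
      using residue_add_pow[OF x(2,3), of "l ^ a"] x(1) by (simp add: nat_pow_def)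
    then have "absv (of_nat (l ^ a) * x) < 1"
      using residue_eq_zero_iff[of "of_nat (l ^ a) * x"] x absv_of_nat_le[of "l ^ a", where 'a = 'a]
        cfield_intros[OF cfield_K] by (simp only: absv_mult mult_le_one absv_nonneg) 
    moreover have "absv (of_nat (l ^ a) :: 'a) = 1"
      using l(1) prime_p \<open>l \<noteq> p\<close>
      by (intro absv_of_nat_eq_1) (metis prime_dvd_power primes_dvd_imp_eq)
    ultimately have "absv x < 1" by (simp add: absv_mult del: of_nat_power)
    then show False using h(2) x residue_eq_zero_iff[of x] by simp
  qed
  then have *: "prime_factors q \<subseteq> {p}" by (auto simp: prime_factors_dvd)
  have "q = (\<Prod>l\<in>prime_factors q. l ^ multiplicity l q)"
    using q_ge_2 by (intro prime_factorization_nat) auto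
  also have "\<dots> = p ^ multiplicity p q"
    using * by (cases "prime_factors q = {}") (auto simp: subset_singleton_iff prime_factorization_empty_iff)
  finally have "q = p ^ multiplicity p q" .
  then show ?thesis by blast
qed

lemma p_dvd_absv: "absv (of_nat p :: 'a) \<le> absv \<pi>"
proof -
  have "absv (of_nat p :: 'a) = 1 / p"
    using absv_padic[of "int p"] prime_p by (simp add: prime_gt_0_nat)
  also have "\<dots> < 1" using prime_gt_1_nat[OF prime_p] by simp
  finally show ?thesis using cfield_intros(11)[OF cfield_K] by (intro absv_less_1_imp_le)
qed

end

section \<open>The formal logarithm\<close>

text \<open>Obtained by comparing coefficients of X^n in \<lambda>(e(X)) = c \<lambda>(X) for a
  series e = cX + ...: the term k = n contributes \<lambda>_n c^n, which accounts for the
  denominator.\<close>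

fun lt_log_coeff :: "'a::field \<Rightarrow> 'a fps \<Rightarrow> nat \<Rightarrow> 'a" where
  "lt_log_coeff c e n = (if n = 0 then 0 else if n = 1 then 1
     else (\<Sum>k<n. lt_log_coeff c e k * (e ^ k) $ n) / (c - c ^ n))"

declare lt_log_coeff.simps [simp del]

text \<open>In a product of \<open>k\<close> series without constant term, each of the other k - 1
  factors uses up at least one degree, so a factor contributes only coefficients of index at most m
  - (k - 1) < n.\<close>

lemma fps_power_nth_cong:
  assumes "c $ 0 = (0::'a::comm_ring_1)" "d $ 0 = 0" "\<And>m. m < n \<Longrightarrow> c $ m = d $ m" "1 \<le> k"
    and "m < n + (k - 1)"
  shows "(c ^ k) $ m = (d ^ k) $ m"
  using assms(4,5)
proof (induction k arbitrary: m rule: nat_induct_at_least)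
  case base
  then show ?case using assms(3) by simp
next
  case (Suc k)
  have "c $ i * (c ^ k) $ (m - i) = d $ i * (d ^ k) $ (m - i)" if "i \<le> m" for i
  proof (cases "i = 0")
    case True
    then show ?thesis using assms by simp
  next
    case i0: False
    have IH: "(c ^ k) $ (m - i) = (d ^ k) $ (m - i)"
      by (rule Suc.IH) (use Suc.prems Suc.hyps i0 that in linarith)
    show ?thesis
    proof (cases "i < n")
      case True
      then show ?thesis using assms(3) IH by simp
    next
      case False
      then have "m - i < k" using Suc.prems Suc.hyps that by linarith
      then show ?thesis using fps_power_nth_0[OF assms(1)] fps_power_nth_0[OF assms(2)] by simp
    qed
  qed
  then show ?case by (simp add: fps_mult_nth)
qed

definition fps_truncate :: "nat \<Rightarrow> 'a::zero fps \<Rightarrow> 'a fps" where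
  "fps_truncate n f = Abs_fps (\<lambda>m. if m < n then f $ m else 0)"

lemma fps_truncate_power_nth:
  assumes "f $ 0 = (0::'a::comm_ring_1)" "2 \<le> k"
  shows "(fps_truncate n f ^ k) $ n = (f ^ k) $ n"
  by (rule fps_power_nth_cong[where n = n]) (use assms in \<open>auto simp: fps_truncate_def\<close>)

text \<open>In h(c(X)) = X the coefficient c_n occurs once, linearly with factor
  \<open>h $ 1 = 1\<close>. The powers c^k with k \<ge> 2 only see the truncation of c below n, to
  which the induction hypothesis applies.\<close>

lemma fps_inv_tame_over:
  assumes C: "cfield C" and s: "0 < s" and h: "h \<in> fps_over C" "tame s h" "h $ 1 = 1"
  shows "tame s (fps_inv h)" "fps_inv h \<in> fps_over C"
proof -
  let ?c = "fps_inv h"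
  have h0: "h $ 0 = 0" using h(2) by (simp add: tame_def)
  have c0: "?c $ 0 = 0" by (simp add: fps_inv_def)
  have comp: "h oo ?c = fps_X" using fps_inv_right[of h] h0 h(3) by simp
  have "?c $ n \<in> C \<and> absv (?c $ n) * s ^ n \<le> s" for n
  proof (induction n rule: less_induct)
    case (less n)
    let ?d = "fps_truncate n ?c"
    consider "n = 0" | "n = 1" | "2 \<le> n" by linarith
    then show ?case
    proof cases
      case 1
      then show ?thesis using c0 s cfield_intros[OF C] by simp
    next
      case 2
      have "(\<Sum>i=0..1. h $ i * (?c ^ i) $ 1) = 1"
        using arg_cong[OF comp, of "\<lambda>f. f $ 1"] by (simp add: fps_compose_nth)
      then have "?c $ 1 = 1" using h0 h(3) by simp
      then show ?thesis using 2 s cfield_intros[OF C] by simp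
    next
      case 3
      have d: "?d \<in> fps_over C" "gauss_le s s ?d"
        using less.IH s cfield_intros(1)[OF C]
        by (auto simp: fps_truncate_def fps_over_def gauss_le_def)
      have "0 = (\<Sum>k=0..n. h $ k * (?c ^ k) $ n)"
        using arg_cong[OF comp, of "\<lambda>f. f $ n"] 3 by (simp add: fps_compose_nth fps_X_def)
      also have "{0..n} = insert 0 (insert 1 {2..n})" using 3 by auto
      also have "(\<Sum>k\<in>\<dots>. h $ k * (?c ^ k) $ n) = ?c $ n + (\<Sum>k=2..n. h $ k * (?c ^ k) $ n)"
        using h0 h(3) by simp
      also have "(\<Sum>k=2..n. h $ k * (?c ^ k) $ n) = (\<Sum>k=2..n. h $ k * (?d ^ k) $ n)"
        using fps_truncate_power_nth[OF c0] by (intro sum.cong) auto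
      finally have eq: "?c $ n = - (\<Sum>k=2..n. h $ k * (?d ^ k) $ n)"
        by (metis add.commute add_eq_0_iff minus_minus)
      have "?c $ n \<in> C"
        unfolding eq using h(1) fps_over_intros(9)[OF C d(1)]
        by (auto intro!: cfield_intros[OF C] fps_overD)
      moreover have "absv (\<Sum>k=2..n. h $ k * (?d ^ k) $ n) * s ^ n \<le> s"
      proof (rule absv_sum_mult_le)
        fix k
        have "absv ((?d ^ k) $ n) * s ^ n \<le> s ^ k"
          using s d by (intro gauss_leD[OF gauss_le_power]) auto
        then have "absv (h $ k) * (absv ((?d ^ k) $ n) * s ^ n) \<le> absv (h $ k) * s ^ k"
          by (intro mult_left_mono) auto
        also have "\<dots> \<le> s" using h(2) by (auto simp: tame_def gauss_le_def)
        finally show "absv (h $ k * (?d ^ k) $ n) * s ^ n \<le> s" by (simp add: absv_mult mult.assoc)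
      qed (use s in auto)
      ultimately show ?thesis by (simp add: eq)
    qed
  qed
  then show "tame s ?c" "?c \<in> fps_over C"
    using c0 by (auto simp: tame_def gauss_le_def fps_over_def)
qed

text \<open>Setting Y = 0 turns F into X and F^n into X^n.\<close>

lemma fps2_power_nth_row0:
  fixes F :: "'a::comm_ring_1 fps fps"
  assumes "\<And>i. F $ i $ 0 = (if i = 1 then 1 else 0)"
  shows "(F ^ n) $ m $ 0 = (if m = n then 1 else 0)"
proof (induction n arbitrary: m)
  case (Suc n)
  have "(F ^ Suc n) $ m $ 0 = (\<Sum>i=0..m. (if i = 1 then (F ^ n) $ (m - i) $ 0 else 0))"
    by (simp add: fps_mult_nth fps_sum_nth assms if_distrib[of "\<lambda>x. x * _"] cong: if_cong)
  also have "\<dots> = (if 1 \<le> m then (F ^ n) $ (m - 1) $ 0 else 0)" by (simp add: sum.delta)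
  also have "\<dots> = (if m = Suc n then 1 else 0)" using Suc by auto
  finally show ?case .
qed auto

text \<open>Modulo Y^2, F is X + Y G(X) with G(0) = 1, so the part of F^(n+1) linear in Y is (n + 1)
  X^n G(X).\<close>

lemma fps2_power_nth_row1:
  fixes F :: "'a::comm_ring_1 fps fps"
  assumes "\<And>i. F $ i $ 0 = (if i = 1 then 1 else 0)" "\<And>j. F $ 0 $ j = (if j = 1 then 1 else 0)"
  shows "(F ^ Suc n) $ n $ 1 = of_nat (Suc n)"
proof (induction n)
  case 0
  show ?case by (simp add: assms)
next
  case (Suc n)
  have "(F ^ Suc (Suc n)) $ Suc n $ 1
      = (\<Sum>i=0..Suc n. F $ i $ 0 * (F ^ Suc n) $ (Suc n - i) $ 1 + F $ i $ 1 * (F ^ Suc n) $ (Suc n - i) $ 0)"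
    by (subst power_Suc) (simp add: fps_mult_nth fps_sum_nth del: power_Suc)
  also have "\<dots> = (\<Sum>i=0..Suc n. (if i = 1 then (F ^ Suc n) $ (Suc n - i) $ 1 else 0)
      + (if i = 0 then F $ i $ 1 else 0))"
    by (intro sum.cong refl) (auto simp: assms(1) fps2_power_nth_row0[OF assms(1)] simp del: power_Suc)
  also have "\<dots> = of_nat (Suc n) + 1"
    using Suc by (simp add: sum.distrib sum.delta assms del: power_Suc)
  finally show ?case by simp
qed

text \<open>The coefficient of X^(n-1) Y is compared. On the left h_n enters with the factor n,
  which is nonzero in characteristic 0; everything else involves only lower coefficients of
  h.\<close>

lemma fgl_hom_unique:
  fixes F :: "'a::nonarch_field fps fps"
  assumes F: "\<And>i. F $ i $ 0 = (if i = 1 then 1 else 0)" "\<And>j. F $ 0 $ j = (if j = 1 then 1 else 0)"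
    and h: "fgl_hom F G h" "fgl_hom F G h'" "h $ 1 = h' $ 1"
  shows "h = h'"
proof (rule fps_ext)
  fix n
  have h0: "h $ 0 = 0" "h' $ 0 = 0" using h by (auto simp: fgl_hom_def)
  show "h $ n = h' $ n"
  proof (induction n rule: less_induct)
    case (less n)
    consider "n = 0" | "n = 1" | m where "n = Suc m" "1 \<le> m" by (cases n) force+
    then show ?case
    proof cases
      case 3
      have agree: "(h ^ i) $ k = (h' ^ i) $ k" if "k < n" for i k
      proof (cases "i = 0")
        case False
        show ?thesis
          by (rule fps_power_nth_cong[where n = n]) (use h0 less that False in auto)
      qed auto
      let ?S = "\<lambda>h. (\<Sum>k<n. h $ k * (F ^ k) $ m $ 1)"
      have eq: "?S h + h $ n * of_nat n = (\<Sum>i\<le>m. \<Sum>j\<le>1. G $ i $ j * (h ^ i) $ m * (h ^ j) $ 1)"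
        if "fgl_hom F G h" for h
      proof -
        have "(\<Sum>k\<le>m + 1. h $ k * (F ^ k) $ m $ 1) = (\<Sum>i\<le>m. \<Sum>j\<le>1. G $ i $ j * (h ^ i) $ m * (h ^ j) $ 1)"
          using that unfolding fgl_hom_def by blast
        moreover have set: "{..m + 1} = insert n {..<n}" using 3 by auto
        moreover have Fn: "(F ^ n) $ m $ 1 = of_nat n" using fps2_power_nth_row1[OF F, of m] 3 by simp
        have "(\<Sum>k\<le>m + 1. h $ k * (F ^ k) $ m $ 1) = ?S h + h $ n * of_nat n"
          unfolding set by (subst sum.insert) (use Fn in auto)
        ultimately show ?thesis by (metis)
      qed
      have S: "?S h = ?S h'" using less by (intro sum.cong) auto
      have "?S h + h $ n * of_nat n = (\<Sum>i\<le>m. \<Sum>j\<le>1. G $ i $ j * (h ^ i) $ m * (h ^ j) $ 1)"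
        by (rule eq[OF h(1)])
      also have "\<dots> = (\<Sum>i\<le>m. \<Sum>j\<le>1. G $ i $ j * (h' ^ i) $ m * (h' ^ j) $ 1)"
        using 3 by (intro sum.cong refl) (simp add: agree)
      also have "\<dots> = ?S h' + h' $ n * of_nat n"
        by (rule eq[OF h(2), symmetric])
      finally have "h $ n * of_nat n = h' $ n * of_nat n"
        unfolding S by (rule add_left_imp_eq)
      moreover have "n \<noteq> 0" using 3 by simp
      ultimately show ?thesis by simp
    qed (use h0 h(3) in auto)
  qed
qed

lemma gauss2_le_outer:
  assumes "0 \<le> s" "gauss_le s B h" "gauss2_le s s F"
  shows "gauss2_le s B (fps2_outer h F)"
  unfolding gauss2_le_def fps2_outer_def fps_nth_Abs_fps
proof (intro allI absv_sum_mult_le)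
  fix a b k
  have "absv ((F ^ k) $ a $ b) * s ^ (a + b) \<le> s ^ k"
    using assms by (intro gauss2_leD[OF gauss2_le_power]) auto
  then have "absv (h $ k) * (absv ((F ^ k) $ a $ b) * s ^ (a + b)) \<le> absv (h $ k) * s ^ k"
    by (intro mult_left_mono) auto
  also have "\<dots> \<le> B" using assms by (auto simp: gauss_le_def)
  finally show "absv (h $ k * (F ^ k) $ a $ b) * s ^ (a + b) \<le> B" by (simp add: absv_mult mult.assoc)
qed (use assms gauss_le_nonneg in auto)

lemma gauss2_le_inner:
  assumes "0 \<le> s" "gauss_le s s h" "gauss2_le s B G"
  shows "gauss2_le s B (fps2_inner G h)"
  unfolding gauss2_le_def fps2_inner_def fps_nth_Abs_fps
proof (intro allI absv_sum_mult_le)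
  fix a b i j
  have "(absv ((h ^ i) $ a) * s ^ a) * (absv ((h ^ j) $ b) * s ^ b) \<le> s ^ i * s ^ j"
    using assms by (intro mult_mono gauss_leD[OF gauss_le_power]) auto
  then have "absv (G $ i $ j) * ((absv ((h ^ i) $ a) * s ^ a) * (absv ((h ^ j) $ b) * s ^ b))
      \<le> absv (G $ i $ j) * (s ^ i * s ^ j)"
    by (intro mult_left_mono) auto
  also have "\<dots> \<le> B" using assms(3) by (auto simp: gauss2_le_def power_add)
  finally show "absv (G $ i $ j * (h ^ i) $ a * (h ^ j) $ b) * s ^ (a + b) \<le> B"
    by (simp add: absv_mult power_add mult_ac)
qed (use assms gauss2_le_nonneg in auto)

lemma has_sum_setsum:
  fixes f :: "'i \<Rightarrow> 'j \<Rightarrow> 'b::topological_comm_monoid_add"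
  assumes "\<And>i. i \<in> A \<Longrightarrow> (f i has_sum t i) B"
  shows "((\<lambda>j. \<Sum>i\<in>A. f i j) has_sum (\<Sum>i\<in>A. t i)) B"
  using assms by (induction A rule: infinite_finite_induct) (auto intro: has_sum_add)

lemma fps_eval2_additive: "fps_eval2 additive_fgl x y = x + y"
proof (rule fps_eval2_eqI)
  let ?f = "\<lambda>(i, j). additive_fgl $ i $ j * (x ^ i * y ^ j)"
  have "(?f has_sum (\<Sum>p\<in>{(0, 1), (1, 0)}. ?f p)) UNIV"
    by (rule has_sum_finite_support)
       (auto simp: additive_fgl_def fps_X_def numeral_eq_Suc split: if_splits)
  then show "(?f has_sum (x + y)) (UNIV \<times> UNIV)"
    by (simp add: additive_fgl_def fps_X_def add.commute)
qed

lemma additive_fgl_over: "cfield C \<Longrightarrow> additive_fgl \<in> fps2_over C"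
  by (auto simp: fps2_over_def additive_fgl_def fps_X_def intro: cfield_intros)

lemma additive_fgl_gauss: "gauss2_le 1 1 additive_fgl"
  by (auto simp: gauss2_le_def additive_fgl_def fps_X_def)

context lubin_tate_tower
begin

section \<open>The radius r and the group of points of F\<close>

definition r :: real where "r = root (q - 1) (absv \<pi>)"

lemma r_pos: "0 < r" and r_less_1: "r < 1" and r_power: "r ^ (q - 1) = absv \<pi>"
  using q_ge_2 \<pi>_pos \<pi>_less_1 by (auto simp: r_def)

lemma absv_\<pi>_less_r: "3 \<le> q \<Longrightarrow> absv \<pi> < r"
proof -
  assume "3 \<le> q"
  then have "r ^ (q - 1) < r ^ 1" using r_pos r_less_1 by (intro power_strict_decreasing) auto
  then show ?thesis using r_power by simp
qed

lemma F_over: "F \<in> fps2_over K" and F_gauss: "gauss2_le 1 1 F"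
  and F_unit1: "\<And>i. F $ i $ 0 = (if i = 1 then 1 else 0)"
  and F_unit2: "\<And>j. F $ 0 $ j = (if j = 1 then 1 else 0)"
  and F_comm: "\<And>i j. F $ i $ j = F $ j $ i"
  and F_assoc: "\<And>a b c. (\<Sum>i\<le>a + b. F $ i $ c * (F ^ i) $ a $ b) =
              (\<Sum>j\<le>b + c. F $ a $ j * (F ^ j) $ b $ c)"
  using lubin_tate
  by (auto simp: lubin_tate_fgl_def formal_group_law_def fps2_over_def gauss2_le_1 val_ring_def)

lemma F_0: "F $ 0 $ 0 = 0"
  by (simp add: F_unit1)

lemma F_overC: "K \<subseteq> C \<Longrightarrow> F \<in> fps2_over C"
  using F_over by (auto simp: fps2_over_def)

lemma F_gauss_small: "0 \<le> s \<Longrightarrow> s \<le> 1 \<Longrightarrow> gauss2_le s s F"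
  using gauss2_le_small[OF F_gauss F_0] .

abbreviation fadd (infixl "\<oplus>\<^sub>F" 66) where "fadd \<equiv> fps_eval2 F"

lemma fadd_in:
  assumes "cfield C" "K \<subseteq> C" "x \<in> C" "y \<in> C" "absv x < 1" "absv y < 1"
  shows "x \<oplus>\<^sub>F y \<in> C"
  using fps_eval2_has_sum(2)[OF assms(1) F_overC[OF assms(2)] assms(3,4) F_gauss assms(5,6)] .

lemma fadd_le:
  assumes "absv x \<le> B" "absv y \<le> B" "B < 1"
  shows "absv (x \<oplus>\<^sub>F y) \<le> B"
proof (rule ccontr)
  assume "\<not> ?thesis"
  then obtain t where t: "B < t" "t < absv (x \<oplus>\<^sub>F y)" "t < 1"
    using dense[of B "min 1 (absv (x \<oplus>\<^sub>F y))"] assms(3) by auto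
  obtain C where C: "cfield C" "K \<subseteq> C" "{x, y} \<subseteq> C" using cfield_containing[of "{x, y}"] by auto
  have "0 \<le> t" using t assms(1) absv_nonneg[of x] by linarith
  then have "absv (x \<oplus>\<^sub>F y) \<le> t"
    using fps_eval2_has_sum(3)[OF C(1) F_overC[OF C(2)] _ _ F_gauss_small, of x y t] t C(3) assms
    by auto
  with t show False by simp
qed

lemma fadd_less: "absv x < 1 \<Longrightarrow> absv y < 1 \<Longrightarrow> absv (x \<oplus>\<^sub>F y) < 1"
  using fadd_le[of x "max (absv x) (absv y)" y] by auto

lemma fadd_0_right: "x \<oplus>\<^sub>F 0 = x"
proof (rule fps_eval2_eqI)
  let ?f = "\<lambda>(i, j). F $ i $ j * (x ^ i * 0 ^ j)"
  have "(?f has_sum (\<Sum>p\<in>{(1, 0)}. ?f p)) UNIV"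
    by (rule has_sum_finite_support) (auto simp: F_unit1 power_0_left split: if_splits)
  then show "(?f has_sum x) (UNIV \<times> UNIV)" by (simp add: F_unit1)
qed

lemma fadd_commute:
  assumes "absv x < 1" "absv y < 1"
  shows "x \<oplus>\<^sub>F y = y \<oplus>\<^sub>F x"
proof (rule fps_eval2_eqI)
  obtain C where C: "cfield C" "K \<subseteq> C" "{x, y} \<subseteq> C" using cfield_containing[of "{x, y}"] by auto
  have "((\<lambda>(i, j). F $ i $ j * (y ^ i * x ^ j)) has_sum (y \<oplus>\<^sub>F x)) (UNIV \<times> UNIV)"
    using fps_eval2_has_sum(1)[OF C(1) F_overC[OF C(2)] _ _ F_gauss] C(3) assms by auto
  then show "((\<lambda>(i, j). F $ i $ j * (x ^ i * y ^ j)) has_sum (y \<oplus>\<^sub>F x)) (UNIV \<times> UNIV)"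
    by (subst has_sum_reindex_bij_witness[where j = prod.swap and i = prod.swap and T = "UNIV \<times> UNIV"
          and h = "\<lambda>(i, j). F $ i $ j * (y ^ i * x ^ j)" and s' = "y \<oplus>\<^sub>F x"])
       (auto simp: F_comm mult.commute)
qed

lemma F_power_comm: "(F ^ k) $ a $ b = (F ^ k) $ b $ a"
proof (induction k arbitrary: a b)
  case (Suc k)
  have "(F ^ Suc k) $ a $ b = (\<Sum>i=0..a. \<Sum>j=0..b. F $ i $ j * (F ^ k) $ (a - i) $ (b - j))"
    by (simp add: fps_mult_nth fps_sum_nth)
  also have "\<dots> = (\<Sum>j=0..b. \<Sum>i=0..a. F $ j $ i * (F ^ k) $ (b - j) $ (a - i))"
    by (subst sum.swap) (simp add: Suc[of "a - _"] F_comm)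
  also have "\<dots> = (F ^ Suc k) $ b $ a"
    by (simp add: fps_mult_nth fps_sum_nth)
  finally show ?case .
qed (simp add: fps_one_nth)

text \<open>The coefficient of X^a Y^b Z^c in F(F(X,Y),Z).\<close>

definition assoc_coeff :: "nat \<Rightarrow> nat \<Rightarrow> nat \<Rightarrow> 'a" where
  "assoc_coeff a b c = (\<Sum>i\<le>a + b. F $ i $ c * (F ^ i) $ a $ b)"

text \<open>Associativity leads to F(X,F(Y,Z)), which by commutativity of F can be read as
  F(F(Z,Y),X).\<close>

lemma assoc_coeff_sym: "assoc_coeff a b c = assoc_coeff c b a"
proof -
  have "assoc_coeff a b c = (\<Sum>j\<le>b + c. F $ a $ j * (F ^ j) $ b $ c)"
    by (simp add: assoc_coeff_def F_assoc)
  also have "\<dots> = assoc_coeff c b a"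
    unfolding assoc_coeff_def by (rule sum.cong) (simp_all add: add.commute F_power_comm[of _ b c] F_comm[of a])
  finally show ?thesis .
qed

text \<open>With a single triple sum for the value, a symmetry of the coefficients becomes a
  symmetry in the arguments.\<close>

lemma fadd_fadd_has_sum:
  assumes "absv x < 1" "absv y < 1" "absv z < 1"
  shows "((\<lambda>((a, b), c). assoc_coeff a b c * (x ^ a * y ^ b * z ^ c)) has_sum ((x \<oplus>\<^sub>F y) \<oplus>\<^sub>F z))
    ((UNIV \<times> UNIV) \<times> UNIV)"
proof -
  obtain C where C: "cfield C" "K \<subseteq> C" "{x, y, z} \<subseteq> C"
    using cfield_containing[of "{x, y, z}"] by auto
  note FC = F_overC[OF C(2)]
  have xyz: "x \<in> C" "y \<in> C" "z \<in> C" using C by auto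
  \<comment> \<open>The midpoint between the larger argument and 1: a radius that admits both
    arguments and is still below 1, as the outer substitution requires.\<close>
  define s where "s = (1 + max (absv x) (absv y)) / 2"
  have s: "absv x < s" "absv y < s" "s < 1" using assms by (auto simp: s_def)
  have s0: "0 < s" using s(1) absv_nonneg[of x] by linarith
  note row = fps2_row[OF C(1) FC xyz(3) F_gauss assms(3)]
  let ?R = "fps2_outer (fps2_row F z) F"
  have R: "?R \<in> fps2_over C" by (rule fps2_outer_over[OF C(1) row(1) FC])
  have gR: "gauss2_le s 1 ?R"
    by (rule gauss2_le_outer) (use s s0 F_gauss_small gauss_le_radius[OF row(2)] in auto)
  have T1: "absv (assoc_coeff a b c) \<le> 1" for a b c
    unfolding assoc_coeff_def
  proof (rule absv_sum_le)
    fix i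
    have "absv ((F ^ i) $ a $ b) \<le> 1 ^ i"
      using gauss2_leD[OF gauss2_le_power[OF _ F_gauss], of i a b] by simp
    moreover have "absv (F $ i $ c) \<le> 1" using F_gauss by (simp add: gauss2_le_1)
    ultimately show "absv (F $ i $ c * (F ^ i) $ a $ b) \<le> 1" by (simp add: absv_mult mult_le_one)
  qed auto
  have TC: "assoc_coeff a b c \<in> C" for a b c
    unfolding assoc_coeff_def using FC fps2_over_power[OF C(1) FC]
    by (auto simp: fps2_over_def intro!: cfield_intros[OF C(1)])
  let ?f = "\<lambda>(a, b) c. assoc_coeff a b c * (x ^ a * y ^ b * z ^ c)"
  let ?t = "max (absv x) (max (absv y) (absv z))"
  have "((\<lambda>(p, c). ?f p c) has_sum ((x \<oplus>\<^sub>F y) \<oplus>\<^sub>F z)) ((UNIV \<times> UNIV) \<times> UNIV)"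
  proof (rule has_sum_fubini(1)[OF C(1)])
    show "?f p c \<in> C" for p c
      using TC xyz by (cases p) (auto intro!: cfield_intros[OF C(1)])
    show "null_family (\<lambda>(p, c). ?f p c) ((UNIV \<times> UNIV) \<times> UNIV)"
    proof (rule null_family_weight[where w = "\<lambda>((a, b), c). a + b + c" and t = ?t and B = 1])
      fix p :: "(nat \<times> nat) \<times> nat"
      obtain a b c where p: "p = ((a, b), c)" by (cases p) auto
      have "absv (assoc_coeff a b c) * (absv x ^ a * absv y ^ b * absv z ^ c)
          \<le> 1 * (absv x ^ a * absv y ^ b * absv z ^ c)"
        by (intro mult_right_mono T1) auto
      also have "\<dots> \<le> 1 * ?t ^ (a + b + c)"
        using max3_power_bound[of "absv x" "absv y" "absv z" 1 a b c] by simp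
      finally show "absv (case p of (p, c) \<Rightarrow> ?f p c) \<le> 1 * ?t ^ ((\<lambda>((a, b), c). a + b + c) p)"
        by (simp add: p absv_mult absv_power)
    next
      fix N :: nat
      show "finite {p \<in> (UNIV \<times> UNIV) \<times> UNIV. (case p of (p, c) \<Rightarrow> ?f p c) \<noteq> 0 \<and>
          (\<lambda>((a, b), c). a + b + c) p \<le> N}"
        by (rule finite_subset[of _ "({..N} \<times> {..N}) \<times> {..N}"]) auto
    qed (use assms in \<open>auto simp: le_max_iff_disj\<close>)
    show "(?f p has_sum (case p of (a, b) \<Rightarrow> ?R $ a $ b * (x ^ a * y ^ b))) UNIV" for p
    proof (cases p)
      case (Pair a b)
      have "((\<lambda>c. \<Sum>i\<le>a + b. (F $ i $ c * z ^ c) * (F ^ i) $ a $ b) has_sum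
          (\<Sum>i\<le>a + b. fps2_row F z $ i * (F ^ i) $ a $ b)) UNIV"
        by (intro has_sum_setsum has_sum_cmult_left row(3))
      from has_sum_cmult_left[OF this, of "x ^ a * y ^ b"] show ?thesis
        by (simp add: Pair fps2_outer_def assoc_coeff_def sum_distrib_left sum_distrib_right mult_ac)
    qed
    have "fps_eval2 ?R x y = fps_eval (fps2_row F z) (x \<oplus>\<^sub>F y)"
      by (rule fps_eval2_outer[OF C(1) row(1,2) FC F_gauss_small F_0]) (use xyz s s0 in auto)
    also have "\<dots> = (x \<oplus>\<^sub>F y) \<oplus>\<^sub>F z"
      using row(4) fadd_in[OF C(1,2) xyz(1,2)] assms fadd_less by auto
    finally show "((\<lambda>(a, b). ?R $ a $ b * (x ^ a * y ^ b)) has_sum ((x \<oplus>\<^sub>F y) \<oplus>\<^sub>F z)) (UNIV \<times> UNIV)"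
      using fps_eval2_has_sum(1)[OF C(1) R xyz(1,2) gR s(1,2)] by simp
  qed
  then show ?thesis by (simp add: case_prod_unfold)
qed

text \<open>Reversing the triple sum exchanges \<open>x\<close> and \<open>z\<close>; commutativity
  then turns the reversed expression into the right-hand side. So only one bracketing has to be
  expanded.\<close>

lemma fadd_assoc:
  assumes "absv x < 1" "absv y < 1" "absv z < 1"
  shows "(x \<oplus>\<^sub>F y) \<oplus>\<^sub>F z = x \<oplus>\<^sub>F (y \<oplus>\<^sub>F z)"
proof -
  have "((\<lambda>((a, b), c). assoc_coeff a b c * (x ^ a * y ^ b * z ^ c)) has_sum ((z \<oplus>\<^sub>F y) \<oplus>\<^sub>F x))
    ((UNIV \<times> UNIV) \<times> UNIV)"
    using fadd_fadd_has_sum[OF assms(3,2,1)]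
    by (subst has_sum_reindex_bij_witness[where j = "\<lambda>((a, b), c). ((c, b), a)"
          and i = "\<lambda>((a, b), c). ((c, b), a)" and T = "(UNIV \<times> UNIV) \<times> UNIV"
          and h = "\<lambda>((a, b), c). assoc_coeff a b c * (z ^ a * y ^ b * x ^ c)"
          and s' = "(z \<oplus>\<^sub>F y) \<oplus>\<^sub>F x"])
       (auto simp: assoc_coeff_sym mult_ac)
  then have "(x \<oplus>\<^sub>F y) \<oplus>\<^sub>F z = (z \<oplus>\<^sub>F y) \<oplus>\<^sub>F x"
    using fadd_fadd_has_sum[OF assms] has_sum_unique by blast
  then show ?thesis using assms by (simp add: fadd_commute fadd_less)
qed

text \<open>By the unit laws every monomial of F other than X and Y is divisible by XY.\<close>

lemma fadd_diff_le:
  assumes "absv x \<le> B" "absv y \<le> B" "B < 1"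
  shows "absv (x \<oplus>\<^sub>F y - (x + y)) \<le> B ^ 2"
proof -
  obtain C where C: "cfield C" "K \<subseteq> C" "{x, y} \<subseteq> C" using cfield_containing[of "{x, y}"] by auto
  have B0: "0 \<le> B" using assms(1) absv_nonneg[of x] by linarith
  let ?f = "\<lambda>(i, j). F $ i $ j * (x ^ i * y ^ j)"
  have "(?f has_sum (x \<oplus>\<^sub>F y)) (UNIV \<times> UNIV)"
    using fps_eval2_has_sum(1)[OF C(1) F_overC[OF C(2)] _ _ F_gauss] C(3) assms by auto
  moreover have "(?f has_sum (\<Sum>p\<in>{(0,1),(1,0)}. ?f p)) {(0,1),(1,0)}" by (rule has_sum_finite) auto
  ultimately have "(?f has_sum (x \<oplus>\<^sub>F y - (\<Sum>p\<in>{(0,1),(1,0)}. ?f p))) (UNIV \<times> UNIV - {(0,1),(1,0)})"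
    by (rule has_sum_Diff) auto
  then have "absv (x \<oplus>\<^sub>F y - (\<Sum>p\<in>{(0,1),(1,0)}. ?f p)) \<le> B ^ 2"
  proof (rule has_sum_absv_le)
    fix p :: "nat \<times> nat" assume p: "p \<in> UNIV \<times> UNIV - {(0,1),(1,0)}"
    obtain i j where ij: "p = (i, j)" by (cases p)
    show "absv (?f p) \<le> B ^ 2"
    proof (cases "i = 0 \<or> j = 0")
      case True
      then have "F $ i $ j = 0" using p ij by (auto simp: F_unit1 F_unit2)
      then show ?thesis by (simp add: ij)
    next
      case False
      have "absv x ^ i * absv y ^ j \<le> B ^ i * B ^ j"
        using assms B0 by (intro mult_mono power_mono) auto
      also have "\<dots> = B ^ (i + j)" by (simp add: power_add)
      also have "\<dots> \<le> B ^ 2" using False B0 assms by (intro power_decreasing) auto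
      finally have "absv (F $ i $ j) * (absv x ^ i * absv y ^ j) \<le> 1 * B ^ 2"
        using F_gauss B0 by (intro mult_mono) (auto simp: gauss2_le_1)
      then show ?thesis by (simp add: ij absv_mult absv_power)
    qed
  qed (use B0 in auto)
  then show ?thesis by (simp add: F_unit1 F_unit2 algebra_simps)
qed

lemma fps_eval_hom:
  assumes "fgl_hom F F h" "h \<in> fps_over K" "gauss_le 1 1 h" "absv x < 1" "absv y < 1"
  shows "fps_eval h (x \<oplus>\<^sub>F y) = fps_eval h x \<oplus>\<^sub>F fps_eval h y"
proof -
  obtain C where C: "cfield C" "K \<subseteq> C" "{x, y} \<subseteq> C" using cfield_containing[of "{x, y}"] by auto
  have hC: "h \<in> fps_over C" using assms(2) C(2) by (rule fps_over_mono)
  define s where "s = (1 + max (absv x) (absv y)) / 2"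
  have s: "absv x < s" "absv y < s" "s < 1" using assms by (auto simp: s_def)
  have s0: "0 < s" using s(1) absv_nonneg[of x] by linarith
  have h0: "h $ 0 = 0" using assms(1) by (simp add: fgl_hom_def)
  have "tame 1 h" using assms(3) h0 by (simp add: tame_def)
  then have hs: "gauss_le s s h" using tame_radius[of 1 h s] s s0 by (simp add: tame_def)
  have xy: "x \<in> C" "y \<in> C" using C by auto
  have "fps_eval h (x \<oplus>\<^sub>F y) = fps_eval2 (fps2_outer h F) x y"
    by (rule fps_eval2_outer[OF C(1) hC assms(3) F_overC[OF C(2)] F_gauss_small F_0, symmetric])
       (use s s0 xy in auto)
  also have "fps2_outer h F = fps2_inner F h" using assms(1) by (simp add: fgl_hom_iff)
  also have "fps_eval2 \<dots> x y = fps_eval h x \<oplus>\<^sub>F fps_eval h y"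
    by (rule fps_eval2_inner[OF C(1) hC hs h0 F_overC[OF C(2)] F_gauss]) (use s s0 xy in auto)
  finally show ?thesis .
qed

lemma frob_fadd:
  "absv x < 1 \<Longrightarrow> absv y < 1 \<Longrightarrow> fps_eval frob (x \<oplus>\<^sub>F y) = fps_eval frob x \<oplus>\<^sub>F fps_eval frob y"
  by (rule fps_eval_hom[OF frob_hom frob_over frob_gauss])

section \<open>Construction of the logarithm\<close>

definition lt_log :: "'a fps" where "lt_log = Abs_fps (lt_log_coeff \<pi> frob)"

lemma lt_log_0: "lt_log $ 0 = 0" and lt_log_1: "lt_log $ 1 = 1"
  by (simp_all add: lt_log_def lt_log_coeff.simps)

lemma lt_log_nth:
  "2 \<le> n \<Longrightarrow> lt_log $ n = (\<Sum>k<n. lt_log $ k * (frob ^ k) $ n) / (\<pi> - \<pi> ^ n)"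
  unfolding lt_log_def fps_nth_Abs_fps by (subst lt_log_coeff.simps) simp

lemma absv_\<pi>_power_less: "2 \<le> n \<Longrightarrow> absv (\<pi> ^ n) < absv \<pi>"
  using power_strict_decreasing[of 1 n "absv \<pi>"] \<pi>_pos \<pi>_less_1 by (simp add: absv_power)

lemma absv_\<pi>_diff: "2 \<le> n \<Longrightarrow> absv (\<pi> - \<pi> ^ n) = absv \<pi>"
  using absv_add_eq[of "- (\<pi> ^ n)" \<pi>] absv_\<pi>_power_less by simp

lemma \<pi>_diff_nz: "2 \<le> n \<Longrightarrow> \<pi> - \<pi> ^ n \<noteq> 0"
  using absv_\<pi>_diff[of n] \<pi>_pos by (metis absv_zero less_irrefl)

lemma lt_log_over: "lt_log \<in> fps_over K"
proof (rule fps_overI)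
  fix n
  show "lt_log $ n \<in> K"
  proof (induction n rule: less_induct)
    case (less n)
    consider "n = 0" | "n = 1" | "2 \<le> n" by linarith
    then show ?case
    proof cases
      case 3
      have "(\<Sum>k<n. lt_log $ k * (frob ^ k) $ n) \<in> K"
        using less fps_overD[OF fps_over_intros(9)[OF cfield_K frob_over]]
        by (auto intro!: cfield_intros[OF cfield_K])
      then show ?thesis
        unfolding lt_log_nth[OF 3] using \<pi>_K by (auto intro!: cfield_intros[OF cfield_K])
    qed (use lt_log_0 lt_log_1 cfield_intros[OF cfield_K] in auto)
  qed
qed

lemma frob_power_cong: "gauss_le 1 (absv \<pi>) (frob ^ k - fps_X ^ (q * k))"
proof (induction k)
  case 0
  then show ?case by (simp add: gauss_le_zero)
next
  case (Suc k)
  have eq: "frob ^ Suc k - fps_X ^ (q * Suc k)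
      = frob * (frob ^ k - fps_X ^ (q * k)) + (frob - fps_X ^ q) * fps_X ^ (q * k)"
    by (simp add: algebra_simps power_add)
  have "gauss_le 1 (1 * absv \<pi>) (frob * (frob ^ k - fps_X ^ (q * k)))"
    by (rule gauss_le_mult[OF _ frob_gauss Suc]) simp
  moreover have "gauss_le 1 (absv \<pi> * 1 ^ (q * k)) ((frob - fps_X ^ q) * fps_X ^ (q * k))"
    by (intro gauss_le_mult gauss_le_power gauss_le_X) (auto simp: gauss_le_1 frob_cong simp del: fps_sub_nth)
  ultimately show ?case unfolding eq by (intro gauss_le_add) auto
qed

lemma frob_power_nth_le: "n \<noteq> q * k \<Longrightarrow> absv ((frob ^ k) $ n) \<le> absv \<pi>"
  using frob_power_cong[of k] by (auto simp: gauss_le_1 fps_X_power_nth dest: spec[of _ n])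

lemma frob_power_nth_le_1: "absv ((frob ^ k) $ n) \<le> 1"
  by (rule gauss_le_1_power_nth[OF frob_gauss])

text \<open>The denominator in the recursion costs a factor |\<pi>|, which every numerator term
  regains: if n \<noteq> qk, the coefficient of X^n in \<open>frob ^ k\<close> is divisible by
  \<pi>; if n = qk, then r^n = r^k |\<pi>|^k with k > 0, by the choice of r.\<close>

lemma lt_log_tame: "tame r lt_log"
  unfolding tame_def gauss_le_def
proof (intro conjI allI lt_log_0)
  fix n
  show "absv (lt_log $ n) * r ^ n \<le> r"
  proof (induction n rule: less_induct)
    case (less n)
    consider "n = 0" | "n = 1" | "2 \<le> n" by linarith
    then show ?case
    proof cases
      case 3
      have "absv (\<Sum>k<n. lt_log $ k * (frob ^ k) $ n) * r ^ n \<le> r * absv \<pi>"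
      proof (rule absv_sum_mult_le)
        fix k assume k: "k \<in> {..<n}"
        have IH: "absv (lt_log $ k) * r ^ k \<le> r" using less k by auto
        show "absv (lt_log $ k * (frob ^ k) $ n) * r ^ n \<le> r * absv \<pi>"
        proof (cases "k = 0")
          case True
          then show ?thesis using lt_log_0 r_pos \<pi>_pos by simp
        next
          case k0: False
          have "absv ((frob ^ k) $ n) * r ^ n \<le> r ^ k * absv \<pi>"
          proof (cases "n = q * k")
            case True
            have "n = k + (q - 1) * k" using True q_ge_2 by (cases q) auto
            then have "r ^ n = r ^ k * absv \<pi> ^ k" by (simp only: power_add power_mult r_power)
            also have "absv \<pi> ^ k \<le> absv \<pi>" using k0 \<pi>_pos \<pi>_less_1 by (cases k) (auto simp: mult_left_le power_le_one)
            finally have "r ^ n \<le> r ^ k * absv \<pi>" using r_pos by (simp add: mult_left_mono)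
            moreover have "absv ((frob ^ k) $ n) * r ^ n \<le> 1 * r ^ n"
              using r_pos by (intro mult_right_mono frob_power_nth_le_1) auto
            ultimately show ?thesis by simp
          next
            case False
            have "absv ((frob ^ k) $ n) * r ^ n \<le> absv \<pi> * r ^ k"
              using False k r_pos r_less_1
              by (intro mult_mono frob_power_nth_le power_decreasing) auto
            then show ?thesis by (simp add: mult.commute)
          qed
          then have "absv (lt_log $ k) * (absv ((frob ^ k) $ n) * r ^ n) \<le> absv (lt_log $ k) * (r ^ k * absv \<pi>)"
            by (intro mult_left_mono) auto
          also have "\<dots> \<le> r * absv \<pi>" using mult_right_mono[OF IH, of "absv \<pi>"] by (simp add: mult.assoc)
          finally show ?thesis by (simp add: absv_mult mult.assoc)
        qed
      qed (use r_pos in auto)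
      then show ?thesis
        unfolding lt_log_nth[OF 3] absv_divide absv_\<pi>_diff[OF 3]
        using \<pi>_pos by (simp add: pos_divide_le_eq)
    qed (use lt_log_0 lt_log_1 r_pos in auto)
  qed
qed

lemma lt_log_frob: "lt_log oo frob = fps_const \<pi> * lt_log"
proof (rule fps_ext)
  fix n :: nat
  consider "n = 0" | "n = 1" | "2 \<le> n" by linarith
  then show "(lt_log oo frob) $ n = (fps_const \<pi> * lt_log) $ n"
  proof cases
    case 3
    have "{0..n} = insert n {..<n}" by auto
    then have "(lt_log oo frob) $ n = (\<Sum>k<n. lt_log $ k * (frob ^ k) $ n) + lt_log $ n * (frob ^ n) $ n"
      by (simp add: fps_compose_nth add.commute)
    also have "(frob ^ n) $ n = \<pi> ^ n" using startsby_zero_power_nth_same[OF frob_0] frob_1 by simp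
    also have "(\<Sum>k<n. lt_log $ k * (frob ^ k) $ n) = lt_log $ n * (\<pi> - \<pi> ^ n)"
      using lt_log_nth[OF 3] \<pi>_diff_nz[OF 3] by simp
    finally show ?thesis by (simp add: algebra_simps)
  qed (use lt_log_0 lt_log_1 frob_1 in \<open>auto simp: fps_compose_nth\<close>)
qed

definition lt_exp :: "'a fps" where "lt_exp = fps_inv lt_log"

lemma lt_exp_tame: "tame r lt_exp" and lt_exp_over: "lt_exp \<in> fps_over K"
  unfolding lt_exp_def
  by (rule fps_inv_tame_over[OF cfield_K r_pos lt_log_over lt_log_tame lt_log_1])+

lemma lt_exp_log: "lt_exp oo lt_log = fps_X" and lt_log_exp: "lt_log oo lt_exp = fps_X"
  unfolding lt_exp_def using fps_inv[of lt_log] fps_inv_right[of lt_log] lt_log_0 lt_log_1 by simp_all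

end

section \<open>Values of the logarithm and endomorphisms\<close>

lemma absv_le_0 [simp]: "absv (x::'a::nonarch_field) \<le> 0 \<longleftrightarrow> x = 0"
  using absv_pos[of x] by linarith

lemma tame_gauss: "tame s h \<Longrightarrow> gauss_le s s h"
  by (simp add: tame_def)

lemma (in lubin_tate_tower) fps_eval_tame_le:
  assumes "g \<in> fps_over K" "tame s g" "absv x < s"
  shows "absv (fps_eval g x) \<le> absv x"
proof -
  obtain C where C: "cfield C" "K \<subseteq> C" "{x} \<subseteq> C" using cfield_containing[of "{x}"] by auto
  show ?thesis
    using fps_eval_tame[OF C(1) fps_over_mono[OF assms(1) C(2)] _ assms(2,3)] C(3) by simp
qed

lemma (in lubin_tate_tower) fps_eval_compose_tame:
  assumes "h \<in> fps_over K" "g \<in> fps_over K" "gauss_le s B h" "tame s g" "absv x < s"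
  shows "fps_eval (h oo g) x = fps_eval h (fps_eval g x)"
proof -
  obtain C where C: "cfield C" "K \<subseteq> C" "{x} \<subseteq> C" using cfield_containing[of "{x}"] by auto
  show ?thesis
    using C(3) fps_over_mono[OF _ C(2)]
    by (intro fps_eval_compose[OF C(1) _ _ _ assms(3-5)] assms) (auto intro: assms)
qed

section \<open>The q-th power map modulo \<pi>\<close>

lemma gauss_le_freshman:
  fixes f g :: "'a::nonarch_field fps"
  assumes p: "prime p" and b: "absv (of_nat p :: 'a) \<le> b" and fg: "gauss_le 1 1 f" "gauss_le 1 1 g"
  shows "gauss_le 1 b ((f + g) ^ p - (f ^ p + g ^ p))"
proof -
  have p0: "0 < p" using p by (simp add: prime_gt_0_nat)
  have "(f + g) ^ p = (\<Sum>k\<le>p. of_nat (p choose k) * f ^ k * g ^ (p - k))"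
    by (rule binomial_ring)
  also have "{..p} = insert 0 (insert p {0<..<p})" using p0 by auto
  also have "(\<Sum>k\<in>\<dots>. of_nat (p choose k) * f ^ k * g ^ (p - k))
      = g ^ p + (f ^ p + (\<Sum>k\<in>{0<..<p}. of_nat (p choose k) * f ^ k * g ^ (p - k)))"
    using p0 by simp
  finally have eq: "(f + g) ^ p - (f ^ p + g ^ p)
      = (\<Sum>k\<in>{0<..<p}. of_nat (p choose k) * f ^ k * g ^ (p - k))" by simp
  have b0: "0 \<le> b" using b absv_nonneg[of "of_nat p :: 'a"] by linarith
  show ?thesis
    unfolding eq
  proof (rule gauss_le_sum)
    fix k assume k: "k \<in> {0<..<p}"
    then obtain c where "p choose k = p * c" using dvd_choose_prime[of k p] p by auto
    then have "absv (of_nat (p choose k) :: 'a) = absv (of_nat p :: 'a) * absv (of_nat c :: 'a)"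
      by (simp add: absv_mult)
    also have "\<dots> \<le> b * 1" using b b0 absv_of_nat_le by (intro mult_mono) auto
    finally have c: "gauss_le 1 b (fps_const (of_nat (p choose k) :: 'a))" using b0 by (intro gauss_le_const) auto
    have "gauss_le 1 (b * 1 ^ k * 1 ^ (p - k)) (fps_const (of_nat (p choose k)) * f ^ k * g ^ (p - k))"
      by (intro gauss_le_mult gauss_le_power c fg) auto
    then show "gauss_le 1 b (of_nat (p choose k) * f ^ k * g ^ (p - k))" by (simp add: fps_of_nat)
  qed (use b0 in auto)
qed

text \<open>The error \<open>W\<close> of the previous stage is treated as a further summand; its
  p-th power is no larger than \<open>W\<close> was because \<open>b \<le> 1\<close>.\<close>

lemma gauss_le_freshman_power:
  fixes f g :: "'a::nonarch_field fps"
  assumes p: "prime p" and b: "absv (of_nat p :: 'a) \<le> b" "b \<le> 1"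
    and fg: "gauss_le 1 1 f" "gauss_le 1 1 g"
  shows "gauss_le 1 b ((f + g) ^ (p ^ m) - (f ^ (p ^ m) + g ^ (p ^ m)))"
proof (induction m)
  have b0: "0 \<le> b" using b absv_nonneg[of "of_nat p :: 'a"] by linarith
  case 0
  show ?case using b0 by (simp add: gauss_le_zero)
next
  have b0: "0 \<le> b" using b absv_nonneg[of "of_nat p :: 'a"] by linarith
  case (Suc m)
  define A B where "A = f ^ (p ^ m)" and "B = g ^ (p ^ m)"
  define W where "W = (f + g) ^ (p ^ m) - (A + B)"
  have W: "gauss_le 1 b W" using Suc by (simp add: W_def A_def B_def)
  have AB: "gauss_le 1 1 A" "gauss_le 1 1 B" "gauss_le 1 1 (A + B)"
    using gauss_le_power[of 1 1 f] gauss_le_power[of 1 1 g] fg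
    by (auto simp: A_def B_def intro!: gauss_le_add)
  have W1: "gauss_le 1 1 W" using gauss_le_mono[OF W b(2)] .
  have "gauss_le 1 (b ^ p) (W ^ p)" by (rule gauss_le_power[OF _ W]) simp
  then have Wp: "gauss_le 1 b (W ^ p)"
  proof (rule gauss_le_mono)
    have "b ^ p \<le> b ^ 1" using b b0 prime_gt_0_nat[OF p] by (intro power_decreasing) auto
    then show "b ^ p \<le> b" by simp
  qed
  have "(f + g) ^ (p ^ Suc m) = ((A + B) + W) ^ p"
    by (simp add: W_def mult.commute flip: power_mult)
  moreover have "f ^ (p ^ Suc m) = A ^ p" "g ^ (p ^ Suc m) = B ^ p"
    by (simp_all add: A_def B_def mult.commute flip: power_mult)
  ultimately have "(f + g) ^ (p ^ Suc m) - (f ^ (p ^ Suc m) + g ^ (p ^ Suc m))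
      = (((A + B) + W) ^ p - ((A + B) ^ p + W ^ p)) + W ^ p + ((A + B) ^ p - (A ^ p + B ^ p))"
    by simp
  also have "gauss_le 1 b \<dots>"
    using gauss_le_freshman[OF p b(1) AB(3) W1] gauss_le_freshman[OF p b(1) AB(1,2)] Wp
    by (intro gauss_le_add) auto
  finally show ?case .
qed

context lubin_tate_tower
begin

lemma gauss_le_sum_power_q:
  fixes f :: "'i \<Rightarrow> 'a fps"
  assumes "finite A" "\<And>i. i \<in> A \<Longrightarrow> gauss_le 1 1 (f i)"
  shows "gauss_le 1 (absv \<pi>) ((\<Sum>i\<in>A. f i) ^ q - (\<Sum>i\<in>A. f i ^ q))"
  using assms
proof (induction A rule: finite_induct)
  case empty
  then show ?case using q_ge_2 by (simp add: gauss_le_zero zero_power)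
next
  case (insert i A)
  obtain m where m: "q = p ^ m" using q_prime_power by blast
  have "gauss_le 1 (absv \<pi>) ((f i + sum f A) ^ q - (f i ^ q + sum f A ^ q))"
    unfolding m using insert.prems \<pi>_less_1
    by (intro gauss_le_freshman_power prime_p p_dvd_absv gauss_le_sum) auto
  moreover have "gauss_le 1 (absv \<pi>) (sum f A ^ q - (\<Sum>i\<in>A. f i ^ q))"
    using insert by auto
  ultimately have "gauss_le 1 (absv \<pi>) (((f i + sum f A) ^ q - (f i ^ q + sum f A ^ q))
      + (sum f A ^ q - (\<Sum>i\<in>A. f i ^ q)))"
    by (intro gauss_le_add) auto
  then show ?case using insert(1,2) by (simp add: algebra_simps)
qed

text \<open>Modulo \<pi>, the q-th power map is additive and fixes the residue classes of K, so it
  sends a polynomial f(X) over the integers of K to f(X^q).\<close>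

lemma truncate_power_q_cong:
  assumes "\<And>k. k < n \<Longrightarrow> f $ k \<in> K \<and> absv (f $ k) \<le> 1"
  shows "absv ((fps_truncate n f ^ q) $ m - (\<Sum>k<n. if m = q * k then f $ k else 0)) \<le> absv \<pi>"
proof -
  let ?t = "\<lambda>k. fps_const (f $ k) * fps_X ^ k"
  have trunc: "fps_truncate n f = (\<Sum>k<n. ?t k)"
    by (rule fps_ext) (simp add: fps_truncate_def fps_sum_nth fps_X_power_nth if_distrib sum.delta cong: if_cong)
  have t: "gauss_le 1 1 (?t k)" if "k < n" for k
    using assms[OF that] by (auto simp: gauss_le_1 fps_X_power_nth)
  have 1: "gauss_le 1 (absv \<pi>) ((\<Sum>k<n. ?t k) ^ q - (\<Sum>k<n. ?t k ^ q))"
    by (rule gauss_le_sum_power_q) (use t in auto)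
  have 2: "absv ((\<Sum>k<n. ?t k ^ q) $ m - (\<Sum>k<n. if m = q * k then f $ k else 0)) \<le> absv \<pi>"
  proof -
    have "(?t k ^ q) $ m = (if m = q * k then (f $ k) ^ q else 0)" for k
      by (simp add: power_mult_distrib fps_const_power fps_X_power_nth mult.commute flip: power_mult)
    then have "(\<Sum>k<n. ?t k ^ q) $ m - (\<Sum>k<n. if m = q * k then f $ k else 0)
        = (\<Sum>k<n. if m = q * k then (f $ k) ^ q - f $ k else 0)"
      by (simp add: fps_sum_nth flip: sum_subtractf cong: if_cong) (intro sum.cong, auto)
    also have "absv \<dots> \<le> absv \<pi>"
      by (rule absv_sum_le) (use assms absv_pow_q_diff_le in auto)
    finally show ?thesis .
  qed
  have "(fps_truncate n f ^ q) $ m - (\<Sum>k<n. if m = q * k then f $ k else 0)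
      = ((\<Sum>k<n. ?t k) ^ q - (\<Sum>k<n. ?t k ^ q)) $ m
        + ((\<Sum>k<n. ?t k ^ q) $ m - (\<Sum>k<n. if m = q * k then f $ k else 0))"
    by (simp add: trunc)
  also have "absv \<dots> \<le> absv \<pi>"
    using 1 2 by (intro absv_add_le) (auto simp: gauss_le_1 simp del: fps_sub_nth)
  finally show ?thesis .
qed

text \<open>Comparing coefficients of X^n in f([\<pi>](X)) = [\<pi>](f(X)) expresses (\<pi> -
  \<pi>^n) f_n by lower coefficients. Modulo \<pi> both sides reduce to f(X^q), so that expression
  is divisible by \<pi>, and \<pi> - \<pi>^n has absolute value |\<pi>|.\<close>

lemma integral_of_frob_commute:
  assumes f: "f \<in> fps_over K" "f $ 0 = 0" "absv (f $ 1) \<le> 1" "f oo frob = frob oo f"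
  shows "gauss_le 1 1 f"
proof -
  have "absv (f $ n) \<le> 1" for n
  proof (induction n rule: less_induct)
    case (less n)
    consider "n = 0" | "n = 1" | "2 \<le> n" by linarith
    then show ?case
    proof cases
      case 3
      let ?d = "fps_truncate n f"
      have fk: "f $ k \<in> K \<and> absv (f $ k) \<le> 1" if "k < n" for k
        using less that f(1) by (auto simp: fps_overD)
      have d1: "gauss_le 1 1 ?d" and d0: "?d $ 0 = 0"
        using fk f(2) by (auto simp: gauss_le_1 fps_truncate_def)
      let ?c = "\<Sum>k<n. if n = q * k then f $ k else 0"
      have "{0..n} = insert n {..<n}" by auto
      then have lhs: "(f oo frob) $ n = (\<Sum>k<n. f $ k * (frob ^ k) $ n) + f $ n * \<pi> ^ n"
        using startsby_zero_power_nth_same[OF frob_0, of n] frob_1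
        by (simp add: fps_compose_nth add.commute)
      have "{0..n} = insert 0 (insert 1 {2..n})" using 3 by auto
      then have "(frob oo f) $ n = \<pi> * f $ n + (\<Sum>k=2..n. frob $ k * (f ^ k) $ n)"
        using frob_0 frob_1 by (simp add: fps_compose_nth)
      also have "(\<Sum>k=2..n. frob $ k * (f ^ k) $ n) = (\<Sum>k=2..n. frob $ k * (?d ^ k) $ n)"
        using fps_truncate_power_nth[OF f(2)] by (intro sum.cong) auto
      finally have "f $ n * (\<pi> - \<pi> ^ n)
          = (\<Sum>k<n. f $ k * (frob ^ k) $ n) - (\<Sum>k=2..n. frob $ k * (?d ^ k) $ n)"
        using lhs f(4) by (simp add: algebra_simps)
      \<comment> \<open>Each bracket is small for its own reason: \<open>frob\<close> is X^q modulo
        \<pi> in its argument, \<open>frob\<close> is X^q modulo \<pi> as outer series, and the q-th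
        power of the truncation is its substitution at X^q modulo \<pi>.\<close>
      also have "\<dots> = ((\<Sum>k<n. f $ k * (frob ^ k) $ n) - ?c)
          - ((\<Sum>k=2..n. frob $ k * (?d ^ k) $ n) - (?d ^ q) $ n) - ((?d ^ q) $ n - ?c)"
        by simp
      also have "absv \<dots> \<le> absv \<pi>"
      proof (rule absv_diff_le[OF absv_diff_le])
        have eq1: "(\<Sum>k<n. f $ k * (frob ^ k) $ n) - ?c
            = (\<Sum>k<n. f $ k * (frob ^ k - fps_X ^ (q * k)) $ n)"
          unfolding sum_subtractf[symmetric]
          by (intro sum.cong) (auto simp: fps_X_power_nth algebra_simps)
        show "absv ((\<Sum>k<n. f $ k * (frob ^ k) $ n) - ?c) \<le> absv \<pi>"
          unfolding eq1
        proof (rule absv_sum_le)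
          fix k assume "k \<in> {..<n}"
          then have "absv (f $ k) * absv ((frob ^ k - fps_X ^ (q * k)) $ n) \<le> 1 * absv \<pi>"
            using fk frob_power_cong[of k] by (intro mult_mono) (auto simp: gauss_le_1 simp del: fps_sub_nth)
          then show "absv (f $ k * (frob ^ k - fps_X ^ (q * k)) $ n) \<le> absv \<pi>"
            by (simp add: absv_mult)
        qed auto
        have "(?d ^ q) $ n = (\<Sum>k=2..n. if k = q then (?d ^ k) $ n else 0)"
          using q_ge_2 fps_power_nth_0[OF d0, of n q] by (simp add: sum.delta)
        then have "(\<Sum>k=2..n. frob $ k * (?d ^ k) $ n) - (?d ^ q) $ n
            = (\<Sum>k=2..n. (frob - fps_X ^ q) $ k * (?d ^ k) $ n)"
          by (simp only: sum_subtractf[symmetric])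
             (intro sum.cong, auto simp: fps_X_power_nth algebra_simps)
        also have "absv \<dots> \<le> absv \<pi>"
        proof (rule absv_sum_le)
          fix k assume "k \<in> {2..n}"
          have "absv ((frob - fps_X ^ q) $ k) * absv ((?d ^ k) $ n) \<le> absv \<pi> * 1"
            by (intro mult_mono frob_cong gauss_le_1_power_nth d1) auto
          then show "absv ((frob - fps_X ^ q) $ k * (?d ^ k) $ n) \<le> absv \<pi>"
            by (simp add: absv_mult)
        qed auto
        finally show "absv ((\<Sum>k=2..n. frob $ k * (?d ^ k) $ n) - (?d ^ q) $ n) \<le> absv \<pi>" .
        show "absv ((?d ^ q) $ n - ?c) \<le> absv \<pi>"
          by (rule truncate_power_q_cong[OF fk])
      qed
      finally have "absv (f $ n) * absv \<pi> \<le> 1 * absv \<pi>"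
        using absv_\<pi>_diff[OF 3] by (simp add: absv_mult)
      then show ?thesis by (rule mult_right_le_imp_le) (rule \<pi>_pos)
    qed (use f in auto)
  qed
  then show ?thesis by (simp add: gauss_le_1)
qed

section \<open>Logarithm and exponential on the disc of radius r\<close>

abbreviation logv :: "'a \<Rightarrow> 'a" where "logv \<equiv> fps_eval lt_log"
abbreviation expv :: "'a \<Rightarrow> 'a" where "expv \<equiv> fps_eval lt_exp"

lemma logv_le: "absv x < r \<Longrightarrow> absv (logv x) \<le> absv x"
  and expv_le: "absv x < r \<Longrightarrow> absv (expv x) \<le> absv x"
  by (rule fps_eval_tame_le[OF lt_log_over lt_log_tame] fps_eval_tame_le[OF lt_exp_over lt_exp_tame];
      assumption)+

lemma expv_logv: "absv x < r \<Longrightarrow> expv (logv x) = x"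
  using fps_eval_compose_tame[OF lt_exp_over lt_log_over tame_gauss[OF lt_exp_tame] lt_log_tame]
  by (simp add: lt_exp_log)

lemma logv_expv: "absv x < r \<Longrightarrow> logv (expv x) = x"
  using fps_eval_compose_tame[OF lt_log_over lt_exp_over tame_gauss[OF lt_log_tame] lt_exp_tame]
  by (simp add: lt_log_exp)

lemma frob_tame_r: "tame r frob"
  using tame_radius[OF frob_tame r_pos] r_less_1 by simp

lemma logv_frob: "absv x < r \<Longrightarrow> logv (fps_eval frob x) = \<pi> * logv x"
proof -
  assume x: "absv x < r"
  obtain C where C: "cfield C" "K \<subseteq> C" "{x} \<subseteq> C" using cfield_containing[of "{x}"] by auto
  have "logv (fps_eval frob x) = fps_eval (lt_log oo frob) x"
    by (rule fps_eval_compose_tame[OF lt_log_over frob_over tame_gauss[OF lt_log_tame] frob_tame_r x, symmetric])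
  also have "\<dots> = \<pi> * logv x"
    unfolding lt_log_frob
    by (rule fps_eval_cmult[OF C(1) fps_over_mono[OF lt_log_over C(2)] _ tame_gauss[OF lt_log_tame] x])
       (use C in auto)
  finally show ?thesis .
qed

text \<open>All coefficients but that of X^q are divisible by \<pi>, and for |x| < r the factor
  |x|^(q-1) \<le> r^(q-1) = |\<pi>| repairs that one.\<close>

lemma absv_frob_le: "absv x < r \<Longrightarrow> absv (fps_eval frob x) \<le> absv \<pi> * absv x"
proof -
  assume x: "absv x < r"
  obtain C where C: "cfield C" "K \<subseteq> C" "{x} \<subseteq> C" using cfield_containing[of "{x}"] by auto
  have x1: "absv x < 1" using x r_less_1 by simp
  have "((\<lambda>n. frob $ n * x ^ n) has_sum fps_eval frob x) UNIV"
    by (rule fps_eval_has_sum(1)[OF C(1) fps_over_mono[OF frob_over C(2)] _ frob_gauss x1])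
       (use C in auto)
  then show ?thesis
  proof (rule has_sum_absv_le)
    fix n
    show "absv (frob $ n * x ^ n) \<le> absv \<pi> * absv x"
    proof (cases "n = 0")
      case True
      then show ?thesis using frob_0 by simp
    next
      case n0: False
      then obtain m where m: "n = Suc m" by (cases n) auto
      show ?thesis
      proof (cases "n = q")
        case True
        have "absv x ^ m \<le> r ^ m" using x by (intro power_mono) auto
        also have "\<dots> = absv \<pi>" using r_power unfolding True[symmetric] m by simp
        finally have "absv x ^ m * absv x \<le> absv \<pi> * absv x" by (intro mult_right_mono) auto
        moreover have "absv (frob $ n) * (absv x ^ m * absv x) \<le> 1 * (absv x ^ m * absv x)"
          using frob_gauss by (intro mult_right_mono) (auto simp: gauss_le_1)
        ultimately show ?thesis by (simp add: absv_mult absv_power m mult.commute)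
      next
        case False
        have "absv x ^ m \<le> 1" using x1 by (intro power_le_one) auto
        then have "absv (frob $ n) * (absv x ^ m * absv x) \<le> absv \<pi> * (1 * absv x)"
          using frob_cong[of n] False
          by (intro mult_mono mult_right_mono) (auto simp: fps_X_power_nth split: if_splits)
        then show ?thesis by (simp add: absv_mult absv_power m mult_ac)
      qed
    qed
  qed simp
qed

lemma logv_diff_le: "absv x < r \<Longrightarrow> absv (logv x - x) \<le> (absv x) ^ 2 / r"
proof -
  assume x: "absv x < r"
  obtain C where C: "cfield C" "K \<subseteq> C" "{x} \<subseteq> C" using cfield_containing[of "{x}"] by auto
  have "((\<lambda>n. lt_log $ n * x ^ n) has_sum logv x) UNIV"
    by (rule fps_eval_has_sum(1)[OF C(1) fps_over_mono[OF lt_log_over C(2)] _ tame_gauss[OF lt_log_tame] x])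
       (use C in auto)
  moreover have "((\<lambda>n. lt_log $ n * x ^ n) has_sum (\<Sum>n\<in>{1}. lt_log $ n * x ^ n)) {1}"
    by (rule has_sum_finite) auto
  ultimately have "((\<lambda>n. lt_log $ n * x ^ n) has_sum (logv x - (\<Sum>n\<in>{1}. lt_log $ n * x ^ n))) (UNIV - {1})"
    by (rule has_sum_Diff) auto
  then have "absv (logv x - (\<Sum>n\<in>{1}. lt_log $ n * x ^ n)) \<le> (absv x) ^ 2 / r"
  proof (rule has_sum_absv_le)
    fix n :: nat assume n: "n \<in> UNIV - {1}"
    show "absv (lt_log $ n * x ^ n) \<le> (absv x) ^ 2 / r"
    proof (cases "n = 0")
      case True
      then show ?thesis using lt_log_0 r_pos by simp
    next
      case False
      then have n2: "2 \<le> n" using n by auto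
      have "absv (lt_log $ n * x ^ n) \<le> r * (absv x / r) ^ n"
        by (rule gauss_le_term[OF tame_gauss[OF lt_log_tame] x])
      also have "\<dots> \<le> r * (absv x / r) ^ 2"
        using n2 x r_pos by (intro mult_left_mono power_decreasing) auto
      also have "\<dots> = (absv x) ^ 2 / r" using r_pos by (simp add: power2_eq_square)
      finally show ?thesis .
    qed
  qed (use r_pos in auto)
  then show ?thesis using lt_log_1 by simp
qed

text \<open>The defect of additivity is multiplied by \<open>\<pi>\<close> when \<open>[\<pi>]\<close> is applied to both arguments, but it is
  quadratic in them; iterating, it must vanish.\<close>

lemma logv_fadd:
  assumes "absv x < r" "absv y < r"
  shows "logv (x \<oplus>\<^sub>F y) = logv x + logv y"
proof -
  let ?D = "\<lambda>x y. logv (x \<oplus>\<^sub>F y) - (logv x + logv y)"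
  have bound: "absv (?D x y) * absv \<pi> ^ n \<le> (absv \<pi> ^ n * B) ^ 2 / r"
    if "absv x \<le> B" "absv y \<le> B" "B < r" for x y B n
    using that
  proof (induction n arbitrary: x y B)
    case 0
    have B: "0 \<le> B" using 0(1) absv_nonneg[of x] by linarith
    have r1: "B < 1" "B \<le> 1" using 0 r_less_1 by auto
    have xy: "absv (x \<oplus>\<^sub>F y) \<le> B" using fadd_le[OF 0(1,2)] r1 by simp
    have sq: "absv z ^ 2 / r \<le> B ^ 2 / r" if "absv z \<le> B" for z
      using that r_pos by (intro divide_right_mono power_mono) auto
    have "?D x y = (logv (x \<oplus>\<^sub>F y) - x \<oplus>\<^sub>F y) + (x \<oplus>\<^sub>F y - (x + y)) - (logv x - x) - (logv y - y)"
      by simp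
    also have "absv \<dots> \<le> B ^ 2 / r"
    proof (rule absv_diff_le[OF absv_diff_le[OF absv_add_le]])
      show "absv (logv (x \<oplus>\<^sub>F y) - x \<oplus>\<^sub>F y) \<le> B ^ 2 / r"
        using xy 0 by (intro order_trans[OF logv_diff_le sq]) auto
      show "absv (logv x - x) \<le> B ^ 2 / r" "absv (logv y - y) \<le> B ^ 2 / r"
        using 0 by (auto intro!: order_trans[OF logv_diff_le sq])
      have "B ^ 2 \<le> B ^ 2 / r" using r_pos r_less_1 mult_left_le_one_le[of "B ^ 2" r]
        by (simp add: pos_le_divide_eq mult.commute)
      then show "absv (x \<oplus>\<^sub>F y - (x + y)) \<le> B ^ 2 / r"
        using fadd_diff_le[OF 0(1,2)] r1 by linarith
    qed
    finally show ?case by simp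
  next
    case (Suc n)
    let ?e = "fps_eval frob"
    have B: "0 \<le> B" using Suc.prems(1) absv_nonneg[of x] by linarith
    have xy: "absv (x \<oplus>\<^sub>F y) \<le> B" using fadd_le[OF Suc.prems(1,2)] Suc.prems(3) r_less_1 by simp
    have e: "absv (?e x) \<le> absv \<pi> * B" "absv (?e y) \<le> absv \<pi> * B"
      using Suc.prems absv_frob_le[of x] absv_frob_le[of y]
        mult_left_mono[of "absv x" B "absv \<pi>"] mult_left_mono[of "absv y" B "absv \<pi>"] by auto
    have "absv \<pi> * B < r" using Suc.prems(3) B mult_right_mono[of "absv \<pi>" 1 B] \<pi>_less_1 by auto
    from Suc.IH[OF e this] have IH: "absv (?D (?e x) (?e y)) * absv \<pi> ^ n
        \<le> (absv \<pi> ^ n * (absv \<pi> * B)) ^ 2 / r" .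
    have "?e x \<oplus>\<^sub>F ?e y = ?e (x \<oplus>\<^sub>F y)"
      using Suc.prems r_less_1 by (intro frob_fadd[symmetric]) auto
    then have "?D (?e x) (?e y) = \<pi> * ?D x y"
      using Suc.prems xy by (simp add: logv_frob algebra_simps)
    with IH show ?case by (simp add: absv_mult mult_ac)
  qed
  define B where "B = max (absv x) (absv y)"
  have B: "absv x \<le> B" "absv y \<le> B" "B < r" using assms by (auto simp: B_def)
  have le: "absv (?D x y) \<le> B ^ 2 / r * absv \<pi> ^ n" for n
  proof -
    have "absv (?D x y) * absv \<pi> ^ n \<le> (B ^ 2 / r * absv \<pi> ^ n) * absv \<pi> ^ n"
      using bound[OF B, of n] by (simp add: power2_eq_square mult_ac)
    then show ?thesis by (rule mult_right_le_imp_le) (use \<pi>_pos in simp)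
  qed
  have "(\<lambda>n. B ^ 2 / r * absv \<pi> ^ n) \<longlonglongrightarrow> B ^ 2 / r * 0"
    using \<pi>_less_1 by (intro tendsto_intros LIMSEQ_power_zero) auto
  then have "absv (?D x y) \<le> B ^ 2 / r * 0"
    using le by (intro LIMSEQ_le_const) auto
  then show ?thesis by simp
qed

lemma expv_add:
  assumes "absv x < r" "absv y < r"
  shows "expv (x + y) = expv x \<oplus>\<^sub>F expv y"
proof -
  have 1: "absv (expv x) < r" "absv (expv y) < r" using expv_le[of x] expv_le[of y] assms by auto
  have "logv (expv x \<oplus>\<^sub>F expv y) = x + y" using logv_fadd[OF 1] assms by (simp add: logv_expv)
  moreover have "absv (expv x \<oplus>\<^sub>F expv y) < r"
    using fadd_le[of "expv x" "max (absv (expv x)) (absv (expv y))" "expv y"] 1 r_less_1 by auto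
  ultimately show ?thesis using expv_logv by metis
qed

text \<open>The formal identity is recovered from additivity on the points of K in the disc of
  radius r.\<close>

lemma fgl_hom_log: "fgl_hom F additive_fgl lt_log"
  unfolding fgl_hom_iff
proof (intro conjI lt_log_0 fps2_eqI_eval[OF cfield_K])
  show "fps2_outer lt_log F \<in> fps2_over K" "fps2_inner additive_fgl lt_log \<in> fps2_over K"
    by (rule fps2_outer_over fps2_inner_over; (rule cfield_K lt_log_over F_over additive_fgl_over[OF cfield_K]))+
  show "gauss2_le r r (fps2_outer lt_log F)"
    using r_pos r_less_1 by (intro gauss2_le_outer tame_gauss lt_log_tame F_gauss_small) auto
  show "gauss2_le r 1 (fps2_inner additive_fgl lt_log)"
    using r_pos r_less_1
    by (intro gauss2_le_inner tame_gauss lt_log_tame gauss2_le_radius[OF additive_fgl_gauss]) auto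
  fix x y assume xy: "x \<in> K" "y \<in> K" "absv x < r" "absv y < r"
  define s where "s = (r + max (absv x) (absv y)) / 2"
  have s: "absv x < s" "absv y < s" "s < r" using xy by (auto simp: s_def)
  have s0: "0 < s" using s(1) absv_nonneg[of x] by linarith
  have "fps_eval2 (fps2_outer lt_log F) x y = logv (x \<oplus>\<^sub>F y)"
    by (rule fps_eval2_outer[OF cfield_K lt_log_over tame_gauss[OF lt_log_tame] F_over F_gauss_small F_0 s(3)])
       (use xy s s0 r_less_1 in auto)
  also have "\<dots> = fps_eval2 additive_fgl (logv x) (logv y)"
    using logv_fadd xy by (simp add: fps_eval2_additive)
  also have "\<dots> = fps_eval2 (fps2_inner additive_fgl lt_log) x y"
    by (rule fps_eval2_inner[OF cfield_K lt_log_over _ lt_log_0 additive_fgl_over[OF cfield_K] additive_fgl_gauss, symmetric])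
       (use xy s s0 r_less_1 tame_radius[OF lt_log_tame s0] in \<open>auto simp: tame_def\<close>)
  finally show "fps_eval2 (fps2_outer lt_log F) x y = fps_eval2 (fps2_inner additive_fgl lt_log) x y" .
qed (use r_pos K_nonzero_small in auto)

lemma fgl_log_eq: "fgl_log K F = lt_log"
  unfolding fgl_log_def
proof (rule the_equality)
  show "lt_log \<in> fps_over K \<and> fgl_hom F additive_fgl lt_log \<and> lt_log $ 1 = 1"
    using lt_log_over fgl_hom_log lt_log_1 by blast
  show "l = lt_log" if "l \<in> fps_over K \<and> fgl_hom F additive_fgl l \<and> l $ 1 = 1" for l
    using that fgl_hom_unique[OF F_unit1 F_unit2, of additive_fgl l lt_log] fgl_hom_log lt_log_1 by auto
qed

lemma fgl_exp_eq: "fgl_exp K F = lt_exp"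
  by (simp add: fgl_exp_def fgl_log_eq lt_exp_def)

section \<open>The endomorphisms [a]\<close>

definition endo :: "'a \<Rightarrow> 'a fps" where "endo a = lt_exp oo (fps_const a * lt_log)"

context
  fixes a :: 'a
  assumes a: "a \<in> K" "absv a \<le> 1"
begin

lemma scaled_log: "fps_const a * lt_log \<in> fps_over K" "tame r (fps_const a * lt_log)"
proof -
  show "fps_const a * lt_log \<in> fps_over K"
    using a lt_log_over by (intro fps_over_intros[OF cfield_K])
  have "absv a * r \<le> r" using a r_pos by (simp add: mult_right_le_one_le mult.commute)
  then have "gauss_le r r (fps_const a * lt_log)"
    using gauss_le_mono[OF gauss_le_const_mult[OF tame_gauss[OF lt_log_tame]]] by blast
  then show "tame r (fps_const a * lt_log)" by (simp add: tame_def lt_log_0)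
qed

lemma endo_over: "endo a \<in> fps_over K"
  unfolding endo_def by (intro fps_over_intros(8)[OF cfield_K] lt_exp_over scaled_log)

lemma endo_tame_r: "tame r (endo a)"
  unfolding endo_def by (intro tame_compose r_pos lt_exp_tame scaled_log)

lemma endo_0: "endo a $ 0 = 0"
  using endo_tame_r by (simp add: tame_def)

lemma lt_exp_1: "lt_exp $ 0 = 0" "lt_exp $ 1 = 1"
proof -
  show 0: "lt_exp $ 0 = 0" using lt_exp_tame by (simp add: tame_def)
  have "(lt_log oo lt_exp) $ 1 = 1" by (simp add: lt_log_exp)
  then show "lt_exp $ 1 = 1" using 0 lt_log_0 lt_log_1 by (simp add: fps_compose_nth)
qed

lemma endo_1: "endo a $ 1 = a"
  using lt_exp_1 lt_log_0 lt_log_1 by (simp add: endo_def fps_compose_nth)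

text \<open>\<open>frob\<close> itself is exp(\<pi> log X), so both sides equal exp(a \<pi> log
  X).\<close>

lemma endo_frob: "endo a oo frob = frob oo endo a"
proof -
  note 0 = lt_exp_1(1) lt_log_0 frob_0
  have "frob = (lt_exp oo lt_log) oo frob" using lt_exp_log frob_0 by simp
  also have "\<dots> = lt_exp oo (fps_const \<pi> * lt_log)"
    using 0 by (simp add: lt_log_frob flip: fps_compose_assoc)
  finally have frob: "frob = lt_exp oo (fps_const \<pi> * lt_log)" .
  have "endo a oo frob = lt_exp oo (fps_const a * (lt_log oo frob))"
    unfolding endo_def using 0 by (simp add: fps_const_mult_apply_left flip: fps_compose_assoc)
  also have "\<dots> = lt_exp oo (fps_const \<pi> * (fps_const a * lt_log))"
    by (simp add: lt_log_frob mult.left_commute)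
  also have "\<dots> = lt_exp oo (fps_const \<pi> * (lt_log oo endo a))"
    unfolding endo_def using 0 lt_log_exp
    by (simp add: fps_compose_assoc fps_mult_nth)
  also have "\<dots> = (lt_exp oo (fps_const \<pi> * lt_log)) oo endo a"
    using 0 endo_0 by (simp add: fps_const_mult_apply_left flip: fps_compose_assoc)
  also have "\<dots> = frob oo endo a" using frob by simp
  finally show ?thesis .
qed

text \<open>The formula exp(a log X) only shows that the coefficients lie in K. Commutation with
  \<open>frob\<close> makes them integral, so that [a] converges on the whole open unit
  disc.\<close>

lemma endo_gauss: "gauss_le 1 1 (endo a)"
  using integral_of_frob_commute[OF endo_over endo_0 _ endo_frob] a endo_1 by simp

lemma endo_tame: "tame 1 (endo a)"
  using endo_gauss endo_0 by (simp add: tame_def)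

lemma endo_eval: "absv x < r \<Longrightarrow> fps_eval (endo a) x = expv (a * logv x)"
proof -
  assume x: "absv x < r"
  obtain C where C: "cfield C" "K \<subseteq> C" "{x} \<subseteq> C" using cfield_containing[of "{x}"] by auto
  have "fps_eval (endo a) x = expv (fps_eval (fps_const a * lt_log) x)"
    unfolding endo_def
    by (rule fps_eval_compose_tame[OF lt_exp_over scaled_log(1) tame_gauss[OF lt_exp_tame] scaled_log(2) x])
  also have "fps_eval (fps_const a * lt_log) x = a * logv x"
    by (rule fps_eval_cmult[OF C(1) fps_over_mono[OF lt_log_over C(2)] _ tame_gauss[OF lt_log_tame] x])
       (use C in auto)
  finally show ?thesis .
qed

lemma endo_le: "absv x < 1 \<Longrightarrow> absv (fps_eval (endo a) x) \<le> absv x"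
  by (rule fps_eval_tame_le[OF endo_over endo_tame])

lemma a_logv_less: "absv x < r \<Longrightarrow> absv (a * logv x) < r"
  using logv_le[of x] mult_mono[of "absv a" 1 "absv (logv x)" "absv x"] a by (simp add: absv_mult)

lemma logv_endo: "absv x < r \<Longrightarrow> logv (fps_eval (endo a) x) = a * logv x"
  using a_logv_less by (simp add: endo_eval logv_expv)

lemma fgl_hom_endo: "fgl_hom F F (endo a)"
  unfolding fgl_hom_iff
proof (intro conjI endo_0 fps2_eqI_eval[OF cfield_K])
  show "fps2_outer (endo a) F \<in> fps2_over K" "fps2_inner F (endo a) \<in> fps2_over K"
    by (rule fps2_outer_over fps2_inner_over; (rule cfield_K endo_over F_over))+
  show "gauss2_le r r (fps2_outer (endo a) F)"
    using r_pos r_less_1 by (intro gauss2_le_outer tame_gauss endo_tame_r F_gauss_small) auto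
  show "gauss2_le r r (fps2_inner F (endo a))"
    using r_pos r_less_1 by (intro gauss2_le_inner tame_gauss endo_tame_r F_gauss_small) auto
  fix x y assume xy: "x \<in> K" "y \<in> K" "absv x < r" "absv y < r"
  define s where "s = (r + max (absv x) (absv y)) / 2"
  have s: "absv x < s" "absv y < s" "s < r" using xy by (auto simp: s_def)
  have s0: "0 < s" using s(1) absv_nonneg[of x] by linarith
  have xyr: "absv (x \<oplus>\<^sub>F y) < r"
    using fadd_le[of x "max (absv x) (absv y)" y] xy r_less_1 by auto
  have "fps_eval2 (fps2_outer (endo a) F) x y = fps_eval (endo a) (x \<oplus>\<^sub>F y)"
    by (rule fps_eval2_outer[OF cfield_K endo_over tame_gauss[OF endo_tame_r] F_over F_gauss_small F_0 s(3)])
       (use xy s s0 r_less_1 in auto)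
  also have "\<dots> = expv (a * logv x + a * logv y)"
    using xyr xy by (simp add: endo_eval logv_fadd distrib_left)
  also have "\<dots> = fps_eval (endo a) x \<oplus>\<^sub>F fps_eval (endo a) y"
    using a_logv_less xy by (simp add: expv_add endo_eval)
  also have "\<dots> = fps_eval2 (fps2_inner F (endo a)) x y"
    by (rule fps_eval2_inner[OF cfield_K endo_over _ endo_0 F_over F_gauss, symmetric])
       (use xy s s0 r_less_1 tame_radius[OF endo_tame_r s0] in \<open>auto simp: tame_def\<close>)
  finally show "fps_eval2 (fps2_outer (endo a) F) x y = fps_eval2 (fps2_inner F (endo a)) x y" .
qed (use r_pos K_nonzero_small in auto)

lemma fgl_endo_unique:
  assumes "fgl_hom F F h" "h $ 1 = a" shows "h = endo a"
  using fgl_hom_unique[OF F_unit1 F_unit2 assms(1) fgl_hom_endo] assms(2) endo_1 by simp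

lemma fgl_endo_eq: "fgl_endo K F a = endo a"
  unfolding fgl_endo_def
proof (rule the_equality)
  show "endo a \<in> fps_over (val_ring K) \<and> fgl_hom F F (endo a) \<and> endo a $ 1 = a"
    using endo_over endo_gauss fgl_hom_endo endo_1 by (auto simp: fps_over_val_ring)
qed (use fgl_endo_unique in auto)

end

lemma endo_\<pi>: "endo \<pi> = frob"
  using fgl_endo_unique[of \<pi> frob] frob_hom frob_1 \<pi>_K \<pi>_less_1 by simp

lemma endo_one: "endo 1 = fps_X"
  using lt_exp_log by (simp add: endo_def)

lemma endo_compose:
  assumes a: "a \<in> K" "absv a \<le> 1" and b: "b \<in> K" "absv b \<le> 1"
  shows "endo a oo endo b = endo (a * b)"
proof -
  note 0 = lt_exp_1(1)[OF a] lt_log_0 endo_0[OF b]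
  have "endo a oo endo b = lt_exp oo (fps_const a * (lt_log oo endo b))"
    unfolding endo_def[of a] using 0 by (simp add: fps_const_mult_apply_left flip: fps_compose_assoc)
  also have "lt_log oo endo b = fps_const b * lt_log"
    unfolding endo_def using 0 lt_log_exp by (simp add: fps_compose_assoc fps_mult_nth)
  finally show ?thesis by (simp add: endo_def mult.assoc flip: fps_const_mult)
qed

lemma endo_mult_eval:
  assumes a: "a \<in> K" "absv a \<le> 1" and b: "b \<in> K" "absv b \<le> 1" and x: "absv x < 1"
  shows "fps_eval (endo a) (fps_eval (endo b) x) = fps_eval (endo (a * b)) x"
  using fps_eval_compose_tame[OF endo_over[OF a] endo_over[OF b] endo_gauss[OF a] endo_tame[OF b] x]
  by (simp add: endo_compose[OF a b])

text \<open>On the disc of radius r the logarithm gives it. By the identity theorem it then holds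
  between the series, and hence at every point of the open unit disc, where the logarithm need no
  longer be injective.\<close>

lemma endo_add_eval:
  assumes a: "a \<in> K" "absv a \<le> 1" and b: "b \<in> K" "absv b \<le> 1" and x: "absv x < 1"
  shows "fps_eval (endo (a + b)) x = fps_eval (endo a) x \<oplus>\<^sub>F fps_eval (endo b) x"
proof -
  have ab: "a + b \<in> K" "absv (a + b) \<le> 1"
    using a b by (auto intro: cfield_intros[OF cfield_K] absv_add_le)
  have g: "gauss_le t t (endo a)" "gauss_le t t (endo b)" if "0 < t" "t \<le> 1" for t
    using tame_radius[OF endo_tame[OF a] that] tame_radius[OF endo_tame[OF b] that]
    by (auto intro: tame_gauss)
  note sub = fps_subst2[OF _ F_overC F_gauss F_0]
  have "fps_subst2 F (endo a) (endo b) = endo (a + b)"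
  proof (rule fps_eqI_eval[OF cfield_K _ endo_over[OF ab] _ tame_gauss[OF endo_tame_r[OF ab]] r_pos K_nonzero_small])
    note sub' = sub[OF cfield_K order_refl endo_over[OF a] g(1) endo_over[OF b] g(2) r_less_1 r_pos]
    show "fps_subst2 F (endo a) (endo b) \<in> fps_over K" "gauss_le r r (fps_subst2 F (endo a) (endo b))"
      using sub'(1,2) r_pos r_less_1 by auto
    fix y assume y: "y \<in> K" "absv y < r"
    have "fps_eval (fps_subst2 F (endo a) (endo b)) y = fps_eval (endo a) y \<oplus>\<^sub>F fps_eval (endo b) y"
      using sub'(3)[OF _ _ _ _ y] r_pos r_less_1 by auto
    also have "\<dots> = expv (a * logv y + b * logv y)"
      using y a_logv_less[OF a] a_logv_less[OF b] by (simp add: expv_add endo_eval a b)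
    also have "\<dots> = fps_eval (endo (a + b)) y"
      using y by (simp add: endo_eval ab distrib_right)
    finally show "fps_eval (fps_subst2 F (endo a) (endo b)) y = fps_eval (endo (a + b)) y" .
  qed
  moreover have "fps_eval (fps_subst2 F (endo a) (endo b)) x = fps_eval (endo a) x \<oplus>\<^sub>F fps_eval (endo b) x"
  proof -
    obtain C where C: "cfield C" "K \<subseteq> C" "{x} \<subseteq> C" using cfield_containing[of "{x}"] by auto
    obtain t where t: "absv x < t" "t < 1" using dense[OF x] by blast
    have t0: "0 < t" using t absv_nonneg[of x] by linarith
    show ?thesis
      using sub(3)[OF C(1,2) fps_over_mono[OF endo_over[OF a] C(2)] g(1)
          fps_over_mono[OF endo_over[OF b] C(2)] g(2) t(2) t0 _ t(1)] C t t0 by auto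
  qed
  ultimately show ?thesis by simp
qed

lemma endo_zero: "endo 0 = 0"
  using lt_exp_1(1)[of 1] cfield_intros(2)[OF cfield_K]
  by (simp add: endo_def fps_eq_iff fps_compose_nth power_0_left)

section \<open>Inverses in the group of points\<close>

definition fneg :: "'a \<Rightarrow> 'a" where "fneg = fps_eval (endo (-1))"

lemma minus_one_K: "(-1::'a) \<in> K" "absv (-1::'a) \<le> 1" and one_K: "(1::'a) \<in> K" "absv (1::'a) \<le> 1"
  using cfield_intros(2,5)[OF cfield_K] by auto

lemma fneg_le: "absv x < 1 \<Longrightarrow> absv (fneg x) \<le> absv x"
  unfolding fneg_def by (rule endo_le[OF minus_one_K])

lemma fadd_fneg: "absv x < 1 \<Longrightarrow> x \<oplus>\<^sub>F fneg x = 0"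
  using endo_add_eval[OF one_K minus_one_K, of x] by (simp add: fneg_def endo_one endo_zero)

lemma fadd_left_cancel:
  assumes "absv x < 1" "absv y < 1" "absv z < 1" "x \<oplus>\<^sub>F y = x \<oplus>\<^sub>F z"
  shows "y = z"
proof -
  have n: "absv (fneg x) < 1" using fneg_le[OF assms(1)] assms(1) by simp
  have "w = fneg x \<oplus>\<^sub>F (x \<oplus>\<^sub>F w)" if "absv w < 1" for w
    using fadd_assoc[OF n assms(1) that] fadd_fneg[OF assms(1)] n assms(1) that
    by (simp add: fadd_commute[of "fneg x" x] fadd_commute[of 0] fadd_0_right)
  then show ?thesis using assms by metis
qed

end

section \<open>Expansion in powers of the Frobenius lift, and torsion points\<close>

lemma gauss_le_compose:
  assumes "gauss_le 1 B f" "gauss_le 1 1 g"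
  shows "gauss_le 1 B (f oo g)"
  unfolding gauss_le_1 fps_compose_nth
proof (intro allI absv_sum_le)
  fix n k
  have "absv (f $ k) * absv ((g ^ k) $ n) \<le> B * 1"
    using assms gauss_le_nonneg[OF assms(1)]
    by (intro mult_mono gauss_le_1_power_nth) (auto simp: gauss_le_1)
  then show "absv (f $ k * (g ^ k) $ n) \<le> B" by (simp add: absv_mult)
qed (rule gauss_le_nonneg[OF assms(1)])

lemma finite_monic_roots:
  fixes c :: "nat \<Rightarrow> 'a::field_char_0"
  shows "finite {x. x ^ m = (\<Sum>i<m. c i * x ^ i)}" "card {x. x ^ m = (\<Sum>i<m. c i * x ^ i)} \<le> m"
proof -
  define P where "P = monom 1 m - (\<Sum>i<m. monom (c i) i)"
  have coeff: "coeff P k = (if k = m then 1 else 0) - (if k < m then c k else 0)" for k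
    by (auto simp: P_def coeff_sum sum.delta)
  have P0: "P \<noteq> 0" using coeff[of m] by auto
  have "degree P \<le> m" by (rule degree_le) (simp add: coeff)
  have eq: "{x. x ^ m = (\<Sum>i<m. c i * x ^ i)} = {x. poly P x = 0}"
    by (auto simp: P_def poly_monom poly_sum)
  show "finite {x. x ^ m = (\<Sum>i<m. c i * x ^ i)}" unfolding eq by (rule poly_roots_finite[OF P0])
  show "card {x. x ^ m = (\<Sum>i<m. c i * x ^ i)} \<le> m"
    unfolding eq using card_poly_roots_bound[OF P0] \<open>degree P \<le> m\<close> by linarith
qed

context lubin_tate_tower
begin

definition digit :: "'a fps \<Rightarrow> nat \<Rightarrow> 'a fps" where
  "digit f i = Abs_fps (\<lambda>n. f $ (q * n + i))"

definition frob_sum :: "(nat \<Rightarrow> 'a fps) \<Rightarrow> 'a fps" where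
  "frob_sum h = (\<Sum>i<q. fps_X ^ i * (h i oo frob))"

lemma frob_sum_over:
  assumes "cfield C" "K \<subseteq> C" "\<And>i. i < q \<Longrightarrow> h i \<in> fps_over C"
  shows "frob_sum h \<in> fps_over C"
  unfolding frob_sum_def
  using assms fps_over_mono[OF frob_over assms(2)] by (auto intro!: fps_over_intros[OF assms(1)])

lemma frob_sum_gauss:
  assumes "\<And>i. i < q \<Longrightarrow> gauss_le 1 B (h i)" "0 \<le> B"
  shows "gauss_le 1 B (frob_sum h)"
  unfolding frob_sum_def
proof (rule gauss_le_sum)
  fix i assume "i \<in> {..<q}"
  then have "gauss_le 1 (1 ^ i * B) (fps_X ^ i * (h i oo frob))"
    using assms by (intro gauss_le_mult gauss_le_power gauss_le_X gauss_le_compose frob_gauss) auto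
  then show "gauss_le 1 B (fps_X ^ i * (h i oo frob))" by simp
qed (use assms in auto)

lemma frob_sum_diff: "frob_sum (\<lambda>i. h i - g i) = frob_sum h - frob_sum g"
  by (simp add: frob_sum_def fps_compose_sub_distrib right_diff_distrib sum_subtractf)

lemma frob_sum_add: "frob_sum (\<lambda>i. h i + g i) = frob_sum h + frob_sum g"
  by (simp add: frob_sum_def fps_compose_add_distrib distrib_left sum.distrib)

lemma frob_sum_cmult: "frob_sum (\<lambda>i. fps_const c * h i) = fps_const c * frob_sum h"
  by (simp add: frob_sum_def sum_distrib_left mult.left_commute flip: fps_const_mult_apply_left)

lemma digit_expansion: "f = (\<Sum>i<q. fps_X ^ i * (digit f i oo fps_X ^ q))"
proof (rule fps_ext)
  fix n
  have comp: "(g oo fps_X ^ q) $ m = (if q dvd m then g $ (m div q) else 0)" for g :: "'a fps" and m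
  proof -
    have "(g oo fps_X ^ q) $ m = (\<Sum>k=0..m. if k = m div q \<and> q dvd m then g $ k else 0)"
      unfolding fps_compose_nth power_mult[symmetric] fps_X_power_nth
      using q_ge_2 by (intro sum.cong refl) auto
    also have "\<dots> = (if q dvd m then g $ (m div q) else 0)" by (auto simp: sum.delta)
    finally show ?thesis .
  qed
  have "(\<Sum>i<q. fps_X ^ i * (digit f i oo fps_X ^ q)) $ n
      = (\<Sum>i<q. if i = n mod q then f $ n else 0)"
    unfolding fps_sum_nth
  proof (rule sum.cong)
    fix i assume i: "i \<in> {..<q}"
    show "(fps_X ^ i * (digit f i oo fps_X ^ q)) $ n = (if i = n mod q then f $ n else 0)"
    proof (cases "i = n mod q")
      case True
      then have "i \<le> n" "q dvd n - i" "q * ((n - i) div q) + i = n"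
        by (auto simp: mod_less_eq_dividend dvd_minus_mod minus_mod_eq_mult_div)
      then show ?thesis
        using True leD[OF mod_less_eq_dividend[of n q]] by (simp add: fps_X_power_mult_nth comp digit_def)
    next
      case False
      have "\<not> q dvd n - i" if "i \<le> n"
      proof
        assume "q dvd n - i"
        then obtain k where "n - i = q * k" by blast
        then have "n = q * k + i" using that by simp
        then show False using False i by simp
      qed
      then show ?thesis using False by (auto simp: fps_X_power_mult_nth comp)
    qed
  qed auto
  also have "\<dots> = f $ n" using q_ge_2 by (simp add: sum.delta)
  finally show "f $ n = (\<Sum>i<q. fps_X ^ i * (digit f i oo fps_X ^ q)) $ n" by simp
qed

text \<open>The expansion by exponents modulo q is exact with X^q in place of \<open>frob\<close>,
  and the two agree modulo \<pi>.\<close>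

lemma frob_sum_digit_cong:
  assumes "gauss_le 1 1 f"
  shows "gauss_le 1 (absv \<pi>) (f - frob_sum (digit f))"
proof -
  have "f - frob_sum (digit f)
      = (\<Sum>i<q. fps_X ^ i * (digit f i oo fps_X ^ q)) - (\<Sum>i<q. fps_X ^ i * (digit f i oo frob))"
    using digit_expansion[of f] by (simp add: frob_sum_def)
  also have "\<dots> = (\<Sum>i<q. fps_X ^ i * ((digit f i oo fps_X ^ q) - (digit f i oo frob)))"
    by (simp add: right_diff_distrib sum_subtractf)
  also have "gauss_le 1 (absv \<pi>) \<dots>"
  proof (rule gauss_le_sum)
    fix i
    have "gauss_le 1 (absv \<pi>) ((digit f i oo fps_X ^ q) - (digit f i oo frob))"
      unfolding gauss_le_1
    proof
      fix n
      have "((digit f i oo fps_X ^ q) - (digit f i oo frob)) $ n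
          = - (\<Sum>k=0..n. digit f i $ k * (frob ^ k - fps_X ^ (q * k)) $ n)"
        by (simp add: fps_compose_nth right_diff_distrib sum_subtractf flip: power_mult)
      also have "absv \<dots> \<le> absv \<pi>"
        unfolding absv_minus
      proof (rule absv_sum_le)
        fix k
        have "absv (digit f i $ k) * absv ((frob ^ k - fps_X ^ (q * k)) $ n) \<le> 1 * absv \<pi>"
          using assms frob_power_cong[of k]
          by (intro mult_mono) (auto simp: gauss_le_1 digit_def simp del: fps_sub_nth)
        then show "absv (digit f i $ k * (frob ^ k - fps_X ^ (q * k)) $ n) \<le> absv \<pi>"
          by (simp add: absv_mult)
      qed auto
      finally show "absv (((digit f i oo fps_X ^ q) - (digit f i oo frob)) $ n) \<le> absv \<pi>" .
    qed
    then have "gauss_le 1 (1 ^ i * absv \<pi>) (fps_X ^ i * ((digit f i oo fps_X ^ q) - (digit f i oo frob)))"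
      by (intro gauss_le_mult gauss_le_power gauss_le_X) auto
    then show "gauss_le 1 (absv \<pi>) (fps_X ^ i * ((digit f i oo fps_X ^ q) - (digit f i oo frob)))"
      by simp
  qed auto
  finally show ?thesis .
qed

definition digit_step :: "'a fps \<Rightarrow> 'a fps" where
  "digit_step f = fps_const (1 / \<pi>) * (f - frob_sum (digit f))"

text \<open>\<open>\<O>[[X]]\<close> is spanned by \<open>1, \<dots>, X\<^sup>q\<^sup>-\<^sup>1\<close> over \<open>\<O>[[[\<pi>](X)]]\<close>: modulo \<open>\<pi>\<close> the coefficients are read off
  from \<open>[\<pi>](X) = X\<^sup>q\<close>, and the error is divided by \<open>\<pi>\<close> and expanded again.\<close>

lemma frob_sum_surj:
  assumes C: "cfield C" "K \<subseteq> C" and f: "f \<in> fps_over C" "gauss_le 1 1 f"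
  obtains h where "\<And>i. h i \<in> fps_over C" "\<And>i. gauss_le 1 1 (h i)" "f = frob_sum h"
proof -
  have \<pi>C: "\<pi> \<in> C" using \<pi>_K C by blast
  define g where "g k = (digit_step ^^ k) f" for k
  have g_Suc: "g (Suc k) = digit_step (g k)" and g_0: "g 0 = f" for k
    by (simp_all add: g_def)
  have digit_over: "f \<in> fps_over C \<Longrightarrow> digit f i \<in> fps_over C"
    and digit_gauss: "gauss_le 1 1 f \<Longrightarrow> gauss_le 1 1 (digit f i)" for f i
    by (auto simp: fps_over_def gauss_le_1 digit_def)
  have g: "g k \<in> fps_over C \<and> gauss_le 1 1 (g k)" for k
  proof (induction k)
    case (Suc k)
    have "g (Suc k) \<in> fps_over C"
      unfolding g_Suc digit_step_def using Suc digit_over \<pi>C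
      by (auto intro!: fps_over_intros[OF C(1)] frob_sum_over[OF C] cfield_intros[OF C(1)])
    moreover have "gauss_le 1 (absv (1 / \<pi>) * absv \<pi>) (g (Suc k))"
      unfolding g_Suc digit_step_def using Suc by (intro gauss_le_const_mult frob_sum_digit_cong) auto
    ultimately show ?case using \<pi>_pos by (simp add: absv_divide)
  qed (use f g_0 in auto)
  let ?t = "\<lambda>i n k. \<pi> ^ k * digit (g k) i $ n"
  have t_le: "absv (?t i n k) \<le> 1 * absv \<pi> ^ k" for i n k
  proof -
    have "absv (digit (g k) i $ n) * absv \<pi> ^ k \<le> 1 * absv \<pi> ^ k"
      using digit_gauss[of "g k" i] g \<pi>_pos by (intro mult_right_mono) (auto simp: gauss_le_1)
    then show ?thesis by (simp add: absv_mult absv_power mult.commute)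
  qed
  have tC: "?t i n k \<in> C" for i n k
    using digit_over[of "g k" i] g \<pi>C by (auto simp: fps_over_def intro!: cfield_intros[OF C(1)])
  have null: "null_family (?t i n) UNIV" for i n
    by (rule null_family_weight[where w = id and t = "absv \<pi>" and B = 1])
       (use t_le \<pi>_pos \<pi>_less_1 in auto)
  have "\<exists>s. s \<in> C \<and> (?t i n has_sum s) UNIV" for i n
    using cfield_has_sum[OF C(1) tC null] by blast
  then obtain s where s: "\<And>i n. s i n \<in> C" "\<And>i n. (?t i n has_sum s i n) UNIV" by metis
  define h where "h i = Abs_fps (s i)" for i
  define hm where "hm m i = (\<Sum>k<m. fps_const (\<pi> ^ k) * digit (g k) i)" for m i
  have hm_nth: "hm m i $ n = (\<Sum>k<m. ?t i n k)" for m i n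
    by (simp add: hm_def fps_sum_nth)
  have tail: "gauss_le 1 (absv \<pi> ^ m) (h i - hm m i)" for m i
    unfolding gauss_le_1
  proof
    fix n
    have "(?t i n has_sum (\<Sum>k<m. ?t i n k)) {..<m}" by (rule has_sum_finite) auto
    with s(2)[of i n] have "(?t i n has_sum (s i n - (\<Sum>k<m. ?t i n k))) (UNIV - {..<m})"
      by (rule has_sum_Diff) auto
    then have "absv (s i n - (\<Sum>k<m. ?t i n k)) \<le> absv \<pi> ^ m"
    proof (rule has_sum_absv_le)
      fix k assume "k \<in> UNIV - {..<m}"
      then have "absv \<pi> ^ k \<le> absv \<pi> ^ m" using \<pi>_pos \<pi>_less_1 by (intro power_decreasing) auto
      then show "absv (?t i n k) \<le> absv \<pi> ^ m" using t_le[of k i n] by linarith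
    qed (use \<pi>_pos in auto)
    then show "absv ((h i - hm m i) $ n) \<le> absv \<pi> ^ m" by (simp add: h_def hm_nth)
  qed
  have rem: "f - frob_sum (hm m) = fps_const (\<pi> ^ m) * g m" for m
  proof (induction m)
    case 0
    have "frob_sum (hm 0) = 0" by (simp add: frob_sum_def hm_def)
    then show ?case by (simp add: g_0)
  next
    case (Suc m)
    have "hm (Suc m) = (\<lambda>i. hm m i + fps_const (\<pi> ^ m) * digit (g m) i)"
      by (auto simp: hm_def)
    then have "f - frob_sum (hm (Suc m)) = fps_const (\<pi> ^ m) * (g m - frob_sum (digit (g m)))"
      using Suc by (simp add: frob_sum_add frob_sum_cmult right_diff_distrib algebra_simps)
    also have "g m - frob_sum (digit (g m)) = fps_const \<pi> * g (Suc m)"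
      using \<pi>_nz by (simp add: g_Suc digit_step_def flip: mult.assoc)
    finally show ?case by (simp add: mult.commute flip: mult.assoc)
  qed
  have small: "gauss_le 1 (absv \<pi> ^ m) (f - frob_sum h)" for m
  proof -
    have eq: "f - frob_sum h = (f - frob_sum (hm m)) - frob_sum (\<lambda>i. h i - hm m i)"
      by (simp add: frob_sum_diff)
    have "gauss_le 1 (absv (\<pi> ^ m) * 1) (f - frob_sum (hm m))"
      unfolding rem using g by (intro gauss_le_const_mult) auto
    then have a: "gauss_le 1 (absv \<pi> ^ m) (f - frob_sum (hm m))" by (simp add: absv_power)
    have b: "gauss_le 1 (absv \<pi> ^ m) (frob_sum (\<lambda>i. h i - hm m i))"
      using tail \<pi>_pos by (intro frob_sum_gauss) auto
    show ?thesis unfolding eq by (rule gauss_le_diff[OF zero_le_one a b])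
  qed
  have "f - frob_sum h = 0"
  proof (rule fps_ext)
    fix n
    have "(\<lambda>m. absv \<pi> ^ m) \<longlonglongrightarrow> 0" using \<pi>_less_1 by (intro LIMSEQ_power_zero) auto
    then have "absv ((f - frob_sum h) $ n) \<le> 0"
      using small by (intro LIMSEQ_le_const) (auto simp: gauss_le_1 simp del: fps_sub_nth)
    then show "(f - frob_sum h) $ n = 0 $ n"
      by (metis absv_eq_0 absv_nonneg antisym fps_zero_nth)
  qed
  then have "f = frob_sum h" by simp
  moreover have "h i \<in> fps_over C" for i using s(1) by (simp add: h_def fps_over_def)
  moreover have "gauss_le 1 1 (h i)" for i using tail[of 0 i] by (simp add: hm_def)
  ultimately show ?thesis using that by blast
qed

section \<open>Fibres of [\<pi>] and torsion points\<close>

lemma frob_le: "absv v < 1 \<Longrightarrow> absv (fps_eval frob v) \<le> absv v"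
  by (rule fps_eval_tame_le[OF frob_over frob_tame])

lemma fps_eval_frob_sum:
  assumes C: "cfield C" "K \<subseteq> C" and h: "\<And>i. h i \<in> fps_over C" "\<And>i. gauss_le 1 1 (h i)"
    and v: "v \<in> C" "absv v < 1"
  shows "fps_eval (frob_sum h) v = (\<Sum>i<q. v ^ i * fps_eval (h i) (fps_eval frob v))"
proof -
  have fC: "frob \<in> fps_over C" by (rule fps_over_mono[OF frob_over C(2)])
  have comp: "h i oo frob \<in> fps_over C" "gauss_le 1 1 (h i oo frob)" for i
    using h fC by (auto intro: fps_over_intros[OF C(1)] gauss_le_compose frob_gauss)
  have X: "fps_X ^ i \<in> fps_over C" "gauss_le 1 (1 ^ i) (fps_X ^ i :: 'a fps)" for i
    by (auto intro: fps_over_intros[OF C(1)] intro!: gauss_le_power gauss_le_X simp del: power_one)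
  have X1: "fps_X \<in> fps_over C" "gauss_le 1 1 (fps_X :: 'a fps)"
    by (auto intro: fps_over_intros[OF C(1)] gauss_le_X)
  have "fps_eval (frob_sum h) v = (\<Sum>i<q. fps_eval (fps_X ^ i * (h i oo frob)) v)"
    unfolding frob_sum_def
    by (rule fps_eval_sum[OF C(1) v, where B = 1])
       (use comp X gauss_le_mult[OF _ X(2) comp(2)] in \<open>auto intro: fps_over_intros[OF C(1)]\<close>)
  also have "\<dots> = (\<Sum>i<q. v ^ i * fps_eval (h i) (fps_eval frob v))"
    by (simp add: fps_eval_mult[OF C(1) X(1) comp(1) v(1) X(2) comp(2) v(2)]
        fps_eval_power[OF C(1) X1(1) v(1) X1(2) v(2)]
        fps_eval_compose[OF C(1) h(1) fC v(1) h(2) frob_tame v(2)])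
  finally show ?thesis .
qed

lemma torsion_0: "torsion K \<pi> F 0 = {z. absv z < 1 \<and> fps_eval frob z = 0}"
  using fgl_endo_eq[OF \<pi>_K] \<pi>_less_1 by (simp add: torsion_def endo_\<pi>)

text \<open>Evaluating the \<open>h\<^sub>i\<close> at \<open>w\<close> gives the Weierstrass polynomial of \<open>[\<pi>](X) - w\<close>, whence the bound \<open>q\<close> on
  the number of its zeros.\<close>

lemma weierstrass_relation:
  "\<exists>h. (\<forall>i. h i \<in> fps_over K) \<and> (\<forall>i. gauss_le 1 1 (h i)) \<and> fps_X ^ q = frob_sum h"
proof -
  obtain h where "\<And>i. h i \<in> fps_over K" "\<And>i. gauss_le 1 1 (h i)" "fps_X ^ q = frob_sum h"
    using frob_sum_surj[OF cfield_K order_refl, of "fps_X ^ q"]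
      gauss_le_power[OF _ gauss_le_X[of 1], of q]
    by (auto intro: fps_over_intros[OF cfield_K])
  then show ?thesis by blast
qed

lemma endo_frob_eval:
  assumes "a \<in> K" "absv a \<le> 1" "absv x < 1"
  shows "fps_eval (endo a) (fps_eval frob x) = fps_eval frob (fps_eval (endo a) x)"
  using endo_mult_eval[OF assms(1,2) \<pi>_K less_imp_le[OF \<pi>_less_1] assms(3)]
    endo_mult_eval[OF \<pi>_K less_imp_le[OF \<pi>_less_1] assms(1,2,3)]
  by (simp add: endo_\<pi> mult.commute)

declare frob_0 [simp]

text \<open>Below the radius \<open>r\<close> the logarithm is injective, so \<open>[\<pi>]\<close> has no zero there but \<open>0\<close>.\<close>

lemma frob_zero_small: "absv x < r \<Longrightarrow> fps_eval frob x = 0 \<Longrightarrow> x = 0"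
proof -
  assume x: "absv x < r" "fps_eval frob x = 0"
  then have "logv x = 0" using logv_frob[of x] lt_log_0 \<pi>_nz by simp
  then have "expv (logv x) = 0" using lt_exp_tame by (simp add: tame_def)
  then show "x = 0" using expv_logv[OF x(1)] by simp
qed

text \<open>Apart from X^q, every term has a coefficient divisible by \<pi> and contains a factor
  x.\<close>

lemma frob_terms:
  assumes "absv x < 1"
  shows "absv (fps_eval frob x - frob $ q * x ^ q) \<le> absv \<pi> * absv x" "absv (frob $ q) = 1"
proof -
  obtain C where C: "cfield C" "K \<subseteq> C" "{x} \<subseteq> C" using cfield_containing[of "{x}"] by auto
  have "((\<lambda>n. frob $ n * x ^ n) has_sum fps_eval frob x) UNIV"
    by (rule fps_eval_has_sum(1)[OF C(1) fps_over_mono[OF frob_over C(2)] _ frob_gauss assms])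
       (use C in auto)
  moreover have "((\<lambda>n. frob $ n * x ^ n) has_sum (\<Sum>n\<in>{q}. frob $ n * x ^ n)) {q}"
    by (rule has_sum_finite) auto
  ultimately have "((\<lambda>n. frob $ n * x ^ n) has_sum (fps_eval frob x - (\<Sum>n\<in>{q}. frob $ n * x ^ n))) (UNIV - {q})"
    by (rule has_sum_Diff) auto
  then have "absv (fps_eval frob x - (\<Sum>n\<in>{q}. frob $ n * x ^ n)) \<le> absv \<pi> * absv x"
  proof (rule has_sum_absv_le)
    fix n assume n: "n \<in> UNIV - {q}"
    show "absv (frob $ n * x ^ n) \<le> absv \<pi> * absv x"
    proof (cases n)
      case 0
      then show ?thesis using frob_0 by simp
    next
      case (Suc m)
      have "absv x ^ m \<le> 1" using assms by (intro power_le_one) auto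
      then have "absv (frob $ n) * (absv x * absv x ^ m) \<le> absv \<pi> * (absv x * 1)"
        using frob_cong[of n] n
        by (intro mult_mono mult_left_mono) (auto simp: fps_X_power_nth)
      then show ?thesis by (simp add: absv_mult absv_power Suc)
    qed
  qed simp
  then show "absv (fps_eval frob x - frob $ q * x ^ q) \<le> absv \<pi> * absv x" by simp
  have "absv (1 + (frob $ q - 1)) = absv (1::'a)"
    using frob_cong[of q] \<pi>_less_1 by (intro absv_add_eq) (simp add: fps_X_power_nth)
  then show "absv (frob $ q) = 1" by simp
qed

text \<open>For |x| > r the inequality |\<pi>| < |x|^(q-1) makes the term X^q strictly
  dominant.\<close>

lemma absv_frob_large:
  assumes "r < absv x" "absv x < 1"
  shows "absv (fps_eval frob x) = absv x ^ q"
proof -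
  have "absv \<pi> < absv x ^ (q - 1)"
    unfolding r_power[symmetric] using assms r_pos q_ge_2 by (intro power_strict_mono) auto
  then have "absv \<pi> * absv x < absv x ^ (q - 1) * absv x"
    using assms r_pos by (intro mult_strict_right_mono) auto
  also have "\<dots> = absv x ^ q" using q_ge_2 by (cases q) auto
  finally have "absv (fps_eval frob x - frob $ q * x ^ q) < absv (frob $ q * x ^ q)"
    using frob_terms[OF assms(2)] by (simp add: absv_mult absv_power)
  from absv_add_eq[OF this] show ?thesis
    using frob_terms(2)[OF assms(2)] by (simp add: absv_mult absv_power)
qed

section \<open>The points u n\<close>

lemma u_0_frob: "absv (u 0) < 1" "fps_eval frob (u 0) = 0"
  using u_0 by (simp_all add: torsion_0)

lemma u_Suc_frob: "fps_eval frob (u (Suc n)) = u n"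
  using u_Suc(2) fgl_endo_eq[OF \<pi>_K] \<pi>_less_1 by (simp add: endo_\<pi>)

lemma u_less_1: "absv (u n) < 1"
  using u_0_frob u_Suc by (cases n) auto

text \<open>Beyond r the value of \<open>frob\<close> has absolute value |z|^q and is nonzero; below
  r the only zero is 0.\<close>

lemma absv_torsion: "z \<in> torsion K \<pi> F 0 \<Longrightarrow> z \<noteq> 0 \<Longrightarrow> absv z = r"
proof (rule antisym)
  assume z: "z \<in> torsion K \<pi> F 0" "z \<noteq> 0"
  then show "absv z \<le> r"
    using absv_frob_large[of z] by (cases "r < absv z") (auto simp: torsion_0)
  show "r \<le> absv z" using frob_zero_small[of z] z by (cases "absv z < r") (auto simp: torsion_0)
qed

lemma absv_u_0: "absv (u 0) = r"
  using absv_torsion u_0 by blast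

text \<open>If |u (Suc n)| were at most r, its image under \<open>frob\<close> would be at most
  |\<pi>| r < r, contrary to the bound for \<open>u n\<close>. So it lies beyond r, where X^q
  dominates.\<close>

lemma absv_u: "r \<le> absv (u n)" and absv_u_Suc: "absv (u (Suc n)) ^ q = absv (u n)"
proof -
  have *: "r < absv (u (Suc n))" if "r \<le> absv (u n)" for n
  proof (rule ccontr)
    assume "\<not> ?thesis"
    then have le: "absv (u (Suc n)) \<le> r" by simp
    have "u n = (fps_eval frob (u (Suc n)) - frob $ q * u (Suc n) ^ q) + frob $ q * u (Suc n) ^ q"
      by (simp add: u_Suc_frob)
    also have "absv \<dots> \<le> absv \<pi> * r"
    proof (rule absv_add_le)
      show "absv (fps_eval frob (u (Suc n)) - frob $ q * u (Suc n) ^ q) \<le> absv \<pi> * r"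
        using frob_terms(1)[OF u_less_1[of "Suc n"]] le mult_left_mono[OF le, of "absv \<pi>"] by simp
      have "absv (u (Suc n)) ^ q \<le> r ^ q" using le by (intro power_mono) auto
      also have "\<dots> = absv \<pi> * r" unfolding r_power[symmetric] using q_ge_2 by (cases q) auto
      finally show "absv (frob $ q * u (Suc n) ^ q) \<le> absv \<pi> * r"
        using frob_terms(2)[OF u_less_1[of "Suc n"]] by (simp add: absv_mult absv_power)
    qed
    also have "\<dots> < r" using r_pos \<pi>_less_1 by simp
    finally show False using that by simp
  qed
  have 1: "r \<le> absv (u n)" for n
    by (induction n) (use absv_u_0 * in \<open>auto intro: less_imp_le\<close>)
  show "r \<le> absv (u n)" by (rule 1)
  show "absv (u (Suc n)) ^ q = absv (u n)"
    by (rule absv_frob_large[OF *[OF 1, of n] u_less_1, unfolded u_Suc_frob, symmetric])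
qed

lemma endo_unit_nz:
  assumes "a \<in> K" "absv a = 1" "absv x < 1" "x \<noteq> 0"
  shows "fps_eval (endo a) x \<noteq> 0"
proof
  assume 0: "fps_eval (endo a) x = 0"
  have a: "a \<noteq> 0" "inverse a \<in> K" "absv (inverse a) \<le> 1"
    using assms by (auto simp: absv_inverse intro: cfield_intros[OF cfield_K])
  have "fps_eval (endo (inverse a)) (fps_eval (endo a) x) = x"
    using endo_mult_eval[of "inverse a" a x] a assms by (simp add: endo_one)
  then show False using 0 endo_0[OF a(2,3)] assms(4) by simp
qed

lemma endo_torsion:
  assumes "a \<in> K" "absv a \<le> 1" "z \<in> torsion K \<pi> F 0"
  shows "fps_eval (endo a) z \<in> torsion K \<pi> F 0"
  using assms endo_frob_eval[of a z] endo_le[of a z] endo_0[of a] by (auto simp: torsion_0)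

text \<open>Otherwise a - b is a unit, [a - b] is invertible, and it cannot kill the nonzero point
  \<open>x\<close>.\<close>

lemma endo_eq_imp_cong:
  assumes a: "a \<in> K" "absv a \<le> 1" and b: "b \<in> K" "absv b \<le> 1"
    and x: "absv x < 1" "x \<noteq> 0" and eq: "fps_eval (endo a) x = fps_eval (endo b) x"
  shows "absv (a - b) < 1"
proof (rule ccontr)
  assume "\<not> ?thesis"
  moreover have ab: "a - b \<in> K" "absv (a - b) \<le> 1"
    using a b by (auto intro: absv_diff_le cfield_intros[OF cfield_K])
  ultimately have 1: "absv (a - b) = 1" by simp
  have mb: "- b \<in> K" "absv (- b) \<le> 1" using b by (auto intro: cfield_intros[OF cfield_K])
  have "fps_eval (endo (a - b)) x = fps_eval (endo (b - b)) x"
    using endo_add_eval[OF a mb x(1)] endo_add_eval[OF b mb x(1)] eq by simp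
  then have "fps_eval (endo (a - b)) x = 0" by (simp add: endo_zero)
  then show False using endo_unit_nz[OF ab(1) 1 x] by simp
qed

text \<open>There are at most q such points, as roots of the Weierstrass polynomial for w = 0.
  Representatives of the q residue classes give q distinct ones of the form [a](u 0), so these
  exhaust the kernel.\<close>

lemma finite_torsion: "finite (torsion K \<pi> F 0)" and card_torsion: "card (torsion K \<pi> F 0) = q"
  and torsion_endo: "z \<in> torsion K \<pi> F 0 \<Longrightarrow> \<exists>a\<in>K. absv a \<le> 1 \<and> z = fps_eval (endo a) (u 0)"
proof -
  obtain h where h: "\<And>i. h i \<in> fps_over K" "\<And>i. gauss_le 1 1 (h i)" "fps_X ^ q = frob_sum h"
    using weierstrass_relation by blast
  let ?R = "{x. x ^ q = (\<Sum>i<q. h i $ 0 * x ^ i)}"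
  have sub: "torsion K \<pi> F 0 \<subseteq> ?R"
  proof
    fix z assume "z \<in> torsion K \<pi> F 0"
    then have z: "absv z < 1" "fps_eval frob z = 0" by (auto simp: torsion_0)
    obtain C where C: "cfield C" "K \<subseteq> C" "{z} \<subseteq> C" using cfield_containing[of "{z}"] by auto
    have "z ^ q = fps_eval (fps_X ^ q) z"
      using fps_eval_power[OF C(1) fps_over_intros(3)[OF C(1)] _ gauss_le_X[of 1] z(1), of q] C by simp
    also have "\<dots> = (\<Sum>i<q. z ^ i * fps_eval (h i) (fps_eval frob z))"
      unfolding h(3) using C z fps_over_mono[OF h(1) C(2)]
      by (intro fps_eval_frob_sum h) auto
    finally show "z \<in> ?R" by (simp add: z mult.commute)
  qed
  have R: "finite ?R" "card ?R \<le> q" by (rule finite_monic_roots)+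
  show fin: "finite (torsion K \<pi> F 0)" using sub R(1) by (rule finite_subset)
  define rep where "rep A = (SOME a. a \<in> K \<and> absv a \<le> 1 \<and> residue a = A)" for A
  have rep: "rep A \<in> K \<and> absv (rep A) \<le> 1 \<and> residue (rep A) = A" if "A \<in> carrier residue_ring" for A
    unfolding rep_def by (rule someI_ex) (use that in \<open>auto simp: residue_carrier\<close>)
  let ?g = "\<lambda>A. fps_eval (endo (rep A)) (u 0)"
  have inj: "inj_on ?g (carrier residue_ring)"
  proof (rule inj_onI)
    fix A B assume AB: "A \<in> carrier residue_ring" "B \<in> carrier residue_ring" "?g A = ?g B"
    let ?a = "rep A" and ?b = "rep B"
    have "absv (?a - ?b) < 1"
      by (rule endo_eq_imp_cong[OF _ _ _ _ u_0_frob(1) u_0(2) AB(3)]) (use rep AB in auto)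
    then have "residue (?b + (?a - ?b)) = residue ?b \<oplus>\<^bsub>residue_ring\<^esub> \<zero>\<^bsub>residue_ring\<^esub>"
      using rep[OF AB(1)] rep[OF AB(2)] residue_add[of ?b "?a - ?b"] residue_eq_zero_iff[of "?a - ?b"]
      by (auto intro: cfield_intros[OF cfield_K])
    also have "\<dots> = residue ?b"
    proof -
      interpret R: field residue_ring by (rule residue_field)
      show ?thesis using rep[OF AB(2)] AB(2) by simp
    qed
    finally show "A = B" using rep[OF AB(1)] rep[OF AB(2)] by simp
  qed
  have im: "?g ` carrier residue_ring \<subseteq> torsion K \<pi> F 0"
    using rep endo_torsion u_0(1) by blast
  have "card (?g ` carrier residue_ring) = q"
    using card_image[OF inj] by (simp add: residue_card_def)
  moreover have "card (torsion K \<pi> F 0) \<le> q" using card_mono[OF R(1) sub] R(2) by linarith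
  ultimately have eq: "?g ` carrier residue_ring = torsion K \<pi> F 0"
    using card_seteq[OF fin im] by simp
  then show "card (torsion K \<pi> F 0) = q" using \<open>card (?g ` carrier residue_ring) = q\<close> by simp
  show "\<exists>a\<in>K. absv a \<le> 1 \<and> z = fps_eval (endo a) (u 0)" if "z \<in> torsion K \<pi> F 0" for z
    using that rep unfolding eq[symmetric] by blast
qed

lemma fadd_fneg_cancel: "absv x < 1 \<Longrightarrow> absv y < 1 \<Longrightarrow> x \<oplus>\<^sub>F (fneg x \<oplus>\<^sub>F y) = y"
  using fadd_assoc[of x "fneg x" y] fneg_le[of x] fadd_fneg[of x] fadd_commute[of 0 y]
  by (simp add: fadd_0_right)

text \<open>On points \<open>frob\<close> is a group homomorphism, so its fibres are the cosets of
  its kernel.\<close>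

lemma frob_fibre:
  assumes v: "absv v < 1"
  shows "{x. absv x < 1 \<and> fps_eval frob x = fps_eval frob v} = (\<lambda>z. v \<oplus>\<^sub>F z) ` torsion K \<pi> F 0"
    and "inj_on (\<lambda>z. v \<oplus>\<^sub>F z) (torsion K \<pi> F 0)"
proof -
  have n: "absv (fneg v) < 1" using fneg_le[OF v] v by simp
  have ev: "absv (fps_eval frob v) < 1" using frob_le[OF v] v by simp
  show "{x. absv x < 1 \<and> fps_eval frob x = fps_eval frob v} = (\<lambda>z. v \<oplus>\<^sub>F z) ` torsion K \<pi> F 0"
  proof (intro equalityI subsetI)
    fix x assume "x \<in> {x. absv x < 1 \<and> fps_eval frob x = fps_eval frob v}"
    then have x: "absv x < 1" "fps_eval frob x = fps_eval frob v" by auto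
    have "fps_eval frob (fneg v) = fneg (fps_eval frob v)"
      unfolding fneg_def by (rule endo_frob_eval[OF minus_one_K v, symmetric])
    then have "fps_eval frob (fneg v \<oplus>\<^sub>F x) = fneg (fps_eval frob v) \<oplus>\<^sub>F fps_eval frob v"
      using frob_fadd[OF n x(1)] x(2) by simp
    also have "\<dots> = 0"
      using fadd_fneg[OF ev] fadd_commute[of "fps_eval frob v"] ev fneg_le[OF ev] by simp
    finally have "fneg v \<oplus>\<^sub>F x \<in> torsion K \<pi> F 0" using fadd_less[OF n x(1)] by (simp add: torsion_0)
    then show "x \<in> (\<lambda>z. v \<oplus>\<^sub>F z) ` torsion K \<pi> F 0"
      using fadd_fneg_cancel[OF v x(1)] by (intro image_eqI[of _ _ "fneg v \<oplus>\<^sub>F x"]) auto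
  next
    fix x assume "x \<in> (\<lambda>z. v \<oplus>\<^sub>F z) ` torsion K \<pi> F 0"
    then show "x \<in> {x. absv x < 1 \<and> fps_eval frob x = fps_eval frob v}"
      using v by (auto simp: torsion_0 fadd_less frob_fadd fadd_0_right)
  qed
  show "inj_on (\<lambda>z. v \<oplus>\<^sub>F z) (torsion K \<pi> F 0)"
    by (rule inj_onI) (use fadd_left_cancel[OF v] in \<open>auto simp: torsion_0\<close>)
qed

lemma torsion_Suc: "torsion K \<pi> F (Suc n) = {z. absv z < 1 \<and> fps_eval frob z \<in> torsion K \<pi> F n}"
proof -
  have pk: "\<pi> ^ k \<in> K" "absv (\<pi> ^ k) \<le> 1" for k
    using \<pi>_K \<pi>_less_1 by (auto intro: cfield_intros[OF cfield_K] absv_le_1_power)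
  have "fps_eval (endo (\<pi> ^ (n + 1))) (fps_eval frob z) = fps_eval (endo (\<pi> ^ (Suc n + 1))) z"
    if "absv z < 1" for z
    using endo_mult_eval[OF pk \<pi>_K _ that, of "n + 1"] \<pi>_less_1 by (simp add: endo_\<pi> mult_ac)
  moreover have "torsion K \<pi> F n = {z. absv z < 1 \<and> fps_eval (endo (\<pi> ^ (n + 1))) z = 0}" for n
    by (simp only: torsion_def fgl_endo_eq[OF pk])
  ultimately show ?thesis
    using le_less_trans[OF frob_le] by auto
qed

lemma u_torsion: "u n \<in> torsion K \<pi> F n"
  by (induction n) (use u_0 u_less_1 in \<open>auto simp: torsion_Suc u_Suc_frob\<close>)

text \<open>If [\<pi>](z) = [a](u n), then z and [a](u (Suc n)) differ by a point of the kernel,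
  which is itself [b c](u (Suc n)). Consequently K(u n) contains all the torsion of level n.\<close>

lemma torsion_eq_endo: "z \<in> torsion K \<pi> F n \<Longrightarrow> \<exists>a\<in>K. absv a \<le> 1 \<and> z = fps_eval (endo a) (u n)"
proof (induction n arbitrary: z)
  case 0
  then show ?case by (rule torsion_endo)
next
  case (Suc n)
  then obtain a where a: "a \<in> K" "absv a \<le> 1" "fps_eval frob z = fps_eval (endo a) (u n)"
    unfolding torsion_Suc by blast
  have z: "absv z < 1" using Suc.prems by (simp add: torsion_Suc)
  let ?v = "fps_eval (endo a) (u (Suc n))"
  have v: "absv ?v < 1" using endo_le[OF a(1,2) u_less_1] u_less_1 by (rule le_less_trans)
  have "fps_eval frob z = fps_eval frob ?v"
    using a(3) endo_frob_eval[OF a(1,2) u_less_1, of "Suc n"] by (simp add: u_Suc_frob)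
  then obtain t where t: "t \<in> torsion K \<pi> F 0" "z = ?v \<oplus>\<^sub>F t"
    using frob_fibre(1)[OF v] z by blast
  obtain b where b: "b \<in> K" "absv b \<le> 1" "t = fps_eval (endo b) (u 0)"
    using torsion_endo[OF t(1)] by blast
  \<comment> \<open>The \<open>c\<close> constructed here is \<pi>^m, because m applications of
    [\<pi>] take \<open>u m\<close> to \<open>u 0\<close>.\<close>
  have u0: "\<exists>c\<in>K. absv c \<le> 1 \<and> u 0 = fps_eval (endo c) (u m)" for m
  proof (induction m)
    case 0
    then show ?case using one_K by (intro bexI[of _ 1]) (auto simp: endo_one)
  next
    case (Suc m)
    then obtain c where c: "c \<in> K" "absv c \<le> 1" "u 0 = fps_eval (endo c) (u m)" by blast
    have "u 0 = fps_eval (endo (c * \<pi>)) (u (Suc m))"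
      using c endo_mult_eval[OF c(1,2) \<pi>_K _ u_less_1, of "Suc m"] \<pi>_less_1
      by (simp add: endo_\<pi> u_Suc_frob)
    moreover have "c * \<pi> \<in> K" "absv (c * \<pi>) \<le> 1"
      using c \<pi>_K \<pi>_less_1 by (auto simp: absv_mult mult_le_one intro: cfield_intros[OF cfield_K])
    ultimately show ?case by blast
  qed
  obtain c where c: "c \<in> K" "absv c \<le> 1" "u 0 = fps_eval (endo c) (u (Suc n))" using u0 by blast
  have "t = fps_eval (endo (b * c)) (u (Suc n))"
    using b c endo_mult_eval[OF b(1,2) c(1,2) u_less_1] by simp
  moreover have bc: "b * c \<in> K" "absv (b * c) \<le> 1"
    using b c by (auto simp: absv_mult mult_le_one intro: cfield_intros[OF cfield_K])
  ultimately have "z = fps_eval (endo (a + b * c)) (u (Suc n))"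
    using t(2) endo_add_eval[OF a(1,2) bc u_less_1] by simp
  moreover have "a + b * c \<in> K" "absv (a + b * c) \<le> 1"
    using a bc by (auto intro: absv_add_le cfield_intros[OF cfield_K])
  ultimately show ?case by blast
qed

end

section \<open>The fields of the tower and their conjugations\<close>

lemma absv_sum_distinct:
  fixes t :: "'i \<Rightarrow> 'a::nonarch_field"
  assumes "finite I" "I \<noteq> {}" "\<And>i j. i \<in> I \<Longrightarrow> j \<in> I \<Longrightarrow> i \<noteq> j \<Longrightarrow> absv (t i) \<noteq> absv (t j)"
  shows "\<exists>j\<in>I. absv (sum t I) = absv (t j)"
  using assms
proof (induction I rule: finite_ne_induct)
  case (insert i I)
  then obtain j where j: "j \<in> I" "absv (sum t I) = absv (t j)" by blast
  then have "absv (t i) \<noteq> absv (sum t I)" using insert by (metis insertI1 insertI2)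
  then consider "absv (t i) < absv (sum t I)" | "absv (sum t I) < absv (t i)" by linarith
  then show ?case
  proof cases
    case 1
    from absv_add_eq[OF this] have "absv (sum t (insert i I)) = absv (t j)"
      using insert j by (simp add: add.commute)
    then show ?thesis using j by blast
  next
    case 2
    from absv_add_eq[OF this] show ?thesis using insert by simp
  qed
qed auto

text \<open>Multiplication by \<open>x\<close> acts on coordinates by the companion matrix of its
  monic equation.\<close>

lemma power_shift_span:
  fixes x :: "'a::comm_ring_1"
  assumes "x ^ m = (\<Sum>i<m. b i * x ^ i)" "0 < m"
  shows "(\<Sum>i<m. c i * x ^ i) * x
    = (\<Sum>i<m. ((if i = 0 then 0 else c (i - 1)) + c (m - 1) * b i) * x ^ i)"
proof -
  obtain k where m: "m = Suc k" using assms(2) by (cases m) auto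
  have "(\<Sum>i<m. c i * x ^ i) * x = (\<Sum>i<k. c i * x ^ Suc i) + c k * x ^ m"
    by (simp add: m distrib_left sum_distrib_left mult_ac)
  also have "(\<Sum>i<k. c i * x ^ Suc i) = (\<Sum>i<m. (if i = 0 then 0 else c (i - 1)) * x ^ i)"
    unfolding m by (subst sum.lessThan_Suc_shift) simp
  also have "c k * x ^ m = (\<Sum>i<m. c (m - 1) * b i * x ^ i)"
  proof -
    have "c k * x ^ m = c k * (\<Sum>i<m. b i * x ^ i)" by (simp only: assms(1))
    also have "\<dots> = (\<Sum>i<m. c (m - 1) * b i * x ^ i)"
      by (simp only: sum_distrib_left mult.assoc m diff_Suc_1)
    finally show ?thesis .
  qed
  finally show ?thesis by (simp add: sum.distrib distrib_right)
qed

text \<open>\<open>simple_extension\<close> is generated by Horner steps \<open>k1 * x + k2\<close>,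
  and \<open>power_shift_span\<close> brings the degree below \<open>m\<close> again after each of
  them.\<close>

lemma simple_extension_span:
  fixes x :: "'a::nonarch_field"
  assumes C: "subfield C ambient" and S: "subfield (ring.simple_extension ambient C x) ambient"
    and b: "x ^ m = (\<Sum>i<m. b i * x ^ i)" "\<And>i. b i \<in> C" "0 < m"
  shows "ring.simple_extension ambient C x = {(\<Sum>i<m. c i * x ^ i) |c. \<forall>i. c i \<in> C}"
proof -
  interpret field "ambient :: 'a ring" by (rule field_ambient)
  note Cs = subfield_ambient[OF C]
  show ?thesis
  proof (intro equalityI subsetI)
    fix y assume "y \<in> simple_extension C x"
    then show "y \<in> {(\<Sum>i<m. c i * x ^ i) |c. \<forall>i. c i \<in> C}"
    proof (induction rule: simple_extension.induct)
      case zero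
      show ?case using Cs(1) by (auto intro!: exI[of _ "\<lambda>_. 0"])
    next
      case (lin k1 k2)
      then obtain c where c: "k1 = (\<Sum>i<m. c i * x ^ i)" "\<And>i. c i \<in> C" by blast
      let ?d = "\<lambda>i. ((if i = 0 then 0 else c (i - 1)) + c (m - 1) * b i) + (if i = 0 then k2 else 0)"
      have "k1 * x + k2 = (\<Sum>i<m. ((if i = 0 then 0 else c (i - 1)) + c (m - 1) * b i) * x ^ i)
          + (\<Sum>i<m. (if i = 0 then k2 else 0) * x ^ i)"
        using b(3) by (simp add: c(1) power_shift_span[OF b(1,3)] if_distrib[of "\<lambda>a. a * _"] sum.delta cong: if_cong)
      also have "\<dots> = (\<Sum>i<m. ?d i * x ^ i)"
        by (simp add: sum.distrib distrib_right)
      finally have "k1 * x + k2 = (\<Sum>i<m. ?d i * x ^ i)" .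
      moreover have "\<forall>i. ?d i \<in> C" using c(2) b(2) lin(2) Cs by auto
      ultimately show ?case by auto
    qed
  next
    fix y assume "y \<in> {(\<Sum>i<m. c i * x ^ i) |c. \<forall>i. c i \<in> C}"
    then obtain c where c: "y = (\<Sum>i<m. c i * x ^ i)" "\<And>i. c i \<in> C" by blast
    have "C \<subseteq> simple_extension C x" "x \<in> simple_extension C x"
      using simple_extension_incl[of C x] simple_extension_mem[OF subfieldE(1)[OF C], of x] by auto
    then show "y \<in> simple_extension C x"
      unfolding c(1) using c(2)
      by (intro subfield_ambient_sum[OF S] subfield_ambient(6)[OF S] subfield_ambient_power[OF S]) auto
  qed
qed

lemma power_int_inj_less_1:
  assumes "0 < (a::real)" "a < 1" "a powi k = a powi l"
  shows "k = l"
  using assms power_int_strict_decreasing[of k l a] power_int_strict_decreasing[of l k a]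
  by (metis less_irrefl linorder_neqE_linordered_idom)

context lubin_tate_tower
begin

text \<open>For a field M containing K this says that its ramification index over K divides
  \<open>d\<close>.\<close>

definition value_group :: "nat \<Rightarrow> 'a set \<Rightarrow> bool" where
  "value_group d M \<longleftrightarrow> (\<forall>x\<in>M. x \<noteq> 0 \<longrightarrow> (\<exists>k::int. absv x ^ d = absv \<pi> powi k))"

text \<open>With m the least exponent such that |\<pi>|^m < |x|, the quotient x / \<pi>^(m-1) has
  absolute value above |\<pi>| and at most 1, hence equal to 1.\<close>

lemma absv_K_power:
  assumes "x \<in> K" "x \<noteq> 0" "absv x \<le> 1"
  shows "\<exists>n. absv x = absv \<pi> ^ n"
proof -
  have "\<exists>m. absv \<pi> ^ m < absv x" using assms(2) \<pi>_less_1 by (intro real_arch_pow_inv) auto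
  define m where "m = (LEAST m. absv \<pi> ^ m < absv x)"
  have m: "absv \<pi> ^ m < absv x" unfolding m_def by (rule LeastI_ex) fact
  then obtain n where n: "m = Suc n" using assms(3) by (cases m) auto
  have le: "absv x \<le> absv \<pi> ^ n"
    using not_less_Least[of n "\<lambda>m. absv \<pi> ^ m < absv x"] n unfolding m_def by auto
  have p: "0 < absv \<pi> ^ n" using \<pi>_pos by simp
  have "x / \<pi> ^ n \<in> K" using assms \<pi>_K by (intro cfield_intros[OF cfield_K])
  moreover have "absv \<pi> < absv (x / \<pi> ^ n)"
    using m n p by (simp add: absv_divide absv_power pos_less_divide_eq)
  ultimately have "\<not> absv (x / \<pi> ^ n) < 1" using absv_less_1_imp_le by fastforce
  then have "absv x = absv \<pi> ^ n"
    using le p by (simp add: absv_divide absv_power not_less pos_le_divide_eq)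
  then show ?thesis by blast
qed

lemma value_group_K: "value_group 1 K"
  unfolding value_group_def
proof (intro ballI impI)
  fix x assume x: "x \<in> K" "x \<noteq> 0"
  show "\<exists>k::int. absv x ^ 1 = absv \<pi> powi k"
  proof (cases "absv x \<le> 1")
    case True
    then obtain n where "absv x = absv \<pi> ^ n" using absv_K_power x by blast
    then show ?thesis by (intro exI[of _ "int n"]) simp
  next
    case False
    then obtain n where "absv (inverse x) = absv \<pi> ^ n"
      using absv_K_power[of "inverse x"] x cfield_intros(7)[OF cfield_K]
      by (auto simp: absv_inverse inverse_le_1_iff)
    then have "absv x = inverse (absv \<pi> ^ n)" by (metis absv_inverse inverse_inverse_eq)
    then show ?thesis by (intro exI[of _ "- int n"]) (simp add: power_int_minus)
  qed
qed

text \<open>The terms \<open>c\<^sub>i x\<^sup>i\<close> have pairwise distinct absolute values, because the exponents of \<open>\<bar>\<pi>\<bar>\<close> are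
  distinct modulo \<open>m\<close>.\<close>

lemma value_group_span:
  assumes M: "value_group d M" and d: "0 < d" and m: "0 < m" and x: "absv x ^ (m * d) = absv \<pi>"
    and c: "\<And>i. i < m \<Longrightarrow> c i \<in> M" and i0: "i0 < m" "c i0 \<noteq> 0"
  shows "(\<Sum>i<m. c i * x ^ i) \<noteq> 0" "\<exists>k::int. absv (\<Sum>i<m. c i * x ^ i) ^ (m * d) = absv \<pi> powi k"
proof -
  define I where "I = {i. i < m \<and> c i \<noteq> 0}"
  have x0: "x \<noteq> 0" using x \<pi>_pos d m by (auto simp: power_0_left)
  have I: "finite I" "I \<noteq> {}" using i0 by (auto simp: I_def)
  have eq: "(\<Sum>i<m. c i * x ^ i) = (\<Sum>i\<in>I. c i * x ^ i)"
    unfolding I_def by (rule sum.mono_neutral_right) auto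
  have "\<forall>i\<in>I. \<exists>k::int. absv (c i) ^ d = absv \<pi> powi k"
    using M c by (auto simp: value_group_def I_def)
  then obtain k where k: "\<And>i. i \<in> I \<Longrightarrow> absv (c i) ^ d = absv \<pi> powi (k i :: int)" by metis
  have val: "absv (c i * x ^ i) ^ (m * d) = absv \<pi> powi (k i * int m + int i)" if "i \<in> I" for i
  proof -
    have "absv (c i * x ^ i) ^ (m * d) = (absv (c i) ^ d) ^ m * (absv x ^ (m * d)) ^ i"
      by (simp add: absv_mult absv_power power_mult_distrib mult_ac flip: power_mult)
    also have "\<dots> = (absv \<pi> powi k i) ^ m * absv \<pi> ^ i" by (simp add: k[OF that] x)
    also have "\<dots> = absv \<pi> powi (k i * int m + int i)"
      using \<pi>_pos by (simp add: power_int_add power_int_mult)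
    finally show ?thesis .
  qed
  have "absv (c i * x ^ i) \<noteq> absv (c j * x ^ j)" if ij: "i \<in> I" "j \<in> I" "i \<noteq> j" for i j
  proof
    assume "absv (c i * x ^ i) = absv (c j * x ^ j)"
    then have "absv \<pi> powi (k i * int m + int i) = absv \<pi> powi (k j * int m + int j)"
      using val ij by metis
    then have "k i * int m + int i = k j * int m + int j"
      by (rule power_int_inj_less_1[OF \<pi>_pos \<pi>_less_1])
    then have "(k i * int m + int i) mod int m = (k j * int m + int j) mod int m" by simp
    then have "int i mod int m = int j mod int m" by simp
    then show False using ij by (simp add: I_def)
  qed
  then obtain j where j: "j \<in> I" "absv (\<Sum>i\<in>I. c i * x ^ i) = absv (c j * x ^ j)"
    using absv_sum_distinct[OF I, of "\<lambda>i. c i * x ^ i"] by blast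
  show "\<exists>k::int. absv (\<Sum>i<m. c i * x ^ i) ^ (m * d) = absv \<pi> powi k"
    unfolding eq j(2) using val[OF j(1)] by blast
  have "absv (c j * x ^ j) \<noteq> 0" using j(1) x0 by (simp add: I_def)
  then show "(\<Sum>i<m. c i * x ^ i) \<noteq> 0" using j(2) eq by auto
qed

section \<open>The fields of the tower as simple extensions\<close>

lemma endo_in:
  assumes "a \<in> K" "absv a \<le> 1" "cfield C" "K \<subseteq> C" "x \<in> C" "absv x < 1"
  shows "fps_eval (endo a) x \<in> C"
  using fps_eval_has_sum(2)[OF assms(3) fps_over_mono[OF endo_over[OF assms(1,2)] assms(4)] assms(5)
      endo_gauss[OF assms(1,2)] assms(6)] .

text \<open>The torsion points of level n are values [a](u n). As K(u n) is complete, it contains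
  these sums of infinite series.\<close>

lemma level_eq: "level K \<pi> F n = ring.simple_extension ambient K (u n)"
  and cfield_level: "cfield (level K \<pi> F n)" and K_level: "K \<subseteq> level K \<pi> F n"
  and u_level: "u n \<in> level K \<pi> F n"
proof -
  interpret field "ambient :: 'a ring" by (rule field_ambient)
  note ext = cfield_simple_extension[OF cfield_K Qp_subset_K, of "u n"]
  have K: "subfield K ambient" by (rule subfield_K)
  show eq: "level K \<pi> F n = simple_extension K (u n)"
  proof
    have "torsion K \<pi> F n \<subseteq> simple_extension K (u n)"
      using torsion_eq_endo[of _ n] endo_in[OF _ _ ext u_less_1] by blast
    then show "level K \<pi> F n \<subseteq> simple_extension K (u n)"
      unfolding level_def using ext by (intro generate_field_min_subfield1) (auto simp: cfield_def)
    have "subfield (level K \<pi> F n) ambient" unfolding level_def by (rule generate_field_is_subfield) simp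
    then show "simple_extension K (u n) \<subseteq> level K \<pi> F n"
      using u_torsion[of n]
      by (intro simple_extension_subring_incl) (auto simp: level_def subfieldE(1) intro: generate_field.incl)
  qed
  show "cfield (level K \<pi> F n)" "K \<subseteq> level K \<pi> F n" "u n \<in> level K \<pi> F n"
    unfolding eq by (rule ext)+
qed

lemma level_mono: "level K \<pi> F n \<subseteq> level K \<pi> F (Suc n)"
proof -
  interpret field "ambient :: 'a ring" by (rule field_ambient)
  note f = fps_eval_has_sum(2)[OF cfield_level[of "Suc n"] fps_over_mono[OF frob_over K_level[of "Suc n"]]
      u_level[of "Suc n"] frob_gauss u_less_1[of "Suc n"]]
  then have "u n \<in> level K \<pi> F (Suc n)" by (simp add: u_Suc_frob)
  then show ?thesis
    unfolding level_eq[of n] using K_level[of "Suc n"] cfield_sub[OF cfield_level[of "Suc n"]]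
    by (intro simple_extension_subring_incl) (auto simp: subfieldE(1))
qed

lemma torsion_level: "torsion K \<pi> F 0 \<subseteq> level K \<pi> F n"
proof (induction n)
  case 0
  show ?case by (auto simp: level_def intro: generate_field.incl)
next
  case (Suc n)
  then show ?case using level_mono by blast
qed

lemma level_Suc: "level K \<pi> F (Suc n) = ring.simple_extension ambient (level K \<pi> F n) (u (Suc n))"
proof
  interpret field "ambient :: 'a ring" by (rule field_ambient)
  show "simple_extension (level K \<pi> F n) (u (Suc n)) \<subseteq> level K \<pi> F (Suc n)"
    using level_mono u_level[of "Suc n"] cfield_sub[OF cfield_level[of "Suc n"]]
    by (intro simple_extension_subring_incl) (auto simp: subfieldE(1))
  show "level K \<pi> F (Suc n) \<subseteq> simple_extension (level K \<pi> F n) (u (Suc n))"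
    unfolding level_eq[of "Suc n"] by (rule mono_simple_extension[OF K_level])
qed

lemma value_group_simple_extension:
  assumes M: "cfield M" "K \<subseteq> M" "value_group d M" and d: "0 < d" and m: "0 < m"
    and x: "absv x ^ (m * d) = absv \<pi>" and b: "x ^ m = (\<Sum>i<m. b i * x ^ i)" "\<And>i. b i \<in> M"
  shows "ring.simple_extension ambient M x = {(\<Sum>i<m. c i * x ^ i) |c. \<forall>i. c i \<in> M}"
    and "value_group (m * d) (ring.simple_extension ambient M x)"
proof -
  have "Qp \<subseteq> M" using M(2) Qp_subset_K by blast
  note ext = cfield_simple_extension[OF M(1) this, of x]
  show eq: "ring.simple_extension ambient M x = {(\<Sum>i<m. c i * x ^ i) |c. \<forall>i. c i \<in> M}"
    by (rule simple_extension_span[OF cfield_sub[OF M(1)] cfield_sub[OF ext(1)] b m])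
  show "value_group (m * d) (ring.simple_extension ambient M x)"
    unfolding eq value_group_def
  proof (intro ballI impI)
    fix y assume "y \<in> {(\<Sum>i<m. c i * x ^ i) |c. \<forall>i. c i \<in> M}" "y \<noteq> 0"
    then obtain c where c: "y = (\<Sum>i<m. c i * x ^ i)" "\<And>i. c i \<in> M" by blast
    have "\<exists>i<m. c i \<noteq> 0"
    proof (rule ccontr)
      assume "\<not> ?thesis"
      then have "y = 0" unfolding c(1) by (intro sum.neutral) auto
      then show False using \<open>y \<noteq> 0\<close> by simp
    qed
    then obtain i where "i < m" "c i \<noteq> 0" by blast
    then show "\<exists>k::int. absv y ^ (m * d) = absv \<pi> powi k"
      unfolding c(1) using value_group_span(2)[OF M(3) d m x] c(2) by blast
  qed
qed

lemma fps_eval_X_power: "absv (v::'a) < 1 \<Longrightarrow> fps_eval (fps_X ^ k) v = v ^ k"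
proof -
  assume v: "absv v < 1"
  obtain C where C: "cfield C" "K \<subseteq> C" "{v} \<subseteq> C" using cfield_containing[of "{v}"] by auto
  then show ?thesis
    using fps_eval_power[OF C(1) fps_over_intros(3)[OF C(1)] _ gauss_le_X[of 1] v, of k] by simp
qed

text \<open>The coefficients of the equation of degree \<open>q\<close> satisfied by all solutions of \<open>[\<pi>](x) = w\<close>.\<close>

definition wcoeff :: "nat \<Rightarrow> 'a fps" where
  "wcoeff = (SOME h. (\<forall>i. h i \<in> fps_over K) \<and> (\<forall>i. gauss_le 1 1 (h i)) \<and> fps_X ^ q = frob_sum h)"

lemma wcoeff:
  shows wcoeff_over: "wcoeff i \<in> fps_over K" and wcoeff_gauss: "gauss_le 1 1 (wcoeff i)"
    and X_power_q: "fps_X ^ q = frob_sum wcoeff"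
  using someI_ex[OF weierstrass_relation] unfolding wcoeff_def[symmetric] by blast+

lemma wcoeff_eval_in:
  "cfield C \<Longrightarrow> K \<subseteq> C \<Longrightarrow> w \<in> C \<Longrightarrow> absv w < 1 \<Longrightarrow> fps_eval (wcoeff i) w \<in> C"
  by (rule fps_eval_has_sum(2)[OF _ fps_over_mono[OF wcoeff_over] _ wcoeff_gauss])

lemma wcoeff_eval:
  assumes "absv v < 1"
  shows "v ^ q = (\<Sum>i<q. fps_eval (wcoeff i) (fps_eval frob v) * v ^ i)"
proof -
  obtain C where C: "cfield C" "K \<subseteq> C" "{v} \<subseteq> C" using cfield_containing[of "{v}"] by auto
  have "v ^ q = fps_eval (frob_sum wcoeff) v"
    using fps_eval_X_power[OF assms, of q] by (simp add: X_power_q)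
  also have "\<dots> = (\<Sum>i<q. v ^ i * fps_eval (wcoeff i) (fps_eval frob v))"
    using C by (intro fps_eval_frob_sum[OF C(1,2)] fps_over_mono[OF wcoeff_over C(2)] wcoeff_gauss assms) auto
  finally show ?thesis by (simp add: mult.commute)
qed

lemma q_pos: "0 < q" and q_minus_1_pos: "0 < q - 1"
  using q_ge_2 by auto

lemma absv_u_power: "absv (u n) ^ (q ^ n * (q - 1)) = absv \<pi>"
proof (induction n)
  case 0
  then show ?case by (simp add: absv_u_0 r_power[simplified])
next
  case (Suc n)
  have "absv (u (Suc n)) ^ (q ^ Suc n * (q - 1)) = (absv (u (Suc n)) ^ q) ^ (q ^ n * (q - 1))"
    by (simp add: mult.assoc flip: power_mult)
  then show ?case using Suc by (simp only: absv_u_Suc)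
qed

text \<open>Each step adjoins a root of a monic equation whose degree is the factor gained by
  \<open>d\<close>. At the bottom the equation for w = 0 has the root 0; cancelling a factor
  \<open>u 0\<close> leaves degree q - 1.\<close>

lemma value_group_level: "value_group (q ^ n * (q - 1)) (level K \<pi> F n)"
proof (induction n)
  case 0
  let ?c = "\<lambda>i. wcoeff i $ 0"
  have c0: "?c 0 = 0"
  proof -
    have "(0::'a) ^ q = (\<Sum>i<q. ?c i * 0 ^ i)" using wcoeff_eval[of 0] by simp
    also have "\<dots> = (\<Sum>i<q. if i = 0 then ?c i else 0)" by (intro sum.cong) auto
    also have "\<dots> = ?c 0" using q_pos by (simp add: sum.delta)
    finally show ?thesis using q_pos by (simp add: zero_power)
  qed
  obtain m where m: "q = Suc m" using q_pos by (cases q) auto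
  have "u 0 * u 0 ^ m = (\<Sum>i<Suc m. ?c i * u 0 ^ i)"
    using wcoeff_eval[OF u_0_frob(1)] u_0_frob(2) m by simp
  also have "\<dots> = u 0 * (\<Sum>i<m. ?c (Suc i) * u 0 ^ i)"
    by (subst sum.lessThan_Suc_shift) (simp add: c0 sum_distrib_left mult_ac)
  finally have rel: "u 0 ^ m = (\<Sum>i<m. ?c (Suc i) * u 0 ^ i)" using u_0(2) by simp
  have "value_group (m * 1) (ring.simple_extension ambient K (u 0))"
    by (rule value_group_simple_extension(2)[OF cfield_K order_refl value_group_K _ _ _ rel])
       (use m q_ge_2 absv_u_power[of 0] fps_overD[OF wcoeff_over] in auto)
  then show ?case by (simp add: level_eq m)
next
  case (Suc n)
  have "value_group (q * (q ^ n * (q - 1))) (ring.simple_extension ambient (level K \<pi> F n) (u (Suc n)))"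
  proof (rule value_group_simple_extension(2)[OF cfield_level K_level Suc _ q_pos])
    show "u (Suc n) ^ q = (\<Sum>i<q. fps_eval (wcoeff i) (u n) * u (Suc n) ^ i)"
      using wcoeff_eval[OF u_less_1[of "Suc n"]] by (simp only: u_Suc_frob)
    show "fps_eval (wcoeff i) (u n) \<in> level K \<pi> F n" for i
      by (rule wcoeff_eval_in[OF cfield_level K_level u_level u_less_1])
    show "0 < q ^ n * (q - 1)" using q_ge_2 by simp
    show "absv (u (Suc n)) ^ (q * (q ^ n * (q - 1))) = absv \<pi>"
      using absv_u_power[of "Suc n"] by (simp only: power_Suc mult.assoc)
  qed
  then show ?case by (simp only: level_Suc power_Suc mult.assoc)
qed

definition xi :: "'a \<Rightarrow> 'a fps" where "xi z = fps_subst2 F fps_X (fps_const z)"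

text \<open>At radius 1 the series X has Gauss norm 1, too large for \<open>fps_subst2\<close>. So
  smaller radii are used throughout, and the bound at radius 1 is their limit.\<close>

lemma xi:
  assumes C: "cfield C" "K \<subseteq> C" and z: "z \<in> C" "absv z < 1"
  shows xi_over: "xi z \<in> fps_over C" and xi_gauss: "gauss_le 1 1 (xi z)"
    and xi_eval: "y \<in> C \<Longrightarrow> absv y < 1 \<Longrightarrow> fps_eval (xi z) y = y \<oplus>\<^sub>F z"
    and xi_gauss_small: "0 < s \<Longrightarrow> s < 1 \<Longrightarrow> gauss_le s (max s (absv z)) (xi z)"
proof -
  have X: "gauss_le s (max s (absv z)) (fps_X :: 'a fps)" if "0 < s" for s
    using that by (intro gauss_le_mono[OF gauss_le_X]) auto
  have z': "gauss_le s (max s (absv z)) (fps_const z)" if "0 < s" for s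
    using that by (intro gauss_le_const) (auto simp: le_max_iff_disj)
  note sub = fps_subst2[OF C(1) F_overC[OF C(2)] F_gauss F_0 fps_over_intros(3)[OF C(1)] X
      fps_over_intros(4)[OF C(1) z(1)] z', folded xi_def]
  show over: "xi z \<in> fps_over C" using sub(1)[of "1/2"] z by simp
  show small: "gauss_le s (max s (absv z)) (xi z)" if "0 < s" "s < 1" for s
    using sub(2)[of s] that z by simp
  show "gauss_le 1 1 (xi z)"
    by (rule gauss_le_limit, rule gauss_le_mono[OF small]) (use z in auto)
  assume y: "y \<in> C" "absv y < 1"
  obtain s where s: "absv y < s" "s < 1" using dense[OF y(2)] by blast
  have "0 < s" using s(1) absv_nonneg[of y] by linarith
  then show "fps_eval (xi z) y = y \<oplus>\<^sub>F z" using sub(3)[of s y] s z y by simp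
qed

end

section \<open>Galois theory of one step of the tower\<close>

lemma galois_group_iff:
  fixes L :: "'a::nonarch_field set"
  shows "\<sigma> \<in> galois_group L M \<longleftrightarrow> \<sigma> \<in> extensional L \<and> bij_betw \<sigma> L L \<and>
    (\<forall>x\<in>L. \<forall>y\<in>L. \<sigma> (x + y) = \<sigma> x + \<sigma> y) \<and> (\<forall>x\<in>L. \<forall>y\<in>L. \<sigma> (x * y) = \<sigma> x * \<sigma> y) \<and>
    \<sigma> 1 = 1 \<and> (\<forall>x\<in>M. \<sigma> x = x)"
  unfolding galois_group_def ring_iso_def ring_hom_def
  by (auto simp: bij_betw_def)

context lubin_tate_tower
begin

context
  fixes n :: nat
begin

abbreviation (input) Ln :: "'a set" where "Ln \<equiv> level K \<pi> F (Suc n)"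
abbreviation (input) Mn :: "'a set" where "Mn \<equiv> level K \<pi> F n"
abbreviation (input) w :: 'a where "w \<equiv> u (Suc n)"
abbreviation (input) bc :: "nat \<Rightarrow> 'a" where "bc i \<equiv> fps_eval (wcoeff i) (u n)"

text \<open>By \<open>galois_bij\<close> below, these are the conjugates of \<open>u (Suc n)\<close>
  over \<open>level K \<pi> F n\<close>.\<close>

definition fibre :: "'a set" where "fibre = {x. absv x < 1 \<and> fps_eval frob x = u n}"

lemma fibre_eq: "fibre = (\<lambda>z. w \<oplus>\<^sub>F z) ` torsion K \<pi> F 0"
  using frob_fibre(1)[OF u_less_1[of "Suc n"]] by (simp add: fibre_def u_Suc_frob)

lemma fibre_inj: "inj_on (\<lambda>z. w \<oplus>\<^sub>F z) (torsion K \<pi> F 0)"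
  by (rule frob_fibre(2)[OF u_less_1])

lemma finite_fibre: "finite fibre" and card_fibre: "card fibre = q"
  using finite_torsion card_torsion card_image[OF fibre_inj] by (auto simp: fibre_eq)

lemma w_fibre: "w \<in> fibre"
  by (simp add: fibre_def u_less_1 u_Suc_frob)

lemma bc_in: "bc i \<in> Mn"
  by (rule wcoeff_eval_in[OF cfield_level K_level u_level u_less_1])

text \<open>The q points of the fibre satisfy an equation of degree q, which leaves no room for
  further roots.\<close>

lemma fibre_iff: "v \<in> fibre \<longleftrightarrow> v ^ q = (\<Sum>i<q. bc i * v ^ i)"
proof -
  let ?R = "{v. v ^ q = (\<Sum>i<q. bc i * v ^ i)}"
  have sub: "fibre \<subseteq> ?R"
  proof
    fix v assume "v \<in> fibre"
    then show "v \<in> ?R" using wcoeff_eval[of v] by (simp add: fibre_def)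
  qed
  have "?R = fibre"
    using card_seteq[OF finite_monic_roots(1) sub] finite_monic_roots(2)[of q bc] card_fibre by simp
  then show ?thesis by blast
qed

lemma fibre_level: "v \<in> fibre \<Longrightarrow> v \<in> Ln"
  unfolding fibre_eq
  using fadd_in[OF cfield_level K_level u_level _ u_less_1, of _ "Suc n"] torsion_level[of "Suc n"]
  by (auto simp: torsion_0)

text \<open>In the expansion of \<open>f\<close> the series in [\<pi>](X) take the same value, in
  \<open>Mn\<close>, at all points of the fibre. So one polynomial over \<open>Mn\<close> represents
  \<open>f\<close> there, and field automorphisms commute with \<open>f\<close> by pure
  algebra.\<close>

lemma fps_eval_fibre:
  assumes f: "f \<in> fps_over Mn" "gauss_le 1 1 f"
  obtains c where "\<And>i. c i \<in> Mn" "\<And>v. v \<in> fibre \<Longrightarrow> fps_eval f v = (\<Sum>i<q. c i * v ^ i)"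
proof -
  obtain h where h: "\<And>i. h i \<in> fps_over Mn" "\<And>i. gauss_le 1 1 (h i)" "f = frob_sum h"
    using frob_sum_surj[OF cfield_level K_level f] by blast
  show ?thesis
  proof (rule that)
    show "fps_eval (h i) (u n) \<in> Mn" for i
      by (rule fps_eval_has_sum(2)[OF cfield_level h(1) u_level h(2) u_less_1])
    fix v assume v: "v \<in> fibre"
    have "fps_eval f v = (\<Sum>i<q. v ^ i * fps_eval (h i) (fps_eval frob v))"
      unfolding h(3) using v fibre_level[OF v]
      by (intro fps_eval_frob_sum[OF cfield_level K_level fps_over_mono[OF h(1) level_mono] h(2)])
         (auto simp: fibre_def)
    then show "fps_eval f v = (\<Sum>i<q. fps_eval (h i) (u n) * v ^ i)"
      using v by (simp add: fibre_def mult.commute)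
  qed
qed

lemma level_span: "Ln = {(\<Sum>i<q. c i * w ^ i) |c. \<forall>i. c i \<in> Mn}"
proof -
  have a: "w ^ q = (\<Sum>i<q. bc i * w ^ i)" using w_fibre fibre_iff by blast
  have b: "0 < q ^ n * (q - 1)" using q_ge_2 by simp
  have c: "absv w ^ (q * (q ^ n * (q - 1))) = absv \<pi>"
    using absv_u_power[of "Suc n"] by (simp only: power_Suc mult.assoc)
  show ?thesis
    unfolding level_Suc
    by (rule value_group_simple_extension(1)[OF cfield_level K_level value_group_level b q_pos c a bc_in])
qed

text \<open>Total ramification: the terms of a nontrivial relation would have pairwise distinct
  absolute values.\<close>

lemma level_independent:
  assumes "\<And>i. c i \<in> Mn" "\<And>i. d i \<in> Mn" "(\<Sum>i<q. c i * w ^ i) = (\<Sum>i<q. d i * w ^ i)" "i < q"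
  shows "c i = d i"
proof (rule ccontr)
  assume "c i \<noteq> d i"
  have "(\<Sum>i<q. (c i - d i) * w ^ i) \<noteq> 0"
  proof (rule value_group_span(1)[OF value_group_level _ q_pos])
    show "0 < q ^ n * (q - 1)" using q_ge_2 by simp
    show "absv w ^ (q * (q ^ n * (q - 1))) = absv \<pi>"
      using absv_u_power[of "Suc n"] by (simp only: power_Suc mult.assoc)
    show "c j - d j \<in> Mn" for j using assms(1,2) by (intro cfield_intros[OF cfield_level])
    show "i < q" "c i - d i \<noteq> 0" using assms(4) \<open>c i \<noteq> d i\<close> by auto
  qed
  then show False using assms(3) by (simp add: left_diff_distrib sum_subtractf)
qed

text \<open>Only the entries with index below q are determined by \<open>y\<close>.\<close>

definition coord :: "'a \<Rightarrow> nat \<Rightarrow> 'a" where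
  "coord y = (SOME c. (\<forall>i. c i \<in> Mn) \<and> y = (\<Sum>i<q. c i * w ^ i))"

lemma coord: "y \<in> Ln \<Longrightarrow> coord y i \<in> Mn" "y \<in> Ln \<Longrightarrow> y = (\<Sum>i<q. coord y i * w ^ i)"
proof -
  assume "y \<in> Ln"
  then have "\<exists>c. (\<forall>i. c i \<in> Mn) \<and> y = (\<Sum>i<q. c i * w ^ i)" unfolding level_span by blast
  from someI_ex[OF this] show "coord y i \<in> Mn" "y = (\<Sum>i<q. coord y i * w ^ i)"
    unfolding coord_def by blast+
qed

text \<open>The conjugation over \<open>K\<^sub>n\<close> that moves \<open>u\<^sub>n\<^sub>+\<^sub>1\<close> to \<open>v\<close>.\<close>

definition conj :: "'a \<Rightarrow> 'a \<Rightarrow> 'a" where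
  "conj v = restrict (\<lambda>y. \<Sum>i<q. coord y i * v ^ i) Ln"

lemma conj_span:
  assumes "\<And>i. c i \<in> Mn"
  shows "(\<Sum>i<q. c i * w ^ i) \<in> Ln" "conj v (\<Sum>i<q. c i * w ^ i) = (\<Sum>i<q. c i * v ^ i)"
proof -
  let ?y = "\<Sum>i<q. c i * w ^ i"
  show L: "?y \<in> Ln" unfolding level_span using assms by blast
  have "coord ?y i = c i" if "i < q" for i
    by (rule level_independent[OF coord(1)[OF L] assms coord(2)[OF L, symmetric] that])
  then show "conj v ?y = (\<Sum>i<q. c i * v ^ i)" using L by (simp add: conj_def)
qed

text \<open>Multiplicativity reduces to multiplication by \<open>w\<close>. There it holds because
  \<open>v\<close> and \<open>w\<close> satisfy the same monic equation, so the companion formula is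
  the same for both.\<close>

lemma conj_hom:
  assumes v: "v \<in> fibre"
  shows conj_add: "x \<in> Ln \<Longrightarrow> y \<in> Ln \<Longrightarrow> conj v (x + y) = conj v x + conj v y"
    and conj_mult: "x \<in> Ln \<Longrightarrow> y \<in> Ln \<Longrightarrow> conj v (x * y) = conj v x * conj v y"
    and conj_fix: "c \<in> Mn \<Longrightarrow> conj v c = c"
    and conj_in: "x \<in> Ln \<Longrightarrow> conj v x \<in> Ln"
proof -
  note [intro] = cfield_intros[OF cfield_level]
  show add: "conj v (x + y) = conj v x + conj v y" if "x \<in> Ln" "y \<in> Ln" for x y
  proof -
    have eq: "x + y = (\<Sum>i<q. (coord x i + coord y i) * w ^ i)"
      using coord(2)[OF that(1)] coord(2)[OF that(2)] by (simp add: distrib_right sum.distrib)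
    have "conj v (x + y) = (\<Sum>i<q. (coord x i + coord y i) * v ^ i)"
      unfolding eq using coord(1)[OF that(1)] coord(1)[OF that(2)]
      by (intro conj_span cfield_intros(3)[OF cfield_level])
    then show ?thesis using that by (simp add: conj_def distrib_right sum.distrib)
  qed
  have smult: "conj v (c * x) = c * conj v x" if "c \<in> Mn" "x \<in> Ln" for c x
  proof -
    have eq: "c * x = (\<Sum>i<q. (c * coord x i) * w ^ i)"
      by (subst coord(2)[OF that(2)]) (simp add: sum_distrib_left mult.assoc)
    have "conj v (c * x) = (\<Sum>i<q. (c * coord x i) * v ^ i)"
      unfolding eq using coord(1)[OF that(2)] that(1)
      by (intro conj_span cfield_intros(6)[OF cfield_level])
    then show ?thesis using that by (simp add: conj_def sum_distrib_left mult.assoc)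
  qed
  have shift: "conj v (x * w) = conj v x * v" if "x \<in> Ln" for x
  proof -
    let ?c = "\<lambda>i. (if i = 0 then 0 else coord x (i - 1)) + coord x (q - 1) * bc i"
    have "x * w = (\<Sum>i<q. ?c i * w ^ i)"
      using power_shift_span[of w q bc "coord x"] w_fibre fibre_iff q_pos coord(2)[OF that] by simp
    moreover have "?c i \<in> Mn" for i using coord(1)[OF that] bc_in by auto
    ultimately have "conj v (x * w) = (\<Sum>i<q. ?c i * v ^ i)"
      using conj_span(2)[of ?c v] by simp
    also have "\<dots> = conj v x * v"
      using power_shift_span[of v q bc "coord x"] v fibre_iff q_pos that by (simp add: conj_def)
    finally show ?thesis .
  qed
  have wL: "w ^ k \<in> Ln" for k using u_level by auto
  have MnLn: "c \<in> Mn \<Longrightarrow> c \<in> Ln" for c using level_mono by blast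
  have pow: "conj v (x * w ^ k) = conj v x * v ^ k" if "x \<in> Ln" for x k
  proof (induction k)
    case (Suc k)
    have "conj v ((x * w ^ k) * w) = conj v (x * w ^ k) * v" using that wL by (intro shift) auto
    then show ?case using Suc by (simp add: mult_ac)
  qed simp
  have conj_sum: "conj v (\<Sum>i<k. f i) = (\<Sum>i<k. conj v (f i))" if "\<And>i. f i \<in> Ln" for f and k :: nat
  proof (induction k)
    case 0
    have "conj v (0 * 0) = 0 * conj v 0" by (rule smult) auto
    then show ?case by simp
  next
    case (Suc k)
    have "(\<Sum>i<k. f i) \<in> Ln" using that by auto
    then show ?case using add that Suc by simp
  qed
  show "conj v (x * y) = conj v x * conj v y" if "x \<in> Ln" "y \<in> Ln"
  proof -
    have "x * y = (\<Sum>i<q. coord y i * (x * w ^ i))"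
      by (subst coord(2)[OF that(2)]) (simp add: sum_distrib_left mult_ac)
    then have "conj v (x * y) = (\<Sum>i<q. conj v (coord y i * (x * w ^ i)))"
      using coord(1)[OF that(2)] wL that MnLn by (auto intro!: conj_sum)
    also have "\<dots> = (\<Sum>i<q. coord y i * (conj v x * v ^ i))"
      using coord(1)[OF that(2)] wL that by (intro sum.cong refl) (simp add: smult pow cfield_intros(6)[OF cfield_level])
    also have "\<dots> = conj v x * conj v y"
      using that by (simp add: conj_def sum_distrib_left mult_ac)
    finally show ?thesis .
  qed
  show "conj v c = c" if "c \<in> Mn"
  proof -
    have "(if i = 0 then c else 0) \<in> Mn" for i :: nat using that by auto
    from conj_span(2)[of "\<lambda>i. if i = 0 then c else 0", OF this, of v] show ?thesis
      using q_pos by (simp add: if_distrib[of "\<lambda>a. a * _"] sum.delta cong: if_cong)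
  qed
  show "conj v x \<in> Ln" if "x \<in> Ln"
    using that coord(1)[OF that] fibre_level[OF v] MnLn by (auto simp: conj_def)
qed

lemma conj_w: "v \<in> fibre \<Longrightarrow> conj v w = v"
proof -
  assume "v \<in> fibre"
  have "(if i = 1 then 1 else 0) \<in> Mn" for i :: nat using cfield_intros(1,2)[OF cfield_level] by auto
  from conj_span(2)[of "\<lambda>i. if i = 1 then 1 else 0", OF this, of v] show ?thesis
    using q_ge_2 by (simp add: if_distrib[of "\<lambda>a. a * _"] sum.delta cong: if_cong)
qed

text \<open>Only surjectivity has content: \<open>w\<close> is obtained from \<open>v\<close> by
  translation with the negative of a kernel point, which lies in \<open>Mn\<close>, so by
  \<open>fps_eval_fibre\<close> it is a polynomial in \<open>v\<close> over
  \<open>Mn\<close>.\<close>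

lemma conj_galois: "v \<in> fibre \<Longrightarrow> conj v \<in> galois_group Ln Mn"
proof -
  assume v: "v \<in> fibre"
  note [intro] = cfield_intros[OF cfield_level]
  note hom = conj_hom[OF v]
  have MnLn: "c \<in> Mn \<Longrightarrow> c \<in> Ln" for c using level_mono by blast
  have inj: "inj_on (conj v) Ln"
  proof (rule inj_onI)
    fix x y assume xy: "x \<in> Ln" "y \<in> Ln" "conj v x = conj v y"
    show "x = y"
    proof (rule ccontr)
      assume "x \<noteq> y"
      let ?d = "x + - 1 * y"
      have d: "?d \<in> Ln" "inverse ?d \<in> Ln" "- 1 * y \<in> Ln" using xy by auto
      have m1: "- 1 \<in> Mn" by auto
      have "conj v ?d = conj v x + conj v (- 1) * conj v y"
        using hom(1)[OF xy(1) d(3)] hom(2)[OF MnLn[OF m1] xy(2)] by simp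
      then have 0: "conj v ?d = 0" using hom(3)[OF m1] xy(3) by simp
      have "conj v (?d * inverse ?d) = 0" using hom(2)[OF d(1,2)] 0 by simp
      moreover have "?d * inverse ?d = 1" using \<open>x \<noteq> y\<close> by simp
      ultimately show False using hom(3)[of 1] by auto
    qed
  qed
  have surj: "conj v ` Ln = Ln"
  proof
    show "conj v ` Ln \<subseteq> Ln" using hom(4) by blast
    obtain z where z: "z \<in> torsion K \<pi> F 0" "v = w \<oplus>\<^sub>F z" using v unfolding fibre_eq by blast
    define z' where "z' = fneg z"
    have z1: "absv z < 1" using z by (simp add: torsion_0)
    have z': "z' \<in> Mn" "absv z' < 1"
      using endo_in[OF minus_one_K cfield_level K_level _ z1, of n] torsion_level[of n] z fneg_le[OF z1] z1
      by (auto simp: z'_def fneg_def)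
    have "w = v \<oplus>\<^sub>F z'"
      using fadd_assoc[OF u_less_1 z1 z'(2), of "Suc n"] z(2) fadd_fneg[OF z1]
      by (simp add: z'_def fadd_0_right)
    also have "\<dots> = fps_eval (xi z') v"
      using v fibre_level[OF v] z' level_mono
      by (intro xi_eval[OF cfield_level K_level, symmetric]) (auto simp: fibre_def)
    finally obtain c where c: "\<And>i. c i \<in> Mn" "w = (\<Sum>i<q. c i * v ^ i)"
      using fps_eval_fibre[OF xi_over[OF cfield_level K_level z'] xi_gauss[OF cfield_level K_level z']] v
      by metis
    \<comment> \<open>A preimage of \<open>w\<close>; replacing \<open>w\<close> by \<open>t\<close>
      in the coordinate expression of an element gives a preimage of that element.\<close>
    define t where "t = (\<Sum>i<q. c i * w ^ i)"
    have t: "t \<in> Ln" "conj v t = w" using conj_span(1)[where c = c, OF c(1)] conj_span(2)[where c = c and v = v, OF c(1)] c(2) by (auto simp: t_def)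
    have tk: "conj v (t ^ k) = w ^ k" for k
    proof (induction k)
      case 0
      show ?case using hom(3)[of 1] by auto
    next
      case (Suc k)
      then show ?case using hom(2)[of t "t ^ k"] t by (auto simp: cfield_intros(10)[OF cfield_level])
    qed
    show "Ln \<subseteq> conj v ` Ln"
    proof
      fix y assume y: "y \<in> Ln"
      have tL: "coord y i * t ^ i \<in> Ln" for i using coord(1)[OF y] t MnLn by auto
      have "conj v (\<Sum>i<k. coord y i * t ^ i) = (\<Sum>i<k. coord y i * w ^ i)" for k
      proof (induction k)
        case 0
        show ?case using hom(3)[of 0] by auto
      next
        case (Suc k)
        have "conj v (coord y k * t ^ k) = coord y k * w ^ k"
          using hom(2)[OF MnLn[OF coord(1)[OF y]], of "t ^ k" k] hom(3)[OF coord(1)[OF y], of k] tk[of k] t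
          by (auto simp: cfield_intros(10)[OF cfield_level])
        then show ?case using hom(1)[OF _ tL, of "\<Sum>i<k. coord y i * t ^ i" k] tL Suc
          by (auto simp: cfield_intros(9)[OF cfield_level])
      qed
      then have "y = conj v (\<Sum>i<q. coord y i * t ^ i)" using coord(2)[OF y] by simp
      then show "y \<in> conj v ` Ln" using tL by (auto intro!: imageI)
    qed
  qed
  show ?thesis
    unfolding galois_group_iff bij_betw_def
  proof (intro conjI ballI)
    show "conj v \<in> extensional Ln" by (simp add: conj_def)
    show "conj v 1 = 1" by (rule hom(3)) auto
  qed (use hom inj surj in auto)
qed

text \<open>An automorphism preserves the monic equation of \<open>w\<close>, so the image is again
  in the fibre, where values of power series are polynomial expressions.\<close>

lemma galois_fps_eval:
  assumes \<sigma>: "\<sigma> \<in> galois_group Ln Mn"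
  shows "\<sigma> w \<in> fibre" "\<And>c. (\<And>i. c i \<in> Mn) \<Longrightarrow> \<sigma> (\<Sum>i<q. c i * w ^ i) = (\<Sum>i<q. c i * \<sigma> w ^ i)"
    "\<And>f. f \<in> fps_over Mn \<Longrightarrow> gauss_le 1 1 f \<Longrightarrow> \<sigma> (fps_eval f w) = fps_eval f (\<sigma> w)"
proof -
  note [intro] = cfield_intros[OF cfield_level]
  have s: "\<And>x y. x \<in> Ln \<Longrightarrow> y \<in> Ln \<Longrightarrow> \<sigma> (x + y) = \<sigma> x + \<sigma> y"
    "\<And>x y. x \<in> Ln \<Longrightarrow> y \<in> Ln \<Longrightarrow> \<sigma> (x * y) = \<sigma> x * \<sigma> y" "\<sigma> 1 = 1" "\<And>x. x \<in> Mn \<Longrightarrow> \<sigma> x = x"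
    using \<sigma> unfolding galois_group_iff by blast+
  have MnLn: "c \<in> Mn \<Longrightarrow> c \<in> Ln" for c using level_mono by blast
  have pow: "\<sigma> (w ^ k) = \<sigma> w ^ k" for k
    by (induction k) (simp_all add: s(2,3) u_level cfield_intros(10)[OF cfield_level])
  have span: "\<sigma> (\<Sum>i<k. c i * w ^ i) = (\<Sum>i<k. c i * \<sigma> w ^ i)" if "\<And>i. c i \<in> Mn" for c and k :: nat
  proof (induction k)
    case 0
    show ?case using s(4)[of 0] by auto
  next
    case (Suc k)
    have "c i * w ^ i \<in> Ln" for i
      by (rule cfield_intros(6)[OF cfield_level MnLn[OF that] cfield_intros(10)[OF cfield_level u_level]])
    then have "\<sigma> ((\<Sum>i<k. c i * w ^ i) + c k * w ^ k) = \<sigma> (\<Sum>i<k. c i * w ^ i) + \<sigma> (c k * w ^ k)"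
      by (intro s(1)) auto
    moreover have "\<sigma> (c k * w ^ k) = c k * \<sigma> w ^ k"
      using s(2)[of "c k" "w ^ k"] that MnLn u_level pow s(4) by auto
    ultimately show ?case using Suc by simp
  qed
  show "\<sigma> (\<Sum>i<q. c i * w ^ i) = (\<Sum>i<q. c i * \<sigma> w ^ i)" if "\<And>i. c i \<in> Mn" for c
    by (rule span[OF that])
  have "w ^ q = (\<Sum>i<q. bc i * w ^ i)" using w_fibre fibre_iff by blast
  then have "\<sigma> w ^ q = (\<Sum>i<q. bc i * \<sigma> w ^ i)"
    using pow[of q] span[where k = q and c = "\<lambda>i. bc i", OF bc_in] by simp
  then show wf: "\<sigma> w \<in> fibre" using fibre_iff by blast
  show "\<sigma> (fps_eval f w) = fps_eval f (\<sigma> w)" if f: "f \<in> fps_over Mn" "gauss_le 1 1 f" for f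
  proof -
    obtain c where c: "\<And>i. c i \<in> Mn" "\<And>v. v \<in> fibre \<Longrightarrow> fps_eval f v = (\<Sum>i<q. c i * v ^ i)"
      using fps_eval_fibre[OF f] by blast
    show ?thesis using span[where k = q and c = c, OF c(1)] c(2) wf w_fibre by simp
  qed
qed

lemma galois_bij: "bij_betw (\<lambda>\<sigma>. \<sigma> w) (galois_group Ln Mn) fibre"
  unfolding bij_betw_def
proof
  show "inj_on (\<lambda>\<sigma>. \<sigma> w) (galois_group Ln Mn)"
  proof (rule inj_onI)
    fix \<sigma> \<tau> assume st: "\<sigma> \<in> galois_group Ln Mn" "\<tau> \<in> galois_group Ln Mn" "\<sigma> w = \<tau> w"
    show "\<sigma> = \<tau>"
    proof (rule extensionalityI)
      show "\<sigma> \<in> extensional Ln" "\<tau> \<in> extensional Ln" using st by (auto simp: galois_group_iff)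
      fix y assume y: "y \<in> Ln"
      have "\<sigma> (\<Sum>i<q. coord y i * w ^ i) = \<tau> (\<Sum>i<q. coord y i * w ^ i)"
        using galois_fps_eval(2)[OF st(1) coord(1)[OF y]] galois_fps_eval(2)[OF st(2) coord(1)[OF y]] st(3)
        by simp
      then show "\<sigma> y = \<tau> y" using coord(2)[OF y] by simp
    qed
  qed
  show "(\<lambda>\<sigma>. \<sigma> w) ` galois_group Ln Mn = fibre"
    using galois_fps_eval(1) conj_galois conj_w by (auto intro!: image_eqI[where x = "conj _"])
qed

end

section \<open>The Lubin-Tate trace as a sum over a fibre\<close>

lemma comm_monoid_points: "Group.comm_monoid (fgl_points F)"
  by (rule comm_monoidI)
     (auto simp: fgl_points_def fadd_less fadd_assoc fadd_commute[of 0] fadd_0_right intro: fadd_commute)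

lemma lt_trace_eq:
  assumes f: "f \<in> fps_over K" "gauss_le 1 1 f" "\<And>v. v \<in> fibre n \<Longrightarrow> absv (fps_eval f v) < 1"
  shows "lt_trace F (level K \<pi> F (Suc n)) (level K \<pi> F n) (fps_eval f (u (Suc n)))
    = finprod (fgl_points F) (fps_eval f) (fibre n)"
proof -
  interpret M: Group.comm_monoid "fgl_points F" by (rule comm_monoid_points)
  let ?G = "galois_group (level K \<pi> F (Suc n)) (level K \<pi> F n)"
  note bij = galois_bij[of n, unfolded bij_betw_def]
  have fM: "f \<in> fps_over (level K \<pi> F n)" using f(1) K_level by (rule fps_over_mono)
  have conj: "\<sigma> (u (Suc n)) \<in> fibre n" "\<sigma> (fps_eval f (u (Suc n))) = fps_eval f (\<sigma> (u (Suc n)))"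
    if "\<sigma> \<in> ?G" for \<sigma>
    using galois_fps_eval[OF that] fM f(2) by auto
  have "finprod (fgl_points F) (fps_eval f) (fibre n)
      = finprod (fgl_points F) (fps_eval f) ((\<lambda>\<sigma>. \<sigma> (u (Suc n))) ` ?G)"
    using bij by simp
  also have "\<dots> = finprod (fgl_points F) (\<lambda>\<sigma>. fps_eval f (\<sigma> (u (Suc n)))) ?G"
    using bij f(3) by (intro M.finprod_reindex) (auto simp: fgl_points_def)
  also have "\<dots> = finprod (fgl_points F) (\<lambda>\<sigma>. \<sigma> (fps_eval f (u (Suc n)))) ?G"
    by (intro M.finprod_cong') (auto simp: fgl_points_def conj f(3))
  finally show ?thesis by (simp add: lt_trace_def)
qed

text \<open>The third claim serves the case |\<pi>| < r. The second, agreement with the ordinary sum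
  to second order, takes its place when the values may reach the radius r.\<close>

lemma finprod_points_le:
  assumes "finite A" "\<And>v. v \<in> A \<Longrightarrow> absv (f v) \<le> B" "0 \<le> B" "B < 1"
  shows "absv (finprod (fgl_points F) f A) \<le> B"
    and "absv (finprod (fgl_points F) f A - sum f A) \<le> B ^ 2"
    and "B < r \<Longrightarrow> logv (finprod (fgl_points F) f A) = (\<Sum>v\<in>A. logv (f v))"
proof -
  interpret M: Group.comm_monoid "fgl_points F" by (rule comm_monoid_points)
  have "absv (finprod (fgl_points F) f A) \<le> B \<and> absv (finprod (fgl_points F) f A - sum f A) \<le> B ^ 2 \<and>
      (B < r \<longrightarrow> logv (finprod (fgl_points F) f A) = (\<Sum>v\<in>A. logv (f v)))"
    using assms(1,2)
  proof (induction A rule: finite_induct)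
    case empty
    have "finprod (fgl_points F) f {} = 0" using M.finprod_empty by (simp add: fgl_points_def)
    then show ?case using assms by (simp add: lt_log_0)
  next
    case (insert v A)
    let ?P = "finprod (fgl_points F) f A"
    have f: "f \<in> A \<rightarrow> carrier (fgl_points F)" "f v \<in> carrier (fgl_points F)"
      using insert.prems assms by (force simp: fgl_points_def)+
    have eq: "finprod (fgl_points F) f (insert v A) = f v \<oplus>\<^sub>F ?P"
      using M.finprod_insert[OF insert(1,2) f] by (simp add: fgl_points_def)
    have IH: "absv ?P \<le> B" "absv (?P - sum f A) \<le> B ^ 2"
      "B < r \<Longrightarrow> logv ?P = (\<Sum>v\<in>A. logv (f v))" and fv: "absv (f v) \<le> B"
      using insert by auto
    have "f v \<oplus>\<^sub>F ?P - sum f (insert v A) = (f v \<oplus>\<^sub>F ?P - (f v + ?P)) + (?P - sum f A)"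
      using insert(1,2) by simp
    also have "absv \<dots> \<le> B ^ 2"
      by (rule absv_add_le[OF fadd_diff_le[OF fv IH(1) assms(4)] IH(2)])
    finally show ?case
      unfolding eq using fadd_le[OF fv IH(1) assms(4)] IH(1,3) fv insert(1,2) logv_fadd[of "f v" ?P] by simp
  qed
  then show "absv (finprod (fgl_points F) f A) \<le> B"
    "absv (finprod (fgl_points F) f A - sum f A) \<le> B ^ 2"
    "B < r \<Longrightarrow> logv (finprod (fgl_points F) f A) = (\<Sum>v\<in>A. logv (f v))" by blast+
qed

end

section \<open>Coleman's trace\<close>

text \<open>The quotients \<open>p / (X - \<xi>)\<close> sum up to \<open>p'\<close>, since the difference has degree below the number of
  its zeros; comparing coefficients gives Newton's identities.\<close>

lemma newton_power_sums:
  fixes p :: "'b::idom poly" and \<xi> :: "'i \<Rightarrow> 'b"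
  assumes T: "finite T" "inj_on \<xi> T" "\<And>z. z \<in> T \<Longrightarrow> poly p (\<xi> z) = 0"
    and p: "degree p = card T" "lead_coeff p = 1"
    and S: "1 \<in> S" "\<And>x y. x \<in> S \<Longrightarrow> y \<in> S \<Longrightarrow> x - y \<in> S" "\<And>x y. x \<in> S \<Longrightarrow> y \<in> S \<Longrightarrow> x * y \<in> S"
      "\<And>i. coeff p i \<in> S"
    and k: "k < card T"
  shows "(\<Sum>z\<in>T. \<xi> z ^ k) \<in> S"
proof -
  define m where "m = card T"
  define D where "D z = synthetic_div p (\<xi> z)" for z
  have S0: "0 \<in> S" using S(2)[OF S(1) S(1)] by simp
  have Sadd: "x \<in> S \<Longrightarrow> y \<in> S \<Longrightarrow> x + y \<in> S" for x y using S(2)[of x "0 - y"] S(2)[OF S0, of y] by simp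
  have Ssum: "(\<And>i. i \<in> A \<Longrightarrow> f i \<in> S) \<Longrightarrow> sum f A \<in> S" for f :: "nat \<Rightarrow> 'b" and A
    by (induction A rule: infinite_finite_induct) (auto intro: S0 Sadd)
  have Snat: "of_nat j \<in> S" for j by (induction j) (auto intro: S0 Sadd S(1))
  have pD: "p = [:- \<xi> z, 1:] * D z" if "z \<in> T" for z
    using synthetic_div_correct'[of "\<xi> z" p] T(3)[OF that] by (simp add: D_def)
  have degD: "degree (D z) \<le> m - 1" for z by (simp add: D_def degree_synthetic_div p m_def)
  define G where "G = (\<Sum>z\<in>T. D z) - pderiv p"
  have "G = 0"
  proof (rule ccontr)
    assume G: "G \<noteq> 0"
    have roots: "poly G (\<xi> z) = 0" if z: "z \<in> T" for z
    proof -
      have "poly (D y) (\<xi> z) = 0" if "y \<in> T - {z}" for y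
      proof -
        have "0 = (\<xi> z - \<xi> y) * poly (D y) (\<xi> z)"
          using T(3)[OF z] that arg_cong[OF pD[of y], of "\<lambda>p. poly p (\<xi> z)"] by (simp add: algebra_simps)
        moreover have "\<xi> z \<noteq> \<xi> y" using T(2) that z by (auto dest: inj_onD)
        ultimately show ?thesis by simp
      qed
      then have "(\<Sum>y\<in>T. poly (D y) (\<xi> z)) = poly (D z) (\<xi> z)"
        by (subst sum.remove[OF T(1) z]) simp
      moreover have "poly (pderiv p) (\<xi> z) = poly (D z) (\<xi> z)"
        by (subst pD[OF z]) (simp only: pderiv_mult poly_add poly_mult, simp add: pderiv_pCons)
      ultimately show ?thesis by (simp add: G_def poly_sum)
    qed
    have "m \<le> card {x. poly G x = 0}"
      using card_mono[OF poly_roots_finite[OF G], of "\<xi> ` T"] roots card_image[OF T(2)]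
      by (auto simp: m_def)
    also have "\<dots> \<le> degree G" by (rule card_poly_roots_bound[OF G])
    also have "\<dots> \<le> m - 1"
    proof -
      have "degree (pderiv p) \<le> m - 1"
        by (rule degree_le) (auto simp: coeff_pderiv coeff_eq_0 p m_def)
      then show ?thesis
        unfolding G_def using degD by (intro degree_diff_le degree_sum_le T(1))
    qed
    finally show False using k by (simp add: m_def)
  qed
  \<comment> \<open>Horner's scheme: the coefficients of the quotient of p by X - \<xi> z, read from
    the top.\<close>
  have cD: "coeff (D z) (m - 1 - k) = (\<Sum>i\<le>k. coeff p (m - i) * \<xi> z ^ (k - i))"
    if "z \<in> T" "k < m" for z k
    using that(2)
  proof (induction k)
    case 0
    have "coeff p m = coeff (D z) (m - 1)"
      using arg_cong[OF pD[OF that(1)], of "\<lambda>p. coeff p m"] degD[of z] 0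
      by (cases m) (auto simp: coeff_eq_0 le_imp_less_Suc)
    then show ?case by simp
  next
    case (Suc k)
    obtain j where j: "m - 1 - Suc k = j" "m - Suc k = Suc j" using Suc.prems by (cases "m - Suc k") auto
    have step: "coeff p (Suc j) = coeff (D z) j - \<xi> z * coeff (D z) (Suc j)"
      by (subst pD[OF that(1)]) simp
    have j': "m - 1 - k = Suc j" using j(2) by simp
    have "coeff (D z) (m - 1 - Suc k) = coeff p (m - Suc k) + \<xi> z * coeff (D z) (m - 1 - k)"
      unfolding j j' by (rule eq_diff_eq[THEN iffD1, OF step, symmetric])
    also have "\<dots> = coeff p (m - Suc k) + \<xi> z * (\<Sum>i\<le>k. coeff p (m - i) * \<xi> z ^ (k - i))"
      using Suc by simp
    also have "\<xi> z * (\<Sum>i\<le>k. coeff p (m - i) * \<xi> z ^ (k - i)) = (\<Sum>i\<le>k. coeff p (m - i) * \<xi> z ^ (Suc k - i))"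
      unfolding sum_distrib_left by (intro sum.cong) (auto simp: Suc_diff_le)
    finally show ?case by simp
  qed
  let ?P = "\<lambda>k. \<Sum>z\<in>T. \<xi> z ^ k"
  have "?P k \<in> S" if "k < m" for k
    using that
  proof (induction k rule: less_induct)
    case (less k)
    have "(\<Sum>z\<in>T. coeff (D z) (m - 1 - k)) = coeff (pderiv p) (m - 1 - k)"
      using \<open>G = 0\<close> by (simp add: G_def flip: coeff_sum)
    also have "\<dots> = of_nat (m - k) * coeff p (m - k)"
      using less.prems by (simp add: coeff_pderiv Suc_diff_Suc)
    finally have "of_nat (m - k) * coeff p (m - k) = (\<Sum>z\<in>T. \<Sum>i\<le>k. coeff p (m - i) * \<xi> z ^ (k - i))"
      using cD[OF _ less.prems] by simp
    also have "\<dots> = (\<Sum>i\<le>k. coeff p (m - i) * ?P (k - i))"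
      by (subst sum.swap) (simp add: sum_distrib_left)
    also have "{..k} = insert 0 {1..k}" by auto
    also have "(\<Sum>i\<in>\<dots>. coeff p (m - i) * ?P (k - i)) = ?P k + (\<Sum>i=1..k. coeff p (m - i) * ?P (k - i))"
      using p by (simp add: m_def)
    \<comment> \<open>As \<open>p\<close> is monic, the power sum of index k occurs with coefficient
      1, next to power sums of smaller index.\<close>
    finally have "?P k = of_nat (m - k) * coeff p (m - k) - (\<Sum>i=1..k. coeff p (m - i) * ?P (k - i))"
      by simp
    also have "\<dots> \<in> S" using less by (intro S Ssum Snat) auto
    finally show ?case .
  qed
  then show ?thesis using k by (simp add: m_def)
qed

context lubin_tate_tower
begin

abbreviation (input) K0 :: "'a set" where "K0 \<equiv> level K \<pi> F 0"

section \<open>Translation by points of the kernel\<close>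

lemma torsion_K0: "z \<in> torsion K \<pi> F 0 \<Longrightarrow> z \<in> K0 \<and> absv z < 1"
  using torsion_level[of 0] by (auto simp: torsion_0)

lemma fps_subst_xi:
  assumes C: "cfield C" "K \<subseteq> C" and f: "f \<in> fps_over C" "gauss_le 1 B f" and z: "z \<in> C" "absv z < 1"
  shows "fps_subst f (xi z) \<in> fps_over C" "gauss_le 1 B (fps_subst f (xi z))"
    "y \<in> C \<Longrightarrow> absv y < 1 \<Longrightarrow> fps_eval (fps_subst f (xi z)) y = fps_eval f (y \<oplus>\<^sub>F z)"
    "((\<lambda>k. f $ k * (xi z ^ k) $ n) has_sum fps_subst f (xi z) $ n) UNIV"
proof -
  note sub = fps_subst[OF C(1) f xi_over[OF C z] xi_gauss_small[OF C z]]
  show "fps_subst f (xi z) \<in> fps_over C" by (rule sub(2)[of "1/2"]) (use z in auto)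
  show "((\<lambda>k. f $ k * (xi z ^ k) $ n) has_sum fps_subst f (xi z) $ n) UNIV"
    by (rule sub(1)[of "1/2"]) (use z in auto)
  show "gauss_le 1 B (fps_subst f (xi z))"
    by (rule gauss_le_limit, rule sub(3)) (use z in auto)
  assume y: "y \<in> C" "absv y < 1"
  obtain s where s: "absv y < s" "s < 1" using dense[OF y(2)] by blast
  have s0: "0 < s" using s(1) absv_nonneg[of y] by linarith
  show "fps_eval (fps_subst f (xi z)) y = fps_eval f (y \<oplus>\<^sub>F z)"
    using sub(5)[of s y] s s0 z y xi_eval[OF C z y] by simp
qed

definition coleman_sum :: "'a fps \<Rightarrow> 'a fps" where
  "coleman_sum f = (\<Sum>z\<in>torsion K \<pi> F 0. fps_subst f (xi z))"

lemma coleman_sum_add: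
  assumes "f \<in> fps_over K" "gauss_le 1 A f" "g \<in> fps_over K" "gauss_le 1 B g"
  shows "coleman_sum (f + g) = coleman_sum f + coleman_sum g"
proof -
  have "fps_subst (f + g) (xi z) = fps_subst f (xi z) + fps_subst g (xi z)" if z: "z \<in> torsion K \<pi> F 0" for z
  proof (rule fps_ext)
    fix n
    have z': "z \<in> K0" "absv z < 1" using torsion_K0[OF z] by auto
    have "((\<lambda>k. f $ k * (xi z ^ k) $ n + g $ k * (xi z ^ k) $ n) has_sum
        (fps_subst f (xi z) $ n + fps_subst g (xi z) $ n)) UNIV"
      by (intro has_sum_add fps_subst_xi(4)[OF cfield_level K_level fps_over_mono[OF assms(1) K_level] assms(2) z']
          fps_subst_xi(4)[OF cfield_level K_level fps_over_mono[OF assms(3) K_level] assms(4) z'])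
    from sums_unique[OF has_sum_imp_sums[OF this]]
    show "fps_subst (f + g) (xi z) $ n = (fps_subst f (xi z) + fps_subst g (xi z)) $ n"
      by (simp add: fps_subst_def distrib_right)
  qed
  then show ?thesis by (simp add: coleman_sum_def sum.distrib)
qed

lemma coleman_sum_cmult:
  assumes "f \<in> fps_over K" "gauss_le 1 A f"
  shows "coleman_sum (fps_const c * f) = fps_const c * coleman_sum f"
proof -
  have "fps_subst (fps_const c * f) (xi z) = fps_const c * fps_subst f (xi z)" if z: "z \<in> torsion K \<pi> F 0" for z
  proof (rule fps_ext)
    fix n
    have z': "z \<in> K0" "absv z < 1" using torsion_K0[OF z] by auto
    have "((\<lambda>k. c * (f $ k * (xi z ^ k) $ n)) has_sum (c * fps_subst f (xi z) $ n)) UNIV"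
      by (intro has_sum_cmult_right fps_subst_xi(4)[OF cfield_level K_level fps_over_mono[OF assms(1) K_level] assms(2) z'])
    from sums_unique[OF has_sum_imp_sums[OF this]]
    show "fps_subst (fps_const c * f) (xi z) $ n = (fps_const c * fps_subst f (xi z)) $ n"
      by (simp add: fps_subst_def mult.assoc)
  qed
  then show ?thesis by (simp add: coleman_sum_def sum_distrib_left)
qed

text \<open>[\<pi>] does not change under translation by a kernel point, so only the powers of X are
  translated. The values on the unit disc show it.\<close>

lemma fps_subst_frob_sum_xi:
  assumes h: "\<And>i. h i \<in> fps_over K" "\<And>i. gauss_le 1 1 (h i)" and z: "z \<in> torsion K \<pi> F 0"
  shows "fps_subst (frob_sum h) (xi z) = (\<Sum>i<q. xi z ^ i * (h i oo frob))"
proof (rule fps_eqI_eval[OF cfield_level _ _ _ _ zero_less_one, of _ 0])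
  note C = cfield_level[of 0] K_level[of 0]
  have z': "z \<in> K0" "absv z < 1" using torsion_K0[OF z] by auto
  have hC: "h i \<in> fps_over K0" for i by (rule fps_over_mono[OF h(1) C(2)])
  have over: "frob_sum h \<in> fps_over K0" by (rule frob_sum_over[OF C hC])
  have gauss: "gauss_le 1 1 (frob_sum h)" by (rule frob_sum_gauss) (use h in auto)
  note sub = fps_subst_xi[OF C over gauss z']
  show "fps_subst (frob_sum h) (xi z) \<in> fps_over K0" "gauss_le 1 1 (fps_subst (frob_sum h) (xi z))"
    by (rule sub)+
  have fC: "frob \<in> fps_over K0" by (rule fps_over_mono[OF frob_over C(2)])
  have hf: "h i oo frob \<in> fps_over K0" "gauss_le 1 1 (h i oo frob)" for i
    using hC h(2) fC by (auto intro: fps_over_intros[OF C(1)] gauss_le_compose frob_gauss)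
  note xo = xi_over[OF C z'] and xg = xi_gauss[OF C z']
  have xp: "xi z ^ i \<in> fps_over K0" "gauss_le 1 1 (xi z ^ i)" for i
    using fps_over_intros(9)[OF C(1) xo] gauss_le_power[OF _ xg, of i] by auto
  have term_over: "xi z ^ i * (h i oo frob) \<in> fps_over K0" and
    term_gauss: "gauss_le 1 1 (xi z ^ i * (h i oo frob))" for i
    using fps_over_intros(7)[OF C(1) xp(1) hf(1)] gauss_le_mult[OF _ xp(2) hf(2), of i i] by auto
  show "(\<Sum>i<q. xi z ^ i * (h i oo frob)) \<in> fps_over K0"
    by (intro fps_over_intros(10)[OF C(1)] term_over)
  show "gauss_le 1 1 (\<Sum>i<q. xi z ^ i * (h i oo frob))"
    by (intro gauss_le_sum term_gauss) auto
  show "\<exists>x\<in>K0. x \<noteq> 0 \<and> absv x < e" if "0 < e" for e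
    using K_nonzero_small[OF that] C(2) by blast
  fix y assume y: "y \<in> K0" "absv y < 1"
  have yz: "y \<oplus>\<^sub>F z \<in> K0" "absv (y \<oplus>\<^sub>F z) < 1" using fadd_in[OF C y(1) z'(1)] fadd_less y z' by auto
  have ey: "fps_eval frob (y \<oplus>\<^sub>F z) = fps_eval frob y"
    using frob_fadd[OF y(2) z'(2)] z by (simp add: torsion_0 fadd_0_right)
  have "fps_eval (fps_subst (frob_sum h) (xi z)) y = fps_eval (frob_sum h) (y \<oplus>\<^sub>F z)"
    by (rule sub(3)[OF y])
  also have "\<dots> = (\<Sum>i<q. (y \<oplus>\<^sub>F z) ^ i * fps_eval (h i) (fps_eval frob y))"
    using fps_eval_frob_sum[OF C hC h(2) yz] by (simp add: ey)
  also have "\<dots> = (\<Sum>i<q. fps_eval (xi z ^ i * (h i oo frob)) y)"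
    by (intro sum.cong refl)
       (simp add: fps_eval_mult[OF C(1) xp(1) hf(1) y(1) xp(2) hf(2) y(2)]
          fps_eval_power[OF C(1) xo y(1) xg y(2)] xi_eval[OF C z' y]
          fps_eval_compose[OF C(1) hC fC y(1) h(2) frob_tame y(2)])
  also have "\<dots> = fps_eval (\<Sum>i<q. xi z ^ i * (h i oo frob)) y"
    by (rule fps_eval_sum[OF C(1) y, symmetric]) (use term_over term_gauss in auto)
  finally show "fps_eval (fps_subst (frob_sum h) (xi z)) y = fps_eval (\<Sum>i<q. xi z ^ i * (h i oo frob)) y" .
qed

text \<open>The ring \<O>[[[\<pi>](X)]].\<close>

definition frob_image :: "'a fps set" where
  "frob_image = {h oo frob |h. h \<in> fps_over K \<and> gauss_le 1 1 h}"

lemma frob_image: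
  shows "1 \<in> frob_image" "x \<in> frob_image \<Longrightarrow> y \<in> frob_image \<Longrightarrow> x - y \<in> frob_image"
    "x \<in> frob_image \<Longrightarrow> y \<in> frob_image \<Longrightarrow> x + y \<in> frob_image"
    "x \<in> frob_image \<Longrightarrow> y \<in> frob_image \<Longrightarrow> x * y \<in> frob_image"
proof -
  have "1 = 1 oo frob" by simp
  then show "1 \<in> frob_image"
    unfolding frob_image_def using fps_over_intros(2)[OF cfield_K] gauss_le_one by blast
  assume "x \<in> frob_image" "y \<in> frob_image"
  then obtain g h where gh: "x = g oo frob" "y = h oo frob" "g \<in> fps_over K" "gauss_le 1 1 g"
    "h \<in> fps_over K" "gauss_le 1 1 h" unfolding frob_image_def by blast
  have "x - y = (g - h) oo frob" "g - h \<in> fps_over K" "gauss_le 1 1 (g - h)"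
    using gh by (auto simp: fps_compose_sub_distrib intro: fps_over_intros[OF cfield_K] gauss_le_diff)
  then show "x - y \<in> frob_image" unfolding frob_image_def by blast
  have "x + y = (g + h) oo frob" "g + h \<in> fps_over K" "gauss_le 1 1 (g + h)"
    using gh by (auto simp: fps_compose_add_distrib intro: fps_over_intros[OF cfield_K] gauss_le_add)
  then show "x + y \<in> frob_image" unfolding frob_image_def by blast
  have "x * y = (g * h) oo frob" "g * h \<in> fps_over K" "gauss_le 1 1 (g * h)"
    using gh gauss_le_mult[of 1 1 g 1 h]
    by (auto simp: fps_compose_mult_distrib intro: fps_over_intros[OF cfield_K])
  then show "x * y \<in> frob_image" unfolding frob_image_def by blast
qed

lemma xi_nth_0: "absv z < 1 \<Longrightarrow> xi z $ 0 = z"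
proof -
  assume z: "absv z < 1"
  obtain C where C: "cfield C" "K \<subseteq> C" "{z} \<subseteq> C" using cfield_containing[of "{z}"] by auto
  have "fps_eval (xi z) 0 = 0 \<oplus>\<^sub>F z"
    using C z by (intro xi_eval[OF C(1,2)]) (auto intro: cfield_intros)
  then show ?thesis using fadd_commute[of 0 z] z by (simp add: fadd_0_right)
qed

text \<open>The translates \<open>xi z\<close> are q roots, distinct by their constant terms, of the
  Weierstrass polynomial with w = [\<pi>](X). Its coefficients lie in \<open>frob_image\<close>, and
  Newton's identities carry this over to the power sums.\<close>

lemma power_sum_xi:
  assumes "k < q"
  shows "(\<Sum>z\<in>torsion K \<pi> F 0. xi z ^ k) \<in> frob_image"
proof -
  define P where "P = monom 1 q - (\<Sum>i<q. monom (wcoeff i oo frob) i)"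
  have coeff: "coeff P j = (if j = q then 1 else 0) - (if j < q then wcoeff j oo frob else 0)" for j
    by (auto simp: P_def coeff_sum sum.delta)
  have "degree P \<le> q" by (rule degree_le) (simp add: coeff)
  moreover have "coeff P q \<noteq> 0" by (simp add: coeff)
  ultimately have deg: "degree P = q" using le_degree[of P q] by simp
  have 0: "0 \<in> frob_image" using frob_image(2)[OF frob_image(1) frob_image(1)] by simp
  have w: "wcoeff j oo frob \<in> frob_image" for j
    unfolding frob_image_def using wcoeff_over wcoeff_gauss by blast
  show ?thesis
  proof (rule newton_power_sums[OF finite_torsion, where p = P])
    show "inj_on xi (torsion K \<pi> F 0)"
      by (rule inj_onI) (metis xi_nth_0 torsion_K0)
    show "degree P = card (torsion K \<pi> F 0)" "k < card (torsion K \<pi> F 0)"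
      using deg assms by (simp_all add: card_torsion)
    show "lead_coeff P = 1" by (simp add: deg coeff)
    show "coeff P i \<in> frob_image" for i
      unfolding coeff by (intro frob_image) (auto simp: 0 w frob_image(1))
    fix z assume z: "z \<in> torsion K \<pi> F 0"
    have z': "z \<in> K0" "absv z < 1" using torsion_K0[OF z] by auto
    have "fps_subst (fps_X ^ q) (xi z) = xi z ^ q"
    proof (rule fps_ext)
      fix n
      have "(\<Sum>k. (fps_X ^ q) $ k * (xi z ^ k) $ n) = (\<Sum>k\<in>{q}. (fps_X ^ q) $ k * (xi z ^ k) $ n)"
        by (rule suminf_finite) (auto simp: fps_X_power_nth)
      then show "fps_subst (fps_X ^ q) (xi z) $ n = (xi z ^ q) $ n"
        by (simp add: fps_subst_def)
    qed
    then have "xi z ^ q = (\<Sum>i<q. xi z ^ i * (wcoeff i oo frob))"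
      using fps_subst_frob_sum_xi[OF wcoeff_over wcoeff_gauss z] by (simp add: X_power_q)
    then show "poly P (xi z) = 0" by (simp add: P_def poly_monom poly_sum mult.commute)
  qed (use frob_image in auto)
qed

section \<open>Existence and properties of Coleman's trace\<close>

lemma frob_compose_inj: "h oo frob = h' oo frob \<Longrightarrow> h = h'"
proof -
  assume "h oo frob = h' oo frob"
  then have "(h - h') oo frob = 0" by (simp add: fps_compose_sub_distrib)
  moreover have "frob \<noteq> 0" using frob_1 \<pi>_nz by auto
  ultimately show ?thesis using fps_compose_eq_0_iff[of frob "h - h'"] by auto
qed

text \<open>Expanding \<open>f\<close> over 1, ..., X^(q-1) pulls the series in [\<pi>](X) out of
  the sum of translates and leaves the power sums of \<open>power_sum_xi\<close>. Uniqueness holds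
  because substitution of \<open>frob\<close> is injective.\<close>

lemma coleman_trace:
  assumes f: "f \<in> fps_over K" "gauss_le 1 1 f"
  shows coleman_trace_over: "coleman_trace K \<pi> F f \<in> fps_over K"
    and coleman_trace_gauss: "gauss_le 1 1 (coleman_trace K \<pi> F f)"
    and coleman_trace_frob: "coleman_trace K \<pi> F f oo frob = coleman_sum f"
proof -
  obtain h where h: "\<And>i. h i \<in> fps_over K" "\<And>i. gauss_le 1 1 (h i)" "f = frob_sum h"
    using frob_sum_surj[OF cfield_K order_refl f] by blast
  have "coleman_sum f = (\<Sum>z\<in>torsion K \<pi> F 0. \<Sum>i<q. xi z ^ i * (h i oo frob))"
    unfolding coleman_sum_def using fps_subst_frob_sum_xi[OF h(1,2)] by (simp add: h(3))
  also have "\<dots> = (\<Sum>i<q. (\<Sum>z\<in>torsion K \<pi> F 0. xi z ^ i) * (h i oo frob))"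
    by (subst sum.swap) (simp add: sum_distrib_right)
  also have "\<dots> \<in> frob_image"
  proof -
    have t: "(\<Sum>z\<in>torsion K \<pi> F 0. xi z ^ i) * (h i oo frob) \<in> frob_image" if "i < q" for i
      using power_sum_xi[OF that] h(1,2) by (intro frob_image(4)) (auto simp: frob_image_def)
    have 0: "0 \<in> frob_image" using frob_image(2)[OF frob_image(1) frob_image(1)] by simp
    have "(\<Sum>i<k. (\<Sum>z\<in>torsion K \<pi> F 0. xi z ^ i) * (h i oo frob)) \<in> frob_image" if "k \<le> q" for k
      using that by (induction k) (auto intro!: frob_image(3) 0 t)
    then show ?thesis by blast
  qed
  finally obtain H where H: "H \<in> fps_over K" "gauss_le 1 1 H" "H oo frob = coleman_sum f"
    unfolding frob_image_def by auto
  have "coleman_trace K \<pi> F f = H"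
    unfolding coleman_trace_def
  proof (rule the_equality)
    have *: "fgl_endo K F \<pi> = frob" using fgl_endo_eq[OF \<pi>_K] \<pi>_less_1 by (simp add: endo_\<pi>)
    show "H \<in> fps_over (val_ring K) \<and> H oo fgl_endo K F \<pi> =
        (\<Sum>z\<in>torsion K \<pi> F 0. fps_subst f (fps_subst2 F fps_X (fps_const z)))"
      using H by (simp add: fps_over_val_ring * coleman_sum_def xi_def)
    fix h assume "h \<in> fps_over (val_ring K) \<and> h oo fgl_endo K F \<pi> =
        (\<Sum>z\<in>torsion K \<pi> F 0. fps_subst f (fps_subst2 F fps_X (fps_const z)))"
    then have "h oo frob = H oo frob" using H(3) by (simp add: * coleman_sum_def xi_def)
    then show "h = H" by (rule frob_compose_inj)
  qed
  with H show "coleman_trace K \<pi> F f \<in> fps_over K" "gauss_le 1 1 (coleman_trace K \<pi> F f)"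
    "coleman_trace K \<pi> F f oo frob = coleman_sum f" by auto
qed

text \<open>Evaluation of the defining identity at \<open>u (Suc n)\<close>: its image under [\<pi>]
  is \<open>u n\<close>, and its translates by the kernel form the fibre.\<close>

lemma coleman_trace_eval:
  assumes f: "f \<in> fps_over K" "gauss_le 1 1 f"
  shows "fps_eval (coleman_trace K \<pi> F f) (u n) = (\<Sum>v\<in>fibre n. fps_eval f v)"
proof -
  let ?C = "level K \<pi> F (Suc n)" and ?w = "u (Suc n)"
  note C = cfield_level[of "Suc n"] K_level[of "Suc n"]
  note w = u_level[of "Suc n"] u_less_1[of "Suc n"]
  have fC: "f \<in> fps_over ?C" by (rule fps_over_mono[OF f(1) C(2)])
  have z: "z \<in> ?C" "absv z < 1" if "z \<in> torsion K \<pi> F 0" for z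
    using that torsion_level[of "Suc n"] by (auto simp: torsion_0)
  have "fps_eval (coleman_trace K \<pi> F f) (u n) = fps_eval (coleman_trace K \<pi> F f oo frob) ?w"
    using fps_eval_compose_tame[OF coleman_trace_over[OF f] frob_over coleman_trace_gauss[OF f] frob_tame w(2)]
    by (simp add: u_Suc_frob)
  also have "\<dots> = fps_eval (coleman_sum f) ?w" by (simp add: coleman_trace_frob[OF f])
  also have "\<dots> = (\<Sum>z\<in>torsion K \<pi> F 0. fps_eval (fps_subst f (xi z)) ?w)"
    unfolding coleman_sum_def
    by (rule fps_eval_sum[OF C(1) w]) (use fps_subst_xi(1,2)[OF C fC f(2) z] in auto)
  also have "\<dots> = (\<Sum>z\<in>torsion K \<pi> F 0. fps_eval f (?w \<oplus>\<^sub>F z))"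
    using fps_subst_xi(3)[OF C fC f(2) z w] by simp
  also have "\<dots> = (\<Sum>v\<in>fibre n. fps_eval f v)"
    unfolding fibre_eq by (simp add: sum.reindex[OF fibre_inj])
  finally show ?thesis .
qed

lemma coleman_trace_add:
  assumes "f \<in> fps_over K" "gauss_le 1 1 f" "g \<in> fps_over K" "gauss_le 1 1 g"
  shows "coleman_trace K \<pi> F (f + g) = coleman_trace K \<pi> F f + coleman_trace K \<pi> F g"
proof (rule frob_compose_inj)
  have fg: "f + g \<in> fps_over K" "gauss_le 1 1 (f + g)"
    using assms by (auto intro: fps_over_intros[OF cfield_K] gauss_le_add)
  show "coleman_trace K \<pi> F (f + g) oo frob = (coleman_trace K \<pi> F f + coleman_trace K \<pi> F g) oo frob"
    using coleman_sum_add[OF assms]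
    by (simp add: fps_compose_add_distrib coleman_trace_frob assms fg)
qed

lemma coleman_trace_cmult:
  assumes "f \<in> fps_over K" "gauss_le 1 1 f" "c \<in> K" "absv c \<le> 1"
  shows "coleman_trace K \<pi> F (fps_const c * f) = fps_const c * coleman_trace K \<pi> F f"
proof (rule frob_compose_inj)
  have cf: "fps_const c * f \<in> fps_over K" "gauss_le 1 1 (fps_const c * f)"
    using assms gauss_le_mono[OF gauss_le_const_mult[OF assms(2), of c], of 1]
    by (auto intro: fps_over_intros[OF cfield_K])
  show "coleman_trace K \<pi> F (fps_const c * f) oo frob = (fps_const c * coleman_trace K \<pi> F f) oo frob"
    using coleman_sum_cmult[OF assms(1,2), of c]
    by (simp add: coleman_trace_frob assms cf flip: fps_const_mult_apply_left)
qed

text \<open>If |u m|^l \<le> M for all m, then |\<pi>|^l, being the power of |u m|^l with exponent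
  q^m (q - 1), would be at most M^m for every m, hence 0.\<close>

lemma absv_u_power_large:
  assumes "M < 1" shows "\<exists>m. M < absv (u m) ^ l"
proof (rule ccontr)
  assume "\<not> ?thesis"
  then have le: "absv (u m) ^ l \<le> M" for m by (auto simp: not_less)
  have M0: "0 \<le> M" using le[of 0] zero_le_power[of "absv (u 0)" l] absv_nonneg[of "u 0"] by linarith
  have "r ^ ((q - 1) * l) \<le> M ^ m" for m
  proof -
    have "absv \<pi> ^ l = (absv (u m) ^ l) ^ (q ^ m * (q - 1))"
      using absv_u_power[of m] by (simp add: mult.commute flip: power_mult) (metis mult.commute power_mult)
    also have "\<dots> \<le> M ^ (q ^ m * (q - 1))" by (intro power_mono le) auto
    also have "\<dots> \<le> M ^ m"
    proof (rule power_decreasing)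
      have "m \<le> 2 ^ m" by (rule less_imp_le[OF less_exp])
      also have "\<dots> \<le> q ^ m" using q_ge_2 by (intro power_mono) auto
      also have "\<dots> \<le> q ^ m * (q - 1)" using q_minus_1_pos by simp
      finally show "m \<le> q ^ m * (q - 1)" .
    qed (use M0 assms in auto)
    finally show ?thesis by (simp only: power_mult r_power)
  qed
  moreover have "(\<lambda>m. M ^ m) \<longlonglongrightarrow> 0" using M0 assms by (intro LIMSEQ_power_zero) auto
  ultimately have "r ^ ((q - 1) * l) \<le> 0" by (intro LIMSEQ_le_const) auto
  then show False using zero_less_power[OF r_pos, of "(q - 1) * l"] by linarith
qed

text \<open>If some coefficient is a unit, the first such coefficient, with index \<open>l\<close>, dominates the value at
  \<open>u\<^sub>n\<close> for large \<open>n\<close>, which then has absolute value \<open>\<bar>u\<^sub>n\<bar>\<^sup>l\<close>.\<close>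

lemma gauss_le_\<pi>_of_values:
  assumes f: "f \<in> fps_over K" "gauss_le 1 1 f" and c: "c < 1" "\<And>n. absv (fps_eval f (u n)) \<le> c"
  shows "gauss_le 1 (absv \<pi>) f"
proof (rule ccontr)
  assume "\<not> ?thesis"
  then obtain l0 where l0: "\<not> absv (f $ l0) \<le> absv \<pi>" by (auto simp: gauss_le_1)
  define l where "l = (LEAST l. \<not> absv (f $ l) \<le> absv \<pi>)"
  have l: "\<not> absv (f $ l) \<le> absv \<pi>" "\<And>k. k < l \<Longrightarrow> absv (f $ k) \<le> absv \<pi>"
    unfolding l_def using l0 by (rule LeastI) (use not_less_Least in blast)
  have fl: "absv (f $ l) = 1"
    using l(1) absv_less_1_imp_le[OF fps_overD[OF f(1), of l]] f(2)
    by (meson gauss_le_1 not_less_iff_gr_or_eq not_le)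
  obtain m where m: "max (absv \<pi>) c < absv (u m) ^ l"
    using absv_u_power_large[of "max (absv \<pi>) c" l] c(1) \<pi>_less_1 by auto
  let ?x = "u m"
  have x: "0 < absv ?x" "absv ?x < 1" using absv_u[of m] r_pos u_less_1[of m] by auto
  have "((\<lambda>k. f $ k * ?x ^ k) has_sum fps_eval f ?x) UNIV"
    by (rule fps_eval_has_sum(1)[OF cfield_level fps_over_mono[OF f(1) K_level] u_level f(2) x(2)])
  moreover have "((\<lambda>k. f $ k * ?x ^ k) has_sum (\<Sum>k\<in>{l}. f $ k * ?x ^ k)) {l}"
    by (rule has_sum_finite) auto
  ultimately have "((\<lambda>k. f $ k * ?x ^ k) has_sum (fps_eval f ?x - (\<Sum>k\<in>{l}. f $ k * ?x ^ k))) (UNIV - {l})"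
    by (rule has_sum_Diff) auto
  then have "absv (fps_eval f ?x - (\<Sum>k\<in>{l}. f $ k * ?x ^ k)) \<le> max (absv \<pi>) (absv ?x ^ (l + 1))"
  proof (rule has_sum_absv_le)
    fix k assume "k \<in> UNIV - {l}"
    then consider "k < l" | "l + 1 \<le> k" by fastforce
    then show "absv (f $ k * ?x ^ k) \<le> max (absv \<pi>) (absv ?x ^ (l + 1))"
    proof cases
      case 1
      have "absv (f $ k) * absv ?x ^ k \<le> absv \<pi> * 1"
        using l(2)[OF 1] x by (intro mult_mono power_le_one) auto
      then show ?thesis by (simp add: absv_mult absv_power)
    next
      case 2
      have "absv (f $ k) * absv ?x ^ k \<le> 1 * absv ?x ^ (l + 1)"
        using f(2) x 2 by (intro mult_mono power_decreasing) (auto simp: gauss_le_1)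
      then show ?thesis by (simp add: absv_mult absv_power)
    qed
  qed (simp add: le_max_iff_disj)
  also have "\<dots> < absv ?x ^ l" using m x by simp
  finally have "absv (fps_eval f ?x - f $ l * ?x ^ l) < absv (f $ l * ?x ^ l)"
    using fl by (simp add: absv_mult absv_power)
  from absv_add_eq[OF this] have "absv (fps_eval f ?x) = absv ?x ^ l"
    using fl by (simp add: absv_mult absv_power)
  then show False using c(2)[of m] m by simp
qed

text \<open>The previous lemma applied to f / \<pi>^j. It is the induction step of every argument
  that divides by \<pi> repeatedly.\<close>

lemma gauss_le_\<pi>_power_Suc:
  assumes f: "f \<in> fps_over K" "gauss_le 1 (absv \<pi> ^ j) f"
    and c: "\<And>n. absv (fps_eval f (u n)) \<le> absv \<pi> ^ Suc j"
  shows "gauss_le 1 (absv \<pi> ^ Suc j) f"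
proof -
  let ?g = "fps_const (1 / \<pi> ^ j) * f"
  have pj: "0 < absv \<pi> ^ j" using \<pi>_pos by simp
  have g: "?g \<in> fps_over K"
    using f \<pi>_K by (auto intro!: fps_over_intros[OF cfield_K] cfield_intros[OF cfield_K])
  have g1: "gauss_le 1 1 ?g"
    using gauss_le_const_mult[OF f(2), of "1 / \<pi> ^ j"] \<pi>_nz by (simp add: absv_divide absv_power)
  have "gauss_le 1 (absv \<pi>) ?g"
  proof (rule gauss_le_\<pi>_of_values[OF g g1 \<pi>_less_1])
    fix n
    have "fps_eval ?g (u n) = 1 / \<pi> ^ j * fps_eval f (u n)"
      by (rule fps_eval_cmult[OF cfield_level fps_over_mono[OF f(1) K_level] u_level f(2) u_less_1])
    then show "absv (fps_eval ?g (u n)) \<le> absv \<pi>"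
      using c[of n] pj by (simp add: absv_mult absv_divide absv_power divide_le_eq)
  qed
  then have *: "gauss_le 1 (absv (\<pi> ^ j) * absv \<pi>) (fps_const (\<pi> ^ j) * ?g)"
    by (rule gauss_le_const_mult)
  have eq: "fps_const (\<pi> ^ j) * ?g = f" using \<pi>_nz by (simp flip: mult.assoc)
  show ?thesis using *[unfolded eq] by (simp add: absv_power mult.commute)
qed

lemma fps_eq_0_of_small: "(\<And>j. gauss_le 1 (absv \<pi> ^ Suc j) f) \<Longrightarrow> f = 0"
proof (rule fps_ext)
  fix n assume *: "\<And>j. gauss_le 1 (absv \<pi> ^ Suc j) f"
  have "(\<lambda>j. absv \<pi> ^ Suc j) \<longlonglongrightarrow> 0"
    using \<pi>_less_1 by (intro LIMSEQ_Suc LIMSEQ_power_zero) auto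
  then have "absv (f $ n) \<le> 0"
    using * by (intro LIMSEQ_le_const) (auto simp: gauss_le_1)
  then show "f $ n = 0 $ n" by simp
qed

text \<open>Zero values permit division by \<pi> any number of times. The points \<open>u n\<close>
  do not accumulate at 0, so the identity theorem above does not apply.\<close>

lemma fps_eq_0_of_u_values:
  assumes f: "f \<in> fps_over K" "gauss_le 1 1 f" and 0: "\<And>n. fps_eval f (u n) = 0"
  shows "f = 0"
proof (rule fps_eq_0_of_small)
  have "gauss_le 1 (absv \<pi> ^ j) f" for j
    by (induction j) (use f 0 gauss_le_\<pi>_power_Suc in auto)
  then show "gauss_le 1 (absv \<pi> ^ Suc j) f" for j by blast
qed

end

section \<open>The isomorphism\<close>

lemma fps_subst_zero: "h $ 0 = 0 \<Longrightarrow> fps_subst h 0 = 0"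
  by (simp add: fps_subst_eq_compose fps_compose_nth fps_eq_iff power_0_left)

lemma absv_power_diff_le:
  assumes "absv x \<le> 1" "absv (y::'a::nonarch_field) \<le> 1"
  shows "absv (x ^ k - y ^ k) \<le> absv (x - y)"
proof (induction k)
  case (Suc k)
  have "x ^ Suc k - y ^ Suc k = x * (x ^ k - y ^ k) + (x - y) * y ^ k"
    by (simp add: algebra_simps)
  also have "absv \<dots> \<le> absv (x - y)"
  proof (rule absv_add_le)
    have "absv x * absv (x ^ k - y ^ k) \<le> 1 * absv (x - y)"
      using assms Suc by (intro mult_mono) auto
    then show "absv (x * (x ^ k - y ^ k)) \<le> absv (x - y)" by (simp add: absv_mult)
    have "absv (x - y) * absv y ^ k \<le> absv (x - y) * 1"
      using assms by (intro mult_left_mono power_le_one) auto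
    then show "absv ((x - y) * y ^ k) \<le> absv (x - y)" by (simp add: absv_mult absv_power)
  qed
  finally show ?case .
qed simp

context lubin_tate_tower
begin

section \<open>Series with coefficients in \<pi>\<O>\<close>

definition piO :: "'a fps set" where
  "piO = {f \<in> fps_over K. gauss_le 1 (absv \<pi>) f}"

lemma piO_gauss_1: "f \<in> piO \<Longrightarrow> gauss_le 1 1 f"
  using gauss_le_mono \<pi>_less_1 by (fastforce simp: piO_def)

lemma piO_eval_le:
  assumes "f \<in> piO" "absv x < 1" shows "absv (fps_eval f x) \<le> absv \<pi>"
proof -
  obtain C where C: "cfield C" "K \<subseteq> C" "{x} \<subseteq> C" using cfield_containing[of "{x}"] by auto
  show ?thesis
    using fps_eval_has_sum(3)[OF C(1) fps_over_mono[OF _ C(2)] _ _ assms(2)] assms(1) C(3)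
    by (auto simp: piO_def)
qed

definition ratio :: 'a where "ratio = of_nat q / \<pi>"

lemma ratio: "ratio \<in> K" "absv ratio \<le> 1"
  using absv_q_le \<pi>_pos \<pi>_K
  by (auto simp: ratio_def absv_divide intro: cfield_intros[OF cfield_K])

lemma E_set_iff: "g \<in> E_set K \<pi> F \<longleftrightarrow> g \<in> piO \<and> coleman_trace K \<pi> F g = fps_const ratio * g"
  by (simp add: E_set_def fps_over_\<pi>_val_ring piO_def ratio_def)

lemma E_set_add: "f \<in> E_set K \<pi> F \<Longrightarrow> g \<in> E_set K \<pi> F \<Longrightarrow> f + g \<in> E_set K \<pi> F"
  using coleman_trace_add[of f g] piO_gauss_1
  by (auto simp: E_set_iff piO_def distrib_left intro: fps_over_intros[OF cfield_K] gauss_le_add)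

lemma E_set_cmult: "a \<in> K \<Longrightarrow> absv a \<le> 1 \<Longrightarrow> g \<in> E_set K \<pi> F \<Longrightarrow> fps_const a * g \<in> E_set K \<pi> F"
proof -
  assume a: "a \<in> K" "absv a \<le> 1" and g: "g \<in> E_set K \<pi> F"
  then have g': "g \<in> fps_over K" "gauss_le 1 (absv \<pi>) g" "gauss_le 1 1 g"
    using piO_gauss_1 by (auto simp: E_set_iff piO_def)
  have "absv a * absv \<pi> \<le> 1 * absv \<pi>" using a by (intro mult_right_mono) auto
  then have "fps_const a * g \<in> piO"
    using a g' gauss_le_mono[OF gauss_le_const_mult[OF g'(2), of a]]
    by (auto simp: piO_def intro: fps_over_intros[OF cfield_K])
  then show ?thesis
    using coleman_trace_cmult[OF g'(1,3) a] g by (simp add: E_set_iff mult.left_commute)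
qed

lemma zero_E_set: "0 \<in> E_set K \<pi> F"
proof -
  have "coleman_trace K \<pi> F (fps_const 0 * 0) = fps_const 0 * coleman_trace K \<pi> F 0"
    using cfield_intros(1)[OF cfield_K]
    by (intro coleman_trace_cmult) (auto intro: fps_over_intros[OF cfield_K] gauss_le_zero)
  then show ?thesis by (auto simp: E_set_iff piO_def intro: fps_over_intros[OF cfield_K] gauss_le_zero)
qed

lemma trace_seqs_iff:
  assumes f: "f \<in> piO"
  shows "(\<lambda>n. fps_eval f (u n)) \<in> trace_seqs K \<pi> F \<longleftrightarrow>
    (\<forall>n. finprod (fgl_points F) (fps_eval f) (fibre n) = fps_eval (endo ratio) (fps_eval f (u n)))"
proof -
  have f': "f \<in> fps_over K" "gauss_le 1 1 f" using f piO_gauss_1 by (auto simp: piO_def)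
  have less: "absv (fps_eval f x) < 1" if "absv x < 1" for x
    using piO_eval_le[OF f that] \<pi>_less_1 by simp
  have "fps_eval f (u n) \<in> max_ideal (level K \<pi> F n)" for n
    using fps_eval_has_sum(2)[OF cfield_level fps_over_mono[OF f'(1) K_level] u_level f'(2) u_less_1]
      less[OF u_less_1] by (simp add: max_ideal_def)
  moreover have "fgl_endo K F (of_nat q / \<pi>) = endo ratio"
    using fgl_endo_eq[OF ratio] by (simp add: ratio_def)
  moreover have "lt_trace F (level K \<pi> F (Suc n)) (level K \<pi> F n) (fps_eval f (u (Suc n)))
      = finprod (fgl_points F) (fps_eval f) (fibre n)" for n
    by (rule lt_trace_eq[OF f']) (auto simp: fibre_def intro: less)
  ultimately show ?thesis by (simp add: trace_seqs_def)
qed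

text \<open>From here on only the product over the fibre remains: neither the Galois group nor the
  supremum occurs any more.\<close>

lemma A_set_iff:
  "f \<in> A_set K \<pi> F u \<longleftrightarrow> f \<in> piO \<and>
    (\<forall>n. finprod (fgl_points F) (fps_eval f) (fibre n) = fps_eval (endo ratio) (fps_eval f (u n)))"
proof -
  have sup: "(SUP n. absv (fps_eval f (u n))) < 1" if "f \<in> piO"
  proof -
    have "(SUP n. absv (fps_eval f (u n))) \<le> absv \<pi>"
      using piO_eval_le[OF that u_less_1] by (intro cSUP_least) auto
    then show ?thesis using \<pi>_less_1 by simp
  qed
  have piO: "f \<in> piO" if f: "f \<in> A_set K \<pi> F u"
  proof -
    have f': "f \<in> fps_over K" "gauss_le 1 1 f" "(SUP n. absv (fps_eval f (u n))) < 1"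
      using f by (auto simp: A_set_def fps_over_val_ring)
    have le: "absv (fps_eval f (u n)) \<le> 1" for n
      by (rule fps_eval_has_sum(3)[OF cfield_level fps_over_mono[OF f'(1) K_level] u_level f'(2) u_less_1])
    have "absv (fps_eval f (u n)) \<le> (SUP n. absv (fps_eval f (u n)))" for n
      by (rule cSUP_upper) (use le in \<open>auto intro!: bdd_aboveI[of _ 1]\<close>)
    then have "gauss_le 1 (absv \<pi>) f" by (rule gauss_le_\<pi>_of_values[OF f'])
    then show ?thesis using f'(1) by (simp add: piO_def)
  qed
  show ?thesis
  proof (cases "f \<in> piO")
    case True
    have "f \<in> fps_over (val_ring K)"
      using piO_gauss_1[OF True] True by (simp add: fps_over_val_ring piO_def)
    then show ?thesis unfolding A_set_def using sup[OF True] trace_seqs_iff[OF True] True by simp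
  next
    case False
    then show ?thesis using piO by blast
  qed
qed

text \<open>The algebraic part of the theorem: the structure of \<^const>\<open>A_set\<close> is transported from
  \<^const>\<open>E_set\<close> along the logarithm of an ambient set of series.\<close>

lemma module_iso_log:
  assumes A: "A_set K \<pi> F u = {f \<in> S. fps_subst lt_log f \<in> E_set K \<pi> F}"
    and E: "E_set K \<pi> F \<subseteq> S"
    and log: "\<And>f. f \<in> S \<Longrightarrow> fps_subst lt_exp (fps_subst lt_log f) = f"
    and exp: "\<And>g. g \<in> S \<Longrightarrow> fps_subst lt_exp g \<in> S" "\<And>g. g \<in> S \<Longrightarrow> fps_subst lt_log (fps_subst lt_exp g) = g"
    and add: "\<And>f g. f \<in> S \<Longrightarrow> g \<in> S \<Longrightarrow> fps_subst2 F f g \<in> S"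
      "\<And>f g. f \<in> S \<Longrightarrow> g \<in> S \<Longrightarrow> fps_subst lt_log (fps_subst2 F f g) = fps_subst lt_log f + fps_subst lt_log g"
    and smult: "\<And>a f. a \<in> K \<Longrightarrow> absv a \<le> 1 \<Longrightarrow> f \<in> S \<Longrightarrow> fps_subst (endo a) f \<in> S"
      "\<And>a f. a \<in> K \<Longrightarrow> absv a \<le> 1 \<Longrightarrow> f \<in> S \<Longrightarrow>
        fps_subst lt_log (fps_subst (endo a) f) = fps_const a * fps_subst lt_log f"
  shows "fps_subst lt_log \<in> module_iso (O_ring K) (A_module K \<pi> F u) (E_module K \<pi> F) \<and>
         fps_subst lt_exp \<in> carrier (E_module K \<pi> F) \<rightarrow> carrier (A_module K \<pi> F u) \<and>
         (\<forall>f\<in>carrier (A_module K \<pi> F u). fps_subst lt_exp (fps_subst lt_log f) = f) \<and>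
         (\<forall>g\<in>carrier (E_module K \<pi> F). fps_subst lt_log (fps_subst lt_exp g) = g)"
proof -
  let ?A = "A_module K \<pi> F u" and ?E = "E_module K \<pi> F" and ?L = "fps_subst lt_log"
  have Ac: "carrier ?A = A_set K \<pi> F u" "\<zero>\<^bsub>?A\<^esub> = 0" "\<And>f g. f \<oplus>\<^bsub>?A\<^esub> g = fps_subst2 F f g"
    "\<And>a f. a \<in> carrier (O_ring K) \<Longrightarrow> a \<odot>\<^bsub>?A\<^esub> f = fps_subst (endo a) f"
    by (auto simp: A_module_def O_carrier fgl_endo_eq)
  have Ec: "carrier ?E = E_set K \<pi> F" "\<zero>\<^bsub>?E\<^esub> = 0" "\<And>f g. f \<oplus>\<^bsub>?E\<^esub> g = f + g"
    "\<And>a f. a \<odot>\<^bsub>?E\<^esub> f = fps_const a * f"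
    by (auto simp: E_module_def)
  have S0: "0 \<in> S" using zero_E_set E by blast
  have L0: "?L 0 = 0" by (rule fps_subst_zero) (rule lt_log_0)
  have AS: "f \<in> S" and AE: "?L f \<in> E_set K \<pi> F" if "f \<in> A_set K \<pi> F u" for f
    using that A by auto
  have AI: "f \<in> A_set K \<pi> F u" if "f \<in> S" "?L f \<in> E_set K \<pi> F" for f using that A by auto
  have inj: "f = g" if "f \<in> S" "g \<in> S" "?L f = ?L g" for f g using that log by metis
  have O: "a \<in> K" "absv a \<le> 1" if "a \<in> carrier (O_ring K)" for a using that by (auto simp: O_carrier)
  have A0: "0 \<in> A_set K \<pi> F u" using S0 L0 zero_E_set by (intro AI) auto
  have Aadd: "fps_subst2 F f g \<in> A_set K \<pi> F u" if "f \<in> A_set K \<pi> F u" "g \<in> A_set K \<pi> F u" for f g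
    using that AS AE add E_set_add by (intro AI) auto
  have Asm: "fps_subst (endo a) f \<in> A_set K \<pi> F u" if "a \<in> carrier (O_ring K)" "f \<in> A_set K \<pi> F u" for a f
    using that AS AE smult[OF O] E_set_cmult[OF O] by (intro AI) auto
  have modE: "Module.module (O_ring K) ?E"
  proof (rule moduleI[OF cring_O])
    show "abelian_group ?E"
    proof (rule abelian_groupI)
      fix x assume "x \<in> carrier ?E"
      then show "\<exists>y\<in>carrier ?E. y \<oplus>\<^bsub>?E\<^esub> x = \<zero>\<^bsub>?E\<^esub>"
        using E_set_cmult[OF minus_one_K, of x]
        by (intro bexI[of _ "fps_const (-1) * x"]) (auto simp: Ec simp flip: fps_const_neg)
    qed (auto simp: Ec zero_E_set E_set_add)
  qed (auto simp: Ec O E_set_cmult distrib_left distrib_right mult.assoc simp flip: fps_const_add fps_const_mult)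
  have modA: "Module.module (O_ring K) ?A"
  proof (rule moduleI[OF cring_O])
    show "abelian_group ?A"
    proof (rule abelian_groupI)
      fix x assume x: "x \<in> carrier ?A"
      have m: "- 1 \<in> carrier (O_ring K)" using minus_one_K by (simp add: O_carrier)
      have "fps_subst2 F (fps_subst (endo (- 1)) x) x = 0"
      proof (rule inj)
        show "?L (fps_subst2 F (fps_subst (endo (- 1)) x) x) = ?L 0"
          using x AS smult[OF minus_one_K] add L0 by (simp add: Ac flip: fps_const_neg)
      qed (use x AS smult[OF minus_one_K] add S0 in \<open>auto simp: Ac\<close>)
      then show "\<exists>y\<in>carrier ?A. y \<oplus>\<^bsub>?A\<^esub> x = \<zero>\<^bsub>?A\<^esub>"
        using Asm[OF m] x by (auto simp: Ac)
    next
      fix x y z assume "x \<in> carrier ?A" "y \<in> carrier ?A" "z \<in> carrier ?A"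
      then show "x \<oplus>\<^bsub>?A\<^esub> y \<oplus>\<^bsub>?A\<^esub> z = x \<oplus>\<^bsub>?A\<^esub> (y \<oplus>\<^bsub>?A\<^esub> z)"
        using AS add by - (rule inj; auto simp: Ac add.assoc)
    next
      fix x y assume "x \<in> carrier ?A" "y \<in> carrier ?A"
      then show "x \<oplus>\<^bsub>?A\<^esub> y = y \<oplus>\<^bsub>?A\<^esub> x"
        using AS add by - (rule inj; auto simp: Ac add.commute)
    next
      fix x assume "x \<in> carrier ?A"
      then show "\<zero>\<^bsub>?A\<^esub> \<oplus>\<^bsub>?A\<^esub> x = x"
        using AS add S0 L0 by - (rule inj; auto simp: Ac)
    qed (auto simp: Ac A0 Aadd)
  next
    fix a x assume "a \<in> carrier (O_ring K)" "x \<in> carrier ?A"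
    then show "a \<odot>\<^bsub>?A\<^esub> x \<in> carrier ?A" using Asm by (simp add: Ac)
  next
    fix a b x assume ab: "a \<in> carrier (O_ring K)" "b \<in> carrier (O_ring K)" and x: "x \<in> carrier ?A"
    have sum: "a + b \<in> carrier (O_ring K)" and prod: "a * b \<in> carrier (O_ring K)"
      using cring.cring_simprules(1,5)[OF cring_O ab] by auto
    show "(a \<oplus>\<^bsub>O_ring K\<^esub> b) \<odot>\<^bsub>?A\<^esub> x = a \<odot>\<^bsub>?A\<^esub> x \<oplus>\<^bsub>?A\<^esub> b \<odot>\<^bsub>?A\<^esub> x"
      using AS x smult[OF O[OF sum]] smult[OF O[OF ab(1)]] smult[OF O[OF ab(2)]] add
      by - (rule inj; auto simp: Ac ab sum distrib_right simp flip: fps_const_add)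
    show "(a \<otimes>\<^bsub>O_ring K\<^esub> b) \<odot>\<^bsub>?A\<^esub> x = a \<odot>\<^bsub>?A\<^esub> (b \<odot>\<^bsub>?A\<^esub> x)"
      using AS x smult[OF O[OF prod]] smult[OF O[OF ab(1)]] smult[OF O[OF ab(2)]]
      by - (rule inj; auto simp: Ac ab prod mult.assoc simp flip: fps_const_mult)
  next
    fix a x y assume "a \<in> carrier (O_ring K)" "x \<in> carrier ?A" "y \<in> carrier ?A"
    then show "a \<odot>\<^bsub>?A\<^esub> (x \<oplus>\<^bsub>?A\<^esub> y) = a \<odot>\<^bsub>?A\<^esub> x \<oplus>\<^bsub>?A\<^esub> a \<odot>\<^bsub>?A\<^esub> y"
      using AS smult[OF O] add by - (rule inj; auto simp: Ac distrib_left)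
  next
    fix x assume "x \<in> carrier ?A"
    moreover have "1 \<in> carrier (O_ring K)" using one_K by (simp add: O_carrier)
    ultimately show "\<one>\<^bsub>O_ring K\<^esub> \<odot>\<^bsub>?A\<^esub> x = x"
      using AS smult[OF one_K] by - (rule inj; auto simp: Ac)
  qed
  have EA: "fps_subst lt_exp g \<in> A_set K \<pi> F u" if "g \<in> E_set K \<pi> F" for g
    using that exp E by (intro AI) auto
  have "bij_betw ?L (carrier ?A) (carrier ?E)"
    by (rule bij_betw_byWitness[where f' = "fps_subst lt_exp"])
       (use AS AE EA log exp E in \<open>auto simp: Ac Ec\<close>)
  then have "?L \<in> module_iso (O_ring K) ?A ?E"
    using modA modE AS add(2) smult(2)[OF O] by (auto simp: module_iso_def Ac Ec)
  then show ?thesis using EA log exp(2) AS E by (auto simp: Ac Ec)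
qed

text \<open>The strict inequality keeps the values of \<open>f\<close> away from the boundary of the
  disc of \<open>h\<close>; it fails for q = 2.\<close>

lemma fps_subst_piO:
  assumes "absv \<pi> < r" "h \<in> fps_over K" "tame r h" "f \<in> piO"
  shows "fps_subst h f \<in> piO" "absv x < 1 \<Longrightarrow> fps_eval (fps_subst h f) x = fps_eval h (fps_eval f x)"
proof -
  have f: "f \<in> fps_over K" "gauss_le 1 (absv \<pi>) f" and h: "h $ 0 = 0" "gauss_le r r h"
    using assms by (auto simp: piO_def tame_def)
  show "fps_subst h f \<in> piO"
    using fps_subst[OF cfield_K assms(2) h(2) f assms(1)] h(1) by (simp add: piO_def)
  assume x: "absv x < 1"
  obtain C where C: "cfield C" "K \<subseteq> C" "{x} \<subseteq> C" using cfield_containing[of "{x}"] by auto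
  show "fps_eval (fps_subst h f) x = fps_eval h (fps_eval f x)"
    using fps_subst(5)[OF C(1) fps_over_mono[OF assms(2) C(2)] h(2) fps_over_mono[OF f(1) C(2)] f(2) assms(1)]
      x C(3) by simp
qed

lemma fps_subst2_piO:
  assumes "f \<in> piO" "g \<in> piO"
  shows "fps_subst2 F f g \<in> piO" "absv x < 1 \<Longrightarrow> fps_eval (fps_subst2 F f g) x = fps_eval f x \<oplus>\<^sub>F fps_eval g x"
proof -
  have fg: "f \<in> fps_over K" "gauss_le 1 (absv \<pi>) f" "g \<in> fps_over K" "gauss_le 1 (absv \<pi>) g"
    using assms by (auto simp: piO_def)
  show "fps_subst2 F f g \<in> piO"
    using fps_subst2[OF cfield_K F_over F_gauss F_0 fg \<pi>_less_1] by (simp add: piO_def)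
  assume x: "absv x < 1"
  obtain C where C: "cfield C" "K \<subseteq> C" "{x} \<subseteq> C" using cfield_containing[of "{x}"] by auto
  show "fps_eval (fps_subst2 F f g) x = fps_eval f x \<oplus>\<^sub>F fps_eval g x"
    using fps_subst2(3)[OF C(1) F_overC[OF C(2)] F_gauss F_0 fps_over_mono[OF fg(1) C(2)] fg(2)
        fps_over_mono[OF fg(3) C(2)] fg(4) \<pi>_less_1] x C(3) by simp
qed

lemma piO_eqI:
  assumes "f \<in> piO" "g \<in> piO" "\<And>x. absv x < 1 \<Longrightarrow> fps_eval f x = fps_eval g x"
  shows "f = g"
  by (rule fps_eqI_eval[OF cfield_K _ _ _ _ zero_less_one K_nonzero_small])
     (use assms in \<open>auto simp: piO_def\<close>)

lemma A_set_iff_E_set: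
  assumes pr: "absv \<pi> < r" and f: "f \<in> piO"
  shows "f \<in> A_set K \<pi> F u \<longleftrightarrow> fps_subst lt_log f \<in> E_set K \<pi> F"
proof -
  let ?g = "fps_subst lt_log f"
  let ?H = "coleman_trace K \<pi> F ?g"
  note g = fps_subst_piO[OF pr lt_log_over lt_log_tame f]
  have gK: "?g \<in> fps_over K" "gauss_le 1 1 ?g" using g(1) piO_gauss_1 by (auto simp: piO_def)
  have fx: "absv (fps_eval f x) < r" if "absv x < 1" for x using piO_eval_le[OF f that] pr by simp
  have cg: "fps_const ratio * ?g \<in> fps_over K" "gauss_le 1 1 (fps_const ratio * ?g)"
    using gK ratio gauss_le_mono[OF gauss_le_const_mult[OF gK(2)]] by (auto intro: fps_over_intros[OF cfield_K])
  have "finprod (fgl_points F) (fps_eval f) (fibre n) = fps_eval (endo ratio) (fps_eval f (u n)) \<longleftrightarrow>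
      fps_eval ?H (u n) = fps_eval (fps_const ratio * ?g) (u n)" for n
  proof -
    let ?P = "finprod (fgl_points F) (fps_eval f) (fibre n)"
    let ?Q = "fps_eval (endo ratio) (fps_eval f (u n))"
    have fv: "absv (fps_eval f v) \<le> absv \<pi>" if "v \<in> fibre n" for v
      using piO_eval_le[OF f] that by (simp add: fibre_def)
    note P = finprod_points_le[OF finite_fibre fv _ \<pi>_less_1]
    have Pr: "absv ?P < r" using P(1) pr by fastforce
    have "logv ?P = (\<Sum>v\<in>fibre n. fps_eval ?g v)"
      using P(3)[OF _ _ pr] g(2) by (simp add: fibre_def)
    also have "\<dots> = fps_eval ?H (u n)" by (rule coleman_trace_eval[OF gK, symmetric])
    finally have 1: "logv ?P = fps_eval ?H (u n)" .
    have Qr: "absv ?Q < r"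
      using endo_le[OF ratio, of "fps_eval f (u n)"] fx[OF u_less_1[of n]] r_less_1 by simp
    have "logv ?Q = ratio * logv (fps_eval f (u n))"
      by (rule logv_endo[OF ratio fx[OF u_less_1]])
    also have "\<dots> = fps_eval (fps_const ratio * ?g) (u n)"
      using fps_eval_cmult[where c = ratio, OF cfield_level fps_over_mono[OF gK(1) K_level] u_level gK(2) u_less_1[of n]]
      by (simp add: g(2)[OF u_less_1])
    finally have 2: "logv ?Q = fps_eval (fps_const ratio * ?g) (u n)" .
    \<comment> \<open>\<open>?P\<close> and \<open>?Q\<close> both lie in the disc where
      \<open>expv\<close> inverts \<open>logv\<close>, so their equality can be tested on
      logarithms.\<close>
    show ?thesis using 1 2 expv_logv[OF Pr] expv_logv[OF Qr] by metis
  qed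
  then have "f \<in> A_set K \<pi> F u \<longleftrightarrow> (\<forall>n. fps_eval ?H (u n) = fps_eval (fps_const ratio * ?g) (u n))"
    using f by (simp add: A_set_iff)
  also have "\<dots> \<longleftrightarrow> ?H = fps_const ratio * ?g"
  proof
    assume eq: "\<forall>n. fps_eval ?H (u n) = fps_eval (fps_const ratio * ?g) (u n)"
    note H = coleman_trace_over[OF gK] coleman_trace_gauss[OF gK]
    have "?H - fps_const ratio * ?g = 0"
    proof (rule fps_eq_0_of_u_values)
      show "?H - fps_const ratio * ?g \<in> fps_over K" by (rule fps_over_intros(6)[OF cfield_K H(1) cg(1)])
      show "gauss_le 1 1 (?H - fps_const ratio * ?g)" using H cg by (intro gauss_le_diff) auto
      show "fps_eval (?H - fps_const ratio * ?g) (u n) = 0" for n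
        using fps_eval_diff[OF cfield_level fps_over_mono[OF H(1) K_level] fps_over_mono[OF cg(1) K_level]
            u_level H(2) cg(2) u_less_1] eq by simp
    qed
    then show "?H = fps_const ratio * ?g" by simp
  qed simp
  finally show ?thesis using g(1) by (simp add: E_set_iff)
qed

section \<open>The case q = 2\<close>

lemma absv_eval_diff_le:
  assumes f: "f \<in> fps_over K" "gauss_le 1 B f" and x: "absv x < 1" "absv y < 1"
  shows "absv (fps_eval f x - fps_eval f y) \<le> B * absv (x - y)"
proof -
  obtain C where C: "cfield C" "K \<subseteq> C" "{x, y} \<subseteq> C" using cfield_containing[of "{x, y}"] by auto
  have fC: "f \<in> fps_over C" by (rule fps_over_mono[OF f(1) C(2)])
  have xy: "x \<in> C" "y \<in> C" using C by auto
  have B: "0 \<le> B" using f(2) by (rule gauss_le_nonneg)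
  have "((\<lambda>n. f $ n * x ^ n + (- 1) * (f $ n * y ^ n)) has_sum (fps_eval f x + (- 1) * fps_eval f y)) UNIV"
    by (intro has_sum_add has_sum_cmult_right fps_eval_has_sum(1)[OF C(1) fC _ f(2)] xy x)
  then have "absv (fps_eval f x + (- 1) * fps_eval f y) \<le> B * absv (x - y)"
  proof (rule has_sum_absv_le)
    fix n
    have "absv (f $ n) * absv (x ^ n - y ^ n) \<le> B * absv (x - y)"
      using f(2) x B by (intro mult_mono absv_power_diff_le) (auto simp: gauss_le_1)
    then show "absv (f $ n * x ^ n + (- 1) * (f $ n * y ^ n)) \<le> B * absv (x - y)"
      by (simp add: algebra_simps flip: absv_mult)
  qed (use B in auto)
  then show ?thesis by simp
qed

text \<open>By the unit law every monomial of F other than X contains Y.\<close>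

lemma absv_fadd_diff_le:
  assumes "absv x < 1" "absv z < 1"
  shows "absv (x \<oplus>\<^sub>F z - x) \<le> absv z"
proof -
  obtain C where C: "cfield C" "K \<subseteq> C" "{x, z} \<subseteq> C" using cfield_containing[of "{x, z}"] by auto
  let ?f = "\<lambda>(i, j). F $ i $ j * (x ^ i * z ^ j)"
  have "(?f has_sum (x \<oplus>\<^sub>F z)) (UNIV \<times> UNIV)"
    using fps_eval2_has_sum(1)[OF C(1) F_overC[OF C(2)] _ _ F_gauss] C(3) assms by auto
  moreover have "(?f has_sum (\<Sum>p\<in>{(1,0)}. ?f p)) {(1,0)}" by (rule has_sum_finite) auto
  ultimately have "(?f has_sum (x \<oplus>\<^sub>F z - (\<Sum>p\<in>{(1,0)}. ?f p))) (UNIV \<times> UNIV - {(1,0)})"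
    by (rule has_sum_Diff) auto
  then have "absv (x \<oplus>\<^sub>F z - (\<Sum>p\<in>{(1,0)}. ?f p)) \<le> absv z"
  proof (rule has_sum_absv_le)
    fix p :: "nat \<times> nat" assume p: "p \<in> UNIV \<times> UNIV - {(1,0)}"
    obtain i j where ij: "p = (i, j)" by (cases p)
    show "absv (?f p) \<le> absv z"
    proof (cases j)
      case 0
      then have "F $ i $ j = 0" using p ij by (auto simp: F_unit1)
      then show ?thesis by (simp add: ij)
    next
      case (Suc k)
      have "absv x ^ i * (absv z * absv z ^ k) \<le> 1 * (absv z * 1)"
        using assms by (intro mult_mono mult_left_mono power_le_one) auto
      then have "absv (F $ i $ j) * (absv x ^ i * (absv z * absv z ^ k)) \<le> 1 * absv z"
        using F_gauss by (intro mult_mono) (auto simp: gauss2_le_1)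
      then show ?thesis by (simp add: ij Suc absv_mult absv_power)
    qed
  qed simp
  then show ?thesis by (simp add: F_unit1)
qed

text \<open>If \<open>q / \<pi>\<close> is a unit, the trace gains a factor \<open>\<pi>\<close> while \<open>[q / \<pi>]\<close> and multiplication by \<open>q / \<pi>\<close>
  lose nothing; this reduces both modules to 0 when \<open>q = 2\<close>, where the exponential need not converge.\<close>

lemma sum_fibre_le:
  assumes q: "q = 2" and f: "f \<in> fps_over K" "gauss_le 1 B f"
  shows "absv (\<Sum>v\<in>fibre n. fps_eval f v) \<le> absv \<pi> * B"
proof -
  let ?w = "u (Suc n)"
  have B: "0 \<le> B" using f(2) by (rule gauss_le_nonneg)
  \<comment> \<open>Each part gains a factor \<pi>: the first because q is divisible by \<pi>, the
    second because the points of the fibre differ from \<open>?w\<close> by at most r, which equals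
    |\<pi>| for q = 2.\<close>
  have "(\<Sum>v\<in>fibre n. fps_eval f v) = of_nat q * fps_eval f ?w + (\<Sum>v\<in>fibre n. fps_eval f v - fps_eval f ?w)"
    by (simp add: sum_subtractf card_fibre)
  also have "absv \<dots> \<le> absv \<pi> * B"
  proof (intro absv_add_le absv_sum_le)
    have "absv (fps_eval f ?w) \<le> B"
      by (rule fps_eval_has_sum(3)[OF cfield_level fps_over_mono[OF f(1) K_level] u_level f(2) u_less_1])
    then have "absv (of_nat q :: 'a) * absv (fps_eval f ?w) \<le> absv \<pi> * B"
      using absv_q_le by (intro mult_mono) auto
    then show "absv (of_nat q * fps_eval f ?w) \<le> absv \<pi> * B" by (simp only: absv_mult)
    fix v assume v: "v \<in> fibre n"
    then obtain z where z: "z \<in> torsion K \<pi> F 0" "v = ?w \<oplus>\<^sub>F z" unfolding fibre_eq by blast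
    have "absv z \<le> absv \<pi>"
      using absv_torsion[OF z(1)] r_power q by (cases "z = 0") auto
    then have "absv (v - ?w) \<le> absv \<pi>"
      using absv_fadd_diff_le[OF u_less_1[of "Suc n"], of z] z by (auto simp: torsion_0)
    then have "B * absv (v - ?w) \<le> B * absv \<pi>" using B by (intro mult_left_mono) auto
    then show "absv (fps_eval f v - fps_eval f ?w) \<le> absv \<pi> * B"
      using absv_eval_diff_le[OF f, of v ?w] v u_less_1[of "Suc n"] by (simp add: fibre_def mult.commute)
  qed (use B in auto)
  finally show ?thesis .
qed

text \<open>The rationals are dense in Qp, and a nonzero \<open>x\<close> has the same absolute
  value as a sufficiently close rational, hence an integral power of p.\<close>

lemma Qp_absv_le:
  assumes "x \<in> Qp" "absv (x :: 'a) < 1"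
  shows "absv x \<le> 1 / real p"
proof (cases "x = 0")
  case False
  then have "0 < absv x" by simp
  then obtain s where s: "s \<in> \<rat>" "dist s x < absv x"
    using assms(1) unfolding Qp_def closure_approachable by blast
  then have "absv (x + (s - x)) = absv x" by (intro absv_add_eq) (simp add: dist_absv)
  then have sx: "absv s = absv x" by simp
  obtain a b :: int where ab: "b \<noteq> 0" "s = of_int a / of_int b"
    using s(1) by (elim Rats_cases') (metis less_irrefl)
  have a0: "a \<noteq> 0" using ab sx False by auto
  define i j where "i = multiplicity (int p) a" and "j = multiplicity (int p) b"
  have p1: "1 < real p" using prime_gt_1_nat[OF prime_p] by simp
  have eq: "absv s = real p ^ j / real p ^ i"
    using absv_padic[OF a0] absv_padic[OF ab(1)] by (simp add: ab(2) absv_divide i_def j_def)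
  have "real p ^ j < real p ^ i"
    using assms(2) p1 unfolding sx[symmetric] eq by (simp add: pos_divide_less_eq)
  then have "j < i" using p1 by simp
  then have "real p ^ Suc j \<le> real p ^ i" using p1 by (intro power_increasing) auto
  then have "real p ^ j / real p ^ i \<le> 1 / real p" using p1 by (simp add: field_simps)
  then show ?thesis using eq sx by simp
qed auto

text \<open>Here p = 2, since p divides q. In the field of 2-adic numbers |2| = 1/2 is the largest
  absolute value below 1, so |\<pi>| \<le> 1/2 = |q| \<le> |\<pi>|.\<close>

lemma absv_ratio_unit:
  assumes "q = 2" "K = Qp"
  shows "absv ratio = 1"
proof -
  have "p dvd q" using absv_of_nat_eq_1[of q] absv_q_le \<pi>_less_1 by (cases "p dvd q") auto
  then have p: "p = 2" using assms(1) prime_p primes_dvd_imp_eq two_is_prime_nat by metis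
  have "absv (of_int (int 2) :: 'a) = 1 / 2"
    using absv_padic[of "int 2"] p by simp
  then have "absv (of_nat q :: 'a) = 1 / 2" using assms(1) by simp
  moreover have "absv \<pi> \<le> 1 / 2" using Qp_absv_le[of \<pi>] \<pi>_K \<pi>_less_1 assms(2) p by simp
  ultimately have "absv \<pi> = absv (of_nat q :: 'a)" using absv_q_le by simp
  then show ?thesis using \<pi>_pos by (simp add: ratio_def absv_divide)
qed

lemma endo_unit_absv:
  assumes "a \<in> K" "absv a = 1" "absv x < 1"
  shows "absv (fps_eval (endo a) x) = absv x"
proof (rule antisym)
  have a: "a \<noteq> 0" "inverse a \<in> K" "absv (inverse a) \<le> 1"
    using assms by (auto simp: absv_inverse intro: cfield_intros[OF cfield_K])
  show le: "absv (fps_eval (endo a) x) \<le> absv x" by (rule endo_le) (use assms in auto)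
  have "x = fps_eval (endo (inverse a)) (fps_eval (endo a) x)"
    using endo_mult_eval[of "inverse a" a x] a assms by (simp add: endo_one)
  also have "absv \<dots> \<le> absv (fps_eval (endo a) x)"
    by (rule endo_le[OF a(2,3)]) (use le assms in auto)
  finally show "absv x \<le> absv (fps_eval (endo a) x)" .
qed

lemma A_set_E_set_trivial:
  assumes q: "q = 2" "absv ratio = 1"
  shows "A_set K \<pi> F u = {0}" "E_set K \<pi> F = {0}"
proof -
  have "g = 0" if g: "g \<in> E_set K \<pi> F" for g
  proof (rule fps_eq_0_of_small)
    have gK: "g \<in> fps_over K" "gauss_le 1 1 g" "gauss_le 1 (absv \<pi>) g"
      using g piO_gauss_1 by (auto simp: E_set_iff piO_def)
    show "gauss_le 1 (absv \<pi> ^ Suc j) g" for j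
    proof (induction j)
      case (Suc j)
      show ?case
      proof (rule gauss_le_\<pi>_power_Suc[OF gK(1) Suc])
        fix n
        have "fps_eval (coleman_trace K \<pi> F g) (u n) = ratio * fps_eval g (u n)"
          using g fps_eval_cmult[where c = ratio, OF cfield_level fps_over_mono[OF gK(1) K_level] u_level gK(2) u_less_1[of n]]
          by (simp add: E_set_iff)
        then have "absv (fps_eval g (u n)) = absv (\<Sum>v\<in>fibre n. fps_eval g v)"
          using q(2) coleman_trace_eval[OF gK(1,2)] by (simp add: absv_mult)
        also have "\<dots> \<le> absv \<pi> ^ Suc (Suc j)" using sum_fibre_le[OF q(1) gK(1) Suc, of n] by simp
        finally show "absv (fps_eval g (u n)) \<le> absv \<pi> ^ Suc (Suc j)" .
      qed
    qed (use gK in simp)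
  qed
  then show "E_set K \<pi> F = {0}" using zero_E_set by blast
  have "f = 0" if f: "f \<in> A_set K \<pi> F u" for f
  proof (rule fps_eq_0_of_small)
    have fp: "f \<in> piO" using f A_set_iff by blast
    then have fK: "f \<in> fps_over K" "gauss_le 1 (absv \<pi>) f" by (auto simp: piO_def)
    show "gauss_le 1 (absv \<pi> ^ Suc j) f" for j
    proof (induction j)
      case (Suc j)
      show ?case
      proof (rule gauss_le_\<pi>_power_Suc[OF fK(1) Suc])
        fix n
        let ?P = "finprod (fgl_points F) (fps_eval f) (fibre n)"
        have B: "absv \<pi> ^ Suc j < 1" using \<pi>_less_1 \<pi>_pos by (simp only: power_less_one_iff) auto
        have fv: "absv (fps_eval f v) \<le> absv \<pi> ^ Suc j" if "v \<in> fibre n" for v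
          using that fibre_level[OF that]
          by (intro fps_eval_has_sum(3)[OF cfield_level fps_over_mono[OF fK(1) K_level] _ Suc]) (auto simp: fibre_def)
        have "fps_eval (endo ratio) (fps_eval f (u n)) = ?P" using f A_set_iff by simp
        then have "absv (fps_eval f (u n)) = absv ?P"
          using endo_unit_absv[OF ratio(1) q(2), of "fps_eval f (u n)"] piO_eval_le[OF fp u_less_1, of n] \<pi>_less_1
          by simp
        \<comment> \<open>The sum with respect to F is replaced by the ordinary sum. The error is
          quadratic, at most |\<pi>|^(2(j+1)), and this is no larger than |\<pi>|^(j+2).\<close>
        also have "?P = (?P - (\<Sum>v\<in>fibre n. fps_eval f v)) + (\<Sum>v\<in>fibre n. fps_eval f v)" by simp
        also have "absv \<dots> \<le> absv \<pi> ^ Suc (Suc j)"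
        proof (rule absv_add_le)
          have "(absv \<pi> ^ Suc j) ^ 2 = absv \<pi> ^ (Suc j * 2)" by (rule power_mult[symmetric])
          also have "\<dots> \<le> absv \<pi> ^ Suc (Suc j)" using \<pi>_less_1 by (intro power_decreasing) auto
          finally show "absv (?P - (\<Sum>v\<in>fibre n. fps_eval f v)) \<le> absv \<pi> ^ Suc (Suc j)"
            using finprod_points_le(2)[OF finite_fibre fv _ B] by fastforce
          show "absv (\<Sum>v\<in>fibre n. fps_eval f v) \<le> absv \<pi> ^ Suc (Suc j)"
            using sum_fibre_le[OF q(1) fK(1) Suc, of n] by simp
        qed
        finally show "absv (fps_eval f (u n)) \<le> absv \<pi> ^ Suc (Suc j)" .
      qed
    qed (use fK in simp)
  qed
  moreover have "0 \<in> A_set K \<pi> F u"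
  proof -
    have "finprod (fgl_points F) (fps_eval 0) (fibre n) = 0" for n
      using finprod_points_le(1)[OF finite_fibre, of n "fps_eval 0" 0] by simp
    moreover have "0 \<in> piO" using zero_E_set by (simp add: E_set_iff)
    ultimately show ?thesis using endo_0[OF ratio] by (simp add: A_set_iff)
  qed
  ultimately show "A_set K \<pi> F u = {0}" by blast
qed

theorem log_module_iso:
  assumes "q = 2 \<Longrightarrow> K = Qp"
  shows "fps_subst lt_log \<in> module_iso (O_ring K) (A_module K \<pi> F u) (E_module K \<pi> F) \<and>
         fps_subst lt_exp \<in> carrier (E_module K \<pi> F) \<rightarrow> carrier (A_module K \<pi> F u) \<and>
         (\<forall>f\<in>carrier (A_module K \<pi> F u). fps_subst lt_exp (fps_subst lt_log f) = f) \<and>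
         (\<forall>g\<in>carrier (E_module K \<pi> F). fps_subst lt_log (fps_subst lt_exp g) = g)"
proof (cases "q = 2")
  case True
  have AE: "A_set K \<pi> F u = {0}" "E_set K \<pi> F = {0}"
    using A_set_E_set_trivial[OF True absv_ratio_unit[OF True assms[OF True]]] by auto
  have exp0: "fps_subst lt_exp 0 = 0" "fps_subst lt_log 0 = 0"
    using lt_exp_tame by (auto intro!: fps_subst_zero simp: lt_log_0 tame_def)
  have F0: "fps_subst2 F 0 0 = 0"
  proof -
    have "0 \<in> piO" using zero_E_set by (simp add: E_set_iff)
    then show ?thesis using fps_subst2_piO[of 0 0] fadd_0_right[of 0] by (intro piO_eqI) auto
  qed
  show ?thesis
    \<comment> \<open>Both modules are zero, so {0} can serve as ambient set; on all of
      \<open>piO\<close> the exponential need not converge here.\<close>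
    by (rule module_iso_log[where S = "{0}"])
       (use AE exp0 F0 endo_0 in \<open>auto simp: fps_subst_zero\<close>)
next
  case False
  then have pr: "absv \<pi> < r" using q_ge_2 by (intro absv_\<pi>_less_r) auto
  note logs = fps_subst_piO[OF pr lt_log_over lt_log_tame]
  note exps = fps_subst_piO[OF pr lt_exp_over lt_exp_tame]
  have lt: "absv (fps_eval f x) < r" if "f \<in> piO" "absv x < 1" for f x
    using piO_eval_le[OF that] pr by simp
  show ?thesis
  proof (rule module_iso_log[where S = piO])
    show "A_set K \<pi> F u = {f \<in> piO. fps_subst lt_log f \<in> E_set K \<pi> F}"
      using A_set_iff_E_set[OF pr] A_set_iff by blast
    show "E_set K \<pi> F \<subseteq> piO" by (auto simp: E_set_iff)
    show "fps_subst lt_exp g \<in> piO" if "g \<in> piO" for g by (rule exps[OF that])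
    show "fps_subst lt_exp (fps_subst lt_log f) = f" if "f \<in> piO" for f
      using that logs exps lt expv_logv by (intro piO_eqI) auto
    show "fps_subst lt_log (fps_subst lt_exp g) = g" if "g \<in> piO" for g
      using that logs exps lt logv_expv by (intro piO_eqI) auto
    show "fps_subst2 F f g \<in> piO" if "f \<in> piO" "g \<in> piO" for f g by (rule fps_subst2_piO[OF that])
    have eval_add: "fps_eval (f + g) x = fps_eval f x + fps_eval g x"
      if "f \<in> piO" "g \<in> piO" "absv x < 1" for f g x
    proof -
      obtain C where C: "cfield C" "K \<subseteq> C" "{x} \<subseteq> C" using cfield_containing[of "{x}"] by auto
      show ?thesis
        using fps_eval_add[OF C(1) fps_over_mono[OF _ C(2)] fps_over_mono[OF _ C(2)] _ _ _ that(3)] that C(3)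
        by (auto simp: piO_def)
    qed
    have piO_add: "f + g \<in> piO" if "f \<in> piO" "g \<in> piO" for f g
      using that by (auto simp: piO_def intro: fps_over_intros[OF cfield_K] gauss_le_add)
    show "fps_subst lt_log (fps_subst2 F f g) = fps_subst lt_log f + fps_subst lt_log g"
      if fg: "f \<in> piO" "g \<in> piO" for f g
    proof (rule piO_eqI)
      show "fps_subst lt_log (fps_subst2 F f g) \<in> piO" using fps_subst2_piO[OF fg] logs by blast
      show "fps_subst lt_log f + fps_subst lt_log g \<in> piO" using logs fg piO_add by blast
      fix x :: 'a assume x: "absv x < 1"
      show "fps_eval (fps_subst lt_log (fps_subst2 F f g)) x = fps_eval (fps_subst lt_log f + fps_subst lt_log g) x"
        using logs fg fps_subst2_piO[OF fg] x lt by (simp add: eval_add logv_fadd)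
    qed
    fix a f assume a: "a \<in> K" "absv a \<le> 1" and f: "f \<in> piO"
    note endos = fps_subst_piO[OF pr endo_over[OF a] endo_tame_r[OF a] f]
    show "fps_subst (endo a) f \<in> piO" by (rule endos)
    show "fps_subst lt_log (fps_subst (endo a) f) = fps_const a * fps_subst lt_log f"
    proof (rule piO_eqI)
      show "fps_subst lt_log (fps_subst (endo a) f) \<in> piO" using logs endos by blast
      have lf: "fps_subst lt_log f \<in> fps_over K" "gauss_le 1 (absv \<pi>) (fps_subst lt_log f)"
        using logs[OF f] by (auto simp: piO_def)
      have "absv a * absv \<pi> \<le> 1 * absv \<pi>" using a by (intro mult_right_mono) auto
      then show "fps_const a * fps_subst lt_log f \<in> piO"
        using a lf gauss_le_mono[OF gauss_le_const_mult[OF lf(2), of a]]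
        by (auto simp: piO_def intro: fps_over_intros[OF cfield_K])
      fix x :: 'a assume x: "absv x < 1"
      obtain C where C: "cfield C" "K \<subseteq> C" "{x} \<subseteq> C" using cfield_containing[of "{x}"] by auto
      have "fps_eval (fps_const a * fps_subst lt_log f) x = a * logv (fps_eval f x)"
        using fps_eval_cmult[OF C(1) fps_over_mono[OF lf(1) C(2)] _ lf(2) x] C(3) logs(2)[OF f x] by simp
      also have "\<dots> = logv (fps_eval (endo a) (fps_eval f x))"
        by (rule logv_endo[OF a lt[OF f x], symmetric])
      finally show "fps_eval (fps_subst lt_log (fps_subst (endo a) f)) x = fps_eval (fps_const a * fps_subst lt_log f) x"
        using logs(2)[OF endos(1) x] endos(2)[OF x] by simp
    qed
  qed
qed

end

theorem theorem3p1p1: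
  fixes p :: nat and K :: "'a::nonarch_field set" and \<pi> :: 'a
    and F :: "'a fps fps" and u :: "nat \<Rightarrow> 'a"
  assumes "lubin_tate_tower p K \<pi> F u"
    and "residue_card K = 2 \<Longrightarrow> K = Qp"
  shows "fps_subst (fgl_log K F) \<in> module_iso (O_ring K) (A_module K \<pi> F u) (E_module K \<pi> F) \<and>
         fps_subst (fgl_exp K F) \<in> carrier (E_module K \<pi> F) \<rightarrow> carrier (A_module K \<pi> F u) \<and>
         (\<forall>f\<in>carrier (A_module K \<pi> F u).
            fps_subst (fgl_exp K F) (fps_subst (fgl_log K F) f) = f) \<and>
         (\<forall>g\<in>carrier (E_module K \<pi> F).
            fps_subst (fgl_log K F) (fps_subst (fgl_exp K F) g) = g)"
proof -
  interpret lubin_tate_tower p K \<pi> F u by (rule assms(1))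
  show ?thesis unfolding fgl_log_eq fgl_exp_eq by (rule log_module_iso[OF assms(2)])
qed

end
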